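(* For every $b>0$, one has $\lambda(b)<\Theta_0 b$.
   Context: Let $\mathbb{D}$ be the open unit disk in $\mathbb{R}^2$ and $\mathbf{A}(x_1,x_2)=\frac12(-x_2,x_1)$. For $b\in\mathbb{R}$ let $H_b$ be the self-adjoint operator in $L^2(\mathbb{D})$ (complex-valued functions) associated with the closed quadratic form $q_b[u]=\int_{\mathbb{D}}|(-i\nabla+b\mathbf{A})u|^2\,d\mathbf{x}$, $u\in H^1(\mathbb{D})$ (magnetic Neumann Laplacian), and let $\lambda(b)=\inf\operatorname{spec}H_b$ be its lowest eigenvalue. The de Gennes constant is $\Theta_0=\inf_{\xi\in\mathbb{R}}\mu(\xi)$, where $\mu(\xi)$ denotes the lowest eigenvalue of the operator $-\frac{d^2}{dt^2}+(t-\xi)^2$ in $L^2(\mathbb{R}_+)$, $\mathbb{R}_+=(0,+\infty)$, with a Neumann condition at the origin. *)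

theory Defs
  imports "HOL-Analysis.Analysis"
begin

section \<open>Operators in complex-valued L2 spaces\<close>

text \<open>Elements of the Hilbert space are represented by functions, identified when they agree
  almost everywhere on the domain; values outside the domain are irrelevant.\<close>

definition L2 :: "'a::euclidean_space set \<Rightarrow> ('a \<Rightarrow> complex) set" where
  "L2 \<Omega> = {u \<in> borel_measurable (lebesgue_on \<Omega>).
             integrable (lebesgue_on \<Omega>) (\<lambda>x. (cmod (u x))\<^sup>2)}"

definition l2_inner :: "'a::euclidean_space set \<Rightarrow> ('a \<Rightarrow> complex) \<Rightarrow> ('a \<Rightarrow> complex) \<Rightarrow> complex" where
  "l2_inner \<Omega> u v = (LINT x|lebesgue_on \<Omega>. u x * cnj (v x))"

definition l2_norm :: "'a::euclidean_space set \<Rightarrow> ('a \<Rightarrow> complex) \<Rightarrow> real" where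
  "l2_norm \<Omega> u = sqrt (LINT x|lebesgue_on \<Omega>. (cmod (u x))\<^sup>2)"

text \<open>An unbounded operator is given by its graph: \<open>T u f\<close> means that \<open>u\<close> is in the domain of
  the operator and is mapped to (the class of) \<open>f\<close>.\<close>

type_synonym 'a graph = "('a \<Rightarrow> complex) \<Rightarrow> ('a \<Rightarrow> complex) \<Rightarrow> bool"

text \<open>The resolvent set: \<open>T - z\<close> maps the domain of \<open>T\<close> onto L2 and has a bounded inverse
  (the second conjunct also gives injectivity).\<close>

definition resolvent_set :: "'a::euclidean_space set \<Rightarrow> 'a graph \<Rightarrow> complex set" where
  "resolvent_set \<Omega> T = {z.
     (\<forall>g\<in>L2 \<Omega>. \<exists>u f. T u f \<and> (AE x in lebesgue_on \<Omega>. f x - z * u x = g x)) \<and>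
     (\<exists>C. \<forall>u f. T u f \<longrightarrow> l2_norm \<Omega> u \<le> C * l2_norm \<Omega> (\<lambda>x. f x - z * u x))}"

definition spectrum :: "'a::euclidean_space set \<Rightarrow> 'a graph \<Rightarrow> complex set" where
  "spectrum \<Omega> T = - resolvent_set \<Omega> T"

definition is_eigenvalue :: "'a::euclidean_space set \<Rightarrow> 'a graph \<Rightarrow> complex \<Rightarrow> bool" where
  "is_eigenvalue \<Omega> T z \<longleftrightarrow>
     (\<exists>u. T u (\<lambda>x. z * u x) \<and> \<not> (AE x in lebesgue_on \<Omega>. u x = 0))"

text \<open>The operator associated with a sesquilinear form \<open>a\<close> (linear in the first argument)
  with form domain \<open>D\<close>.\<close>

definition form_operator ::
  "'a::euclidean_space set \<Rightarrow> ('a \<Rightarrow> complex) set \<Rightarrow>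
   (('a \<Rightarrow> complex) \<Rightarrow> ('a \<Rightarrow> complex) \<Rightarrow> complex) \<Rightarrow> 'a graph" where
  "form_operator \<Omega> D a u f \<longleftrightarrow>
     u \<in> D \<and> f \<in> L2 \<Omega> \<and> (\<forall>v\<in>D. a u v = l2_inner \<Omega> f v)"

section \<open>Weak derivatives and the Sobolev space H1\<close>

primrec Ck :: "nat \<Rightarrow> ('a::euclidean_space \<Rightarrow> complex) \<Rightarrow> bool" where
  "Ck 0 f \<longleftrightarrow> continuous_on UNIV f"
| "Ck (Suc k) f \<longleftrightarrow>
     (\<forall>x. f differentiable (at x)) \<and> (\<forall>e\<in>Basis. Ck k (\<lambda>x. frechet_derivative f (at x) e))"

definition test_functions :: "'a::euclidean_space set \<Rightarrow> ('a \<Rightarrow> complex) set" where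
  "test_functions \<Omega> = {\<phi>. (\<forall>k. Ck k \<phi>) \<and>
     compact (closure {x. \<phi> x \<noteq> 0}) \<and> closure {x. \<phi> x \<noteq> 0} \<subseteq> \<Omega>}"

definition is_weak_partial ::
  "'a::euclidean_space set \<Rightarrow> 'a \<Rightarrow> ('a \<Rightarrow> complex) \<Rightarrow> ('a \<Rightarrow> complex) \<Rightarrow> bool" where
  "is_weak_partial \<Omega> e u g \<longleftrightarrow> (\<forall>\<phi>\<in>test_functions \<Omega>.
     (LINT x|lebesgue_on \<Omega>. u x * frechet_derivative \<phi> (at x) e) =
     - (LINT x|lebesgue_on \<Omega>. g x * \<phi> x))"

definition H1 :: "'a::euclidean_space set \<Rightarrow> ('a \<Rightarrow> complex) set" where
  "H1 \<Omega> = {u \<in> L2 \<Omega>. \<forall>e\<in>Basis. \<exists>g\<in>L2 \<Omega>. is_weak_partial \<Omega> e u g}"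

text \<open>Weak derivatives are unique almost everywhere, so the choice does not affect integrals.\<close>

definition weak_partial ::
  "'a::euclidean_space set \<Rightarrow> 'a \<Rightarrow> ('a \<Rightarrow> complex) \<Rightarrow> 'a \<Rightarrow> complex" where
  "weak_partial \<Omega> e u = (SOME g. g \<in> L2 \<Omega> \<and> is_weak_partial \<Omega> e u g)"

section \<open>The magnetic Neumann Laplacian on the unit disk\<close>

abbreviation disk :: "(real^2) set" where
  "disk \<equiv> ball 0 1"

definition vecpot :: "real^2 \<Rightarrow> real^2" where
  "vecpot x = (1/2) *\<^sub>R vector [- (x $ 2), x $ 1]"

text \<open>The component of \<open>(-\<i>\<nabla> + b A) u\<close> in the direction of the basis vector \<open>e\<close>.\<close>

definition mag_grad :: "real \<Rightarrow> real^2 \<Rightarrow> (real^2 \<Rightarrow> complex) \<Rightarrow> real^2 \<Rightarrow> complex" where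
  "mag_grad b e u x =
     - \<i> * weak_partial disk e u x + complex_of_real (b * (vecpot x \<bullet> e)) * u x"

definition mag_qform :: "real \<Rightarrow> (real^2 \<Rightarrow> complex) \<Rightarrow> real" where
  "mag_qform b u = (LINT x|lebesgue_on disk. (\<Sum>e\<in>Basis. (cmod (mag_grad b e u x))\<^sup>2))"

definition mag_form :: "real \<Rightarrow> (real^2 \<Rightarrow> complex) \<Rightarrow> (real^2 \<Rightarrow> complex) \<Rightarrow> complex" where
  "mag_form b u v =
     (LINT x|lebesgue_on disk. (\<Sum>e\<in>Basis. mag_grad b e u x * cnj (mag_grad b e v x)))"

lemma mag_form_diag: "mag_form b u u = complex_of_real (mag_qform b u)"
  unfolding mag_form_def mag_qform_def complex_norm_square of_real_sum[symmetric]
  by (simp flip: complex_norm_square of_real_power of_real_sum)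

definition mag_laplacian :: "real \<Rightarrow> (real^2) graph" where
  "mag_laplacian b = form_operator disk (H1 disk) (mag_form b)"

definition mag_lambda :: "real \<Rightarrow> real" where
  "mag_lambda b = Inf {E. complex_of_real E \<in> spectrum disk (mag_laplacian b)}"

section \<open>The de Gennes constant\<close>

text \<open>The operator \<open>- d\<^sup>2/dt\<^sup>2 + (t - \<xi>)\<^sup>2\<close> on the half-line with Neumann condition, on its maximal
  domain: \<open>w\<close> is the C1 representative of \<open>u\<close> up to the boundary, \<open>w'\<close> its derivative, and the
  last conjunct states that \<open>w'\<close> is locally absolutely continuous with
  \<open>- w'' + (t - \<xi>)\<^sup>2 w = f\<close> almost everywhere.\<close>

definition half_line_oscillator :: "real \<Rightarrow> real graph" where
  "half_line_oscillator \<xi> u f \<longleftrightarrow>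
     u \<in> L2 {0<..} \<and> f \<in> L2 {0<..} \<and>
     (\<exists>w w'. (AE t in lebesgue_on {0<..}. u t = w t) \<and>
        (\<forall>t\<ge>0. (w has_vector_derivative w' t) (at t within {0..})) \<and>
        w' 0 = 0 \<and>
        (\<forall>t\<ge>0. ((\<lambda>s. complex_of_real ((s - \<xi>)\<^sup>2) * w s - f s) has_integral (w' t - w' 0)) {0..t}))"

definition half_line_mu :: "real \<Rightarrow> real" where
  "half_line_mu \<xi> =
     (LEAST E. is_eigenvalue {0<..} (half_line_oscillator \<xi>) (complex_of_real E))"

definition Theta0 :: real where
  "Theta0 = (INF \<xi>. half_line_mu \<xi>)"

end

theory Submission
  imports Defs "HOL-Real_Asymp.Real_Asymp" "HOL-Computational_Algebra.Polynomial"
begin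

text \<open>The function \<open>cnj z ^ m * F (\<bar>z\<bar>\<^sup>2)\<close> is an eigenfunction of the magnetic Neumann Laplacian as soon as the
radial profile \<open>F\<close> solves a second order equation on \<open>[0,1]\<close> and satisfies a boundary condition at \<open>1\<close>
(lemma \<open>mag_lambda_le_radial\<close>). It therefore suffices to find, for each \<open>b > 0\<close>, an angular momentum \<open>m\<close> and a
positive radial eigenfunction whose eigenvalue is below \<open>\<Theta>\<^sub>0 b\<close>.

The radial eigenvalues are controlled without spectral theory. The regular solution \<open>rad m b l\<close> is an entire
power series in \<open>x = \<bar>z\<bar>\<^sup>2\<close> that depends continuously on the spectral parameter \<open>l\<close>. For \<open>l = -1\<close> it is positive
with positive flux at the boundary, and a trial function with negative energy at level \<open>l\<close> shows that this is no
longer the case at \<open>l\<close> (\<open>trial_inequality\<close>, Jacobi's form of completing the square). By connectedness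
some intermediate level has a positive solution with zero flux, which is an eigenfunction (\<open>radial_eigenvalue\<close>).

The same shooting argument on the half-line yields a number \<open>\<kappa> > 0\<close> and the de Gennes function \<open>f\<close>, the positive
decaying solution of \<open>f'' = (t\<^sup>2 - 2 \<kappa> t) f\<close> with \<open>f 0 = 1\<close> and \<open>f' 0 = 0\<close>. Shifting \<open>f\<close> gives, for each \<open>\<xi>\<close>, a positive
supersolution of the oscillator centred at \<open>\<xi>\<close>, and comparison with it gives \<open>\<kappa>\<^sup>2 \<le> \<Theta>\<^sub>0\<close> (\<open>Theta0_ge\<close>).
Only this inequality between \<open>\<kappa>\<close> and \<open>\<Theta>\<^sub>0\<close> enters the argument.

For moderate \<open>b\<close> the trial functions are explicit polynomials, one for each of eight ranges of \<open>b\<close>, and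
the bound \<open>\<kappa>\<^sup>2 > 9/16\<close> is enough. For large \<open>b\<close> one puts \<open>\<epsilon> = 2 / sqrt b\<close> and \<open>x = 1 - \<epsilon> t\<close>, so that \<open>t\<close>
measures the distance to the boundary on the magnetic length scale; the trial function is
\<open>f\<close> with a first order correction in \<open>\<epsilon>\<close>. Its energy is a polynomial in \<open>\<epsilon>\<close>, \<open>\<kappa>\<close>, the offset
of the momentum and \<open>M\<^sub>0 = \<integral> f\<^sup>2\<close>. Its leading part is negative: the curvature of the boundary lowers
the energy. Since the angular momentum is an integer, the offset is only known to lie in an interval
of length \<open>\<epsilon>/2\<close>, and negativity over this interval is established for \<open>\<epsilon> \<le> 17/40\<close> from the bounds \<open>3/4 < \<kappa> < 17/20\<close> and
\<open>29/40 * M\<^sub>0 \<le> 1\<close>, which follow from moment identities for \<open>f\<close>.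

Two functional analytic facts relate this to \<open>mag_lambda\<close>, which is an infimum of real spectral points. Every
\<open>E < 0\<close> is in the resolvent set, by the Riesz representation in the form domain
(\<open>negative_in_resolvent_set\<close>), so the infimum is over a set that is bounded below. And a smooth solution of the
eigenvalue equation with vanishing flux is in the operator domain, because the boundary term produced by
cutoffs tends to zero (\<open>smooth_eigenfunction\<close>).\<close>

section \<open>Power series solutions of second order equations\<close>

text \<open>A growth condition that every recursion of the form ``\<open>n c\<^sub>n\<close> is bounded by the previous four coefficients''
satisfies. Being uniform in \<open>c\<close>, it turns continuity of each coefficient in a parameter into joint continuity of the sum.\<close>

definition tame_coeffs :: "real \<Rightarrow> (nat \<Rightarrow> real) \<Rightarrow> bool" where
  "tame_coeffs M c \<longleftrightarrow> \<bar>c 0\<bar> \<le> 1 \<and> (\<forall>n\<ge>1. real n * \<bar>c n\<bar> \<le> M * (\<Sum>i\<in>{n-4..<n}. \<bar>c i\<bar>))"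

lemma tame_crude:
  assumes "tame_coeffs M c" "M \<ge> 0"
  shows "\<bar>c n\<bar> \<le> (4*M+1)^n"
proof (induction n rule: less_induct)
  case (less n)
  let ?A = "4*M+1"
  show ?case
  proof (cases "n = 0")
    case True then show ?thesis using assms unfolding tame_coeffs_def by simp
  next
    case False
    have "\<bar>c i\<bar> \<le> ?A^(n-1)" if "i \<in> {n-4..<n}" for i
    proof -
      have "\<bar>c i\<bar> \<le> ?A^i" using less that by auto
      also have "\<dots> \<le> ?A^(n-1)" using that assms by (intro power_increasing) auto
      finally show ?thesis .
    qed
    then have "(\<Sum>i\<in>{n-4..<n}. \<bar>c i\<bar>) \<le> of_nat (card {n-4..<n}) * ?A^(n-1)"
      by (intro sum_bounded_above) auto
    also have "\<dots> \<le> 4 * ?A^(n-1)" using assms by (intro mult_right_mono) auto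
    finally have s: "(\<Sum>i\<in>{n-4..<n}. \<bar>c i\<bar>) \<le> 4 * ?A^(n-1)" .
    have "\<bar>c n\<bar> \<le> real n * \<bar>c n\<bar>" using False by (simp add: mult_le_cancel_right1)
    also have "\<dots> \<le> M * (\<Sum>i\<in>{n-4..<n}. \<bar>c i\<bar>)" using assms False unfolding tame_coeffs_def by auto
    also have "\<dots> \<le> M * (4 * ?A^(n-1))" using s assms by (intro mult_left_mono) auto
    also have "\<dots> \<le> ?A * ?A^(n-1)" using assms by (simp add: algebra_simps)
    also have "\<dots> = ?A^n" using False by (simp add: power_eq_if)
    finally show ?thesis .
  qed
qed

text \<open>For \<open>n\<close> large compared with \<open>M R\<^sup>4\<close> the recursion cannot increase the largest of the preceding weighted
coefficients, so the crude exponential bound up to that index is a bound for all indices. The bound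
depends only on \<open>M\<close> and \<open>R\<close>.\<close>

lemma tame_bound:
  fixes M R :: real
  assumes "M \<ge> 0" "R \<ge> 1"
  obtains K where "K \<ge> 0" "\<And>c n. tame_coeffs M c \<Longrightarrow> \<bar>c n\<bar> * R^n \<le> K"
proof -
  let ?A = "4*M+1"
  obtain N :: nat where N: "real N \<ge> 4*M*R^4" "N \<ge> 1"
    using real_arch_simple[of "4*M*R^4"] by (metis le_add2 of_nat_le_iff order_trans le_cases)
  define K where "K = (?A*R)^N"
  have AR: "?A*R \<ge> 1" using assms by (simp add: mult_ge1_I)
  have K0: "K \<ge> 0" using AR unfolding K_def by simp
  have "\<bar>c n\<bar> * R^n \<le> K" if c: "tame_coeffs M c" for c n
  proof (induction n rule: less_induct)
    case (less n)
    show ?case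
    proof (cases "n \<le> N")
      case True
      have "\<bar>c n\<bar> * R^n \<le> ?A^n * R^n" using tame_crude[OF c assms(1), of n] assms by (intro mult_right_mono) auto
      also have "\<dots> = (?A*R)^n" by (simp add: power_mult_distrib)
      also have "\<dots> \<le> K" unfolding K_def using AR True by (intro power_increasing) auto
      finally show ?thesis .
    next
      case False
      then have n: "n \<ge> 1" "real n \<ge> 4*M*R^4" "real n > 0" using N by auto
      have "\<bar>c i\<bar> * R^n \<le> K * R^4" if i: "i \<in> {n-4..<n}" for i
      proof -
        have "R^n = R^i * R^(n-i)" using i by (simp flip: power_add)
        moreover have "R^(n-i) \<le> R^4" using i assms by (intro power_increasing) auto
        moreover have "\<bar>c i\<bar> * R^i \<le> K" using less i by auto
        ultimately show ?thesis using mult_mono[of "\<bar>c i\<bar> * R^i" K "R^(n-i)" "R^4"] assms K0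
          by (simp add: mult.assoc)
      qed
      then have "(\<Sum>i\<in>{n-4..<n}. \<bar>c i\<bar> * R^n) \<le> of_nat (card {n-4..<n}) * (K * R^4)"
        by (intro sum_bounded_above) auto
      also have "\<dots> \<le> 4 * (K * R^4)" using assms K0 by (intro mult_right_mono) auto
      finally have s: "(\<Sum>i\<in>{n-4..<n}. \<bar>c i\<bar>) * R^n \<le> 4 * (K * R^4)" by (simp add: sum_distrib_right)
      have "real n * (\<bar>c n\<bar> * R^n) = (real n * \<bar>c n\<bar>) * R^n" by simp
      also have "\<dots> \<le> (M * (\<Sum>i\<in>{n-4..<n}. \<bar>c i\<bar>)) * R^n"
        using c n assms unfolding tame_coeffs_def by (intro mult_right_mono) auto
      also have "\<dots> \<le> M * (4 * (K * R^4))"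
        using mult_left_mono[OF s assms(1)] by (simp add: mult.assoc)
      also have "\<dots> = (4*M*R^4) * K" by simp
      also have "\<dots> \<le> real n * K" using n K0 by (intro mult_right_mono) auto
      finally show ?thesis using n by simp
    qed
  qed
  then show ?thesis using K0 that by blast
qed

lemma tame_summable:
  assumes "tame_coeffs M c" "M \<ge> 0"
  shows "summable (\<lambda>n. c n * t^n)"
proof -
  define R where "R = 2 * (\<bar>t\<bar> + 1)"
  have R: "R \<ge> 1" unfolding R_def by simp
  obtain K where K: "\<And>c n. tame_coeffs M c \<Longrightarrow> \<bar>c n\<bar> * R^n \<le> K" using tame_bound[OF assms(2) R] by metis
  show ?thesis
  proof (rule summable_comparison_test)
    show "\<exists>N. \<forall>n\<ge>N. norm (c n * t^n) \<le> K * (1/2)^n"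
    proof (intro exI allI impI)
      fix n
      have "\<bar>t\<bar>^n \<le> (R/2)^n" unfolding R_def by (intro power_mono) auto
      then have "\<bar>c n\<bar> * \<bar>t\<bar>^n \<le> \<bar>c n\<bar> * R^n * (1/2)^n"
        by (simp add: power_divide mult_left_mono field_simps)
      also have "\<dots> \<le> K * (1/2)^n" using K[OF assms(1)] by (intro mult_right_mono) auto
      finally show "norm (c n * t^n) \<le> K * (1/2)^n" by (simp add: abs_mult power_abs)
    qed
  qed (intro summable_mult summable_geometric, simp)
qed

lemma powser_entire_deriv:
  fixes c :: "nat \<Rightarrow> real"
  assumes "\<And>t. summable (\<lambda>n. c n * t^n)"
  shows "((\<lambda>t. \<Sum>n. c n * t^n) has_real_derivative (\<Sum>n. diffs c n * t^n)) (at t)"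
    and "summable (\<lambda>n. diffs c n * t^n)"
  using termdiffs_strong_converges_everywhere[OF assms] termdiff_converges_all[OF assms] by auto

text \<open>The uniform bound gives a geometric majorant, so the partial sums converge uniformly and the limit inherits their continuity.\<close>

lemma tame_continuous:
  fixes c :: "real \<Rightarrow> nat \<Rightarrow> real"
  assumes M: "M \<ge> 0" and tame: "\<And>k. k \<in> I \<Longrightarrow> tame_coeffs M (c k)"
    and cont: "\<And>n. continuous_on I (\<lambda>k. c k n)"
  shows "continuous_on (I \<times> {-r..r}) (\<lambda>z. \<Sum>n. c (fst z) n * snd z^n)"
    and "continuous_on (I \<times> {-r..r}) (\<lambda>z. \<Sum>n. diffs (c (fst z)) n * snd z^n)"
proof -
  define R where "R = 4 * (\<bar>r\<bar> + 1)"
  have R: "R \<ge> 1" unfolding R_def by simp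
  obtain K where K0: "K \<ge> 0" and K: "\<And>c n. tame_coeffs M c \<Longrightarrow> \<bar>c n\<bar> * R^n \<le> K"
    using tame_bound[OF M R] by metis
  have sm: "summable (\<lambda>n. K * (1/2::real)^n)" by (intro summable_mult summable_geometric) simp
  have tR: "\<bar>t\<bar>^n \<le> R^n * (1/4)^n" if "t \<in> {-r..r}" for t n
  proof -
    have "\<bar>t\<bar>^n \<le> (R/4)^n" unfolding R_def using that by (intro power_mono) auto
    then show ?thesis by (simp add: power_divide)
  qed
  have b1: "norm (c k n * t^n) \<le> K * (1/2)^n" if "k \<in> I" "t \<in> {-r..r}" for k n t
  proof -
    have "\<bar>c k n\<bar> * \<bar>t\<bar>^n \<le> \<bar>c k n\<bar> * (R^n * (1/4)^n)" using tR[OF that(2)] by (intro mult_left_mono) auto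
    also have "\<dots> \<le> K * (1/4)^n" using mult_right_mono[OF K[OF tame[OF that(1)], of n], of "(1/4)^n"]
      by (simp add: mult.assoc)
    also have "\<dots> \<le> K * (1/2)^n" using K0 by (intro mult_left_mono power_mono) auto
    finally show ?thesis by (simp add: abs_mult power_abs)
  qed
  have b2: "norm (diffs (c k) n * t^n) \<le> K * (1/2)^n" if "k \<in> I" "t \<in> {-r..r}" for k n t
  proof -
    have n2: "real (Suc n) \<le> 2^n" by (metis Suc_leI less_exp of_nat_le_iff of_nat_numeral of_nat_power)
    have "R^n \<le> R^Suc n" using R by (intro power_increasing) auto
    then have cn: "\<bar>c k (Suc n)\<bar> * R^n \<le> K"
      using K[OF tame[OF that(1)], of "Suc n"] mult_left_mono[of "R^n" "R^Suc n" "\<bar>c k (Suc n)\<bar>"] by linarith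
    have "\<bar>c k (Suc n)\<bar> * \<bar>t\<bar>^n \<le> \<bar>c k (Suc n)\<bar> * (R^n * (1/4)^n)" using tR[OF that(2)] by (intro mult_left_mono) auto
    also have "\<dots> \<le> K * (1/4)^n" using mult_right_mono[OF cn, of "(1/4)^n"]
      by (simp add: mult.assoc)
    finally have "real (Suc n) * (\<bar>c k (Suc n)\<bar> * \<bar>t\<bar>^n) \<le> 2^n * (K * (1/4)^n)"
      using n2 by (intro mult_mono[of "real (Suc n)" "2^n"]) auto
    also have "\<dots> = K * (1/2)^n"
    proof -
      have "(2::real)^n * (1/4)^n = (1/2)^n" by (simp flip: power_mult_distrib)
      then show ?thesis by (metis mult.assoc mult.commute)
    qed
    finally show ?thesis by (simp add: abs_mult power_abs diffs_def mult.assoc)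
  qed
  have u1: "uniform_limit (I \<times> {-r..r}) (\<lambda>N z. \<Sum>n<N. c (fst z) n * snd z^n)
      (\<lambda>z. \<Sum>n. c (fst z) n * snd z^n) sequentially"
    by (rule Weierstrass_m_test[OF b1 sm]) auto
  have u2: "uniform_limit (I \<times> {-r..r}) (\<lambda>N z. \<Sum>n<N. diffs (c (fst z)) n * snd z^n)
      (\<lambda>z. \<Sum>n. diffs (c (fst z)) n * snd z^n) sequentially"
    by (rule Weierstrass_m_test[OF b2 sm]) auto
  have cc: "continuous_on (I \<times> {-r..r}) (\<lambda>z. c (fst z) n)" for n
    by (rule continuous_on_compose2[OF cont[of n] continuous_on_fst[OF continuous_on_id]]) auto
  have p1: "continuous_on (I \<times> {-r..r}) (\<lambda>z. \<Sum>n<N. c (fst z) n * snd z^n)" for N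
    by (intro continuous_on_sum continuous_on_mult cc continuous_on_power continuous_on_snd continuous_on_id)
  have p2: "continuous_on (I \<times> {-r..r}) (\<lambda>z. \<Sum>n<N. diffs (c (fst z)) n * snd z^n)" for N
    unfolding diffs_def
    by (intro continuous_on_sum continuous_on_mult continuous_on_const cc continuous_on_power continuous_on_snd continuous_on_id)
  show "continuous_on (I \<times> {-r..r}) (\<lambda>z. \<Sum>n. c (fst z) n * snd z^n)"
    by (rule uniform_limit_theorem[OF always_eventually u1]) (simp_all add: p1)
  show "continuous_on (I \<times> {-r..r}) (\<lambda>z. \<Sum>n. diffs (c (fst z)) n * snd z^n)"
    by (rule uniform_limit_theorem[OF always_eventually u2]) (simp_all add: p2)
qed

lemma sums_shift:
  fixes c :: "nat \<Rightarrow> real"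
  assumes "(\<lambda>n. c n * t^n) sums S"
  shows "(\<lambda>n. (if n = 0 then 0 else c (n-1)) * t^n) sums (t * S)"
proof -
  have "(\<lambda>n. (if Suc n = 0 then 0 else c (Suc n-1)) * t^Suc n) sums (t * S)"
    using sums_mult[OF assms, of t] by (simp add: mult_ac)
  then show ?thesis by (subst (asm) sums_Suc_iff) simp
qed

text \<open>Taylor coefficients at \<open>0\<close> of the solution of \<open>y'' = (a + b t + c t\<^sup>2) y\<close> with \<open>y 0 = 1\<close> and \<open>y' 0 = 0\<close>.\<close>

fun schr_coeff :: "real \<Rightarrow> real \<Rightarrow> real \<Rightarrow> nat \<Rightarrow> real" where
  "schr_coeff a b c 0 = 1"
| "schr_coeff a b c (Suc 0) = 0"
| "schr_coeff a b c (Suc (Suc n)) =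
     (a * schr_coeff a b c n + b * (if n = 0 then 0 else schr_coeff a b c (n-1))
      + c * (if n \<le> 1 then 0 else schr_coeff a b c (n-2))) / (real (n+2) * real (n+1))"

lemma schr_tame:
  assumes "\<bar>a\<bar> \<le> M" "\<bar>b\<bar> \<le> M" "\<bar>c\<bar> \<le> M"
  shows "tame_coeffs M (schr_coeff a b c)"
  unfolding tame_coeffs_def
proof (intro conjI allI impI)
  fix n :: nat assume "n \<ge> 1"
  let ?s = "schr_coeff a b c"
  have M: "M \<ge> 0" using assms by linarith
  show "real n * \<bar>?s n\<bar> \<le> M * (\<Sum>i\<in>{n-4..<n}. \<bar>?s i\<bar>)"
  proof (cases "n = 1")
    case True
    then have "?s n = 0" by simp
    moreover have "(\<Sum>i\<in>{n-4..<n}. \<bar>?s i\<bar>) \<ge> 0" by (intro sum_nonneg) auto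
    ultimately show ?thesis using M by simp
  next
    case False
    then obtain k where k: "n = Suc (Suc k)" using \<open>n \<ge> 1\<close> that[of "n-2"] by auto
    define u where "u = (if k = 0 then 0 else ?s (k-1))"
    define v where "v = (if k \<le> 1 then 0 else ?s (k-2))"
    let ?x = "\<bar>?s k\<bar> + \<bar>u\<bar> + \<bar>v\<bar>"
    have "\<bar>a * ?s k + b * u + c * v\<bar> \<le> \<bar>a * ?s k\<bar> + \<bar>b * u\<bar> + \<bar>c * v\<bar>" by linarith
    also have "\<dots> \<le> M * \<bar>?s k\<bar> + M * \<bar>u\<bar> + M * \<bar>v\<bar>"
      unfolding abs_mult using assms by (intro add_mono mult_right_mono) auto
    finally have num: "\<bar>a * ?s k + b * u + c * v\<bar> \<le> M * ?x"
      by (simp only: distrib_left)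
    have xs: "?x \<le> (\<Sum>i\<in>{n-4..<n}. \<bar>?s i\<bar>)"
    proof -
      consider "k = 0" | "k = 1" | j where "k = Suc (Suc j)" by (metis One_nat_def not0_implies_Suc)
      then show ?thesis
      proof cases
        case 3
        have "{n-4..<n} = {j,Suc j,Suc (Suc j),Suc (Suc (Suc j))}" using k 3 by auto
        then show ?thesis using 3 by (simp add: u_def v_def)
      next
        case 2
        have "{n-4..<n} = {0,1,2}" using k 2 by auto
        then show ?thesis using 2 by (simp add: u_def v_def)
      next
        case 1
        have "{n-4..<n} = {0,1}" using k 1 by auto
        then show ?thesis using 1 by (simp add: u_def v_def)
      qed
    qed
    have sn: "?s n = (a * ?s k + b * u + c * v) / (real (k+2) * real (k+1))"
      unfolding k u_def v_def by simp
    have "real n * \<bar>?s n\<bar> = \<bar>a * ?s k + b * u + c * v\<bar> / real (k+1)"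
      unfolding sn abs_divide by (simp add: k abs_mult divide_simps)
    also have "\<dots> \<le> \<bar>a * ?s k + b * u + c * v\<bar>"
      by (intro mult_imp_div_pos_le) (auto simp: algebra_simps)
    also have "\<dots> \<le> M * ?x" by (rule num)
    also have "\<dots> \<le> M * (\<Sum>i\<in>{n-4..<n}. \<bar>?s i\<bar>)" using xs M by (intro mult_left_mono)
    finally show ?thesis .
  qed
qed simp

definition schr :: "real \<Rightarrow> real \<Rightarrow> real \<Rightarrow> real \<Rightarrow> real" where
  "schr a b c t = (\<Sum>n. schr_coeff a b c n * t^n)"
definition schr' :: "real \<Rightarrow> real \<Rightarrow> real \<Rightarrow> real \<Rightarrow> real" where
  "schr' a b c t = (\<Sum>n. diffs (schr_coeff a b c) n * t^n)"

lemma schr_summable: "summable (\<lambda>n. schr_coeff a b c n * t^n)"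
  by (rule tame_summable[OF schr_tame[of a "\<bar>a\<bar>+\<bar>b\<bar>+\<bar>c\<bar>"]]) auto

lemma schr_deriv: "(schr a b c has_real_derivative schr' a b c t) (at t)"
  unfolding schr_def[abs_def] schr'_def by (rule powser_entire_deriv(1)[OF schr_summable])

lemma schr'_deriv: "(schr' a b c has_real_derivative (a + b*t + c*t^2) * schr a b c t) (at t)"
proof -
  let ?s = "schr_coeff a b c"
  have s1: "summable (\<lambda>n. diffs ?s n * t^n)" for t
    using powser_entire_deriv(2)[OF schr_summable] .
  have "((\<lambda>t. \<Sum>n. diffs ?s n * t^n) has_real_derivative (\<Sum>n. diffs (diffs ?s) n * t^n)) (at t)"
    by (rule powser_entire_deriv(1)[OF s1])
  moreover have "(\<lambda>n. diffs (diffs ?s) n * t^n) sums ((a + b*t + c*t^2) * schr a b c t)"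
  proof -
    have 0: "(\<lambda>n. ?s n * t^n) sums schr a b c t"
      unfolding schr_def using schr_summable by (rule summable_sums)
    note 1 = sums_shift[OF 0]
    note 2 = sums_shift[OF 1]
    have "(\<lambda>n. a * (?s n * t^n) + b * ((if n = 0 then 0 else ?s (n-1)) * t^n)
       + c * ((if n = 0 then 0 else if n - 1 = 0 then 0 else ?s (n-1-1)) * t^n)) sums
       (a * schr a b c t + b * (t * schr a b c t) + c * (t * (t * schr a b c t)))"
      by (intro sums_add sums_mult 0 1 2)
    also have "(\<lambda>n. a * (?s n * t^n) + b * ((if n = 0 then 0 else ?s (n-1)) * t^n)
       + c * ((if n = 0 then 0 else if n - 1 = 0 then 0 else ?s (n-1-1)) * t^n)) = (\<lambda>n. diffs (diffs ?s) n * t^n)"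
    proof
      fix n
      have "diffs (diffs ?s) n = a * ?s n + b * (if n = 0 then 0 else ?s (n-1)) + c * (if n \<le> 1 then 0 else ?s (n-2))"
        unfolding diffs_def by (simp del: of_nat_Suc add: field_simps)
      moreover have "(if n = 0 then 0 else if n - 1 = 0 then 0 else ?s (n-1-1)) = (if n \<le> 1 then 0 else ?s (n-2))"
        by (auto simp: numeral_2_eq_2)
      ultimately show "a * (?s n * t^n) + b * ((if n = 0 then 0 else ?s (n-1)) * t^n)
       + c * ((if n = 0 then 0 else if n - 1 = 0 then 0 else ?s (n-1-1)) * t^n) = diffs (diffs ?s) n * t^n"
        by (simp only: distrib_right mult.assoc)
    qed
    finally show ?thesis by (simp add: algebra_simps power2_eq_square)
  qed
  ultimately show ?thesis unfolding schr'_def[abs_def] by (metis sums_unique)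
qed

lemma schr_0 [simp]: "schr a b c 0 = 1" and schr'_0 [simp]: "schr' a b c 0 = 0"
proof -
  show "schr a b c 0 = 1" unfolding schr_def using powser_zero[of "schr_coeff a b c"] by simp
  show "schr' a b c 0 = 0" unfolding schr'_def using powser_zero[of "diffs (schr_coeff a b c)"] by (simp add: diffs_def)
qed

lemma schr_coeff_continuous:
  fixes a b c :: "real \<Rightarrow> real"
  assumes [continuous_intros]: "continuous_on I a" "continuous_on I b" "continuous_on I c"
  shows "continuous_on I (\<lambda>k. schr_coeff (a k) (b k) (c k) n)"
proof (induction n rule: less_induct)
  case (less n)
  consider "n = 0" | "n = 1" | k where "n = Suc (Suc k)" by (metis One_nat_def not0_implies_Suc)
  then show ?case
  proof cases
    case 3
    have [continuous_intros]: "continuous_on I (\<lambda>x. schr_coeff (a x) (b x) (c x) k)"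
      "continuous_on I (\<lambda>x. schr_coeff (a x) (b x) (c x) (k-1))" 
      "continuous_on I (\<lambda>x. schr_coeff (a x) (b x) (c x) (k-2))" using less 3 by auto
    show ?thesis unfolding 3 schr_coeff.simps
      by (cases "k = 0"; cases "k \<le> 1") (auto intro!: continuous_intros simp del: One_nat_def)
  qed auto
qed

lemma schr_joint_continuous:
  fixes a b c :: "real \<Rightarrow> real"
  assumes "continuous_on {0..L} a" "continuous_on {0..L} b" "continuous_on {0..L} c"
  shows "continuous_on ({0..L} \<times> {-r..r}) (\<lambda>z. schr (a (fst z)) (b (fst z)) (c (fst z)) (snd z))"
    and "continuous_on ({0..L} \<times> {-r..r}) (\<lambda>z. schr' (a (fst z)) (b (fst z)) (c (fst z)) (snd z))"
proof -
  have "\<exists>B. \<forall>k\<in>{0..L}. \<bar>f k\<bar> \<le> B" if "continuous_on {0..L} f" for f :: "real \<Rightarrow> real"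
    using compact_imp_bounded[OF compact_continuous_image[OF that compact_Icc]]
    by (auto simp: bounded_iff)
  then obtain A B C where ABC: "\<And>k. k\<in>{0..L} \<Longrightarrow> \<bar>a k\<bar> \<le> A" "\<And>k. k\<in>{0..L} \<Longrightarrow> \<bar>b k\<bar> \<le> B" "\<And>k. k\<in>{0..L} \<Longrightarrow> \<bar>c k\<bar> \<le> C"
    using assms by metis
  let ?M = "\<bar>A\<bar>+\<bar>B\<bar>+\<bar>C\<bar>"
  have t: "tame_coeffs ?M (schr_coeff (a k) (b k) (c k))" if "k \<in> {0..L}" for k
    using ABC[OF that] by (intro schr_tame) linarith+
  show "continuous_on ({0..L} \<times> {-r..r}) (\<lambda>z. schr (a (fst z)) (b (fst z)) (c (fst z)) (snd z))"
    unfolding schr_def by (rule tame_continuous(1)[where c="\<lambda>k. schr_coeff (a k) (b k) (c k)", OF _ t]) (auto intro: schr_coeff_continuous assms)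
  show "continuous_on ({0..L} \<times> {-r..r}) (\<lambda>z. schr' (a (fst z)) (b (fst z)) (c (fst z)) (snd z))"
    unfolding schr'_def by (rule tame_continuous(2)[where c="\<lambda>k. schr_coeff (a k) (b k) (c k)", OF _ t]) (auto intro: schr_coeff_continuous assms)
qed

section \<open>Uniqueness, convexity and connectedness\<close>

text \<open>A Gronwall argument for the energy \<open>y\<^sup>2 + y'\<^sup>2\<close>. The bound on \<open>y''\<close> is required only in the open interval,
which later allows equations that are singular at an endpoint.\<close>

lemma second_order_zero:
  fixes y y' y'' :: "real \<Rightarrow> real"
  assumes t0: "a \<le> t0" "t0 \<le> b"
    and cont: "continuous_on {a..b} y" "continuous_on {a..b} y'"
    and d1: "\<And>t. a < t \<Longrightarrow> t < b \<Longrightarrow> (y has_real_derivative y' t) (at t)"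
    and d2: "\<And>t. a < t \<Longrightarrow> t < b \<Longrightarrow> (y' has_real_derivative y'' t) (at t)"
    and bound: "\<And>t. a < t \<Longrightarrow> t < b \<Longrightarrow> \<bar>y'' t\<bar> \<le> M * (\<bar>y t\<bar> + \<bar>y' t\<bar>)"
    and M: "M \<ge> 0"
    and z: "y t0 = 0" "y' t0 = 0"
    and t: "t \<in> {a..b}"
  shows "y t = 0"
proof -
  define C where "C = 1 + 3 * M"
  define E where "E = (\<lambda>t. (y t)\<^sup>2 + (y' t)\<^sup>2)"
  have E': "(E has_real_derivative (2 * y t * y' t + 2 * y' t * y'' t)) (at t)"
    and Eb: "\<bar>2 * y t * y' t + 2 * y' t * y'' t\<bar> \<le> C * E t" if "a < t" "t < b" for t
  proof -
    show "(E has_real_derivative (2 * y t * y' t + 2 * y' t * y'' t)) (at t)"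
      unfolding E_def by (rule derivative_eq_intros d1 d2 that refl | simp)+
    have s: "2 * (\<bar>y t\<bar> * \<bar>y' t\<bar>) \<le> E t"
      using sum_squares_bound[of "\<bar>y t\<bar>" "\<bar>y' t\<bar>"] unfolding E_def by simp
    have "\<bar>y' t\<bar> * \<bar>y'' t\<bar> \<le> \<bar>y' t\<bar> * (M * (\<bar>y t\<bar> + \<bar>y' t\<bar>))"
      using bound[OF that] by (intro mult_left_mono) auto
    also have "\<dots> = M * (\<bar>y t\<bar> * \<bar>y' t\<bar> + (y' t)\<^sup>2)" by (simp add: algebra_simps power2_eq_square flip: abs_mult)
    finally have 1: "2 * (\<bar>y' t\<bar> * \<bar>y'' t\<bar>) \<le> M * (2 * (\<bar>y t\<bar> * \<bar>y' t\<bar>) + 2 * (y' t)\<^sup>2)"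
      by (simp add: algebra_simps)
    have "2 * (\<bar>y t\<bar> * \<bar>y' t\<bar>) + 2 * (y' t)\<^sup>2 \<le> 3 * E t" using s unfolding E_def by (smt (verit) zero_le_power2)
    then have "2 * (\<bar>y' t\<bar> * \<bar>y'' t\<bar>) \<le> M * (3 * E t)" using 1 M by (smt (verit) mult_left_mono)
    then show "\<bar>2 * y t * y' t + 2 * y' t * y'' t\<bar> \<le> C * E t"
    proof -
      have "\<bar>2 * y t * y' t + 2 * y' t * y'' t\<bar> \<le> \<bar>2 * y t * y' t\<bar> + \<bar>2 * y' t * y'' t\<bar>" by (rule abs_triangle_ineq)
      also have "\<dots> = 2 * (\<bar>y t\<bar> * \<bar>y' t\<bar>) + 2 * (\<bar>y' t\<bar> * \<bar>y'' t\<bar>)" by (simp add: abs_mult)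
      also have "\<dots> \<le> E t + M * (3 * E t)" using s \<open>2 * (\<bar>y' t\<bar> * \<bar>y'' t\<bar>) \<le> M * (3 * E t)\<close> by linarith
      also have "\<dots> = C * E t" unfolding C_def by (simp add: algebra_simps)
      finally show ?thesis .
    qed
  qed
  have Ec: "continuous_on {a..b} E" unfolding E_def by (intro continuous_intros cont)
  have E0: "E t0 = 0" using z unfolding E_def by simp
  have Enn: "E t \<ge> 0" unfolding E_def by simp
  have "E t \<le> 0"
  proof (cases "t0 \<le> t")
    case True
    have "E t * exp (- C * t) \<le> E t0 * exp (- C * t0)"
    proof (rule DERIV_nonpos_imp_decreasing_open[OF True])
      fix s assume s: "t0 < s" "s < t"
      then have s': "a < s" "s < b" using t0 t by auto
      have "((\<lambda>s. E s * exp (- C * s)) has_real_derivative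
         ((2 * y s * y' s + 2 * y' s * y'' s) - C * E s) * exp (- C * s)) (at s)"
        by (rule derivative_eq_intros E'[OF s'] refl | simp add: algebra_simps)+
      moreover have "((2 * y s * y' s + 2 * y' s * y'' s) - C * E s) * exp (- C * s) \<le> 0"
        using Eb[OF s'] by (intro mult_nonpos_nonneg) auto
      ultimately show "\<exists>y. ((\<lambda>s. E s * exp (- C * s)) has_real_derivative y) (at s) \<and> y \<le> 0" by blast
    next
      show "continuous_on {t0..t} (\<lambda>s. E s * exp (- C * s))"
        using t0 t by (intro continuous_intros continuous_on_subset[OF Ec]) auto
    qed
    then show ?thesis using E0 by (simp add: mult_le_0_iff)
  next
    case False
    then have le: "t \<le> t0" by simp
    have "E t * exp (C * t) \<le> E t0 * exp (C * t0)"
    proof (rule DERIV_nonneg_imp_increasing_open[OF le])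
      fix s assume s: "t < s" "s < t0"
      then have s': "a < s" "s < b" using t0 t by auto
      have "((\<lambda>s. E s * exp (C * s)) has_real_derivative
         ((2 * y s * y' s + 2 * y' s * y'' s) + C * E s) * exp (C * s)) (at s)"
        by (rule derivative_eq_intros E'[OF s'] refl | simp add: algebra_simps)+
      moreover have "((2 * y s * y' s + 2 * y' s * y'' s) + C * E s) * exp (C * s) \<ge> 0"
        using Eb[OF s'] by (intro mult_nonneg_nonneg) auto
      ultimately show "\<exists>y. ((\<lambda>s. E s * exp (C * s)) has_real_derivative y) (at s) \<and> 0 \<le> y" by blast
    next
      show "continuous_on {t..t0} (\<lambda>s. E s * exp (C * s))"
        using t0 t by (intro continuous_intros continuous_on_subset[OF Ec]) auto
    qed
    then show ?thesis using E0 by (simp add: mult_le_0_iff)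
  qed
  then have "E t = 0" using Enn by simp
  then show ?thesis unfolding E_def by (simp add: sum_power2_eq_zero_iff)
qed

lemma convex_growth:
  fixes y y' q :: "real \<Rightarrow> real"
  assumes d1: "\<And>s. s \<ge> t \<Longrightarrow> (y has_real_derivative y' s) (at s)"
    and d2: "\<And>s. s \<ge> t \<Longrightarrow> (y' has_real_derivative q s * y s) (at s)"
    and q: "\<And>s. s \<ge> t \<Longrightarrow> q s \<ge> 0"
    and init: "y t > 0" "y' t \<ge> 0"
    and r: "r \<ge> t"
  shows "y r \<ge> y t" "y' r \<ge> y' t"
proof -
  have *: "y' r \<ge> y' t \<and> y r \<ge> y t" if r: "r \<ge> t" and pos: "\<And>s. t < s \<Longrightarrow> s < r \<Longrightarrow> y s \<ge> 0" for r
  proof -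
    have m: "y' s \<ge> y' t" if "s \<in> {t..r}" for s
    proof (rule DERIV_nonneg_imp_increasing_open[of t s y'])
      show "t \<le> s" using that by simp
      show "continuous_on {t..s} y'" using d2 by (intro DERIV_atLeastAtMost_imp_continuous_on) fastforce
      fix x assume x: "t < x" "x < s"
      then have "q x * y x \<ge> 0" using q[of x] pos[of x] that by auto
      then show "\<exists>z. (y' has_real_derivative z) (at x) \<and> 0 \<le> z" using d2[of x] x by auto
    qed
    have "y t \<le> y r"
    proof (rule DERIV_nonneg_imp_increasing_open[of t r y, OF r])
      show "continuous_on {t..r} y" using d1 by (intro DERIV_atLeastAtMost_imp_continuous_on) fastforce
      fix x assume x: "t < x" "x < r"
      then show "\<exists>z. (y has_real_derivative z) (at x) \<and> 0 \<le> z" using d1[of x] m[of x] init by auto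
    qed
    then show ?thesis using m[of r] r by auto
  qed
  have pos: "y s > 0" if s: "s \<in> {t..r}" for s
  proof (rule ccontr)
    assume neg: "\<not> y s > 0"
    define Z where "Z = {x\<in>{t..s}. y x \<le> 0}"
    have c: "continuous_on {t..s} y" using d1 by (intro DERIV_atLeastAtMost_imp_continuous_on) fastforce
    have "Z = {t..s} \<inter> y -` {..0}" unfolding Z_def by auto
    then have cl: "closed Z" using continuous_closed_preimage[OF c] by simp
    have ne: "Z \<noteq> {}" using neg s unfolding Z_def by auto
    have bb: "bdd_below Z" unfolding Z_def by (intro bdd_belowI[of _ t]) auto
    define z where "z = Inf Z"
    have zZ: "z \<in> Z" unfolding z_def using closed_contains_Inf[OF ne bb cl] .
    have "y x \<ge> 0" if "t < x" "x < z" for x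
    proof (rule ccontr)
      assume "\<not> y x \<ge> 0"
      then have "x \<in> Z" using that zZ unfolding Z_def by auto
      then have "z \<le> x" unfolding z_def by (rule cInf_lower[OF _ bb])
      then show False using that by simp
    qed
    then have "y z \<ge> y t" using *[of z] zZ unfolding Z_def by auto
    then show False using zZ init unfolding Z_def by auto
  qed
  show "y r \<ge> y t" "y' r \<ge> y' t" using *[OF r] pos by (auto simp: less_imp_le)
qed

lemma nearby_positive:
  fixes y :: "real \<Rightarrow> real \<Rightarrow> real"
  assumes S: "compact S" and I: "compact I"
    and c: "continuous_on (I \<times> S) (\<lambda>z. y (fst z) (snd z))"
    and k: "k \<in> I" and pos: "\<And>s. s \<in> S \<Longrightarrow> y k s > 0"
  shows "\<exists>e>0. \<forall>k'\<in>I. dist k' k < e \<longrightarrow> (\<forall>s\<in>S. y k' s > 0)"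
proof (cases "S = {}")
  case False
  have "continuous_on S (\<lambda>s. y k s)"
  proof -
    have "continuous_on S (\<lambda>s. (k,s))" by (intro continuous_intros)
    moreover have "(\<lambda>s. (k,s)) ` S \<subseteq> I \<times> S" using k by auto
    ultimately show ?thesis using continuous_on_compose2[OF c, of S "\<lambda>s. (k,s)"] by simp
  qed
  then obtain s0 where s0: "s0 \<in> S" "\<And>s. s \<in> S \<Longrightarrow> y k s0 \<le> y k s"
    using continuous_attains_inf[OF S False] by metis
  have "uniformly_continuous_on (I \<times> S) (\<lambda>z. y (fst z) (snd z))"
    using compact_uniformly_continuous[OF c compact_Times[OF I S]] .
  then obtain d where d: "d > 0" "\<And>z z'. z \<in> I \<times> S \<Longrightarrow> z' \<in> I \<times> S \<Longrightarrow> dist z' z < d \<Longrightarrow>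
      dist (y (fst z') (snd z')) (y (fst z) (snd z)) < y k s0"
    unfolding uniformly_continuous_on_def using pos[OF s0(1)] by meson
  have "y k' s > 0" if "k' \<in> I" "dist k' k < d" "s \<in> S" for k' s
  proof -
    have "dist (k',s) (k,s) < d" using that by (simp add: dist_Pair_Pair)
    then have "dist (y k' s) (y k s) < y k s0" using d(2)[of "(k,s)" "(k',s)"] that k by auto
    then show ?thesis using s0(2)[OF that(3)] by (auto simp: dist_real_def)
  qed
  then show ?thesis using d(1) by blast
qed (auto intro: exI[of _ 1])

text \<open>The shooting principle: two disjoint relatively open conditions that hold at opposite ends of an interval cannot cover it.\<close>

lemma connected_interval_gap:
  fixes L :: real
  assumes L: "0 \<le> L" and PQ: "\<And>k. \<not> (P k \<and> Q k)" and P: "P L" and Q: "Q 0"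
    and oP: "\<And>k. k \<in> {0..L} \<Longrightarrow> P k \<Longrightarrow> \<exists>e>0. \<forall>k'\<in>{0..L}. dist k' k < e \<longrightarrow> P k'"
    and oQ: "\<And>k. k \<in> {0..L} \<Longrightarrow> Q k \<Longrightarrow> \<exists>e>0. \<forall>k'\<in>{0..L}. dist k' k < e \<longrightarrow> Q k'"
  obtains k where "0 < k" "k < L" "\<not> P k" "\<not> Q k"
proof -
  have oA: "openin (top_of_set {0..L}) {k\<in>{0..L}. P k}"
    unfolding openin_euclidean_subtopology_iff using oP by (auto; metis)
  have oB: "openin (top_of_set {0..L}) {k\<in>{0..L}. Q k}"
    unfolding openin_euclidean_subtopology_iff using oQ by (auto; metis)
  have "\<exists>k\<in>{0..L}. \<not> P k \<and> \<not> Q k"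
  proof (rule ccontr)
    assume "\<not> ?thesis"
    then have "{0..L} \<subseteq> {k\<in>{0..L}. P k} \<union> {k\<in>{0..L}. Q k}" by auto
    moreover have "{k\<in>{0..L}. P k} \<inter> {k\<in>{0..L}. Q k} = {}" using PQ by auto
    moreover have "{k\<in>{0..L}. P k} \<noteq> {}" "{k\<in>{0..L}. Q k} \<noteq> {}" using P Q L by auto
    ultimately show False using oA oB connected_Icc[of 0 L] unfolding connected_openin by blast
  qed
  then obtain k where k: "k \<in> {0..L}" "\<not> P k" "\<not> Q k" by auto
  then have "k \<noteq> 0" "k \<noteq> L" using P Q by auto
  then have "0 < k" "k < L" using k by auto
  then show ?thesis using that k by blast
qed

section \<open>Shooting on the half-line\<close>

lemma continuous_on_Icc_bounded:
  fixes f :: "real \<Rightarrow> real"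
  assumes "continuous_on {a..b} f"
  obtains M where "\<And>s. s \<in> {a..b} \<Longrightarrow> \<bar>f s\<bar> \<le> M"
proof -
  have "bounded (f ` {a..b})" by (intro compact_imp_bounded compact_continuous_image assms compact_Icc)
  then obtain M where "\<forall>x\<in>f ` {a..b}. norm x \<le> M" unfolding bounded_iff by blast
  then show ?thesis using that[of M] by auto
qed

lemma derivative_imp_continuous_on:
  fixes f :: "real \<Rightarrow> real"
  assumes "\<And>t. t \<in> S \<Longrightarrow> (f has_real_derivative f' t) (at t)"
  shows "continuous_on S f"
  by (rule DERIV_continuous_on[of S f f']) (use assms in \<open>auto intro: has_field_derivative_at_within\<close>)

text \<open>Where \<open>q\<close> is at most \<open>-4\<close> a positive solution turns down too fast to stay positive up to \<open>t = 3\<close>.\<close>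

lemma concave_becomes_negative:
  fixes y y' q :: "real \<Rightarrow> real"
  assumes d1: "\<And>t. (y has_real_derivative y' t) (at t)"
    and d2: "\<And>t. (y' has_real_derivative q t * y t) (at t)"
    and init: "y 0 = 1" "y' 0 = 0"
    and q0: "\<And>t. 0 \<le> t \<Longrightarrow> t \<le> 3 \<Longrightarrow> q t \<le> 0"
    and q4: "\<And>t. 1 \<le> t \<Longrightarrow> t \<le> 2 \<Longrightarrow> q t \<le> -4"
  shows "\<exists>t\<ge>0. y t < 0"
proof (rule ccontr)
  assume "\<not> ?thesis"
  then have nn: "y t \<ge> 0" if "t \<ge> 0" for t using that by force
  have dec': "y' t \<le> y' s" if "0 \<le> s" "s \<le> t" "t \<le> 3" for s t
    by (rule DERIV_nonpos_imp_nonincreasing[of s t y'])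
       (use that q0 nn d2 in \<open>auto intro!: exI conjI mult_nonpos_nonneg\<close>)
  have y'0: "y' t \<le> 0" if "0 \<le> t" "t \<le> 3" for t using dec'[of 0 t] that init by auto
  have dec: "y t \<le> y s" if "0 \<le> s" "s \<le> t" "t \<le> 3" for s t
    by (rule DERIV_nonpos_imp_nonincreasing[of s t y])
       (use that y'0 d1 in \<open>auto intro!: exI conjI\<close>)
  obtain c1 where c1: "2 < c1" "c1 < 3" "y 3 - y 2 = (3 - 2) * y' c1" using MVT2[of 2 3 y y'] d1 by auto
  obtain c2 where c2: "0 < c2" "c2 < 2" "y 2 - y 0 = (2 - 0) * y' c2" using MVT2[of 0 2 y y'] d1 by auto
  obtain c3 where c3: "1 < c3" "c3 < 2" "y' 2 - y' 1 = (2 - 1) * (q c3 * y c3)"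
    using MVT2[of 1 2 y' "\<lambda>t. q t * y t"] d2 by auto
  have "y' c1 \<le> y' c2" using dec'[of c2 c1] c1 c2 by auto
  then have y2: "y 2 \<ge> 1/3" using c1(3) c2(3) init nn[of 3] by auto
  have "y c3 \<ge> 1/3" using dec[of c3 2] c3 y2 by auto
  moreover have "q c3 \<le> -4" using q4 c3 by auto
  ultimately have "q c3 * y c3 \<le> (-4) * (1/3)"
    using mult_mono[of 4 "- q c3" "1/3" "y c3"] by auto
  then have "y' 2 \<le> -4/3" using c3(3) y'0[of 1] by auto
  then have "y' c1 \<le> -4/3" using dec'[of 2 c1] c1 by auto
  moreover have "y 2 \<le> 1" using dec[of 0 2] init by auto
  ultimately show False using c1(3) nn[of 3] by auto
qed

text \<open>At \<open>k = 0\<close> the solution is convex and grows, at \<open>k = L\<close> it becomes negative. Both behaviours are stable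
under small changes of \<open>k\<close>, because beyond \<open>T\<close> a positive solution with positive slope stays convex. A
parameter with neither behaviour has a solution that is positive and eventually nonincreasing.\<close>

lemma half_line_shooting:
  fixes y y' q :: "real \<Rightarrow> real \<Rightarrow> real"
  assumes d1: "\<And>k t. (y k has_real_derivative y' k t) (at t)"
    and d2: "\<And>k t. (y' k has_real_derivative q k t * y k t) (at t)"
    and init: "\<And>k. y k 0 = 1" "\<And>k. y' k 0 = 0"
    and jc: "\<And>r. continuous_on ({0..L} \<times> {-r..r}) (\<lambda>z. y (fst z) (snd z))"
    and jc': "\<And>r. continuous_on ({0..L} \<times> {-r..r}) (\<lambda>z. y' (fst z) (snd z))"
    and cq: "\<And>k. continuous_on UNIV (q k)"
    and q0: "\<And>t. t \<ge> 0 \<Longrightarrow> q 0 t \<ge> 0"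
    and qT: "\<And>k t. k \<in> {0..L} \<Longrightarrow> t \<ge> T \<Longrightarrow> q k t \<ge> 4"
    and T: "T \<ge> 0" and L: "L \<ge> 0"
    and neg: "\<exists>t\<ge>0. y L t < 0"
  obtains k where "0 < k" "k < L" "\<And>t. t \<ge> 0 \<Longrightarrow> y k t > 0" "\<And>t. t \<ge> T \<Longrightarrow> y' k t \<le> 0"
proof -
  define P where "P = (\<lambda>k. k \<in> {0..L} \<and> (\<exists>t\<ge>0. y k t < 0))"
  define Q where "Q = (\<lambda>k. k \<in> {0..L} \<and> (\<exists>t\<ge>T. (\<forall>s\<in>{0..t}. y k s > 0) \<and> y' k t > 0))"
  have sub: "continuous_on ({0..L} \<times> S) (\<lambda>z. y (fst z) (snd z))"
            "continuous_on ({0..L} \<times> S) (\<lambda>z. y' (fst z) (snd z))" if "S \<subseteq> {-r..r}" for S r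
    using that by (auto intro: continuous_on_subset[OF jc[of r]] continuous_on_subset[OF jc'[of r]])
  obtain k where k: "0 < k" "k < L" "\<not> P k" "\<not> Q k"
  proof (rule connected_interval_gap[OF L, of P Q])
    show "\<not> (P k \<and> Q k)" for k
    proof
      assume pq: "P k \<and> Q k"
      then obtain t1 where t1: "t1 \<ge> 0" "y k t1 < 0" unfolding P_def by blast
      obtain t where t: "t \<ge> T" "\<forall>s\<in>{0..t}. y k s > 0" "y' k t > 0" using pq unfolding Q_def by blast
      have lt: "t1 > t"
      proof (rule ccontr)
        assume "\<not> t1 > t"
        then have "y k t1 > 0" using t t1 by auto
        then show False using t1 by auto
      qed
      have qn: "q k s \<ge> 0" if "s \<ge> t" for s using qT[of k s] pq that t(1) unfolding P_def by force
      have "y k t1 \<ge> y k t"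
        using convex_growth(1)[of t "y k" "y' k" "q k" t1] d1 d2 qn t T lt by force
      moreover have "y k t > 0" using t T by auto
      ultimately show False using t1 by auto
    qed
    show "P L" unfolding P_def using neg L by auto
    have g: "y 0 r \<ge> y 0 0" "y' 0 r \<ge> y' 0 0" if "r \<ge> 0" for r
      using convex_growth[of 0 "y 0" "y' 0" "q 0" r] d1 d2 q0 init that by auto
    show "Q 0"
    proof -
      obtain c where c: "T < c" "c < T+1" "y' 0 (T+1) - y' 0 T = (T + 1 - T) * (q 0 c * y 0 c)"
        using MVT2[of T "T+1" "y' 0" "\<lambda>t. q 0 t * y 0 t"] d2 by auto
      have "q 0 c \<ge> 4" "y 0 c \<ge> 1" using qT[of 0 c] g(1)[of c] c T L init by auto
      then have "q 0 c * y 0 c > 0" by (intro mult_pos_pos) auto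
      then have "y' 0 (T+1) > 0" using c(3) g(2)[of T] T init by auto
      moreover have "\<forall>s\<in>{0..T+1}. y 0 s > 0" using g(1) init by fastforce
      ultimately show ?thesis unfolding Q_def using L by (auto intro!: exI[of _ "T+1"])
    qed
    show "\<exists>e>0. \<forall>k'\<in>{0..L}. dist k' k < e \<longrightarrow> P k'" if kk: "k \<in> {0..L}" "P k" for k
    proof -
      obtain t where t: "t \<ge> 0" "y k t < 0" using kk unfolding P_def by auto
      have c: "continuous_on ({0..L} \<times> {t}) (\<lambda>z. - y (fst z) (snd z))"
        using sub(1)[of "{t}" t] t by (intro continuous_on_minus) auto
      obtain e where e: "e > 0" "\<forall>k'\<in>{0..L}. dist k' k < e \<longrightarrow> (\<forall>s\<in>{t}. - y k' s > 0)"
        using nearby_positive[of "{t}" "{0..L}" "\<lambda>k s. - y k s" k, OF _ _ c] kk t by auto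
      have "\<forall>k'\<in>{0..L}. dist k' k < e \<longrightarrow> y k' t < 0" using e by auto
      then show ?thesis unfolding P_def using e(1) t(1) by blast
    qed
    show "\<exists>e>0. \<forall>k'\<in>{0..L}. dist k' k < e \<longrightarrow> Q k'" if kk: "k \<in> {0..L}" "Q k" for k
    proof -
      obtain t where t: "t \<ge> T" "\<forall>s\<in>{0..t}. y k s > 0" "y' k t > 0" using kk unfolding Q_def by auto
      have t0: "t \<ge> 0" using t T by auto
      obtain e1 where e1: "e1 > 0" "\<forall>k'\<in>{0..L}. dist k' k < e1 \<longrightarrow> (\<forall>s\<in>{0..t}. y k' s > 0)"
        using nearby_positive[of "{0..t}" "{0..L}" y k, OF _ _ sub(1)[of _ t]] kk t t0 by auto
      obtain e2 where e2: "e2 > 0" "\<forall>k'\<in>{0..L}. dist k' k < e2 \<longrightarrow> (\<forall>s\<in>{t}. y' k' s > 0)"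
        using nearby_positive[of "{t}" "{0..L}" y' k, OF _ _ sub(2)[of _ t]] kk t t0 by auto
      show ?thesis unfolding Q_def using e1 e2 t
        by (intro exI[of _ "min e1 e2"]) auto
    qed
  qed auto
  have nn: "y k t \<ge> 0" if "t \<ge> 0" for t using k that unfolding P_def by (force simp: not_less)
  have pos: "y k t > 0" if t: "t \<ge> 0" for t
  proof (rule ccontr)
    assume "\<not> y k t > 0"
    then have z: "y k t = 0" using nn[OF t] by simp
    then have t0: "t > 0" using init[of k] t by (cases "t = 0") auto
    have z': "y' k t = 0"
      by (rule DERIV_local_min[OF d1 t0]) (use nn z t0 in \<open>auto simp: abs_if split: if_splits\<close>)
    obtain M where M: "\<And>s. s \<in> {0..t} \<Longrightarrow> \<bar>q k s\<bar> \<le> M"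
      using continuous_on_Icc_bounded[OF continuous_on_subset[OF cq[of k] subset_UNIV], of 0 t] by blast
    have M0: "M \<ge> 0" using M[of 0] t0 by auto
    have "y k 0 = 0"
    proof (rule second_order_zero[where a=0 and b=t and ?t0.0=t and y="y k" and t=0 and y'="y' k" and y''="\<lambda>s. q k s * y k s" and M=M])
      show "continuous_on {0..t} (y k)" "continuous_on {0..t} (y' k)"
        using derivative_imp_continuous_on[OF d1] derivative_imp_continuous_on[OF d2] by blast+
      fix s assume s: "0 < s" "s < t"
      show "\<bar>q k s * y k s\<bar> \<le> M * (\<bar>y k s\<bar> + \<bar>y' k s\<bar>)"
        unfolding abs_mult using M[of s] s by (intro mult_mono) auto
    qed (use t0 z z' M0 d1 d2 in auto)
    then show False using init by simp
  qed
  have "y' k t \<le> 0" if "t \<ge> T" for t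
  proof (rule ccontr)
    assume "\<not> y' k t \<le> 0"
    then have "Q k" unfolding Q_def using that pos k by (auto intro!: exI[of _ t])
    then show False using k by simp
  qed
  then show ?thesis using that k pos by blast
qed

text \<open>Since \<open>y'' \<ge> 4 y\<close>, the quantity \<open>y' + 2 y\<close> cannot become positive without forcing growth, so \<open>y\<close> decays at least like \<open>exp (-2 t)\<close>.\<close>

lemma decaying_exponential_bound:
  fixes y y' q :: "real \<Rightarrow> real"
  assumes d1: "\<And>t. (y has_real_derivative y' t) (at t)"
    and d2: "\<And>t. (y' has_real_derivative q t * y t) (at t)"
    and q4: "\<And>t. t \<ge> T \<Longrightarrow> q t \<ge> 4"
    and pos: "\<And>t. t \<ge> T \<Longrightarrow> y t > 0"
    and neg: "\<And>t. t \<ge> T \<Longrightarrow> y' t \<le> 0"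
  obtains C where "C > 0" "\<And>t. t \<ge> 0 \<Longrightarrow> \<bar>y t\<bar> \<le> C * exp (-2*t)" "\<And>t. t \<ge> 0 \<Longrightarrow> \<bar>y' t\<bar> \<le> C * exp (-2*t)"
proof -
  have dec: "y t \<le> y s" if "T \<le> s" "s \<le> t" for s t
    by (rule DERIV_nonpos_imp_nonincreasing[of s t y]) (use that neg d1 in \<open>auto intro!: exI conjI\<close>)
  have inc': "y' s \<le> y' t" if "T \<le> s" "s \<le> t" for s t
  proof (rule DERIV_nonneg_imp_nondecreasing[of s t y'])
    fix x assume x: "s \<le> x" "x \<le> t"
    then have "q x * y x \<ge> 0" using q4[of x] pos[of x] that by (intro mult_nonneg_nonneg) auto
    then show "\<exists>z. (y' has_real_derivative z) (at x) \<and> 0 \<le> z" using d2 by blast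
  qed (use that in auto)
  have z0: "y' t + 2 * y t \<le> 0" if t: "t \<ge> T" for t
  proof (rule ccontr)
    assume nz: "\<not> ?thesis"
    define z where "z = (\<lambda>t. (y' t + 2 * y t) * exp (-2*t))"
    have zt: "z t > 0" unfolding z_def using nz by simp
    have zinc: "z t \<le> z s" if "t \<le> s" for s
    proof (rule DERIV_nonneg_imp_nondecreasing[of t s z])
      fix x assume x: "t \<le> x" "x \<le> s"
      have "(z has_real_derivative (q x - 4) * y x * exp (-2*x)) (at x)"
        unfolding z_def by (rule derivative_eq_intros d1 d2 refl | simp add: algebra_simps)+
      moreover have "(q x - 4) * y x * exp (-2*x) \<ge> 0"
        using q4[of x] pos[of x] x t by (intro mult_nonneg_nonneg) auto
      ultimately show "\<exists>w. (z has_real_derivative w) (at x) \<and> 0 \<le> w" by blast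
    qed (use that in auto)
    have "((\<lambda>s. 2 * y T * exp (-2 * s)) \<longlongrightarrow> 0) at_top" by real_asymp
    then have "eventually (\<lambda>s. 2 * y T * exp (-2 * s) < z t) at_top"
      using zt by (simp add: order_tendstoD(2))
    then obtain s where s: "s \<ge> t" "2 * y T * exp (-2 * s) < z t"
      using eventually_happens[OF eventually_conj[OF _ eventually_ge_at_top[of t]]] by fastforce
    have "z s \<le> 2 * y T * exp (-2 * s)" unfolding z_def
      using neg[of s] dec[of T s] s t by (intro mult_right_mono) auto
    then show False using zinc[OF s(1)] s by simp
  qed
  have yb: "y t \<le> y T * exp (2*T) * exp (-2*t)" if t: "t \<ge> T" for t
  proof -
    have "y t * exp (2*t) \<le> y T * exp (2*T)"
    proof (rule DERIV_nonpos_imp_nonincreasing[of T t "\<lambda>t. y t * exp (2*t)"])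
      fix x assume x: "T \<le> x" "x \<le> t"
      have "((\<lambda>t. y t * exp (2*t)) has_real_derivative (y' x + 2 * y x) * exp (2*x)) (at x)"
        by (rule derivative_eq_intros d1 d2 refl | simp add: algebra_simps)+
      moreover have "(y' x + 2 * y x) * exp (2*x) \<le> 0" using z0[of x] x by (intro mult_nonpos_nonneg) auto
      ultimately show "\<exists>w. ((\<lambda>t. y t * exp (2*t)) has_real_derivative w) (at x) \<and> w \<le> 0" by blast
    qed (use t in auto)
    then have "y t * exp (2*t) * exp (-2*t) \<le> y T * exp (2*T) * exp (-2*t)" by (intro mult_right_mono) auto
    then show ?thesis by (simp add: mult.assoc flip: exp_add)
  qed
  define C0 where "C0 = y T * exp (2*T)"
  have C0: "C0 > 0" unfolding C0_def using pos by auto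
  have y'b: "- y' t \<le> C0 * exp 2 * exp (-2*t)" if t: "t \<ge> T + 1" for t
  proof -
    obtain c where c: "t - 1 < c" "c < t" "y t - y (t-1) = (t - (t-1)) * y' c" using MVT2[of "t-1" t y y'] d1 by auto
    have "- y' t \<le> y (t-1) - y t" using inc'[of c t] c t by auto
    also have "\<dots> \<le> y (t-1)" using pos[of t] t by auto
    also have "\<dots> \<le> C0 * exp (-2*(t-1))" using yb[of "t-1"] t unfolding C0_def by auto
    also have "\<dots> = C0 * exp 2 * exp (-2*t)" by (simp add: mult.assoc flip: exp_add)
    finally show ?thesis .
  qed
  define S where "S = \<bar>T\<bar> + 1"
  have "continuous_on {0..S} y" "continuous_on {0..S} y'"
    using derivative_imp_continuous_on[OF d1] derivative_imp_continuous_on[OF d2] by blast+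
  then have "continuous_on {0..S} (\<lambda>t. \<bar>y t\<bar> + \<bar>y' t\<bar>)" by (intro continuous_intros)
  then obtain B where "\<And>t. t \<in> {0..S} \<Longrightarrow> \<bar>\<bar>y t\<bar> + \<bar>y' t\<bar>\<bar> \<le> B"
    using continuous_on_Icc_bounded by blast
  then have B: "\<And>t. t \<in> {0..S} \<Longrightarrow> \<bar>y t\<bar> + \<bar>y' t\<bar> \<le> B" by force
  define C where "C = C0 * exp 2 + \<bar>B\<bar> * exp (2*S)"
  have C: "C > 0" unfolding C_def using C0 by (intro add_pos_nonneg) auto
  have cmp: "\<bar>y t\<bar> \<le> C * exp (-2*t) \<and> \<bar>y' t\<bar> \<le> C * exp (-2*t)" if t: "t \<ge> 0" for t
  proof (cases "t \<le> S")
    case True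
    have "\<bar>B\<bar> * 1 \<le> \<bar>B\<bar> * exp (2*S + -2*t)" using True by (intro mult_left_mono) auto
    also have "\<dots> = \<bar>B\<bar> * exp (2*S) * exp (-2*t)" by (simp add: mult.assoc flip: exp_add)
    also have "\<dots> \<le> C * exp (-2*t)" unfolding C_def using C0 by (intro mult_right_mono) auto
    finally show ?thesis using B[of t] t True by auto
  next
    case False
    have "C0 * 1 \<le> C0 * exp 2" using C0 by (intro mult_left_mono) auto
    moreover have "\<bar>B\<bar> * exp (2*S) \<ge> 0" by simp
    ultimately have "C0 \<le> C" "C0 * exp 2 \<le> C" unfolding C_def by linarith+
    then have "C0 * exp (-2*t) \<le> C * exp (-2*t)" "C0 * exp 2 * exp (-2*t) \<le> C * exp (-2*t)"
      by (auto intro!: mult_right_mono)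
    moreover have tT: "t \<ge> T + 1" using False unfolding S_def by auto
    moreover have "y t \<le> C0 * exp (-2*t)" using yb[of t] tT unfolding C0_def by auto
    moreover have "- y' t \<le> C0 * exp 2 * exp (-2*t)" "y t > 0" "y' t \<le> 0" using y'b pos neg tT by auto
    ultimately show ?thesis by linarith
  qed
  then show ?thesis using that[of C] C by blast
qed

section \<open>Eigenfunctions of the half-line oscillator\<close>

text \<open>If \<open>E < l\<close>, the Wronskian \<open>u' v - u v'\<close> is increasing as long as \<open>u\<close> is positive, so \<open>u / v\<close> is nondecreasing and \<open>u\<close>
stays positive. Where \<open>Q \<ge> E\<close> the function \<open>u\<close> is convex, hence nonincreasing because it takes small values. There the Wronskian is at most \<open>C u\<close>,
which contradicts its positive lower bound.\<close>

lemma sturm_barrier: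
  fixes u u' v v' Q :: "real \<Rightarrow> real"
  assumes cu: "continuous_on {0..} u" "continuous_on {0..} u'"
    and u1: "\<And>t. t > 0 \<Longrightarrow> (u has_real_derivative u' t) (at t)"
    and u2: "\<And>t. t > 0 \<Longrightarrow> (u' has_real_derivative (Q t - E) * u t) (at t)"
    and u0: "u 0 > 0" "u' 0 = 0"
    and small: "\<And>c T. c > 0 \<Longrightarrow> \<exists>t\<ge>T. \<bar>u t\<bar> < c"
    and v1: "\<And>t. (v has_real_derivative v' t) (at t)"
    and v2: "\<And>t. (v' has_real_derivative (Q t - l) * v t) (at t)"
    and v0: "\<And>t. t \<ge> 0 \<Longrightarrow> v t > 0" "v' 0 \<le> 0"
    and vb: "\<And>t. t \<ge> 0 \<Longrightarrow> \<bar>v' t\<bar> \<le> C"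
    and Qinf: "\<And>t. t \<ge> T0 \<Longrightarrow> Q t \<ge> E"
  shows "l \<le> E"
proof (rule ccontr)
  assume "\<not> l \<le> E"
  then have El: "E < l" by simp
  define W where "W = (\<lambda>t. u' t * v t - u t * v' t)"
  have cv: "continuous_on A v" "continuous_on A v'" for A
    using derivative_imp_continuous_on[OF v1] derivative_imp_continuous_on[OF v2] by blast+
  have W': "(W has_real_derivative (l - E) * u t * v t) (at t)" if "t > 0" for t
    unfolding W_def by (rule derivative_eq_intros u1 u2 v1 v2 that refl | simp add: algebra_simps)+
  have cW: "continuous_on {0..t} W" for t
    unfolding W_def by (intro continuous_intros cv continuous_on_subset[OF cu(1)] continuous_on_subset[OF cu(2)]) auto
  have W0: "W 0 \<ge> 0" unfolding W_def using u0 v0(2) by (auto simp: mult_le_0_iff)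
  have Wpos: "W t \<ge> W 0" if t: "t \<ge> 0" and pos: "\<And>s. 0 < s \<Longrightarrow> s < t \<Longrightarrow> u s > 0" for t
  proof (rule DERIV_nonneg_imp_increasing_open[of 0 t W, OF t _ cW])
    fix s assume s: "0 < s" "s < t"
    have "(l - E) * u s * v s \<ge> 0" using pos[of s] s v0(1)[of s] El by auto
    then show "\<exists>w. (W has_real_derivative w) (at s) \<and> 0 \<le> w" using W'[of s] s by auto
  qed
  have ratio: "u t / v t \<ge> u 0 / v 0" if t: "t \<ge> 0" and pos: "\<And>s. 0 < s \<Longrightarrow> s < t \<Longrightarrow> u s > 0" for t
  proof (rule DERIV_nonneg_imp_increasing_open[of 0 t "\<lambda>t. u t / v t", OF t])
    fix s assume s: "0 < s" "s < t"
    have vs: "v s \<noteq> 0" using v0(1)[of s] s by simp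
    have "((\<lambda>t. u t / v t) has_real_derivative W s / (v s * v s)) (at s)"
      unfolding W_def by (rule derivative_eq_intros u1 v1 refl s vs | simp)+
    moreover have "W s / (v s * v s) \<ge> 0" using Wpos[of s] pos s W0 by (intro divide_nonneg_nonneg) auto
    ultimately show "\<exists>w. ((\<lambda>t. u t / v t) has_real_derivative w) (at s) \<and> 0 \<le> w" by blast
  next
    show "continuous_on {0..t} (\<lambda>t. u t / v t)"
      using v0(1) by (intro continuous_intros cv continuous_on_subset[OF cu(1)]) force+
  qed
  have upos: "u t > 0" if t: "t \<ge> 0" for t
  proof (rule ccontr)
    assume neg: "\<not> u t > 0"
    define Z where "Z = {x\<in>{0..t}. u x \<le> 0}"
    have c: "continuous_on {0..t} u" by (rule continuous_on_subset[OF cu(1)]) auto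
    have "Z = {0..t} \<inter> u -` {..0}" unfolding Z_def by auto
    then have cl: "closed Z" using continuous_closed_preimage[OF c] by simp
    have ne: "Z \<noteq> {}" using neg t unfolding Z_def by auto
    have bb: "bdd_below Z" unfolding Z_def by (intro bdd_belowI[of _ 0]) auto
    define z where "z = Inf Z"
    have zZ: "z \<in> Z" unfolding z_def using closed_contains_Inf[OF ne bb cl] .
    have "u s > 0" if s: "0 < s" "s < z" for s
    proof (rule ccontr)
      assume "\<not> u s > 0"
      then have "s \<in> Z" using s zZ unfolding Z_def by auto
      then have "z \<le> s" unfolding z_def by (rule cInf_lower[OF _ bb])
      then show False using s by simp
    qed
    then have "u z / v z \<ge> u 0 / v 0" using ratio[of z] zZ unfolding Z_def by auto
    moreover have "u 0 / v 0 > 0" using u0 v0(1)[of 0] by simp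
    ultimately have "u z / v z > 0" by linarith
    then show False using zZ v0(1)[of z] unfolding Z_def by (auto simp: zero_less_divide_iff)
  qed
  have Wmono: "W s \<le> W t" if "0 < s" "s \<le> t" for s t
  proof (rule DERIV_nonneg_imp_nondecreasing[OF that(2)])
    fix x assume x: "s \<le> x" "x \<le> t"
    have "(l - E) * u x * v x \<ge> 0" using upos[of x] x that v0(1)[of x] El by auto
    then show "\<exists>w. (W has_real_derivative w) (at x) \<and> 0 \<le> w" using W'[of x] x that by auto
  qed
  have W1: "W 1 > 0"
  proof -
    obtain z where z: "1 < z" "z < 2" "W 2 - W 1 = (2 - 1) * ((l - E) * u z * v z)"
      using MVT2[of 1 2 W "\<lambda>t. (l - E) * u t * v t"] W' by auto
    obtain z' where z': "1/2 < z'" "z' < 1" "W 1 - W (1/2) = (1 - 1/2) * ((l - E) * u z' * v z')"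
      using MVT2[of "1/2" 1 W "\<lambda>t. (l - E) * u t * v t"] W' by auto
    have "(l - E) * u z' * v z' > 0" using El upos[of z'] v0(1)[of z'] z' by auto
    moreover have "W (1/2) \<ge> 0" using Wpos[of "1/2"] W0 upos by auto
    ultimately show ?thesis using z' by auto
  qed
  define T where "T = max T0 1"
  have u'neg: "u' t \<le> 0" if t: "t \<ge> T" for t
  proof (rule ccontr)
    assume n: "\<not> u' t \<le> 0"
    have "u r \<ge> u t" if "r \<ge> t" for r
      using convex_growth(1)[of t u u' "\<lambda>t. Q t - E" r] u1 u2 Qinf upos[of t] n t that unfolding T_def by auto
    moreover obtain r where "r \<ge> t" "\<bar>u r\<bar> < u t" using small[of "u t" t] upos[of t] t unfolding T_def by auto
    ultimately show False by force
  qed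
  have C0: "C \<ge> 0" using vb[of 0] by auto
  obtain t where t: "t \<ge> T" "\<bar>u t\<bar> < W 1 / (C + 1)" using small[of "W 1 / (C+1)" T] W1 C0 by auto
  have t1: "t \<ge> 1" using t unfolding T_def by auto
  have "W t \<le> u t * \<bar>v' t\<bar>"
  proof -
    have "u' t * v t \<le> 0" using u'neg[OF t(1)] v0(1)[of t] t1 by (auto simp: mult_le_0_iff)
    moreover have "- u t * v' t \<le> u t * \<bar>v' t\<bar>" using upos[of t] t1 by (simp add: abs_if)
    ultimately show ?thesis unfolding W_def by auto
  qed
  also have "\<dots> \<le> u t * C" using vb[of t] upos[of t] t1 by (intro mult_left_mono) auto
  also have "\<dots> \<le> \<bar>u t\<bar> * (C + 1)" using upos[of t] t1 C0 by (simp add: algebra_simps)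
  also have "\<dots> < W 1" using t(2) C0 by (simp add: pos_less_divide_eq)
  finally show False using Wmono[of 1 t] t1 by simp
qed

text \<open>The equation has real coefficients, so a nonzero real or imaginary part of the eigenfunction is again a solution; it
does not vanish at \<open>0\<close> by uniqueness, and a square integrable function takes small values arbitrarily far out.\<close>

lemma half_line_eigenfunction:
  assumes "is_eigenvalue {0<..} (half_line_oscillator \<xi>) (complex_of_real E)"
  obtains u u' where "continuous_on {0..} u" "continuous_on {0..} u'"
    "\<And>t. t > 0 \<Longrightarrow> (u has_real_derivative u' t) (at t)"
    "\<And>t. t > 0 \<Longrightarrow> (u' has_real_derivative ((t-\<xi>)\<^sup>2 - E) * u t) (at t)"
    "u 0 > 0" "u' 0 = 0" "\<And>c T. c > 0 \<Longrightarrow> \<exists>t\<ge>T. \<bar>u t\<bar> < c"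
proof -
  obtain f where f: "half_line_oscillator \<xi> f (\<lambda>x. complex_of_real E * f x)"
    and nz: "\<not> (AE x in lebesgue_on {0<..}. f x = 0)"
    using assms unfolding is_eigenvalue_def by blast
  then obtain w w' where ae: "AE t in lebesgue_on {0<..}. f t = w t"
    and w1: "\<And>t. t \<ge> 0 \<Longrightarrow> (w has_vector_derivative w' t) (at t within {0..})"
    and w'0: "w' 0 = 0"
    and hi: "\<And>t. t \<ge> 0 \<Longrightarrow> ((\<lambda>s. complex_of_real ((s - \<xi>)\<^sup>2) * w s - complex_of_real E * f s) has_integral (w' t - w' 0)) {0..t}"
    and L2: "f \<in> L2 {0<..}"
    unfolding half_line_oscillator_def by blast
  have cw: "continuous_on {0..} w"
    using w1 by (intro continuous_on_vector_derivative) auto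
  define g where "g = (\<lambda>s. complex_of_real ((s - \<xi>)\<^sup>2 - E) * w s)"
  have cg: "continuous_on {0..} g" unfolding g_def by (intro continuous_intros cw)
  have "AE x in lebesgue. x \<in> {0<..} \<longrightarrow> f x = w x"
    using ae by (subst (asm) AE_restrict_space_iff) auto
  then obtain N where N: "negligible N" "\<And>x. x > 0 \<Longrightarrow> x \<notin> N \<Longrightarrow> f x = w x"
    unfolding eventually_ae_filter negligible_iff_null_sets by (auto simp: subset_iff)
  have hg: "(g has_integral w' t) {0..t}" if "t \<ge> 0" for t
  proof (rule has_integral_spike[of "insert 0 N"])
    show "negligible (insert 0 N)" using N by simp
    show "((\<lambda>s. complex_of_real ((s - \<xi>)\<^sup>2) * w s - complex_of_real E * f s) has_integral w' t) {0..t}"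
      using hi[OF that] w'0 by simp
    show "g x = complex_of_real ((x - \<xi>)\<^sup>2) * w x - complex_of_real E * f x" if "x \<in> {0..t} - insert 0 N" for x
      using N(2)[of x] that unfolding g_def by (simp add: algebra_simps)
  qed
  have w'T: "(w' has_vector_derivative g t) (at t within {0..T})" if t: "t \<in> {0..T}" for t T
  proof -
    have "((\<lambda>t. integral {0..t} g) has_vector_derivative g t) (at t within {0..T})"
      by (rule integral_has_vector_derivative[OF continuous_on_subset[OF cg] t]) auto
    then show ?thesis
      by (rule has_vector_derivative_transform[OF t, rotated]) (use hg in \<open>auto simp: has_integral_iff\<close>)
  qed
  have cw': "continuous_on {0..T} w'" for T
    using w'T by (intro continuous_on_vector_derivative) auto
  have d1: "(w has_vector_derivative w' t) (at t)" if "t > 0" for t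
  proof -
    have "at t within {0..} = at t" using that by (intro at_within_interior) auto
    then show ?thesis using w1[of t] that by simp
  qed
  have d2: "(w' has_vector_derivative g t) (at t)" if "t > 0" for t
  proof -
    have "at t within {0..t+1} = at t" using that by (intro at_within_interior) auto
    then show ?thesis using w'T[of t "t+1"] that by simp
  qed
  define c where "c = cnj (w 0)"
  define u where "u = (\<lambda>t. Re (w t * c))"
  define u' where "u' = (\<lambda>t. Re (w' t * c))"
  have key: "((\<lambda>t. Re (w t * d)) has_real_derivative Re (w' t * d)) (at t)"
       "((\<lambda>t. Re (w' t * d)) has_real_derivative ((t-\<xi>)\<^sup>2 - E) * Re (w t * d)) (at t)" if t: "t > 0" for t d
  proof -
    have "((\<lambda>t. Re (w t * d)) has_vector_derivative Re (w' t * d)) (at t)"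
      by (intro bounded_linear.has_vector_derivative[OF bounded_linear_Re]
            bounded_linear.has_vector_derivative[OF bounded_linear_mult_left] d1 t)
    then show "((\<lambda>t. Re (w t * d)) has_real_derivative Re (w' t * d)) (at t)"
      by (simp add: has_real_derivative_iff_has_vector_derivative)
    have "((\<lambda>t. Re (w' t * d)) has_vector_derivative Re (g t * d)) (at t)"
      by (intro bounded_linear.has_vector_derivative[OF bounded_linear_Re]
            bounded_linear.has_vector_derivative[OF bounded_linear_mult_left] d2 t)
    moreover have "Re (g t * d) = ((t-\<xi>)\<^sup>2 - E) * Re (w t * d)"
      unfolding g_def mult.assoc by (simp only: Re_complex_of_real Im_complex_of_real times_complex.sel)
    ultimately show "((\<lambda>t. Re (w' t * d)) has_real_derivative ((t-\<xi>)\<^sup>2 - E) * Re (w t * d)) (at t)"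
      by (simp add: has_real_derivative_iff_has_vector_derivative)
  qed
  have w0: "w 0 \<noteq> 0"
  proof
    assume z: "w 0 = 0"
    have "w t = 0" if t: "t > 0" for t
    proof -
      have re0: "Re (w t * d) = 0" for d
      proof -
        have "continuous_on {0..t} (\<lambda>s. (s - \<xi>)\<^sup>2 - E)" by (intro continuous_intros)
        then obtain M where M: "\<And>s. s \<in> {0..t} \<Longrightarrow> \<bar>(s - \<xi>)\<^sup>2 - E\<bar> \<le> M"
          using continuous_on_Icc_bounded by blast
        have M0: "M \<ge> 0" using M[of 0] t by auto
        show ?thesis
        proof (rule second_order_zero[where a=0 and b=t and ?t0.0=0 and t=t and y="\<lambda>t. Re (w t * d)" and y'="\<lambda>t. Re (w' t * d)"
              and y''="\<lambda>t. ((t-\<xi>)\<^sup>2 - E) * Re (w t * d)" and M=M])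
          show "continuous_on {0..t} (\<lambda>t. Re (w t * d))" "continuous_on {0..t} (\<lambda>t. Re (w' t * d))"
            by (intro continuous_intros cw' continuous_on_subset[OF cw]; auto)+
          fix s assume s: "0 < s" "s < t"
          show "\<bar>((s-\<xi>)\<^sup>2 - E) * Re (w s * d)\<bar> \<le> M * (\<bar>Re (w s * d)\<bar> + \<bar>Re (w' s * d)\<bar>)"
            unfolding abs_mult using M[of s] s by (intro mult_mono) auto
        qed (use t z w'0 M0 key in auto)
      qed
      have "Re (w t) = 0" "Im (w t) = 0" using re0[of 1] re0[of "-\<i>"] by auto
      then show ?thesis by (simp add: complex_eq_iff)
    qed
    then have "AE x in lebesgue_on {0<..}. f x = 0"
      using ae by (elim AE_mp) (intro AE_I2, auto)
    then show False using nz by simp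
  qed
  have small: "\<exists>t\<ge>T. \<bar>u t\<bar> < e" if e: "e > 0" for e T
  proof (rule ccontr)
    assume "\<not> ?thesis"
    then have big: "\<bar>u t\<bar> \<ge> e" if "t \<ge> T" for t using that by force
    define d where "d = e / cmod c"
    have cp: "cmod c > 0" using w0 unfolding c_def by simp
    have d0: "d > 0" unfolding d_def using e cp by simp
    have wd: "cmod (w t) \<ge> d" if "t \<ge> T" for t
    proof -
      have "e \<le> \<bar>Re (w t * c)\<bar>" using big[OF that] unfolding u_def .
      also have "\<dots> \<le> cmod (w t) * cmod c" using abs_Re_le_cmod[of "w t * c"] by (simp add: norm_mult)
      finally show ?thesis unfolding d_def using cp by (simp add: pos_divide_le_eq)
    qed
    define I where "I = (LINT x|lebesgue_on {0<..}. (cmod (f x))\<^sup>2)"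
    have int: "integrable (lebesgue_on {0<..}) (\<lambda>x. (cmod (f x))\<^sup>2)" using L2 unfolding L2_def by simp
    define S where "S = \<bar>T\<bar> + 1"
    have "d\<^sup>2 * real n \<le> I" for n :: nat
    proof -
      have sub: "{S..S+real n} \<subseteq> {0<..}" unfolding S_def by auto
      have ms: "{S..S+real n} \<in> sets (lebesgue_on {0<..})"
        using sub by (subst sets_restrict_space_iff) auto
      have em: "emeasure (lebesgue_on {0<..}) {S..S+real n} = ennreal (real n)"
        using sub by (subst emeasure_restrict_space) auto
      have "(LINT x|lebesgue_on {0<..}. d\<^sup>2 * indicator {S..S+real n} x) \<le> I"
        unfolding I_def
      proof (rule integral_mono_AE)
        show "integrable (lebesgue_on {0<..}) (\<lambda>x. d\<^sup>2 * indicator {S..S+real n} x)"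
          using ms em by (intro integrable_mult_right integrable_real_indicator) auto
        show "AE x in lebesgue_on {0<..}. d\<^sup>2 * indicator {S..S+real n} x \<le> (cmod (f x))\<^sup>2"
          using ae
        proof (elim AE_mp, intro AE_I2 impI)
          fix x assume fx: "f x = w x"
          show "d\<^sup>2 * indicator {S..S+real n} x \<le> (cmod (f x))\<^sup>2"
          proof (cases "x \<in> {S..S+real n}")
            case True
            then have "d\<^sup>2 \<le> (cmod (w x))\<^sup>2" using wd[of x] d0 unfolding S_def by (intro power_mono) auto
            then show ?thesis using True fx by simp
          qed simp
        qed
      qed (rule int)
      moreover have "(LINT x|lebesgue_on {0<..}. d\<^sup>2 * indicator {S..S+real n} x) = d\<^sup>2 * real n"
        using ms em sub by (simp add: measure_def Int_absorb2)
      ultimately show ?thesis by (simp only:)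
    qed
    moreover obtain n :: nat where "real n > I / d\<^sup>2" using reals_Archimedean2 by blast
    ultimately show False using d0 by (smt (verit, best) mult.commute pos_divide_less_eq zero_less_power)
  qed
  show ?thesis
  proof (rule that[of u u'])
    show "continuous_on {0..} u" unfolding u_def by (intro continuous_intros cw)
    have "continuous_on {0..} w'"
      unfolding continuous_on_eq_continuous_within
    proof
      fix t :: real assume t: "t \<in> {0..}"
      have "continuous (at t within {0..t+1}) w'" using cw'[of "t+1"] t by (auto simp: continuous_on_eq_continuous_within)
      moreover have "at t within {0..t+1} = at t within {0..}"
        by (rule at_within_nhd[of t "{..<t+1}"]) auto
      ultimately show "continuous (at t within {0..}) w'" by simp
    qed
    then show "continuous_on {0..} u'" unfolding u'_def by (intro continuous_intros)
    have "Re (w 0 * cnj (w 0)) = Re (w 0) * Re (w 0) + Im (w 0) * Im (w 0)" by simp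
    then show "u 0 > 0" unfolding u_def c_def
      using w0 by (simp add: sum_squares_gt_zero_iff complex_eq_iff)
    show "u' 0 = 0" unfolding u'_def using w'0 by simp
    show "\<And>c T. c > 0 \<Longrightarrow> \<exists>t\<ge>T. \<bar>u t\<bar> < c" by (rule small)
  qed (use key in \<open>auto simp: u_def u'_def\<close>)
qed

section \<open>A lower bound for the de Gennes constant\<close>

lemma integrable_exp_decay: "integrable (lebesgue_on {0<..}) (\<lambda>t::real. exp (-t))"
proof -
  have "((\<lambda>x::real. exp (-1*x)) has_integral exp (-1*0)/1) {0..}"
    by (rule has_integral_exp_minus_to_infinity) simp
  then have "(\<lambda>x::real. exp (-x)) absolutely_integrable_on {0..}"
    by (intro nonnegative_absolutely_integrable_1) (auto simp: integrable_on_def)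
  then have "(\<lambda>x::real. exp (-x)) absolutely_integrable_on {0<..}"
    by (rule set_integrable_subset) auto
  then show ?thesis by (simp add: integrable_restrict_space set_integrable_def)
qed

lemma decaying_in_L2:
  fixes y :: "real \<Rightarrow> real"
  assumes c: "continuous_on UNIV y" and b: "\<And>t. t \<ge> 0 \<Longrightarrow> \<bar>y t\<bar> \<le> C * exp (-2*t)"
  shows "(\<lambda>t. complex_of_real (y t)) \<in> L2 {0<..}"
proof -
  have m: "(\<lambda>t. complex_of_real (y t)) \<in> borel_measurable (lebesgue_on {0<..})"
    by (intro continuous_imp_measurable_on_sets_lebesgue continuous_intros continuous_on_subset[OF c]) auto
  have "integrable (lebesgue_on {0<..}) (\<lambda>t. (cmod (complex_of_real (y t)))\<^sup>2)"
  proof (rule Bochner_Integration.integrable_bound)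
    show "integrable (lebesgue_on {0<..}) (\<lambda>t. C\<^sup>2 * exp (-t))"
      by (intro integrable_mult_right integrable_exp_decay)
    show "(\<lambda>t. (cmod (complex_of_real (y t)))\<^sup>2) \<in> borel_measurable (lebesgue_on {0<..})"
      using m by measurable
    show "AE t in lebesgue_on {0<..}. norm ((cmod (complex_of_real (y t)))\<^sup>2) \<le> norm (C\<^sup>2 * exp (-t))"
    proof (rule AE_I2)
      fix t :: real assume "t \<in> space (lebesgue_on {0<..})"
      then have t: "t > 0" by simp
      have "(y t)\<^sup>2 = \<bar>y t\<bar>\<^sup>2" by simp
      also have "\<dots> \<le> (C * exp (-2*t))\<^sup>2" using b[of t] t by (intro power_mono) auto
      also have "\<dots> = C\<^sup>2 * exp (-4*t)" by (simp add: power_mult_distrib flip: exp_double)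
      also have "\<dots> \<le> C\<^sup>2 * exp (-t)" using t by (intro mult_left_mono) auto
      finally show "norm ((cmod (complex_of_real (y t)))\<^sup>2) \<le> norm (C\<^sup>2 * exp (-t))" by simp
    qed
  qed
  then show ?thesis using m unfolding L2_def by simp
qed

lemma L2_scale:
  assumes "u \<in> L2 S" shows "(\<lambda>x. c * u x) \<in> L2 S"
  using assms unfolding L2_def by (auto simp: norm_mult power_mult_distrib)

lemma half_line_eigenvalueI:
  fixes y y' :: "real \<Rightarrow> real"
  assumes d1: "\<And>t. (y has_real_derivative y' t) (at t)"
    and d2: "\<And>t. (y' has_real_derivative ((t-\<xi>)\<^sup>2 - E) * y t) (at t)"
    and y0: "y' 0 = 0" and pos: "\<And>t. t \<ge> 0 \<Longrightarrow> y t > 0"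
    and b: "\<And>t. t \<ge> 0 \<Longrightarrow> \<bar>y t\<bar> \<le> C * exp (-2*t)"
  shows "is_eigenvalue {0<..} (half_line_oscillator \<xi>) (complex_of_real E)"
  unfolding is_eigenvalue_def
proof (intro exI conjI)
  let ?u = "\<lambda>t. complex_of_real (y t)" and ?w = "\<lambda>t. complex_of_real (y' t)"
  have u: "?u \<in> L2 {0<..}" by (rule decaying_in_L2[OF derivative_imp_continuous_on[OF d1] b])
  have v1: "(?u has_vector_derivative ?w t) (at t within S)" for t S
    using has_vector_derivative_of_real[OF has_field_derivative_at_within[OF d1]] .
  have v2: "(?w has_vector_derivative complex_of_real (((t-\<xi>)\<^sup>2 - E) * y t)) (at t within S)" for t S
    using has_vector_derivative_of_real[OF has_field_derivative_at_within[OF d2]] .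
  show "half_line_oscillator \<xi> ?u (\<lambda>x. complex_of_real E * ?u x)"
    unfolding half_line_oscillator_def
  proof (intro conjI)
    show "?u \<in> L2 {0<..}" "(\<lambda>x. complex_of_real E * ?u x) \<in> L2 {0<..}" using u by (auto intro: L2_scale)
    have hi: "((\<lambda>s. complex_of_real ((s - \<xi>)\<^sup>2) * ?u s - complex_of_real E * ?u s) has_integral (?w t - ?w 0)) {0..t}"
      if t: "0 \<le> t" for t
    proof -
      have "((\<lambda>s. complex_of_real (((s-\<xi>)\<^sup>2 - E) * y s)) has_integral (?w t - ?w 0)) {0..t}"
        by (rule fundamental_theorem_of_calculus[OF t]) (rule v2)
      then show ?thesis by (simp add: algebra_simps)
    qed
    show "\<exists>w w'. (AE t in lebesgue_on {0<..}. ?u t = w t) \<and>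
        (\<forall>t\<ge>0. (w has_vector_derivative w' t) (at t within {0..})) \<and> w' 0 = 0 \<and>
        (\<forall>t\<ge>0. ((\<lambda>s. complex_of_real ((s - \<xi>)\<^sup>2) * w s - complex_of_real E * ?u s) has_integral (w' t - w' 0)) {0..t})"
      by (rule exI[of _ ?u], rule exI[of _ ?w]) (use v1 hi y0 in simp)
  qed
  show "\<not> (AE x in lebesgue_on {0<..}. ?u x = 0)"
  proof
    assume "AE x in lebesgue_on {0<..}. ?u x = 0"
    then have "AE x in lebesgue. x \<in> {0<..} \<longrightarrow> ?u x = 0"
      by (subst (asm) AE_restrict_space_iff) auto
    then have "AE x::real in lebesgue. \<not> x > 0"
      by (rule eventually_mono) (metis greaterThan_iff less_imp_le of_real_eq_0_iff pos less_irrefl)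
    then obtain N where N: "negligible N" "\<And>x::real. x > 0 \<Longrightarrow> x \<in> N"
      unfolding eventually_ae_filter negligible_iff_null_sets by (auto simp: subset_iff)
    then have "negligible {0<..<1::real}" by (intro negligible_subset[OF N(1)]) auto
    then show False using open_not_negligible[of "{0<..<1::real}"] by auto
  qed
qed

text \<open>Existence of the least eigenvalue, obtained by shooting in the energy. It is needed because \<open>half_line_mu\<close>
is defined by \<open>LEAST\<close>, which says nothing unless a least element exists.\<close>

lemma half_line_ground_state:
  obtains E v v' C where "\<And>t. (v has_real_derivative v' t) (at t)"
    "\<And>t. (v' has_real_derivative ((t-\<xi>)\<^sup>2 - E) * v t) (at t)" "v' 0 = 0" "\<And>t. t \<ge> 0 \<Longrightarrow> v t > 0"
    "\<And>t. t \<ge> 0 \<Longrightarrow> \<bar>v t\<bar> \<le> C * exp (-2*t)" "\<And>t. t \<ge> 0 \<Longrightarrow> \<bar>v' t\<bar> \<le> C * exp (-2*t)"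
proof -
  define y where "y = (\<lambda>k. schr (\<xi>\<^sup>2 - k) (-2*\<xi>) 1)"
  define y' where "y' = (\<lambda>k. schr' (\<xi>\<^sup>2 - k) (-2*\<xi>) 1)"
  define q where "q = (\<lambda>k t. (t-\<xi>)\<^sup>2 - k)"
  define L where "L = (3 + \<bar>\<xi>\<bar>)\<^sup>2 + 4"
  define T where "T = \<bar>\<xi>\<bar> + L + 4"
  have L0: "L > 0" unfolding L_def by (simp add: add_nonneg_pos)
  have d1: "(y k has_real_derivative y' k t) (at t)" for k t
    unfolding y_def y'_def by (rule schr_deriv)
  have d2: "(y' k has_real_derivative q k t * y k t) (at t)" for k t
    using schr'_deriv[of "\<xi>\<^sup>2 - k" "-2*\<xi>" 1 t] unfolding y_def y'_def q_def
    by (simp add: power2_diff algebra_simps)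
  have init: "y k 0 = 1" "y' k 0 = 0" for k unfolding y_def y'_def by auto
  have qT: "q k t \<ge> 4" if "k \<in> {0..L}" "t \<ge> T" for k t
  proof -
    have "(L + 4) * 1 \<le> (L+4) * (L+4)" using L0 by (intro mult_left_mono) auto
    also have "\<dots> \<le> (t-\<xi>) * (t-\<xi>)" using that L0 unfolding T_def by (intro mult_mono) auto
    finally show ?thesis using that unfolding q_def power2_eq_square by auto
  qed
  have neg: "\<exists>t\<ge>0. y L t < 0"
  proof (rule concave_becomes_negative[of "y L" "y' L" "q L"])
    have "q L t \<le> -4" if "0 \<le> t" "t \<le> 3" for t
    proof -
      have "(t-\<xi>)\<^sup>2 \<le> (3 + \<bar>\<xi>\<bar>)\<^sup>2" using that by (intro abs_le_square_iff[THEN iffD1]) auto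
      then show ?thesis unfolding q_def L_def by simp
    qed
    then show "\<And>t. 0 \<le> t \<Longrightarrow> t \<le> 3 \<Longrightarrow> q L t \<le> 0" "\<And>t. 1 \<le> t \<Longrightarrow> t \<le> 2 \<Longrightarrow> q L t \<le> -4" by force+
  qed (use d1 d2 init in auto)
  have T0: "T \<ge> 0" unfolding T_def using L0 by auto
  have ci: "continuous_on A (\<lambda>k. \<xi>\<^sup>2 - k)" for A by (intro continuous_intros)
  obtain k where k: "0 < k" "k < L" "\<And>t. t \<ge> 0 \<Longrightarrow> y k t > 0" "\<And>t. t \<ge> T \<Longrightarrow> y' k t \<le> 0"
  proof (rule half_line_shooting[of y y' q L T])
    show "continuous_on ({0..L} \<times> {-r..r}) (\<lambda>z. y (fst z) (snd z))" for r
      unfolding y_def using schr_joint_continuous(1)[of L "\<lambda>k. \<xi>\<^sup>2 - k" "\<lambda>_. -2*\<xi>" "\<lambda>_. 1" r] ci by simp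
    show "continuous_on ({0..L} \<times> {-r..r}) (\<lambda>z. y' (fst z) (snd z))" for r
      unfolding y'_def using schr_joint_continuous(2)[of L "\<lambda>k. \<xi>\<^sup>2 - k" "\<lambda>_. -2*\<xi>" "\<lambda>_. 1" r] ci by simp
    show "continuous_on UNIV (q k)" for k unfolding q_def by (intro continuous_intros)
    show "q 0 t \<ge> 0" for t unfolding q_def by simp
    show "L \<ge> 0" using L0 by simp
  qed (use d1 d2 init qT T0 neg in auto)
  have q4: "q k t \<ge> 4" "y k t > 0" "y' k t \<le> 0" if "t \<ge> T" for t using that qT[of k t] k T0 by auto
  obtain C where C: "\<And>t. t \<ge> 0 \<Longrightarrow> \<bar>y k t\<bar> \<le> C * exp (-2*t)" "\<And>t. t \<ge> 0 \<Longrightarrow> \<bar>y' k t\<bar> \<le> C * exp (-2*t)"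
    using decaying_exponential_bound[of "y k" "y' k" "q k" T, OF d1 d2 q4] by metis
  show ?thesis
    by (rule that[of "y k" "y' k" k C]) (use d1 d2 init k C in \<open>auto simp: q_def\<close>)
qed

lemma half_line_mu_lower_bound:
  fixes v v' :: "real \<Rightarrow> real"
  assumes v1: "\<And>t. (v has_real_derivative v' t) (at t)"
    and v2: "\<And>t. (v' has_real_derivative ((t-\<xi>)\<^sup>2 - l) * v t) (at t)"
    and v0: "\<And>t. t \<ge> 0 \<Longrightarrow> v t > 0" "v' 0 \<le> 0"
    and vb: "\<And>t. t \<ge> 0 \<Longrightarrow> \<bar>v' t\<bar> \<le> C"
    and ev: "is_eigenvalue {0<..} (half_line_oscillator \<xi>) (complex_of_real E)"
  shows "l \<le> E"
proof -
  obtain u u' where u: "continuous_on {0..} u" "continuous_on {0..} u'"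
    "\<And>t. t > 0 \<Longrightarrow> (u has_real_derivative u' t) (at t)"
    "\<And>t. t > 0 \<Longrightarrow> (u' has_real_derivative ((t-\<xi>)\<^sup>2 - E) * u t) (at t)"
    "u 0 > 0" "u' 0 = 0" "\<And>c T. c > 0 \<Longrightarrow> \<exists>t\<ge>T. \<bar>u t\<bar> < c"
    using half_line_eigenfunction[OF ev] by metis
  have Q: "(t-\<xi>)\<^sup>2 \<ge> E" if "t \<ge> \<bar>\<xi>\<bar> + \<bar>E\<bar> + 1" for t
  proof -
    have "(\<bar>E\<bar> + 1) * 1 \<le> (\<bar>E\<bar>+1) * (\<bar>E\<bar>+1)" by (intro mult_left_mono) auto
    also have "\<dots> \<le> (t-\<xi>) * (t-\<xi>)" using that by (intro mult_mono) auto
    finally show ?thesis unfolding power2_eq_square by auto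
  qed
  show ?thesis
    by (rule sturm_barrier[of u u' "\<lambda>t. (t-\<xi>)\<^sup>2" E v v' l C "\<bar>\<xi>\<bar> + \<bar>E\<bar> + 1", OF u v1 v2 v0 vb Q])
qed

text \<open>A positive supersolution bounds every eigenvalue from below, in particular the least one.\<close>

lemma half_line_mu_ge:
  fixes v v' :: "real \<Rightarrow> real"
  assumes v1: "\<And>t. (v has_real_derivative v' t) (at t)"
    and v2: "\<And>t. (v' has_real_derivative ((t-\<xi>)\<^sup>2 - l) * v t) (at t)"
    and v0: "\<And>t. t \<ge> 0 \<Longrightarrow> v t > 0" "v' 0 \<le> 0"
    and vb: "\<And>t. t \<ge> 0 \<Longrightarrow> \<bar>v' t\<bar> \<le> C"
  shows "l \<le> half_line_mu \<xi>"
proof -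
  obtain E g g' C' where g: "\<And>t. (g has_real_derivative g' t) (at t)"
    "\<And>t. (g' has_real_derivative ((t-\<xi>)\<^sup>2 - E) * g t) (at t)" "g' 0 = 0" "\<And>t. t \<ge> 0 \<Longrightarrow> g t > 0"
    "\<And>t. t \<ge> 0 \<Longrightarrow> \<bar>g t\<bar> \<le> C' * exp (-2*t)" "\<And>t. t \<ge> 0 \<Longrightarrow> \<bar>g' t\<bar> \<le> C' * exp (-2*t)"
    using half_line_ground_state[of \<xi>] by metis
  have C': "C' \<ge> 0" using g(5)[of 0] by auto
  have gb: "\<bar>g' t\<bar> \<le> C'" if "t \<ge> 0" for t
  proof -
    have "C' * exp (-2*t) \<le> C' * 1" using C' that by (intro mult_left_mono) auto
    then show ?thesis using g(6)[OF that] by simp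
  qed
  have ev: "is_eigenvalue {0<..} (half_line_oscillator \<xi>) (complex_of_real E)"
    by (rule half_line_eigenvalueI[OF g(1) g(2) g(3) g(4) g(5)])
  have "half_line_mu \<xi> = E"
    unfolding half_line_mu_def
  proof (rule Least_equality)
    show "is_eigenvalue {0<..} (half_line_oscillator \<xi>) (complex_of_real E)" by (rule ev)
    show "E \<le> E'" if "is_eigenvalue {0<..} (half_line_oscillator \<xi>) (complex_of_real E')" for E'
      by (rule half_line_mu_lower_bound[OF g(1) g(2) g(4) _ gb that]) (use g(3) in auto)
  qed
  then show ?thesis using half_line_mu_lower_bound[OF v1 v2 v0 vb ev] by simp
qed

text \<open>Shooting in \<open>\<kappa>\<close> between \<open>0\<close>, where the potential \<open>t\<^sup>2 - 2 \<kappa> t\<close> is nonnegative, and \<open>5/2\<close>, where it is deep enough to force a zero.\<close>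

lemma de_Gennes_function:
  obtains \<kappa> f f' C where "\<kappa> > 0" "\<And>t. (f has_real_derivative f' t) (at t)"
    "\<And>t. (f' has_real_derivative (t\<^sup>2 - 2*\<kappa>*t) * f t) (at t)" "f 0 = 1" "f' 0 = 0"
    "\<And>t. f t > 0" "\<And>t. f' t \<le> 0"
    "\<And>t. t \<ge> 0 \<Longrightarrow> \<bar>f t\<bar> \<le> C * exp (-2*t)" "\<And>t. t \<ge> 0 \<Longrightarrow> \<bar>f' t\<bar> \<le> C * exp (-2*t)"
proof -
  define y where "y = (\<lambda>k. schr 0 (-2*k) 1)"
  define y' where "y' = (\<lambda>k. schr' 0 (-2*k) 1)"
  define q where "q = (\<lambda>k t::real. t\<^sup>2 - 2*k*t)"
  define L T :: real where "L = 5/2" and "T = 6"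
  have d1: "(y k has_real_derivative y' k t) (at t)" for k t
    unfolding y_def y'_def by (rule schr_deriv)
  have d2: "(y' k has_real_derivative q k t * y k t) (at t)" for k t
    using schr'_deriv[of 0 "-2*k" 1 t] unfolding y_def y'_def q_def
    by (simp add: algebra_simps)
  have init: "y k 0 = 1" "y' k 0 = 0" for k unfolding y_def y'_def by auto
  have qT: "q k t \<ge> 4" if "k \<in> {0..L}" "t \<ge> T" for k t
  proof -
    have "1 * 4 \<le> (t - 2*k) * t" using that unfolding L_def T_def by (intro mult_mono) auto
    then show ?thesis unfolding q_def power2_eq_square by (simp add: algebra_simps)
  qed
  have neg: "\<exists>t\<ge>0. y L t < 0"
  proof (rule concave_becomes_negative[of "y L" "y' L" "q L"])
    show "q L t \<le> 0" if "0 \<le> t" "t \<le> 3" for t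
      using mult_nonneg_nonneg[of t "5 - t"] that unfolding q_def L_def power2_eq_square by (simp add: algebra_simps)
    show "q L t \<le> -4" if "1 \<le> t" "t \<le> 2" for t
      using mult_nonneg_nonneg[of "t - 1" "4 - t"] that unfolding q_def L_def power2_eq_square by (simp add: algebra_simps)
  qed (use d1 d2 init in auto)
  have ci: "continuous_on A (\<lambda>k::real. -2*k)" for A by (intro continuous_intros)
  obtain k where k: "0 < k" "k < L" "\<And>t. t \<ge> 0 \<Longrightarrow> y k t > 0" "\<And>t. t \<ge> T \<Longrightarrow> y' k t \<le> 0"
  proof (rule half_line_shooting[of y y' q L T])
    show "continuous_on ({0..L} \<times> {-r..r}) (\<lambda>z. y (fst z) (snd z))" for r
      unfolding y_def using schr_joint_continuous(1)[of L "\<lambda>_. 0" "\<lambda>k. -2*k" "\<lambda>_. 1" r] ci by simp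
    show "continuous_on ({0..L} \<times> {-r..r}) (\<lambda>z. y' (fst z) (snd z))" for r
      unfolding y'_def using schr_joint_continuous(2)[of L "\<lambda>_. 0" "\<lambda>k. -2*k" "\<lambda>_. 1" r] ci by simp
    show "continuous_on UNIV (q k)" for k unfolding q_def by (intro continuous_intros)
    show "q 0 t \<ge> 0" for t unfolding q_def by simp
    show "L \<ge> 0" "T \<ge> 0" unfolding L_def T_def by auto
  qed (use d1 d2 init qT neg in auto)
  have T0: "T \<ge> 0" unfolding T_def by simp
  have q4: "q k t \<ge> 4" "y k t > 0" "y' k t \<le> 0" if "t \<ge> T" for t using that qT[of k t] k T0 by auto
  obtain C where C: "\<And>t. t \<ge> 0 \<Longrightarrow> \<bar>y k t\<bar> \<le> C * exp (-2*t)" "\<And>t. t \<ge> 0 \<Longrightarrow> \<bar>y' k t\<bar> \<le> C * exp (-2*t)"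
    using decaying_exponential_bound[of "y k" "y' k" "q k" T, OF d1 d2 q4] by metis
  have n1: "y k (-t) \<ge> 1 \<and> - y' k (-t) \<ge> 0" if "t \<ge> 0" for t
  proof -
    have e1: "((\<lambda>s. y k (-s)) has_real_derivative - y' k (-s)) (at s)" for s
      using DERIV_mirror[THEN iffD1, OF d1] .
    have e2: "((\<lambda>s. - y' k (-s)) has_real_derivative q k (-s) * y k (-s)) (at s)" for s
      using DERIV_minus[OF DERIV_mirror[THEN iffD1, OF d2]] by simp
    have "q k (-s) \<ge> 0" if "s \<ge> 0" for s using that k(1) unfolding q_def by simp
    then show ?thesis
      using convex_growth[of 0 "\<lambda>s. y k (-s)" "\<lambda>s. - y' k (-s)" "\<lambda>s. q k (-s)" t] e1 e2 that init by auto
  qed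
  have pos: "y k t > 0" for t using k(3)[of t] n1[of "-t"] by (cases "t \<ge> 0") auto
  have neg': "y' k t \<le> 0" for t
  proof -
    consider "t \<le> 0" | "0 \<le> t" "t \<le> 2*k" | "2*k \<le> t" "t \<le> T" | "t \<ge> T" by linarith
    then show ?thesis
    proof cases
      case 2
      have "y' k t \<le> y' k 0"
      proof (rule DERIV_nonpos_imp_nonincreasing[of 0 t "y' k"])
        fix x assume x: "0 \<le> x" "x \<le> t"
        have "q k x * y k x \<le> 0" using pos[of x] x 2 unfolding q_def power2_eq_square
          by (intro mult_nonpos_nonneg) (auto simp: mult_right_mono)
        then show "\<exists>w. (y' k has_real_derivative w) (at x) \<and> w \<le> 0" using d2 by blast
      qed (use 2 in auto)
      then show ?thesis using init by simp
    next
      case 3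
      have "y' k t \<le> y' k T"
      proof (rule DERIV_nonneg_imp_nondecreasing[of t T "y' k"])
        fix x assume x: "t \<le> x" "x \<le> T"
        have "q k x * y k x \<ge> 0" using pos[of x] x 3 k(1) unfolding q_def power2_eq_square
          by (intro mult_nonneg_nonneg) (auto simp: mult_right_mono)
        then show "\<exists>w. (y' k has_real_derivative w) (at x) \<and> 0 \<le> w" using d2 by blast
      qed (use 3 in auto)
      then show ?thesis using k(4)[of T] by simp
    qed (use n1[of "-t"] k(4)[of t] in auto)
  qed
  show ?thesis
    by (rule that[of k "y k" "y' k" C]) (use d1 d2 init k C pos neg' in \<open>auto simp: q_def\<close>)
qed

text \<open>The translate of \<open>f\<close> whose potential is centred at \<open>\<xi>\<close> solves the equation of the oscillator at level \<open>\<kappa>\<^sup>2\<close>. Its slope at \<open>0\<close> is nonpositive for every \<open>\<xi>\<close>,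
since \<open>f\<close> is nonincreasing on the whole line.\<close>

lemma Theta0_ge:
  assumes "\<kappa> > 0" and f1: "\<And>t. (f has_real_derivative f' t) (at t)"
    and f2: "\<And>t. (f' has_real_derivative (t\<^sup>2 - 2*\<kappa>*t) * f t) (at t)"
    and pos: "\<And>t. f t > 0" and neg: "\<And>t. f' t \<le> 0"
    and b: "\<And>t. t \<ge> 0 \<Longrightarrow> \<bar>f' t\<bar> \<le> C * exp (-2*t)"
  shows "\<kappa>\<^sup>2 \<le> Theta0"
  unfolding Theta0_def
proof (rule cINF_greatest)
  fix \<xi> :: real
  define v where "v = (\<lambda>t. f (t + (\<kappa> - \<xi>)))"
  define v' where "v' = (\<lambda>t. f' (t + (\<kappa> - \<xi>)))"
  have v1: "(v has_real_derivative v' t) (at t)" for t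
    unfolding v_def v'_def using DERIV_shift[THEN iffD1, OF f1, of "\<kappa> - \<xi>" t] by simp
  have v2: "(v' has_real_derivative ((t-\<xi>)\<^sup>2 - \<kappa>\<^sup>2) * v t) (at t)" for t
  proof -
    have "(v' has_real_derivative ((t + (\<kappa> - \<xi>))\<^sup>2 - 2*\<kappa>*(t + (\<kappa> - \<xi>))) * f (t + (\<kappa> - \<xi>))) (at t)"
      unfolding v'_def using DERIV_shift[THEN iffD1, OF f2, of "\<kappa> - \<xi>" t] by simp
    moreover have "(t + (\<kappa> - \<xi>))\<^sup>2 - 2*\<kappa>*(t + (\<kappa> - \<xi>)) = (t-\<xi>)\<^sup>2 - \<kappa>\<^sup>2"
      by (simp add: power2_eq_square algebra_simps)
    ultimately show ?thesis unfolding v_def by simp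
  qed
  have C: "C \<ge> 0" using b[of 0] by auto
  obtain B where B: "\<And>s. s \<in> {-\<bar>\<xi>\<bar>..0} \<Longrightarrow> \<bar>f' s\<bar> \<le> B"
    using continuous_on_Icc_bounded[OF derivative_imp_continuous_on[OF f2]] by blast
  have vb: "\<bar>v' t\<bar> \<le> \<bar>B\<bar> + C" if "t \<ge> 0" for t
  proof (cases "t + (\<kappa> - \<xi>) \<ge> 0")
    case True
    have "C * exp (-2*(t + (\<kappa> - \<xi>))) \<le> C * 1" using C True by (intro mult_left_mono) auto
    then show ?thesis using b[OF True] unfolding v'_def by simp
  next
    case False
    then show ?thesis using B[of "t + (\<kappa> - \<xi>)"] that assms(1) C unfolding v'_def by auto
  qed
  show "\<kappa>\<^sup>2 \<le> half_line_mu \<xi>"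
    by (rule half_line_mu_ge[OF v1 v2 _ _ vb]) (use pos neg in \<open>auto simp: v_def v'_def\<close>)
qed simp

section \<open>Moments of the de Gennes function\<close>

text \<open>Integrals over the half-line of explicit total derivatives are limits of antiderivatives; this definition
keeps measurability and integrability out of the moment computations.\<close>

definition improper_integral :: "(real \<Rightarrow> real) \<Rightarrow> real \<Rightarrow> bool" where
  "improper_integral h I \<longleftrightarrow>
     (\<exists>H. (\<forall>t\<ge>0. (H has_real_derivative h t) (at t)) \<and> H 0 = 0 \<and> (H \<longlongrightarrow> I) at_top)"

lemma antiderivative_mono:
  fixes H h :: "real \<Rightarrow> real"
  assumes "\<And>t. t \<ge> 0 \<Longrightarrow> (H has_real_derivative h t) (at t)" "\<And>t. t \<ge> a \<Longrightarrow> h t \<ge> 0" "0 \<le> a" "a \<le> s" "s \<le> t"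
  shows "H s \<le> H t"
proof (rule DERIV_nonneg_imp_nondecreasing[OF assms(5)])
  fix x assume "s \<le> x" "x \<le> t"
  then show "\<exists>w. (H has_real_derivative w) (at x) \<and> 0 \<le> w" using assms(1)[of x] assms(2)[of x] assms(3,4) by auto
qed

lemma improper_tail:
  fixes H h :: "real \<Rightarrow> real"
  assumes H: "\<And>t. t \<ge> 0 \<Longrightarrow> (H has_real_derivative h t) (at t)" and l: "(H \<longlongrightarrow> I) at_top"
    and h: "\<And>t. t \<ge> a \<Longrightarrow> h t \<ge> 0" and a: "0 \<le> a"
  shows "H a \<le> I"
proof (rule tendsto_lowerbound[OF l])
  show "\<forall>\<^sub>F t in at_top. H a \<le> H t"
    using eventually_ge_at_top[of a] by eventually_elim (rule antiderivative_mono[OF H h a order_refl])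
qed simp

lemma improper_integral_nonneg:
  assumes "improper_integral h I" "\<And>t. t \<ge> 0 \<Longrightarrow> h t \<ge> 0"
  shows "I \<ge> 0"
  using assms improper_tail[of _ h I 0] unfolding improper_integral_def by (metis order_refl)

lemma improper_integral_add:
  assumes "improper_integral h I" "improper_integral g J"
  shows "improper_integral (\<lambda>t. h t + g t) (I + J)"
proof -
  obtain H G where "\<forall>t\<ge>0. (H has_real_derivative h t) (at t)" "H 0 = 0" "(H \<longlongrightarrow> I) at_top"
    "\<forall>t\<ge>0. (G has_real_derivative g t) (at t)" "G 0 = 0" "(G \<longlongrightarrow> J) at_top"
    using assms unfolding improper_integral_def by blast
  then show ?thesis unfolding improper_integral_def
    by (intro exI[of _ "\<lambda>t. H t + G t"]) (auto intro!: derivative_intros tendsto_intros)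
qed

lemma improper_integral_cmult:
  assumes "improper_integral h I"
  shows "improper_integral (\<lambda>t. c * h t) (c * I)"
proof -
  obtain H where "\<forall>t\<ge>0. (H has_real_derivative h t) (at t)" "H 0 = 0" "(H \<longlongrightarrow> I) at_top"
    using assms unfolding improper_integral_def by blast
  then show ?thesis unfolding improper_integral_def
    by (intro exI[of _ "\<lambda>t. c * H t"]) (auto intro!: DERIV_cmult tendsto_intros)
qed

lemma improper_integral_FTC:
  assumes "\<And>t. t \<ge> 0 \<Longrightarrow> (H has_real_derivative h t) (at t)" "(H \<longlongrightarrow> 0) at_top"
  shows "improper_integral h (- H 0)"
  unfolding improper_integral_def
proof (intro exI conjI)
  show "\<forall>t\<ge>0. ((\<lambda>t. H t - H 0) has_real_derivative h t) (at t)"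
    using assms by (auto intro!: derivative_eq_intros)
  show "((\<lambda>t. H t - H 0) \<longlongrightarrow> - H 0) at_top"
    using tendsto_diff[OF assms(2) tendsto_const[of "H 0"]] by simp
qed simp

lemma improper_integral_unique:
  assumes "improper_integral h I" "improper_integral h J"
  shows "I = J"
proof -
  have "improper_integral (\<lambda>t. 0) (I - J)"
    using improper_integral_add[OF assms(1) improper_integral_cmult[OF assms(2), of "-1"]] by simp
  moreover have "improper_integral (\<lambda>t. 0) (J - I)"
    using improper_integral_add[OF assms(2) improper_integral_cmult[OF assms(1), of "-1"]] by simp
  ultimately show ?thesis using improper_integral_nonneg[of "\<lambda>t. 0" "I - J"] improper_integral_nonneg[of "\<lambda>t. 0" "J - I"] by simp
qed

lemma improper_integral_exists:
  fixes h :: "real \<Rightarrow> real"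
  assumes c: "continuous_on UNIV h" and b: "\<And>t. t \<ge> 0 \<Longrightarrow> \<bar>h t\<bar> \<le> K * exp (-t)"
  shows "\<exists>I. improper_integral h I"
proof -
  have K: "K \<ge> 0" using b[of 0] by simp
  have exp1: "((\<lambda>t. - K * exp (-t)) has_real_derivative K * exp (-t)) (at t)" for t
    by (rule derivative_eq_intros refl | simp)+
  have expl: "((\<lambda>t. - K * exp (-t)) \<longlongrightarrow> 0) at_top" by real_asymp
  have e: "improper_integral (\<lambda>t. K * exp (-t)) K"
    using improper_integral_FTC[OF exp1 expl] by simp
  define g where "g = (\<lambda>t. h t + K * exp (-t))"
  have g0: "g t \<ge> 0" if "t \<ge> 0" for t using b[OF that] unfolding g_def by (simp add: abs_le_iff)
  have cg: "continuous_on A g" for A unfolding g_def by (intro continuous_intros continuous_on_subset[OF c]) auto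
  define G where "G = (\<lambda>t. integral {-1..t} g - integral {-1..0} g)"
  have G': "(G has_real_derivative g t) (at t)" if t: "t \<ge> 0" for t
  proof -
    have "((\<lambda>t. integral {-1..t} g) has_vector_derivative g t) (at t within {-1..t+1})"
      by (rule integral_has_vector_derivative[OF cg]) (use t in auto)
    moreover have "at t within {-1..t+1} = at t" using t by (intro at_within_interior) auto
    ultimately have "((\<lambda>t. integral {-1..t} g) has_real_derivative g t) (at t)"
      by (simp add: has_real_derivative_iff_has_vector_derivative)
    then show ?thesis unfolding G_def by (auto intro!: derivative_eq_intros)
  qed
  have mono: "G s \<le> G t" if "0 \<le> s" "s \<le> t" for s t
    by (rule antiderivative_mono[OF G' g0, of 0 s t]) (use that in auto)
  have bdd: "G t \<le> 2 * K" if t: "t \<ge> 0" for t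
  proof -
    have "G t + 2 * K * exp (-t) \<le> G 0 + 2 * K * exp (-0)"
    proof (rule DERIV_nonpos_imp_nonincreasing[OF t])
      fix x assume x: "0 \<le> x" "x \<le> t"
      have "((\<lambda>t. G t + 2 * K * exp (-t)) has_real_derivative (g x - 2 * K * exp (-x))) (at x)"
        by (rule derivative_eq_intros G' x refl | simp)+
      moreover have "g x - 2 * K * exp (-x) \<le> 0" using b[OF x(1)] unfolding g_def by (simp add: abs_le_iff)
      ultimately show "\<exists>w. ((\<lambda>t. G t + 2 * K * exp (-t)) has_real_derivative w) (at x) \<and> w \<le> 0" by blast
    qed
    moreover have "G 0 = 0" unfolding G_def by simp
    moreover have "2 * K * exp (-t) \<ge> 0" using K by simp
    ultimately show ?thesis by simp
  qed
  define S where "S = (SUP t\<in>{0..}. G t)"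
  have ba: "bdd_above (G ` {0..})" using bdd by (auto intro!: bdd_aboveI[of _ "2*K"])
  have "(G \<longlongrightarrow> S) at_top"
  proof (rule order_tendstoI)
    fix a assume "a < S"
    then obtain t0 where t0: "t0 \<ge> 0" "a < G t0" unfolding S_def using less_cSUP_iff[OF _ ba, of a] by auto
    show "\<forall>\<^sub>F t in at_top. a < G t"
      using eventually_ge_at_top[of t0]
    proof eventually_elim
      case (elim t) then show ?case using mono[OF t0(1) elim] t0(2) by linarith
    qed
  next
    fix a assume a: "S < a"
    show "\<forall>\<^sub>F t in at_top. G t < a"
      using eventually_ge_at_top[of 0]
    proof eventually_elim
      case (elim t) 
      have "G t \<le> S" unfolding S_def by (rule cSUP_upper[OF _ ba]) (use elim in auto)
      then show ?case using a by linarith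
    qed
  qed
  then have "improper_integral g S" unfolding improper_integral_def using G' by (intro exI[of _ G]) (auto simp: G_def)
  then have "improper_integral (\<lambda>t. g t + (-1) * (K * exp (-t))) (S + (-1) * K)"
    by (intro improper_integral_add improper_integral_cmult e)
  then show ?thesis unfolding g_def by (intro exI[of _ "S + (-1)*K"]) simp
qed

lemma poly_exp_bound:
  fixes p :: "real poly"
  assumes "d > 0"
  shows "\<exists>K\<ge>0. \<forall>t\<ge>0. \<bar>poly p t\<bar> \<le> K * exp (d*t)"
  using assms
proof (induction p arbitrary: d)
  case (pCons a p)
  obtain K where K: "K \<ge> 0" "\<And>t. t \<ge> 0 \<Longrightarrow> \<bar>poly p t\<bar> \<le> K * exp (d/2*t)" using pCons.IH[of "d/2"] pCons.prems by auto
  have "\<bar>poly (pCons a p) t\<bar> \<le> (\<bar>a\<bar> + 2/d*K) * exp (d*t)" if t: "t \<ge> 0" for t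
  proof -
    have "1 + d/2*t \<le> exp (d/2*t)" by (rule exp_ge_add_one_self)
    then have "t \<le> 2/d * exp (d/2*t)" using pCons.prems by (simp add: field_simps)
    then have "t * \<bar>poly p t\<bar> \<le> (2/d * exp (d/2*t)) * (K * exp (d/2*t))"
      using K t pCons.prems by (intro mult_mono) auto
    also have "\<dots> = 2/d*K * (exp (d/2*t) * exp (d/2*t))" by simp
    also have "exp (d/2*t) * exp (d/2*t) = exp (d*t)" by (simp flip: exp_add)
    finally have 1: "t * \<bar>poly p t\<bar> \<le> 2/d*K * exp (d*t)" .
    have "\<bar>a\<bar> * 1 \<le> \<bar>a\<bar> * exp (d*t)" using t pCons.prems by (intro mult_left_mono) auto
    moreover have "\<bar>a + t * poly p t\<bar> \<le> \<bar>a\<bar> + t * \<bar>poly p t\<bar>"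
      using abs_triangle_ineq[of a "t * poly p t"] t by (simp add: abs_mult)
    ultimately show ?thesis using 1 by (simp add: distrib_right)
  qed
  moreover have "\<bar>a\<bar> + 2/d*K \<ge> 0" using K pCons.prems by simp
  ultimately show ?case by blast
qed (auto intro!: exI[of _ 0])

locale de_Gennes =
  fixes \<kappa> :: real and f f' :: "real \<Rightarrow> real" and C :: real
  assumes kappa_pos: "\<kappa> > 0"
    and f_deriv: "\<And>t. (f has_real_derivative f' t) (at t)"
    and f'_deriv: "\<And>t. (f' has_real_derivative (t\<^sup>2 - 2*\<kappa>*t) * f t) (at t)"
    and f_0: "f 0 = 1" and f'_0: "f' 0 = 0"
    and f_pos: "\<And>t. f t > 0" and f'_nonpos: "\<And>t. f' t \<le> 0"
    and f_bound: "\<And>t. t \<ge> 0 \<Longrightarrow> \<bar>f t\<bar> \<le> C * exp (-2*t)"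
    and f'_bound: "\<And>t. t \<ge> 0 \<Longrightarrow> \<bar>f' t\<bar> \<le> C * exp (-2*t)"
begin

lemma product_bound:
  fixes u v :: "real \<Rightarrow> real"
  assumes "\<And>t. t \<ge> 0 \<Longrightarrow> \<bar>u t\<bar> \<le> C * exp (-2*t)" "\<And>t. t \<ge> 0 \<Longrightarrow> \<bar>v t\<bar> \<le> C * exp (-2*t)"
  shows "\<exists>K. \<forall>t\<ge>0. \<bar>poly p t * (u t * v t)\<bar> \<le> K * exp (-t)"
proof -
  obtain K where K: "K \<ge> 0" "\<And>t. t \<ge> 0 \<Longrightarrow> \<bar>poly p t\<bar> \<le> K * exp (1*t)" using poly_exp_bound[of 1 p] by auto
  have "\<bar>poly p t * (u t * v t)\<bar> \<le> (K * C\<^sup>2) * exp (-t)" if t: "t \<ge> 0" for t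
  proof -
    have "\<bar>u t * v t\<bar> \<le> (C * exp (-2*t)) * (C * exp (-2*t))"
      unfolding abs_mult using assms[OF t] by (intro mult_mono) (auto intro: order_trans[OF abs_ge_zero])
    then have "\<bar>poly p t * (u t * v t)\<bar> \<le> (K * exp (1*t)) * ((C * exp (-2*t)) * (C * exp (-2*t)))"
      using K t unfolding abs_mult[of "poly p t"] by (intro mult_mono) auto
    also have "\<dots> = (K * C\<^sup>2) * (exp t * exp (-2*t) * exp (-2*t))" by (simp add: power2_eq_square)
    also have "\<dots> \<le> (K * C\<^sup>2) * exp (-t)" using t K by (intro mult_left_mono) (auto simp flip: exp_add)
    finally show ?thesis .
  qed
  then show ?thesis by blast
qed

lemma product_tendsto_0:
  fixes u v :: "real \<Rightarrow> real"
  assumes "\<And>t. t \<ge> 0 \<Longrightarrow> \<bar>u t\<bar> \<le> C * exp (-2*t)" "\<And>t. t \<ge> 0 \<Longrightarrow> \<bar>v t\<bar> \<le> C * exp (-2*t)"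
  shows "((\<lambda>t. poly p t * (u t * v t)) \<longlongrightarrow> 0) at_top"
proof -
  obtain K where K: "\<And>t. t \<ge> 0 \<Longrightarrow> \<bar>poly p t * (u t * v t)\<bar> \<le> K * exp (-t)" using product_bound[OF assms, of p] by blast
  have "((\<lambda>t. K * exp (-t)) \<longlongrightarrow> 0) at_top" by real_asymp
  then show ?thesis
    by (rule Lim_null_comparison[rotated]) (rule eventually_mono[OF eventually_ge_at_top[of 0]], simp add: K)
qed

definition moment :: "nat \<Rightarrow> real poly \<Rightarrow> real" where
  "moment n p = (THE I. improper_integral (\<lambda>t. t^n * poly p t * (f t)\<^sup>2) I)"

lemma f_continuous: "continuous_on A f" and f'_continuous: "continuous_on A f'"
  using derivative_imp_continuous_on[OF f_deriv] derivative_imp_continuous_on[OF f'_deriv] by blast+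

lemma moment: "improper_integral (\<lambda>t. t^n * poly p t * (f t)\<^sup>2) (moment n p)"
proof -
  obtain K where K: "\<And>t. t \<ge> 0 \<Longrightarrow> \<bar>poly (monom 1 n * p) t * (f t * f t)\<bar> \<le> K * exp (-t)"
    using product_bound[OF f_bound f_bound, of "monom 1 n * p"] by blast
  have eq: "(\<lambda>t. t^n * poly p t * (f t)\<^sup>2) = (\<lambda>t. poly (monom 1 n * p) t * (f t * f t))"
    by (auto simp: poly_monom power2_eq_square)
  have "\<exists>I. improper_integral (\<lambda>t. t^n * poly p t * (f t)\<^sup>2) I"
    unfolding eq by (rule improper_integral_exists[OF _ K]) (intro continuous_intros f_continuous)
  then obtain I where I: "improper_integral (\<lambda>t. t^n * poly p t * (f t)\<^sup>2) I" by blast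
  have "moment n p = I" unfolding moment_def
    by (rule the_equality) (use I improper_integral_unique in blast)+
  then show ?thesis using I by simp
qed

lemma moment_eqI: "improper_integral (\<lambda>t. t^n * poly p t * (f t)\<^sup>2) I \<Longrightarrow> moment n p = I"
  using improper_integral_unique moment by blast

definition M :: "nat \<Rightarrow> real" where "M n = moment n 1"

lemma moment_0 [simp]: "moment n 0 = 0"
  by (rule moment_eqI) (use improper_integral_cmult[OF moment[of n 1], of 0] in simp)

lemma moment_pCons [simp]: "moment n (pCons a p) = a * M n + moment (n+1) p"
proof (rule moment_eqI)
  have "improper_integral (\<lambda>t. a * (t^n * poly 1 t * (f t)\<^sup>2) + t^(n+1) * poly p t * (f t)\<^sup>2) (a * M n + moment (n+1) p)"
    unfolding M_def by (intro improper_integral_add improper_integral_cmult moment)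
  then show "improper_integral (\<lambda>t. t^n * poly (pCons a p) t * (f t)\<^sup>2) (a * M n + moment (n+1) p)"
    by (simp add: algebra_simps)
qed

abbreviation L :: "real poly \<Rightarrow> real" where "L p \<equiv> moment 0 p"

lemma L: "improper_integral (\<lambda>t. poly p t * (f t)\<^sup>2) (L p)"
  using moment[of 0 p] by simp

definition qpoly :: "real poly" where "qpoly = [:0, -2*\<kappa>, 1:]"

lemma poly_qpoly: "poly qpoly t = t\<^sup>2 - 2*\<kappa>*t"
  unfolding qpoly_def by (simp add: power2_eq_square algebra_simps)

lemma poly_deriv: "(poly p has_real_derivative poly (pderiv p) t) (at t)"
  by (rule poly_DERIV)

text \<open>Integration by parts removes \<open>f f'\<close> and \<open>f'\<^sup>2\<close>: every quadratic expression in \<open>f\<close> and \<open>f'\<close> with polynomial coefficients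
reduces to moments of \<open>f\<^sup>2\<close> and boundary values.\<close>

lemma quadratic_form_integral:
  "improper_integral (\<lambda>t. poly P0 t * (f t)\<^sup>2 + poly P1 t * (f t * f' t) + poly P2 t * (f' t)\<^sup>2)
     (L (P0 - smult (1/2) (pderiv P1) + smult (1/2) (pderiv (pderiv P2)) - qpoly * P2)
       - poly P1 0 / 2 + poly (pderiv P2) 0 / 2)"
proof -
  define A where "A = smult (1/2) P1 - smult (1/2) (pderiv P2)"
  define H where "H = (\<lambda>t. poly A t * (f t * f t) + poly P2 t * (f t * f' t))"
  define R where "R = P0 - smult (1/2) (pderiv P1) + smult (1/2) (pderiv (pderiv P2)) - qpoly * P2"
  have H0: "- H 0 = - poly P1 0 / 2 + poly (pderiv P2) 0 / 2"
    unfolding H_def A_def using f_0 f'_0 by (simp add: field_simps)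
  have "improper_integral (\<lambda>t. poly (pderiv A) t * (f t)\<^sup>2 + (2 * poly A t + poly (pderiv P2) t) * (f t * f' t)
      + poly P2 t * ((f' t)\<^sup>2 + poly qpoly t * (f t)\<^sup>2)) (- H 0)"
  proof (rule improper_integral_FTC)
    show "(H has_real_derivative poly (pderiv A) t * (f t)\<^sup>2 + (2 * poly A t + poly (pderiv P2) t) * (f t * f' t)
      + poly P2 t * ((f' t)\<^sup>2 + poly qpoly t * (f t)\<^sup>2)) (at t)" for t
      unfolding H_def poly_qpoly
      by (rule derivative_eq_intros poly_deriv f_deriv f'_deriv refl)+ (simp add: algebra_simps power2_eq_square)
    show "(H \<longlongrightarrow> 0) at_top"
      unfolding H_def using tendsto_add[OF product_tendsto_0[OF f_bound f_bound, of A] product_tendsto_0[OF f_bound f'_bound, of P2]] by simp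
  qed
  from improper_integral_add[OF L[of R] this]
  have "improper_integral (\<lambda>t. poly P0 t * (f t)\<^sup>2 + poly P1 t * (f t * f' t) + poly P2 t * (f' t)\<^sup>2) (L R + - H 0)"
    unfolding R_def A_def
    by (simp add: pderiv_diff pderiv_smult algebra_simps)
  then show ?thesis unfolding R_def H0 by (simp add: algebra_simps)
qed

text \<open>The function \<open>f\<^sup>2\<close> solves a linear third order equation. Testing it with a polynomial gives a recursion
through which all moments are expressed by \<open>M 0\<close> and \<open>\<kappa>\<close>.\<close>

lemma moment_identity:
  "L (smult (1/2) (pderiv (pderiv (pderiv P))) - smult 2 (pderiv P * qpoly) - P * pderiv qpoly)
    = - poly (pderiv (pderiv P)) 0 / 2"
proof (rule moment_eqI)
  define B where "B = smult (1/2) (pderiv (pderiv P)) - P * qpoly"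
  define H where "H = (\<lambda>t. poly P t * (f' t * f' t) - poly (pderiv P) t * (f t * f' t) + poly B t * (f t * f t))"
  have "improper_integral (\<lambda>t. poly (smult (1/2) (pderiv (pderiv (pderiv P))) - smult 2 (pderiv P * qpoly) - P * pderiv qpoly) t * (f t)\<^sup>2) (- H 0)"
  proof (rule improper_integral_FTC)
    show "(H has_real_derivative poly (smult (1/2) (pderiv (pderiv (pderiv P))) - smult 2 (pderiv P * qpoly) - P * pderiv qpoly) t * (f t)\<^sup>2) (at t)" for t
      unfolding H_def
      by (rule derivative_eq_intros poly_deriv f_deriv f'_deriv refl)+
         (simp add: B_def pderiv_diff pderiv_smult pderiv_mult algebra_simps power2_eq_square poly_qpoly)
    show "(H \<longlongrightarrow> 0) at_top"
      unfolding H_def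
      using tendsto_add[OF tendsto_diff[OF product_tendsto_0[OF f'_bound f'_bound, of P] product_tendsto_0[OF f_bound f'_bound, of "pderiv P"]]
          product_tendsto_0[OF f_bound f_bound, of B]] by simp
  qed
  moreover have "- H 0 = - poly (pderiv (pderiv P)) 0 / 2"
    unfolding H_def B_def using f_0 f'_0 by (simp add: poly_qpoly)
  ultimately show "improper_integral (\<lambda>t. t^0 * poly (smult (1/2) (pderiv (pderiv (pderiv P))) - smult 2 (pderiv P * qpoly) - P * pderiv qpoly) t * (f t)\<^sup>2)
     (- poly (pderiv (pderiv P)) 0 / 2)" by simp
qed

lemma moments:
  "M 1 = \<kappa> * M 0"
  "M 2 = 3/2 * \<kappa> * M 1"
  "M 3 = 5/3 * \<kappa> * M 2 + 1/6"
  "M 4 = 7/4 * \<kappa> * M 3 + 3/8 * M 0"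
  "M 5 = 9/5 * \<kappa> * M 4 + 6/5 * M 1"
  "M 6 = 11/6 * \<kappa> * M 5 + 5/2 * M 2"
  "M 7 = 13/7 * \<kappa> * M 6 + 30/7 * M 3"
  "M 8 = 15/8 * \<kappa> * M 7 + 105/16 * M 4"
proof -
  note s = qpoly_def pderiv_pCons eval_nat_numeral
  show "M 1 = \<kappa> * M 0"
    using moment_identity[of "[:1:]"] by ((simp add: s)?; linarith)
  show "M 2 = 3/2 * \<kappa> * M 1"
    using moment_identity[of "[:0,1:]"] by ((simp add: s)?; linarith)
  show "M 3 = 5/3 * \<kappa> * M 2 + 1/6"
    using moment_identity[of "[:0,0,1:]"] by ((simp add: s)?; linarith)
  show "M 4 = 7/4 * \<kappa> * M 3 + 3/8 * M 0"
    using moment_identity[of "[:0,0,0,1:]"] by ((simp add: s)?; linarith)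
  show "M 5 = 9/5 * \<kappa> * M 4 + 6/5 * M 1"
    using moment_identity[of "[:0,0,0,0,1:]"] by ((simp add: s)?; linarith)
  show "M 6 = 11/6 * \<kappa> * M 5 + 5/2 * M 2"
    using moment_identity[of "[:0,0,0,0,0,1:]"] by ((simp add: s)?; linarith)
  show "M 7 = 13/7 * \<kappa> * M 6 + 30/7 * M 3"
    using moment_identity[of "[:0,0,0,0,0,0,1:]"] by ((simp add: s)?; linarith)
  show "M 8 = 15/8 * \<kappa> * M 7 + 105/16 * M 4"
    using moment_identity[of "[:0,0,0,0,0,0,0,1:]"] by ((simp add: s)?; linarith)
qed

lemma M_0_pos: "M 0 > 0"
proof -
  have i: "improper_integral (\<lambda>t. (f t)\<^sup>2) (M 0)" using L[of 1] unfolding M_def by simp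
  then obtain H where H: "\<And>t. t \<ge> 0 \<Longrightarrow> (H has_real_derivative (f t)\<^sup>2) (at t)" "H 0 = 0" "(H \<longlongrightarrow> M 0) at_top"
    unfolding improper_integral_def by blast
  have "H 1 \<le> M 0" by (rule improper_tail[OF H(1) H(3)]) auto
  moreover obtain z where z: "0 < z" "z < 1" "H 1 - H 0 = (1 - 0) * (f z)\<^sup>2"
    using MVT2[of 0 1 H "\<lambda>t. (f t)\<^sup>2"] H(1) by auto
  moreover have "(f z)\<^sup>2 > 0" using f_pos[of z] by simp
  moreover have "H 1 = (f z)\<^sup>2" using z H(2) by simp
  ultimately show ?thesis by linarith
qed

text \<open>The function \<open>f\<^sup>2\<close> is nonincreasing, so a nonnegative weight \<open>p\<close> gives \<open>0 \<le> - \<integral> p (f\<^sup>2)'\<close>, which is evaluated by parts. Inequalities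
of this kind are linear in \<open>M 0\<close> with coefficients that are polynomials in \<open>\<kappa>\<close>.\<close>

lemma decreasing_test:
  assumes "\<And>t. t \<ge> 0 \<Longrightarrow> poly p t \<ge> 0"
  shows "0 \<le> poly p 0 + L (pderiv p)"
proof -
  have "improper_integral (\<lambda>t. poly 0 t * (f t)\<^sup>2 + poly (smult (-2) p) t * (f t * f' t) + poly 0 t * (f' t)\<^sup>2)
     (L (pderiv p) + poly p 0)"
    using quadratic_form_integral[of 0 "smult (-2) p" 0] by (simp add: pderiv_smult pderiv_minus del: moment_pCons)
  then have "0 \<le> L (pderiv p) + poly p 0"
  proof (rule improper_integral_nonneg)
    fix t :: real assume t: "t \<ge> 0"
    have "poly p t * (f t * (- f' t)) \<ge> 0" using assms[OF t] f_pos[of t] f'_nonpos[of t] by (intro mult_nonneg_nonneg) auto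
    then show "0 \<le> poly 0 t * (f t)\<^sup>2 + poly (smult (-2) p) t * (f t * f' t) + poly 0 t * (f' t)\<^sup>2" by (simp add: mult_ac)
  qed
  then show ?thesis by simp
qed

text \<open>Comparison with the Gaussian centred at \<open>1\<close>, which solves the equation for \<open>\<kappa> = 1\<close> but has positive slope at \<open>0\<close>.\<close>

lemma kappa_less_1: "\<kappa> < 1"
proof (rule ccontr)
  assume "\<not> \<kappa> < 1"
  then have k: "\<kappa> \<ge> 1" by simp
  define h where "h = (\<lambda>t::real. exp (- (t-1)\<^sup>2 / 2))"
  \<comment> \<open>The Wronskian of \<open>h\<close> and \<open>f\<close> is nondecreasing if \<open>\<kappa> \<ge> 1\<close>, positive at \<open>0\<close>, and tends to \<open>0\<close>.\<close>
  define W where "W = (\<lambda>t. (1 - t) * h t * f t - h t * f' t)"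
  have h1: "(h has_real_derivative (1 - t) * h t) (at t)" for t
    unfolding h_def by (rule derivative_eq_intros refl | simp)+
  have w1: "W 0 \<le> W t" if t: "t \<ge> 0" for t
  proof (rule DERIV_nonneg_imp_nondecreasing[OF t])
    fix x assume x: "0 \<le> x" "x \<le> t"
    have "(W has_real_derivative 2 * (\<kappa> - 1) * x * h x * f x) (at x)"
      unfolding W_def by (rule derivative_eq_intros h1 f_deriv f'_deriv refl)+ (simp add: algebra_simps power2_eq_square)
    moreover have "2 * (\<kappa> - 1) * x * h x * f x \<ge> 0" using k x f_pos[of x] unfolding h_def by (intro mult_nonneg_nonneg) auto
    ultimately show "\<exists>w. (W has_real_derivative w) (at x) \<and> 0 \<le> w" by blast
  qed
  have w0: "W 0 > 0" unfolding W_def h_def using f_0 f'_0 by simp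
  have w2: "W t \<le> C * exp (-2*t)" if t: "t \<ge> 1" for t
  proof -
    have h: "h t \<ge> 0" "h t \<le> 1" unfolding h_def by auto
    have "(1 - t) * h t * f t \<le> 0" using t h f_pos[of t] by (intro mult_nonpos_nonneg) auto
    moreover have "h t * (- f' t) \<le> 1 * (C * exp (-2*t))" using h f'_bound[of t] f'_nonpos[of t] t by (intro mult_mono) auto
    ultimately show ?thesis unfolding W_def by simp
  qed
  have "\<forall>\<^sub>F t in at_top. C * exp (-2*t) < W 0"
  proof -
    have "((\<lambda>t. C * exp (-2*t)) \<longlongrightarrow> 0) at_top" by real_asymp
    then show ?thesis using \<open>W 0 > 0\<close> by (simp add: order_tendstoD(2))
  qed
  then obtain t where "t \<ge> 1" "C * exp (-2*t) < W 0"
    using eventually_happens[OF eventually_conj[OF _ eventually_ge_at_top[of 1]]] by fastforce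
  then show False using w1[of t] w2[of t] by simp
qed

end

text \<open>The next three lemmas are the polynomial inequalities that make two linear inequalities for \<open>M 0\<close> contradictory, on the three
parts of \<open>[0,1]\<close> that have to be excluded for \<open>\<kappa>\<close>.\<close>

lemma elimination_negative_above_17_20:
  fixes k :: real
  assumes "17/20 \<le> k" "k \<le> 1"
  shows "(6107/800 - (373/20) * k + (82499/2000) * k^2 - (373/5) * k^3 + (12383/160) * k^4 - (3969/100) * k^5 + (79233/10000) * k^6) * (9689/3000 - (1827/1600) * k + (45927/200000) * k^2) - (- 9709/1600 + (137601/8000) * k - (6489/200) * k^2 + (6689/200) * k^3 - (5481/320) * k^4 + (137781/40000) * k^5) * (- 373/75 + (12383/2400) * k - (1323/500) * k^2 + (26411/50000) * k^3) < 0"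
proof -
  define x y where "x = k - 17/20" and "y = 1 - k"
  have xy: "x \<ge> 0" "y \<ge> 0" and "x > 0 \<or> y > 0" using assms unfolding x_def y_def by auto
  have "(6107/800 - (373/20) * k + (82499/2000) * k^2 - (373/5) * k^3 + (12383/160) * k^4 - (3969/100) * k^5 + (79233/10000) * k^6) * (9689/3000 - (1827/1600) * k + (45927/200000) * k^2) - (- 9709/1600 + (137601/8000) * k - (6489/200) * k^2 + (6689/200) * k^3 - (5481/320) * k^4 + (137781/40000) * k^5) * (- 373/75 + (12383/2400) * k - (1323/500) * k^2 + (26411/50000) * k^3)
     = ((- 122094592/18225) * (x^6) + (- 428664469691/60750000) * (y^6)) + ((- 4174821031951/72900000) * (x * y^5) + (- 59657179540819/364500000) * (x^2 * y^4) + (- 4082130417523/18225000) * (x^3 * y^3) + (- 143595842111/911250) * (x^4 * y^2) + (- 4898892394/91125) * (x^5 * y))"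
    unfolding x_def y_def by algebra
  also have "\<dots> < 0"
  proof (rule add_neg_nonpos)
    show "(- 122094592/18225) * (x^6) + (- 428664469691/60750000) * (y^6) < 0"
      using \<open>x > 0 \<or> y > 0\<close>
    proof
      assume "x > 0"
      then show ?thesis using xy by (intro add_neg_nonpos mult_neg_pos mult_nonpos_nonneg) simp_all
    next
      assume "y > 0"
      then show ?thesis using xy by (intro add_nonpos_neg mult_neg_pos mult_nonpos_nonneg) simp_all
    qed
    show "(- 4174821031951/72900000) * (x * y^5) + (- 59657179540819/364500000) * (x^2 * y^4) + (- 4082130417523/18225000) * (x^3 * y^3) + (- 143595842111/911250) * (x^4 * y^2) + (- 4898892394/91125) * (x^5 * y) \<le> 0"
      by (intro add_nonpos_nonpos mult_nonpos_nonneg mult_nonneg_nonneg zero_le_power xy) simp_all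
  qed
  finally show ?thesis .
qed

lemma elimination_negative_from_1_2_to_3_4:
  fixes k :: real
  assumes "1/2 \<le> k" "k \<le> 3/4"
  shows "(478663/2560 - (6665/8) * k + (60827/40) * k^2 - (8289/5) * k^3 + (606389/256) * k^4 - (142317/40) * k^5 + (308847/100) * k^6 - (33033/25) * k^7 + (567567/2560) * k^8) * (9689/3000 - (1827/1600) * k + (45927/200000) * k^2) - (- 9709/1600 + (137601/8000) * k - (6489/200) * k^2 + (6689/200) * k^3 - (5481/320) * k^4 + (137781/40000) * k^5) * (- 200/3 + (1156267/7680) * k - (47439/200) * k^2 + (102949/500) * k^3 - (11011/125) * k^4 + (189189/12800) * k^5) < 0"
proof -
  define x y where "x = k - 1/2" and "y = 3/4 - k"
  have xy: "x \<ge> 0" "y \<ge> 0" and "x > 0 \<or> y > 0" using assms unfolding x_def y_def by auto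
  have "(478663/2560 - (6665/8) * k + (60827/40) * k^2 - (8289/5) * k^3 + (606389/256) * k^4 - (142317/40) * k^5 + (308847/100) * k^6 - (33033/25) * k^7 + (567567/2560) * k^8) * (9689/3000 - (1827/1600) * k + (45927/200000) * k^2) - (- 9709/1600 + (137601/8000) * k - (6489/200) * k^2 + (6689/200) * k^3 - (5481/320) * k^4 + (137781/40000) * k^5) * (- 200/3 + (1156267/7680) * k - (47439/200) * k^2 + (102949/500) * k^3 - (11011/125) * k^4 + (189189/12800) * k^5)
     = ((- 24599266853/3200000) * (x^8) + (- 19635501453/15625) * (y^8)) + ((- 481840386437/50000) * (x * y^7) + (- 22728421857851/750000) * (x^2 * y^6) + (- 153402802791247/3000000) * (x^3 * y^5) + (- 150994457093429/3000000) * (x^4 * y^4) + (- 348699367557689/12000000) * (x^5 * y^3) + (- 110023116959209/12000000) * (x^6 * y^2) + (- 59513585711597/48000000) * (x^7 * y))"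
    unfolding x_def y_def by algebra
  also have "\<dots> < 0"
  proof (rule add_neg_nonpos)
    show "(- 24599266853/3200000) * (x^8) + (- 19635501453/15625) * (y^8) < 0"
      using \<open>x > 0 \<or> y > 0\<close>
    proof
      assume "x > 0"
      then show ?thesis using xy by (intro add_neg_nonpos mult_neg_pos mult_nonpos_nonneg) simp_all
    next
      assume "y > 0"
      then show ?thesis using xy by (intro add_nonpos_neg mult_neg_pos mult_nonpos_nonneg) simp_all
    qed
    show "(- 481840386437/50000) * (x * y^7) + (- 22728421857851/750000) * (x^2 * y^6) + (- 153402802791247/3000000) * (x^3 * y^5) + (- 150994457093429/3000000) * (x^4 * y^4) + (- 348699367557689/12000000) * (x^5 * y^3) + (- 110023116959209/12000000) * (x^6 * y^2) + (- 59513585711597/48000000) * (x^7 * y) \<le> 0"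
      by (intro add_nonpos_nonpos mult_nonpos_nonneg mult_nonneg_nonneg zero_le_power xy) simp_all
  qed
  finally show ?thesis .
qed

lemma elimination_negative_below_1_2:
  fixes k :: real
  assumes "0 \<le> k" "k \<le> 1/2"
  shows "(1343/800 - (121/20) * k + (26801/2000) * k^2 - (74/5) * k^3 + (1267/160) * k^4 - (189/100) * k^5 + (1617/10000) * k^6) * (9689/3000 - (1827/1600) * k + (45927/200000) * k^2) - (- 9709/1600 + (137601/8000) * k - (6489/200) * k^2 + (6689/200) * k^3 - (5481/320) * k^4 + (137781/40000) * k^5) * (- 74/75 + (1267/2400) * k - (63/500) * k^2 + (539/50000) * k^3) < 0"
proof -
  define x y where "x = k" and "y = 1/2 - k"
  have xy: "x \<ge> 0" "y \<ge> 0" and "x > 0 \<or> y > 0" using assms unfolding x_def y_def by auto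
  have "(1343/800 - (121/20) * k + (26801/2000) * k^2 - (74/5) * k^3 + (1267/160) * k^4 - (189/100) * k^5 + (1617/10000) * k^6) * (9689/3000 - (1827/1600) * k + (45927/200000) * k^2) - (- 9709/1600 + (137601/8000) * k - (6489/200) * k^2 + (6689/200) * k^3 - (5481/320) * k^4 + (137781/40000) * k^5) * (- 74/75 + (1267/2400) * k - (63/500) * k^2 + (539/50000) * k^3)
     = ((- 406221727/37500000) * (x^6) + (- 452331/12500) * (y^6)) + ((- 484027/1875) * (x * y^5) + (- 47538208/78125) * (x^2 * y^4) + (- 100987399/150000) * (x^3 * y^3) + (- 28545284479/75000000) * (x^4 * y^2) + (- 2621913871/25000000) * (x^5 * y))"
    unfolding x_def y_def by algebra
  also have "\<dots> < 0"
  proof (rule add_neg_nonpos)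
    show "(- 406221727/37500000) * (x^6) + (- 452331/12500) * (y^6) < 0"
      using \<open>x > 0 \<or> y > 0\<close>
    proof
      assume "x > 0"
      then show ?thesis using xy by (intro add_neg_nonpos mult_neg_pos mult_nonpos_nonneg) simp_all
    next
      assume "y > 0"
      then show ?thesis using xy by (intro add_nonpos_neg mult_neg_pos mult_nonpos_nonneg) simp_all
    qed
    show "(- 484027/1875) * (x * y^5) + (- 47538208/78125) * (x^2 * y^4) + (- 100987399/150000) * (x^3 * y^3) + (- 28545284479/75000000) * (x^4 * y^2) + (- 2621913871/25000000) * (x^5 * y) \<le> 0"
      by (intro add_nonpos_nonpos mult_nonpos_nonneg mult_nonneg_nonneg zero_le_power xy) simp_all
  qed
  finally show ?thesis .
qed

context de_Gennes begin

text \<open>The weights in this and the following three inequalities are chosen numerically so that, combined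
in pairs, they confine \<open>\<kappa>\<close> to a short interval.\<close>

lemma moment_inequality_b: "0 \<le> (- 9709/1600 + (137601/8000) * \<kappa> - (6489/200) * \<kappa>^2 + (6689/200) * \<kappa>^3 - (5481/320) * \<kappa>^4 + (137781/40000) * \<kappa>^5) * M 0 + (9689/3000 - (1827/1600) * \<kappa> + (45927/200000) * \<kappa>^2)"
proof -
  have "poly ([:1, -23/10, 29/20, -27/100:] * [:1, -23/10, 29/20, -27/100:]) t \<ge> 0" if "t \<ge> 0" for t :: real
    unfolding poly_mult using that by (intro zero_le_square)
  then have "0 \<le> poly ([:1, -23/10, 29/20, -27/100:] * [:1, -23/10, 29/20, -27/100:]) 0 + L (pderiv ([:1, -23/10, 29/20, -27/100:] * [:1, -23/10, 29/20, -27/100:]))" by (rule decreasing_test)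
  also have "poly ([:1, -23/10, 29/20, -27/100:] * [:1, -23/10, 29/20, -27/100:]) 0 + L (pderiv ([:1, -23/10, 29/20, -27/100:] * [:1, -23/10, 29/20, -27/100:])) = 1 + (-23/5) * M 0 + (819/50) * M 1 + (-2163/100) * M 2 + (6689/500) * M 3 + (-783/200) * M 4 + (2187/5000) * M 5"
    by (simp add: pderiv_pCons numeral_2_eq_2[symmetric])
  also have "\<dots> = (- 9709/1600 + (137601/8000) * \<kappa> - (6489/200) * \<kappa>^2 + (6689/200) * \<kappa>^3 - (5481/320) * \<kappa>^4 + (137781/40000) * \<kappa>^5) * M 0 + (9689/3000 - (1827/1600) * \<kappa> + (45927/200000) * \<kappa>^2)"
    unfolding moments by algebra
  finally show ?thesis .
qed

lemma moment_inequality_e: "0 \<le> (6107/800 - (373/20) * \<kappa> + (82499/2000) * \<kappa>^2 - (373/5) * \<kappa>^3 + (12383/160) * \<kappa>^4 - (3969/100) * \<kappa>^5 + (79233/10000) * \<kappa>^6) * M 0 + (- 373/75 + (12383/2400) * \<kappa> - (1323/500) * \<kappa>^2 + (26411/50000) * \<kappa>^3)"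
proof -
  have "poly ([:0, 1:] * ([:1, -23/10, 3/2, -7/25:] * [:1, -23/10, 3/2, -7/25:])) t \<ge> 0" if "t \<ge> 0" for t :: real
    unfolding poly_mult using that by (intro mult_nonneg_nonneg[OF _ zero_le_square] zero_le_square) simp
  then have "0 \<le> poly ([:0, 1:] * ([:1, -23/10, 3/2, -7/25:] * [:1, -23/10, 3/2, -7/25:])) 0 + L (pderiv ([:0, 1:] * ([:1, -23/10, 3/2, -7/25:] * [:1, -23/10, 3/2, -7/25:])))" by (rule decreasing_test)
  also have "poly ([:0, 1:] * ([:1, -23/10, 3/2, -7/25:] * [:1, -23/10, 3/2, -7/25:])) 0 + L (pderiv ([:0, 1:] * ([:1, -23/10, 3/2, -7/25:] * [:1, -23/10, 3/2, -7/25:]))) = 0 + (1) * M 0 + (-46/5) * M 1 + (2487/100) * M 2 + (-746/25) * M 3 + (1769/100) * M 4 + (-126/25) * M 5 + (343/625) * M 6"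
    by (simp add: pderiv_pCons numeral_2_eq_2[symmetric])
  also have "\<dots> = (6107/800 - (373/20) * \<kappa> + (82499/2000) * \<kappa>^2 - (373/5) * \<kappa>^3 + (12383/160) * \<kappa>^4 - (3969/100) * \<kappa>^5 + (79233/10000) * \<kappa>^6) * M 0 + (- 373/75 + (12383/2400) * \<kappa> - (1323/500) * \<kappa>^2 + (26411/50000) * \<kappa>^3)"
    unfolding moments by algebra
  finally show ?thesis .
qed

lemma moment_inequality_f: "0 \<le> (478663/2560 - (6665/8) * \<kappa> + (60827/40) * \<kappa>^2 - (8289/5) * \<kappa>^3 + (606389/256) * \<kappa>^4 - (142317/40) * \<kappa>^5 + (308847/100) * \<kappa>^6 - (33033/25) * \<kappa>^7 + (567567/2560) * \<kappa>^8) * M 0 + (- 200/3 + (1156267/7680) * \<kappa> - (47439/200) * \<kappa>^2 + (102949/500) * \<kappa>^3 - (11011/125) * \<kappa>^4 + (189189/12800) * \<kappa>^5)"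
proof -
  have "poly ([:0, 1:] * ([:1, 7/2, -8, 22/5, -7/10:] * [:1, 7/2, -8, 22/5, -7/10:])) t \<ge> 0" if "t \<ge> 0" for t :: real
    unfolding poly_mult using that by (intro mult_nonneg_nonneg[OF _ zero_le_square] zero_le_square) simp
  then have "0 \<le> poly ([:0, 1:] * ([:1, 7/2, -8, 22/5, -7/10:] * [:1, 7/2, -8, 22/5, -7/10:])) 0 + L (pderiv ([:0, 1:] * ([:1, 7/2, -8, 22/5, -7/10:] * [:1, 7/2, -8, 22/5, -7/10:])))" by (rule decreasing_test)
  also have "poly ([:0, 1:] * ([:1, 7/2, -8, 22/5, -7/10:] * [:1, 7/2, -8, 22/5, -7/10:])) 0 + L (pderiv ([:0, 1:] * ([:1, 7/2, -8, 22/5, -7/10:] * [:1, 7/2, -8, 22/5, -7/10:]))) = 0 + (1) * M 0 + (14) * M 1 + (-45/4) * M 2 + (-944/5) * M 3 + (467) * M 4 + (-2259/5) * M 5 + (5348/25) * M 6 + (-1232/25) * M 7 + (441/100) * M 8"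
    by (simp add: pderiv_pCons numeral_2_eq_2[symmetric])
  also have "\<dots> = (478663/2560 - (6665/8) * \<kappa> + (60827/40) * \<kappa>^2 - (8289/5) * \<kappa>^3 + (606389/256) * \<kappa>^4 - (142317/40) * \<kappa>^5 + (308847/100) * \<kappa>^6 - (33033/25) * \<kappa>^7 + (567567/2560) * \<kappa>^8) * M 0 + (- 200/3 + (1156267/7680) * \<kappa> - (47439/200) * \<kappa>^2 + (102949/500) * \<kappa>^3 - (11011/125) * \<kappa>^4 + (189189/12800) * \<kappa>^5)"
    unfolding moments by algebra
  finally show ?thesis .
qed

lemma moment_inequality_h: "0 \<le> (1343/800 - (121/20) * \<kappa> + (26801/2000) * \<kappa>^2 - (74/5) * \<kappa>^3 + (1267/160) * \<kappa>^4 - (189/100) * \<kappa>^5 + (1617/10000) * \<kappa>^6) * M 0 + (- 74/75 + (1267/2400) * \<kappa> - (63/500) * \<kappa>^2 + (539/50000) * \<kappa>^3)"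
proof -
  have "poly ([:0, 1:] * ([:1, -7/5, 1/2, -1/25:] * [:1, -7/5, 1/2, -1/25:])) t \<ge> 0" if "t \<ge> 0" for t :: real
    unfolding poly_mult using that by (intro mult_nonneg_nonneg[OF _ zero_le_square] zero_le_square) simp
  then have "0 \<le> poly ([:0, 1:] * ([:1, -7/5, 1/2, -1/25:] * [:1, -7/5, 1/2, -1/25:])) 0 + L (pderiv ([:0, 1:] * ([:1, -7/5, 1/2, -1/25:] * [:1, -7/5, 1/2, -1/25:])))" by (rule decreasing_test)
  also have "poly ([:0, 1:] * ([:1, -7/5, 1/2, -1/25:] * [:1, -7/5, 1/2, -1/25:])) 0 + L (pderiv ([:0, 1:] * ([:1, -7/5, 1/2, -1/25:] * [:1, -7/5, 1/2, -1/25:]))) = 0 + (1) * M 0 + (-28/5) * M 1 + (222/25) * M 2 + (-148/25) * M 3 + (181/100) * M 4 + (-6/25) * M 5 + (7/625) * M 6"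
    by (simp add: pderiv_pCons numeral_2_eq_2[symmetric])
  also have "\<dots> = (1343/800 - (121/20) * \<kappa> + (26801/2000) * \<kappa>^2 - (74/5) * \<kappa>^3 + (1267/160) * \<kappa>^4 - (189/100) * \<kappa>^5 + (1617/10000) * \<kappa>^6) * M 0 + (- 74/75 + (1267/2400) * \<kappa> - (63/500) * \<kappa>^2 + (539/50000) * \<kappa>^3)"
    unfolding moments by algebra
  finally show ?thesis .
qed

end

lemma constant_term_f_negative:
  fixes k :: real
  assumes "1/2 \<le> k" "k \<le> 3/4"
  shows "- 200/3 + (1156267/7680) * k - (47439/200) * k^2 + (102949/500) * k^3 - (11011/125) * k^4 + (189189/12800) * k^5 < 0"
proof -
  define x y where "x = k - 1/2" and "y = 3/4 - k"
  have xy: "x \<ge> 0" "y \<ge> 0" and "x > 0 \<or> y > 0" using assms unfolding x_def y_def by auto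
  have "- 200/3 + (1156267/7680) * k - (47439/200) * k^2 + (102949/500) * k^3 - (11011/125) * k^4 + (189189/12800) * k^5
     = ((- 4850923727/192000) * (x^5) + (- 61427671/2000) * (y^5)) + ((- 1755711371/12000) * (x * y^4) + (- 3369444689/12000) * (x^2 * y^3) + (- 2164616593/8000) * (x^3 * y^2) + (- 2508777029/19200) * (x^4 * y))"
    unfolding x_def y_def by algebra
  also have "\<dots> < 0"
  proof (rule add_neg_nonpos)
    show "(- 4850923727/192000) * (x^5) + (- 61427671/2000) * (y^5) < 0"
      using \<open>x > 0 \<or> y > 0\<close>
    proof
      assume "x > 0"
      then show ?thesis using xy by (intro add_neg_nonpos mult_neg_pos mult_nonpos_nonneg) simp_all
    next
      assume "y > 0"
      then show ?thesis using xy by (intro add_nonpos_neg mult_neg_pos mult_nonpos_nonneg) simp_all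
    qed
    show "(- 1755711371/12000) * (x * y^4) + (- 3369444689/12000) * (x^2 * y^3) + (- 2164616593/8000) * (x^3 * y^2) + (- 2508777029/19200) * (x^4 * y) \<le> 0"
      by (intro add_nonpos_nonpos mult_nonpos_nonneg mult_nonneg_nonneg zero_le_power xy) simp_all
  qed
  finally show ?thesis .
qed

lemma combination_b_negative:
  fixes k :: real
  assumes "3/4 \<le> k" "k \<le> 17/20"
  shows "(- 9709/1600 + (137601/8000) * k - (6489/200) * k^2 + (6689/200) * k^3 - (5481/320) * k^4 + (137781/40000) * k^5) + 29/40 * (9689/3000 - (1827/1600) * k + (45927/200000) * k^2) < 0"
proof -
  define x y where "x = k - 3/4" and "y = 17/20 - k"
  have xy: "x \<ge> 0" "y \<ge> 0" and "x > 0 \<or> y > 0" using assms unfolding x_def y_def by auto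
  have "(- 9709/1600 + (137601/8000) * k - (6489/200) * k^2 + (6689/200) * k^3 - (5481/320) * k^4 + (137781/40000) * k^5) + 29/40 * (9689/3000 - (1827/1600) * k + (45927/200000) * k^2)
     = ((- 1782273109/3840000) * (x^5) + (- 296498447/30720) * (y^5)) + ((- 5970823121/153600) * (x * y^4) + (- 22762314451/384000) * (x^2 * y^3) + (- 15731757013/384000) * (x^3 * y^2) + (- 8739639571/768000) * (x^4 * y))"
    unfolding x_def y_def by algebra
  also have "\<dots> < 0"
  proof (rule add_neg_nonpos)
    show "(- 1782273109/3840000) * (x^5) + (- 296498447/30720) * (y^5) < 0"
      using \<open>x > 0 \<or> y > 0\<close>
    proof
      assume "x > 0"
      then show ?thesis using xy by (intro add_neg_nonpos mult_neg_pos mult_nonpos_nonneg) simp_all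
    next
      assume "y > 0"
      then show ?thesis using xy by (intro add_nonpos_neg mult_neg_pos mult_nonpos_nonneg) simp_all
    qed
    show "(- 5970823121/153600) * (x * y^4) + (- 22762314451/384000) * (x^2 * y^3) + (- 15731757013/384000) * (x^3 * y^2) + (- 8739639571/768000) * (x^4 * y) \<le> 0"
      by (intro add_nonpos_nonpos mult_nonpos_nonneg mult_nonneg_nonneg zero_le_power xy) simp_all
  qed
  finally show ?thesis .
qed

text \<open>Elimination of \<open>m\<close> from two linear inequalities whose constant terms have opposite signs.\<close>

lemma eliminate_unknown:
  fixes a b c d m :: real
  assumes "0 \<le> a * m + b" "0 \<le> c * m + d" "0 \<le> b" "d \<le> 0" "0 < m"
  shows "0 \<le> c * b - a * d"
proof -
  have "0 \<le> (a * m + b) * (- d) + (c * m + d) * b" using mult_nonneg_nonneg[OF assms(1), of "- d"] mult_nonneg_nonneg[OF assms(2,3)] assms(4) by simp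
  also have "\<dots> = m * (c * b - a * d)" by algebra
  finally show ?thesis using assms(5) by (simp add: zero_le_mult_iff)
qed

lemma bound_unknown:
  fixes a b m r :: real
  assumes "0 \<le> a * m + b" "0 \<le> b" "a + r * b < 0" "0 < m"
  shows "r * m \<le> 1"
proof (rule ccontr)
  assume "\<not> r * m \<le> 1"
  then have "b * 1 \<le> b * (r * m)" using assms(2) by (intro mult_left_mono) auto
  then have "0 \<le> (a + r * b) * m" using assms(1) by (simp add: algebra_simps)
  then show False using assms(3,4) by (simp add: zero_le_mult_iff)
qed

context de_Gennes begin

lemma kappa_not_above_17_20:
  assumes "17/20 \<le> \<kappa>" "\<kappa> \<le> 1"
  shows False
proof -
  let ?Bb = "9689/3000 - (1827/1600) * \<kappa> + (45927/200000) * \<kappa>^2" and ?By = "- 373/75 + (12383/2400) * \<kappa> - (1323/500) * \<kappa>^2 + (26411/50000) * \<kappa>^3"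
  have Bb: "?Bb \<ge> 0" using kappa_less_1 zero_le_power2[of \<kappa>] by linarith
  have "(17/20)^2 \<le> \<kappa>^2" "\<kappa>^3 \<le> 1^3" using assms by (intro power_mono; simp)+
  then have By: "?By \<le> 0" using assms by (simp add: power2_eq_square)
  show False
    using leD[OF eliminate_unknown[OF moment_inequality_b moment_inequality_e Bb By M_0_pos]] elimination_negative_above_17_20[OF assms] by (rule notE)
qed

lemma kappa_not_from_1_2_to_3_4:
  assumes "1/2 \<le> \<kappa>" "\<kappa> \<le> 3/4"
  shows False
proof -
  let ?Bb = "9689/3000 - (1827/1600) * \<kappa> + (45927/200000) * \<kappa>^2" and ?By = "- 200/3 + (1156267/7680) * \<kappa> - (47439/200) * \<kappa>^2 + (102949/500) * \<kappa>^3 - (11011/125) * \<kappa>^4 + (189189/12800) * \<kappa>^5"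
  have Bb: "?Bb \<ge> 0" using kappa_less_1 zero_le_power2[of \<kappa>] by linarith
  have By: "?By \<le> 0" using constant_term_f_negative[OF assms] by simp
  show False
    using leD[OF eliminate_unknown[OF moment_inequality_b moment_inequality_f Bb By M_0_pos]] elimination_negative_from_1_2_to_3_4[OF assms] by (rule notE)
qed

lemma kappa_not_below_1_2:
  assumes "0 \<le> \<kappa>" "\<kappa> \<le> 1/2"
  shows False
proof -
  let ?Bb = "9689/3000 - (1827/1600) * \<kappa> + (45927/200000) * \<kappa>^2" and ?By = "- 74/75 + (1267/2400) * \<kappa> - (63/500) * \<kappa>^2 + (539/50000) * \<kappa>^3"
  have Bb: "?Bb \<ge> 0" using kappa_less_1 zero_le_power2[of \<kappa>] by linarith
  have "\<kappa>^3 \<le> (1/2)^3" using assms by (intro power_mono) auto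
  then have "\<kappa>^3 \<le> 1/8" by (simp add: power_divide)
  then have By: "?By \<le> 0" using assms zero_le_power2[of \<kappa>] by linarith
  show False
    using leD[OF eliminate_unknown[OF moment_inequality_b moment_inequality_h Bb By M_0_pos]] elimination_negative_below_1_2[OF assms] by (rule notE)
qed

lemma kappa_bounds: "3/4 < \<kappa>" "\<kappa> < 17/20"
  using kappa_not_below_1_2 kappa_not_from_1_2_to_3_4 kappa_not_above_17_20 kappa_less_1 kappa_pos by fastforce+

text \<open>One of the inequalities that confine \<open>\<kappa>\<close>, read as a bound on \<open>M 0\<close> once \<open>\<kappa>\<close> is known to be in \<open>[3/4, 17/20]\<close>.\<close>

lemma M_0_le: "29/40 * M 0 \<le> 1"
proof -
  have Bb: "9689/3000 - (1827/1600) * \<kappa> + (45927/200000) * \<kappa>^2 \<ge> 0" using kappa_less_1 zero_le_power2[of \<kappa>] by linarith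
  show ?thesis
    by (rule bound_unknown[OF moment_inequality_b Bb combination_b_negative M_0_pos]) (use kappa_bounds in auto)
qed

end

context de_Gennes begin

text \<open>The factors \<open>4/5\<close> and \<open>9/10\<close> approximate the first order perturbation of the de Gennes function by the curvature of the boundary;
they are chosen so that the energy stays negative up to \<open>\<epsilon> = 17/40\<close>.\<close>

definition trial :: "real \<Rightarrow> real \<Rightarrow> real" where
  "trial \<epsilon> t = (1 + 4/5 * \<epsilon> * t) * f t + 9/10 * \<epsilon> * t * f' t"

definition trial' :: "real \<Rightarrow> real \<Rightarrow> real" where
  "trial' \<epsilon> t = (4/5 * \<epsilon> + 9/10 * \<epsilon> * t * (t\<^sup>2 - 2*\<kappa>*t)) * f t + (1 + 4/5 * \<epsilon> * t + 9/10 * \<epsilon>) * f' t"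

lemma trial_deriv: "(trial \<epsilon> has_real_derivative trial' \<epsilon> t) (at t)"
  unfolding trial_def trial'_def
  by (rule derivative_eq_intros f_deriv f'_deriv refl)+ (simp add: field_simps)

text \<open>The density of the radial energy minus \<open>\<kappa>\<^sup>2 b\<close> times the norm, for the profile \<open>trial \<epsilon> t\<close> at \<open>x = 1 - \<epsilon> t\<close>, up to a constant
factor; \<open>s\<close> is the position of the centre of the oscillator seen by the chosen angular momentum.\<close>

definition energy_density :: "real \<Rightarrow> real \<Rightarrow> real \<Rightarrow> real" where
  "energy_density \<epsilon> s t = ((1 - \<epsilon>*t) * trial' \<epsilon> t - \<epsilon>/2 * trial \<epsilon> t)\<^sup>2
     + (t - s)\<^sup>2 * (trial \<epsilon> t)\<^sup>2 - \<kappa>\<^sup>2 * (1 - \<epsilon>*t) * (trial \<epsilon> t)\<^sup>2"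

text \<open>A certificate form of \<open>quadratic_form_integral\<close>: the polynomials \<open>A\<close> and \<open>B\<close> are the coefficients of the total derivative of \<open>A f\<^sup>2 + B f f'\<close>.\<close>

lemma integral_by_reduction:
  fixes A A' B B' R :: "real poly"
  assumes "pderiv A = A'" "pderiv B = B'"
    and "\<And>t. h t = poly R t * (f t)\<^sup>2 + poly A' t * (f t)\<^sup>2 + (2 * poly A t + poly B' t) * (f t * f' t)
        + poly B t * ((f' t)\<^sup>2 + (t\<^sup>2 - 2*\<kappa>*t) * (f t)\<^sup>2)"
  shows "improper_integral h (L R - poly A 0)"
proof -
  define H where "H = (\<lambda>t. poly A t * (f t * f t) + poly B t * (f t * f' t))"
  have "improper_integral (\<lambda>t. poly A' t * (f t)\<^sup>2 + (2 * poly A t + poly B' t) * (f t * f' t)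
        + poly B t * ((f' t)\<^sup>2 + (t\<^sup>2 - 2*\<kappa>*t) * (f t)\<^sup>2)) (- H 0)"
  proof (rule improper_integral_FTC)
    show "(H has_real_derivative poly A' t * (f t)\<^sup>2 + (2 * poly A t + poly B' t) * (f t * f' t)
        + poly B t * ((f' t)\<^sup>2 + (t\<^sup>2 - 2*\<kappa>*t) * (f t)\<^sup>2)) (at t)" for t
      unfolding H_def assms(1,2)[symmetric]
      by (rule derivative_eq_intros poly_deriv f_deriv f'_deriv refl)+ (simp add: algebra_simps power2_eq_square)
    show "(H \<longlongrightarrow> 0) at_top"
      unfolding H_def using tendsto_add[OF product_tendsto_0[OF f_bound f_bound, of A] product_tendsto_0[OF f_bound f'_bound, of B]] by simp
  qed
  from improper_integral_add[OF L[of R] this] show ?thesis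
    using f_0 f'_0 unfolding assms(3) H_def by (simp add: add.assoc)
qed

lemma energy_density_integral:
  "improper_integral (energy_density \<epsilon> (\<kappa> + h * \<epsilon>)) (\<epsilon> * (((123/200) * \<epsilon> + 1 * \<epsilon> * h^2 + (369/400) * \<epsilon>^2 - (9/10) * \<epsilon>^2 * h^2 + (2187/2560) * \<epsilon>^3 + (81/160) * \<epsilon>^3 * h^2 + (9/5) * \<kappa> * \<epsilon> * h - (3/25) * \<kappa> * \<epsilon>^2 - (81/40) * \<kappa> * \<epsilon>^2 * h + (8/5) * \<kappa> * \<epsilon>^2 * h^2 - (54/25) * \<kappa> * \<epsilon>^3 - (36/25) * \<kappa> * \<epsilon>^3 * h^2 + (243/100) * \<kappa>^2 * \<epsilon> - (8/5) * \<kappa>^2 * \<epsilon> * h + (18/5) * \<kappa>^2 * \<epsilon>^2 * h + (7/5) * \<kappa>^2 * \<epsilon>^3 + (24/25) * \<kappa>^2 * \<epsilon>^3 * h^2 - (81/25) * \<kappa>^3 * \<epsilon> - (891/400) * \<kappa>^3 * \<epsilon>^2 - (32/25) * \<kappa>^3 * \<epsilon>^2 * h + (41/40) * \<kappa>^4 * \<epsilon> - (441/400) * \<kappa>^4 * \<epsilon>^2 + (5103/1280) * \<kappa>^4 * \<epsilon>^3 + (81/160) * \<kappa>^4 * \<epsilon>^3 * h^2 + (47/25) * \<kappa>^5 * \<epsilon>^2 - (81/200) * \<kappa>^5 * \<epsilon>^2 * h - (63/25) * \<kappa>^5 * \<epsilon>^3 + (21/25) * \<kappa>^6 * \<epsilon>^3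 - (81/400) * \<kappa>^7 * \<epsilon>^2 + (8019/12800) * \<kappa>^8 * \<epsilon>^3) * M 0
     + (- (1/6) - (24/25) * \<epsilon> - (108/175) * \<epsilon>^2 - (16/75) * \<epsilon>^2 * h - (11/120) * \<kappa> * \<epsilon> + (57/400) * \<kappa> * \<epsilon>^2 + (21951/89600) * \<kappa> * \<epsilon>^3 + (27/800) * \<kappa> * \<epsilon>^3 * h^2 + (47/375) * \<kappa>^2 * \<epsilon>^2 - (27/1000) * \<kappa>^2 * \<epsilon>^2 * h - (21/125) * \<kappa>^2 * \<epsilon>^3 + (7/125) * \<kappa>^3 * \<epsilon>^3 - (27/2000) * \<kappa>^4 * \<epsilon>^2 + (2673/64000) * \<kappa>^5 * \<epsilon>^3)))"
proof -
  define A :: "real poly" where "A = [:(1/2) * \<epsilon> + (9/5) * \<epsilon>^2 + (243/200) * \<epsilon>^3,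
      (3/10) * \<epsilon>^2 - (117/200) * \<epsilon>^3 + (9/10) * \<epsilon>^3 * h^2 - (729/400) * \<epsilon>^4 - (81/100) * \<epsilon>^4 * h^2 + (9/5) * \<kappa> * \<epsilon>^2 * h - (81/50) * \<kappa> * \<epsilon>^3 * h,
      - (9/5) * \<epsilon>^2 * h - (12/25) * \<epsilon>^3 + (243/100) * \<epsilon>^3 * h - (81/50) * \<epsilon>^4 + (18/25) * \<epsilon>^4 * h^2 - (18/5) * \<kappa> * \<epsilon> + (81/100) * \<kappa> * \<epsilon>^2 + (36/25) * \<kappa> * \<epsilon>^3 * h + (9/10) * \<kappa>^2 * \<epsilon>^2 - (243/200) * \<kappa>^2 * \<epsilon>^3,
      (9/5) * \<epsilon> - (81/100) * \<epsilon>^2 - (36/25) * \<epsilon>^3 * h - (8/25) * \<epsilon>^4 + (18/25) * \<kappa> * \<epsilon>^2 + (81/20) * \<kappa> * \<epsilon>^3 + (18/25) * \<kappa>^2 * \<epsilon>^3,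
      - (9/25) * \<epsilon>^2 - (81/40) * \<epsilon>^3 + (27/25) * \<kappa> * \<epsilon>^3 - (243/100) * \<kappa> * \<epsilon>^4,
      - (27/50) * \<epsilon>^3 + (243/200) * \<epsilon>^4 - (36/25) * \<kappa> * \<epsilon>^4,
      (18/25) * \<epsilon>^4:]"
  define B :: "real poly" where "B = [:1 + (9/5) * \<epsilon> + (81/100) * \<epsilon>^2,
      - (2/5) * \<epsilon> - (153/50) * \<epsilon>^2 - (243/100) * \<epsilon>^3,
      - (39/25) * \<epsilon>^2 - (9/10) * \<epsilon>^3 + (729/400) * \<epsilon>^4 + (81/100) * \<epsilon>^4 * h^2 + (81/50) * \<kappa> * \<epsilon>^3 * h,
      (8/25) * \<epsilon>^3 - (81/50) * \<epsilon>^3 * h + (54/25) * \<epsilon>^4 - (81/50) * \<kappa> * \<epsilon>^2 + (81/100) * \<kappa>^2 * \<epsilon>^3,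
      (81/100) * \<epsilon>^2 + (16/25) * \<epsilon>^4:]"
  define R :: "real poly" where "R = [:- (21/100) * \<epsilon>^2 + 1 * \<epsilon>^2 * h^2 + (117/200) * \<epsilon>^3 - (9/10) * \<epsilon>^3 * h^2 + (729/400) * \<epsilon>^4 + (81/100) * \<epsilon>^4 * h^2 + 2 * \<kappa> * \<epsilon> * h - (9/5) * \<kappa> * \<epsilon>^2 * h + (81/50) * \<kappa> * \<epsilon>^3 * h,
      - 2 * \<epsilon> * h + (18/5) * \<epsilon>^2 * h + (6/25) * \<epsilon>^3 - (243/50) * \<epsilon>^3 * h + (8/5) * \<epsilon>^3 * h^2 + (81/25) * \<epsilon>^4 - (36/25) * \<epsilon>^4 * h^2 + (54/5) * \<kappa> * \<epsilon> + (16/5) * \<kappa> * \<epsilon>^2 * h - (72/25) * \<kappa> * \<epsilon>^3 * h + 1 * \<kappa>^2 * \<epsilon> - (9/5) * \<kappa>^2 * \<epsilon>^2 + (243/100) * \<kappa>^2 * \<epsilon>^3,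
      - (36/5) * \<epsilon> + (81/50) * \<epsilon>^2 - (16/5) * \<epsilon>^2 * h + (108/25) * \<epsilon>^3 * h + (12/5) * \<epsilon>^4 + (16/25) * \<epsilon>^4 * h^2 - 4 * \<kappa> * \<epsilon> - (234/25) * \<kappa> * \<epsilon>^2 - (1701/100) * \<kappa> * \<epsilon>^3 + (32/25) * \<kappa> * \<epsilon>^3 * h + (8/5) * \<kappa>^2 * \<epsilon>^2 - (54/25) * \<kappa>^2 * \<epsilon>^3,
      2 * \<epsilon> + (126/25) * \<epsilon>^2 + (1053/100) * \<epsilon>^3 - (32/25) * \<epsilon>^3 * h - (22/5) * \<kappa> * \<epsilon>^2 - (18/25) * \<kappa> * \<epsilon>^3 + (2673/200) * \<kappa> * \<epsilon>^4 + (81/50) * \<kappa> * \<epsilon>^4 * h^2 + (16/25) * \<kappa>^2 * \<epsilon>^3 + (81/25) * \<kappa>^2 * \<epsilon>^3 * h,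
      (11/5) * \<epsilon>^2 + (9/10) * \<epsilon>^3 - (3159/400) * \<epsilon>^4 - (81/100) * \<epsilon>^4 * h^2 + (16/25) * \<kappa> * \<epsilon>^3 - (243/50) * \<kappa> * \<epsilon>^3 * h + (36/5) * \<kappa> * \<epsilon>^4 + (81/50) * \<kappa>^3 * \<epsilon>^3,
      - (8/25) * \<epsilon>^3 + (81/50) * \<epsilon>^3 * h - (108/25) * \<epsilon>^4 + (32/25) * \<kappa> * \<epsilon>^4 - (729/100) * \<kappa>^2 * \<epsilon>^3,
      - (16/25) * \<epsilon>^4 + (162/25) * \<kappa> * \<epsilon>^3 + (81/25) * \<kappa>^2 * \<epsilon>^4,
      - (81/50) * \<epsilon>^3 - (81/25) * \<kappa> * \<epsilon>^4,
      (81/100) * \<epsilon>^4:]"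
  have A': "pderiv A = pderiv A" and B': "pderiv B = pderiv B" by simp_all
  have pA: "pderiv [:a0, a1, a2, a3, a4, a5, a6:] = [:a1, 2 * a2, 3 * a3, 4 * a4, 5 * a5, 6 * a6:]" and pB: "pderiv [:a0, a1, a2, a3, a4:] = [:a1, 2 * a2, 3 * a3, 4 * a4:]" for a0 a1 a2 a3 a4 a5 a6 :: real
    by (simp_all add: pderiv_pCons)
  have "improper_integral (energy_density \<epsilon> (\<kappa> + h * \<epsilon>)) (L R - poly A 0)"
  proof (rule integral_by_reduction[OF A' B'])
    fix t
    show "energy_density \<epsilon> (\<kappa> + h * \<epsilon>) t = poly R t * (f t)\<^sup>2 + poly (pderiv A) t * (f t)\<^sup>2 + (2 * poly A t + poly (pderiv B) t) * (f t * f' t)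
        + poly B t * ((f' t)\<^sup>2 + (t\<^sup>2 - 2*\<kappa>*t) * (f t)\<^sup>2)"
      unfolding energy_density_def trial_def trial'_def A_def B_def R_def pA pB poly_pCons poly_0
      by algebra
  qed
  moreover have "L R - poly A 0 = \<epsilon> * (((123/200) * \<epsilon> + 1 * \<epsilon> * h^2 + (369/400) * \<epsilon>^2 - (9/10) * \<epsilon>^2 * h^2 + (2187/2560) * \<epsilon>^3 + (81/160) * \<epsilon>^3 * h^2 + (9/5) * \<kappa> * \<epsilon> * h - (3/25) * \<kappa> * \<epsilon>^2 - (81/40) * \<kappa> * \<epsilon>^2 * h + (8/5) * \<kappa> * \<epsilon>^2 * h^2 - (54/25) * \<kappa> * \<epsilon>^3 - (36/25) * \<kappa> * \<epsilon>^3 * h^2 + (243/100) * \<kappa>^2 * \<epsilon> - (8/5) * \<kappa>^2 * \<epsilon> * h + (18/5) * \<kappa>^2 * \<epsilon>^2 * h + (7/5) * \<kappa>^2 * \<epsilon>^3 + (24/25) * \<kappa>^2 * \<epsilon>^3 * h^2 - (81/25) * \<kappa>^3 * \<epsilon> - (891/400) * \<kappa>^3 * \<epsilon>^2 - (32/25) * \<kappa>^3 * \<epsilon>^2 * h + (41/40) * \<kappa>^4 * \<epsilon> - (441/400) * \<kappa>^4 * \<epsilon>^2 + (5103/1280) * \<kappa>^4 * \<epsilon>^3 + (81/160) * \<kappa>^4 * \<epsilon>^3 * h^2 + (47/25) * \<kappa>^5 * \<epsilon>^2 - (81/200) * \<kappa>^5 * \<epsilon>^2 * h - (63/25) * \<kappa>^5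 * \<epsilon>^3 + (21/25) * \<kappa>^6 * \<epsilon>^3 - (81/400) * \<kappa>^7 * \<epsilon>^2 + (8019/12800) * \<kappa>^8 * \<epsilon>^3) * M 0
     + (- (1/6) - (24/25) * \<epsilon> - (108/175) * \<epsilon>^2 - (16/75) * \<epsilon>^2 * h - (11/120) * \<kappa> * \<epsilon> + (57/400) * \<kappa> * \<epsilon>^2 + (21951/89600) * \<kappa> * \<epsilon>^3 + (27/800) * \<kappa> * \<epsilon>^3 * h^2 + (47/375) * \<kappa>^2 * \<epsilon>^2 - (27/1000) * \<kappa>^2 * \<epsilon>^2 * h - (21/125) * \<kappa>^2 * \<epsilon>^3 + (7/125) * \<kappa>^3 * \<epsilon>^3 - (27/2000) * \<kappa>^4 * \<epsilon>^2 + (2673/64000) * \<kappa>^5 * \<epsilon>^3))"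
  proof -
    have LR: "L R = (- (21/100) * \<epsilon>^2 + 1 * \<epsilon>^2 * h^2 + (117/200) * \<epsilon>^3 - (9/10) * \<epsilon>^3 * h^2 + (729/400) * \<epsilon>^4 + (81/100) * \<epsilon>^4 * h^2 + 2 * \<kappa> * \<epsilon> * h - (9/5) * \<kappa> * \<epsilon>^2 * h + (81/50) * \<kappa> * \<epsilon>^3 * h) * M 0 + (- 2 * \<epsilon> * h + (18/5) * \<epsilon>^2 * h + (6/25) * \<epsilon>^3 - (243/50) * \<epsilon>^3 * h + (8/5) * \<epsilon>^3 * h^2 + (81/25) * \<epsilon>^4 - (36/25) * \<epsilon>^4 * h^2 + (54/5) * \<kappa> * \<epsilon> + (16/5) * \<kappa> * \<epsilon>^2 * h - (72/25) * \<kappa> * \<epsilon>^3 * h + 1 * \<kappa>^2 * \<epsilon> - (9/5) * \<kappa>^2 * \<epsilon>^2 + (243/100) * \<kappa>^2 * \<epsilon>^3) * M 1 + (- (36/5) * \<epsilon> + (81/50) * \<epsilon>^2 - (16/5) * \<epsilon>^2 * h + (108/25) * \<epsilon>^3 * h + (12/5) * \<epsilon>^4 + (16/25) * \<epsilon>^4 * h^2 - 4 * \<kappa> * \<epsilon> - (234/25) * \<kappa> * \<epsilon>^2 - (1701/100) * \<kappa> * \<epsilon>^3 + (32/25) * \<kappa> * \<epsilon>^3 * h + (8/5) * \<kappa>^2 * \<epsilon>^2 - (54/25) * \<kappa>^2 * \<epsilon>^3) * M 2 + (2 * \<epsilon> + (126/25) * \<epsilon>^2 + (1053/100) * \<epsilon>^3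 - (32/25) * \<epsilon>^3 * h - (22/5) * \<kappa> * \<epsilon>^2 - (18/25) * \<kappa> * \<epsilon>^3 + (2673/200) * \<kappa> * \<epsilon>^4 + (81/50) * \<kappa> * \<epsilon>^4 * h^2 + (16/25) * \<kappa>^2 * \<epsilon>^3 + (81/25) * \<kappa>^2 * \<epsilon>^3 * h) * M 3 + ((11/5) * \<epsilon>^2 + (9/10) * \<epsilon>^3 - (3159/400) * \<epsilon>^4 - (81/100) * \<epsilon>^4 * h^2 + (16/25) * \<kappa> * \<epsilon>^3 - (243/50) * \<kappa> * \<epsilon>^3 * h + (36/5) * \<kappa> * \<epsilon>^4 + (81/50) * \<kappa>^3 * \<epsilon>^3) * M 4 + (- (8/25) * \<epsilon>^3 + (81/50) * \<epsilon>^3 * h - (108/25) * \<epsilon>^4 + (32/25) * \<kappa> * \<epsilon>^4 - (729/100) * \<kappa>^2 * \<epsilon>^3) * M 5 + (- (16/25) * \<epsilon>^4 + (162/25) * \<kappa> * \<epsilon>^3 + (81/25) * \<kappa>^2 * \<epsilon>^4) * M 6 + (- (81/50) * \<epsilon>^3 - (81/25) * \<kappa> * \<epsilon>^4) * M 7 + ((81/100) * \<epsilon>^4) * M 8"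
      unfolding R_def by (simp only: moment_pCons moment_0 add_0 add_0_right add.assoc one_add_one numeral_plus_one semiring_norm)
    have A0: "poly A 0 = (1/2) * \<epsilon> + (9/5) * \<epsilon>^2 + (243/200) * \<epsilon>^3" unfolding A_def by simp
    show ?thesis unfolding LR A0 moments by algebra
  qed
  ultimately show ?thesis by simp
qed

end

text \<open>A cubic whose Bernstein coefficients are negative is negative.\<close>

lemma bernstein_cubic_negative:
  fixes u v :: real
  assumes "0 \<le> u" "0 \<le> v" "0 < u + v" "b0 < 0" "b1 < 0" "b2 < 0" "b3 < 0"
  shows "(b0 * u^3 + b3 * v^3) + (b1 * (u\<^sup>2 * v) + b2 * (u * v\<^sup>2)) < 0"
proof (rule add_neg_nonpos)
  show "b0 * u^3 + b3 * v^3 < 0"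
  proof (cases "u = 0")
    case True
    then show ?thesis using assms by (simp add: mult_neg_pos)
  next
    case False
    then show ?thesis using assms by (intro add_neg_nonpos mult_neg_pos mult_nonpos_nonneg) auto
  qed
  show "b1 * (u\<^sup>2 * v) + b2 * (u * v\<^sup>2) \<le> 0"
    using assms by (intro add_nonpos_nonpos mult_nonpos_nonneg mult_nonneg_nonneg) auto
qed

lemma cubic_negative_on_interval:
  fixes E e :: real
  assumes "0 < E" "0 \<le> e" "e \<le> E"
    and "c0 < 0" "3 * c0 + E * c1 < 0" "3 * c0 + 2 * E * c1 + E\<^sup>2 * c2 < 0"
      "c0 + E * c1 + E\<^sup>2 * c2 + E^3 * c3 < 0"
  shows "c0 + c1 * e + c2 * e\<^sup>2 + c3 * e^3 < 0"
proof -
  have "E^3 * (c0 + c1 * e + c2 * e\<^sup>2 + c3 * e^3)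
      = (c0 * (E - e)^3 + (c0 + E * c1 + E\<^sup>2 * c2 + E^3 * c3) * e^3)
        + ((3 * c0 + E * c1) * ((E - e)\<^sup>2 * e) + (3 * c0 + 2 * E * c1 + E\<^sup>2 * c2) * ((E - e) * e\<^sup>2))"
    by algebra
  also have "\<dots> < 0"
    by (rule bernstein_cubic_negative) (use assms in auto)
  finally show ?thesis using assms(1) by (simp add: mult_less_0_iff)
qed

text \<open>The Bernstein coefficients on \<open>[0, 17/40]\<close> of an upper bound for the energy at the lower end of the interval of offsets, and after them those at the upper
end, with \<open>M 0\<close> eliminated.\<close>

lemma bernstein_minus_1:
  fixes k :: real
  assumes "3/4 \<le> k" "k \<le> 17/20"
  shows "3 * (- 29/240) + 17/40 * (711/10000 - (18443/24000) * k + (1527/500) * k^2 - (81/25) * k^3 + (41/40) * k^4) < 0"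
proof -
  define x y where "x = k - 3/4" and "y = 17/20 - k"
  have xy: "x \<ge> 0" "y \<ge> 0" and "x > 0 \<or> y > 0" using assms unfolding x_def y_def by auto
  have "3 * (- 29/240) + 17/40 * (711/10000 - (18443/24000) * k + (1527/500) * k^2 - (81/25) * k^3 + (41/40) * k^4)
     = ((- 223004429/76800) * (x^4) + (- 14859219/5120) * (y^4)) + ((- 44455699/3840) * (x * y^3) + (- 222091189/12800) * (x^2 * y^2) + (- 74113277/6400) * (x^3 * y))"
    unfolding x_def y_def by algebra
  also have "\<dots> < 0"
  proof (rule add_neg_nonpos)
    show "(- 223004429/76800) * (x^4) + (- 14859219/5120) * (y^4) < 0"
      using \<open>x > 0 \<or> y > 0\<close>
    proof
      assume "x > 0"
      then show ?thesis using xy by (intro add_neg_nonpos mult_neg_pos mult_nonpos_nonneg) simp_all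
    next
      assume "y > 0"
      then show ?thesis using xy by (intro add_nonpos_neg mult_neg_pos mult_nonpos_nonneg) simp_all
    qed
    show "(- 44455699/3840) * (x * y^3) + (- 222091189/12800) * (x^2 * y^2) + (- 74113277/6400) * (x^3 * y) \<le> 0"
      by (intro add_nonpos_nonpos mult_nonpos_nonneg mult_nonneg_nonneg zero_le_power xy) simp_all
  qed
  finally show ?thesis .
qed

lemma bernstein_minus_2:
  fixes k :: real
  assumes "3/4 \<le> k" "k \<le> 17/20"
  shows "3 * (- 29/240) + 2 * (17/40) * (711/10000 - (18443/24000) * k + (1527/500) * k^2 - (81/25) * k^3 + (41/40) * k^4) + (17/40)\<^sup>2 * (278951/700000 + (406569/400000) * k - (15665989/12000000) * k^2 - (17283/10000) * k^3 - (88983/80000) * k^4 + (40759/20000) * k^5 - (81/400) * k^7) < 0"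
proof -
  define x y where "x = k - 3/4" and "y = 17/20 - k"
  have xy: "x \<ge> 0" "y \<ge> 0" and "x > 0 \<or> y > 0" using assms unfolding x_def y_def by auto
  have "3 * (- 29/240) + 2 * (17/40) * (711/10000 - (18443/24000) * k + (1527/500) * k^2 - (81/25) * k^3 + (41/40) * k^4) + (17/40)\<^sup>2 * (278951/700000 + (406569/400000) * k - (15665989/12000000) * k^2 - (17283/10000) * k^3 - (88983/80000) * k^4 + (40759/20000) * k^5 - (81/400) * k^7)
     = ((- 5256655685885461/1720320000) * (x^7) + (- 11638642966749/4587520) * (y^7)) + ((- 178862137005053/9830400) * (x * y^6) + (- 2751621255437341/49152000) * (x^2 * y^5) + (- 941527419363217/9830400) * (x^3 * y^4) + (- 1611994722969001/16384000) * (x^4 * y^3) + (- 14911885933468127/245760000) * (x^5 * y^2) + (- 5111049793871899/245760000) * (x^6 * y))"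
    unfolding x_def y_def by algebra
  also have "\<dots> < 0"
  proof (rule add_neg_nonpos)
    show "(- 5256655685885461/1720320000) * (x^7) + (- 11638642966749/4587520) * (y^7) < 0"
      using \<open>x > 0 \<or> y > 0\<close>
    proof
      assume "x > 0"
      then show ?thesis using xy by (intro add_neg_nonpos mult_neg_pos mult_nonpos_nonneg) simp_all
    next
      assume "y > 0"
      then show ?thesis using xy by (intro add_nonpos_neg mult_neg_pos mult_nonpos_nonneg) simp_all
    qed
    show "(- 178862137005053/9830400) * (x * y^6) + (- 2751621255437341/49152000) * (x^2 * y^5) + (- 941527419363217/9830400) * (x^3 * y^4) + (- 1611994722969001/16384000) * (x^4 * y^3) + (- 14911885933468127/245760000) * (x^5 * y^2) + (- 5111049793871899/245760000) * (x^6 * y) \<le> 0"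
      by (intro add_nonpos_nonpos mult_nonpos_nonneg mult_nonneg_nonneg zero_le_power xy) simp_all
  qed
  finally show ?thesis .
qed

lemma bernstein_minus_3:
  fixes k :: real
  assumes "3/4 \<le> k" "k \<le> 17/20"
  shows "(- 29/240) + 17/40 * (711/10000 - (18443/24000) * k + (1527/500) * k^2 - (81/25) * k^3 + (41/40) * k^4) + (17/40)\<^sup>2 * (278951/700000 + (406569/400000) * k - (15665989/12000000) * k^2 - (17283/10000) * k^3 - (88983/80000) * k^4 + (40759/20000) * k^5 - (81/400) * k^7) + (17/40)^3 * (372519/400000 - (1230703821/560000000) * k + (178027/125000) * k^2 + (203/5000) * k^3 + (6501951/1600000) * k^4 - (6373683/2560000) * k^5 + (21/25) * k^6 + (8019/12800) * k^8) < 0"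
proof -
  define x y where "x = k - 3/4" and "y = 17/20 - k"
  have xy: "x \<ge> 0" "y \<ge> 0" and "x > 0 \<or> y > 0" using assms unfolding x_def y_def by auto
  have "(- 29/240) + 17/40 * (711/10000 - (18443/24000) * k + (1527/500) * k^2 - (81/25) * k^3 + (41/40) * k^4) + (17/40)\<^sup>2 * (278951/700000 + (406569/400000) * k - (15665989/12000000) * k^2 - (17283/10000) * k^3 - (88983/80000) * k^4 + (40759/20000) * k^5 - (81/400) * k^7) + (17/40)^3 * (372519/400000 - (1230703821/560000000) * k + (178027/125000) * k^2 + (203/5000) * k^3 + (6501951/1600000) * k^4 - (6373683/2560000) * k^5 + (21/25) * k^6 + (8019/12800) * k^8)
     = ((- 5093620721238822713/4404019200000) * (x^8) + (- 24313014058964989/35232153600) * (y^8)) + ((- 143502025553846077/22020096000) * (x * y^7) + (- 163344374908030877/6291456000) * (x^2 * y^6) + (- 180548664492924377/3145728000) * (x^3 * y^5) + (- 4862851861228016353/62914560000) * (x^4 * y^4) + (- 1022893672005920617/15728640000) * (x^5 * y^3) + (- 1050078213149498953/31457280000) * (x^6 * y^2) + (- 1050140667260026997/110100480000) * (x^7 * y))"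
    unfolding x_def y_def by algebra
  also have "\<dots> < 0"
  proof (rule add_neg_nonpos)
    show "(- 5093620721238822713/4404019200000) * (x^8) + (- 24313014058964989/35232153600) * (y^8) < 0"
      using \<open>x > 0 \<or> y > 0\<close>
    proof
      assume "x > 0"
      then show ?thesis using xy by (intro add_neg_nonpos mult_neg_pos mult_nonpos_nonneg) simp_all
    next
      assume "y > 0"
      then show ?thesis using xy by (intro add_nonpos_neg mult_neg_pos mult_nonpos_nonneg) simp_all
    qed
    show "(- 143502025553846077/22020096000) * (x * y^7) + (- 163344374908030877/6291456000) * (x^2 * y^6) + (- 180548664492924377/3145728000) * (x^3 * y^5) + (- 4862851861228016353/62914560000) * (x^4 * y^4) + (- 1022893672005920617/15728640000) * (x^5 * y^3) + (- 1050078213149498953/31457280000) * (x^6 * y^2) + (- 1050140667260026997/110100480000) * (x^7 * y) \<le> 0"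
      by (intro add_nonpos_nonpos mult_nonpos_nonneg mult_nonneg_nonneg zero_le_power xy) simp_all
  qed
  finally show ?thesis .
qed

lemma bernstein_plus_1:
  fixes k :: real
  assumes "3/4 \<le> k" "k \<le> 17/20"
  shows "3 * (- 29/240) + 17/40 * (- 689/10000 + (3157/24000) * k + (1127/500) * k^2 - (81/25) * k^3 + (41/40) * k^4) < 0"
proof -
  define x y where "x = k - 3/4" and "y = 17/20 - k"
  have xy: "x \<ge> 0" "y \<ge> 0" and "x > 0 \<or> y > 0" using assms unfolding x_def y_def by auto
  have "3 * (- 29/240) + 17/40 * (- 689/10000 + (3157/24000) * k + (1127/500) * k^2 - (81/25) * k^3 + (41/40) * k^4)
     = ((- 207663629/76800) * (x^4) + (- 13009619/5120) * (y^4)) + ((- 39396499/3840) * (x * y^3) + (- 199678389/12800) * (x^2 * y^2) + (- 67748477/6400) * (x^3 * y))"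
    unfolding x_def y_def by algebra
  also have "\<dots> < 0"
  proof (rule add_neg_nonpos)
    show "(- 207663629/76800) * (x^4) + (- 13009619/5120) * (y^4) < 0"
      using \<open>x > 0 \<or> y > 0\<close>
    proof
      assume "x > 0"
      then show ?thesis using xy by (intro add_neg_nonpos mult_neg_pos mult_nonpos_nonneg) simp_all
    next
      assume "y > 0"
      then show ?thesis using xy by (intro add_nonpos_neg mult_neg_pos mult_nonpos_nonneg) simp_all
    qed
    show "(- 39396499/3840) * (x * y^3) + (- 199678389/12800) * (x^2 * y^2) + (- 67748477/6400) * (x^3 * y) \<le> 0"
      by (intro add_nonpos_nonpos mult_nonpos_nonneg mult_nonneg_nonneg zero_le_power xy) simp_all
  qed
  finally show ?thesis .
qed

lemma bernstein_plus_2: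
  fixes k :: real
  assumes "3/4 \<le> k" "k \<le> 17/20"
  shows "3 * (- 29/240) + 2 * (17/40) * (- 689/10000 + (3157/24000) * k + (1127/500) * k^2 - (81/25) * k^3 + (41/40) * k^4) + (17/40)\<^sup>2 * (939053/2100000 - (88031/400000) * k + (5816561/12000000) * k^2 - (23683/10000) * k^3 - (88983/80000) * k^4 + (36709/20000) * k^5 - (81/400) * k^7) < 0"
proof -
  define x y where "x = k - 3/4" and "y = 17/20 - k"
  have xy: "x \<ge> 0" "y \<ge> 0" and "x > 0 \<or> y > 0" using assms unfolding x_def y_def by auto
  have "3 * (- 29/240) + 2 * (17/40) * (- 689/10000 + (3157/24000) * k + (1127/500) * k^2 - (81/25) * k^3 + (41/40) * k^4) + (17/40)\<^sup>2 * (939053/2100000 - (88031/400000) * k + (5816561/12000000) * k^2 - (23683/10000) * k^3 - (88983/80000) * k^4 + (36709/20000) * k^5 - (81/400) * k^7)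
     = ((- 1721811966720887/573440000) * (x^7) + (- 29689850691847/13762560) * (y^7)) + ((- 155152456189453/9830400) * (x * y^6) + (- 2436076562740141/49152000) * (x^2 * y^5) + (- 851007573008417/9830400) * (x^3 * y^4) + (- 4463332605065003/49152000) * (x^4 * y^3) + (- 14054206670803727/245760000) * (x^5 * y^2) + (- 1639635020611033/81920000) * (x^6 * y))"
    unfolding x_def y_def by algebra
  also have "\<dots> < 0"
  proof (rule add_neg_nonpos)
    show "(- 1721811966720887/573440000) * (x^7) + (- 29689850691847/13762560) * (y^7) < 0"
      using \<open>x > 0 \<or> y > 0\<close>
    proof
      assume "x > 0"
      then show ?thesis using xy by (intro add_neg_nonpos mult_neg_pos mult_nonpos_nonneg) simp_all
    next
      assume "y > 0"
      then show ?thesis using xy by (intro add_nonpos_neg mult_neg_pos mult_nonpos_nonneg) simp_all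
    qed
    show "(- 155152456189453/9830400) * (x * y^6) + (- 2436076562740141/49152000) * (x^2 * y^5) + (- 851007573008417/9830400) * (x^3 * y^4) + (- 4463332605065003/49152000) * (x^4 * y^3) + (- 14054206670803727/245760000) * (x^5 * y^2) + (- 1639635020611033/81920000) * (x^6 * y) \<le> 0"
      by (intro add_nonpos_nonpos mult_nonpos_nonneg mult_nonneg_nonneg zero_le_power xy) simp_all
  qed
  finally show ?thesis .
qed

lemma bernstein_plus_3:
  fixes k :: real
  assumes "3/4 \<le> k" "k \<le> 17/20"
  shows "(- 29/240) + 17/40 * (- 689/10000 + (3157/24000) * k + (1127/500) * k^2 - (81/25) * k^3 + (41/40) * k^4) + (17/40)\<^sup>2 * (939053/2100000 - (88031/400000) * k + (5816561/12000000) * k^2 - (23683/10000) * k^3 - (88983/80000) * k^4 + (36709/20000) * k^5 - (81/400) * k^7) + (17/40)^3 * (344169/400000 - (1119726171/560000000) * k + (161227/125000) * k^2 + (203/5000) * k^3 + (6388551/1600000) * k^4 - (6373683/2560000) * k^5 + (21/25) * k^6 + (8019/12800) * k^8) < 0"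
proof -
  define x y where "x = k - 3/4" and "y = 17/20 - k"
  have xy: "x \<ge> 0" "y \<ge> 0" and "x > 0 \<or> y > 0" using assms unfolding x_def y_def by auto
  have "(- 29/240) + 17/40 * (- 689/10000 + (3157/24000) * k + (1127/500) * k^2 - (81/25) * k^3 + (41/40) * k^4) + (17/40)\<^sup>2 * (939053/2100000 - (88031/400000) * k + (5816561/12000000) * k^2 - (23683/10000) * k^3 - (88983/80000) * k^4 + (36709/20000) * k^5 - (81/400) * k^7) + (17/40)^3 * (344169/400000 - (1119726171/560000000) * k + (161227/125000) * k^2 + (203/5000) * k^3 + (6388551/1600000) * k^4 - (6373683/2560000) * k^5 + (21/25) * k^6 + (8019/12800) * k^8)
     = ((- 12790350398891558713/4404019200000) * (x^8) + (- 23283696018747389/35232153600) * (y^8)) + ((- 55527785636429759/7340032000) * (x * y^7) + (- 217545999626930077/6291456000) * (x^2 * y^6) + (- 268869174749871577/3145728000) * (x^3 * y^5) + (- 2667182262543167051/20971520000) * (x^4 * y^4) + (- 1852878661913069417/15728640000) * (x^5 * y^3) + (- 2099005436833953353/31457280000) * (x^6 * y^2) + (- 778437560628060199/36700160000) * (x^7 * y))"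
    unfolding x_def y_def by algebra
  also have "\<dots> < 0"
  proof (rule add_neg_nonpos)
    show "(- 12790350398891558713/4404019200000) * (x^8) + (- 23283696018747389/35232153600) * (y^8) < 0"
      using \<open>x > 0 \<or> y > 0\<close>
    proof
      assume "x > 0"
      then show ?thesis using xy by (intro add_neg_nonpos mult_neg_pos mult_nonpos_nonneg) simp_all
    next
      assume "y > 0"
      then show ?thesis using xy by (intro add_nonpos_neg mult_neg_pos mult_nonpos_nonneg) simp_all
    qed
    show "(- 55527785636429759/7340032000) * (x * y^7) + (- 217545999626930077/6291456000) * (x^2 * y^6) + (- 268869174749871577/3145728000) * (x^3 * y^5) + (- 2667182262543167051/20971520000) * (x^4 * y^4) + (- 1852878661913069417/15728640000) * (x^5 * y^3) + (- 2099005436833953353/31457280000) * (x^6 * y^2) + (- 778437560628060199/36700160000) * (x^7 * y) \<le> 0"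
      by (intro add_nonpos_nonpos mult_nonpos_nonneg mult_nonneg_nonneg zero_le_power xy) simp_all
  qed
  finally show ?thesis .
qed

lemma combine_unknown:
  fixes a b m r :: real
  assumes "0 < m" "r * m \<le> 1" "b \<le> 0" "a + r * b < 0"
  shows "a * m + b < 0"
proof -
  have "b * 1 \<le> b * (r * m)" using assms by (intro mult_left_mono_neg) auto
  then have "a * m + b \<le> (a + r * b) * m" by (simp add: algebra_simps)
  also have "\<dots> < 0" using assms by (intro mult_neg_pos)
  finally show ?thesis .
qed

lemma monomial_bound:
  fixes k e :: real
  assumes "0 \<le> k" "k \<le> 1" "0 \<le> e" "e^j \<le> b"
  shows "0 \<le> k^i * e^j" "k^i * e^j \<le> b"
proof -
  show "0 \<le> k^i * e^j" using assms by simp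
  have "k^i * e^j \<le> 1 * e^j" using assms by (intro mult_right_mono power_le_one) auto
  then show "k^i * e^j \<le> b" using assms by simp
qed

context de_Gennes begin

lemma trial_energy_minus:
  assumes "0 < \<epsilon>" "\<epsilon> \<le> 17/40"
  shows "((123/200) * \<epsilon> + 1 * \<epsilon> * (-39/100)^2 + (369/400) * \<epsilon>^2 - (9/10) * \<epsilon>^2 * (-39/100)^2 + (2187/2560) * \<epsilon>^3 + (81/160) * \<epsilon>^3 * (-39/100)^2 + (9/5) * \<kappa> * \<epsilon> * (-39/100) - (3/25) * \<kappa> * \<epsilon>^2 - (81/40) * \<kappa> * \<epsilon>^2 * (-39/100) + (8/5) * \<kappa> * \<epsilon>^2 * (-39/100)^2 - (54/25) * \<kappa> * \<epsilon>^3 - (36/25) * \<kappa> * \<epsilon>^3 * (-39/100)^2 + (243/100) * \<kappa>^2 * \<epsilon> - (8/5) * \<kappa>^2 * \<epsilon> * (-39/100) + (18/5) * \<kappa>^2 * \<epsilon>^2 * (-39/100) + (7/5) * \<kappa>^2 * \<epsilon>^3 + (24/25) * \<kappa>^2 * \<epsilon>^3 * (-39/100)^2 - (81/25) * \<kappa>^3 * \<epsilon> - (891/400) * \<kappa>^3 * \<epsilon>^2 - (32/25) * \<kappa>^3 * \<epsilon>^2 * (-39/100) + (41/40) * \<kappa>^4 * \<epsilon> - (441/400) * \<kappa>^4 * \<epsilon>^2 + (5103/1280) * \<kappa>^4 * \<epsilon>^3 + (81/160) * \<kappa>^4 * \<epsilon>^3 * (-39/100)^2 + (47/25) * \<kappa>^5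 * \<epsilon>^2 - (81/200) * \<kappa>^5 * \<epsilon>^2 * (-39/100) - (63/25) * \<kappa>^5 * \<epsilon>^3 + (21/25) * \<kappa>^6 * \<epsilon>^3 - (81/400) * \<kappa>^7 * \<epsilon>^2 + (8019/12800) * \<kappa>^8 * \<epsilon>^3) * M 0
     + (- (1/6) - (24/25) * \<epsilon> - (108/175) * \<epsilon>^2 - (16/75) * \<epsilon>^2 * (-39/100) - (11/120) * \<kappa> * \<epsilon> + (57/400) * \<kappa> * \<epsilon>^2 + (21951/89600) * \<kappa> * \<epsilon>^3 + (27/800) * \<kappa> * \<epsilon>^3 * (-39/100)^2 + (47/375) * \<kappa>^2 * \<epsilon>^2 - (27/1000) * \<kappa>^2 * \<epsilon>^2 * (-39/100) - (21/125) * \<kappa>^2 * \<epsilon>^3 + (7/125) * \<kappa>^3 * \<epsilon>^3 - (27/2000) * \<kappa>^4 * \<epsilon>^2 + (2673/64000) * \<kappa>^5 * \<epsilon>^3) < 0"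
proof -
  let ?A = "(7671/10000) * \<epsilon> + (78561/100000) * \<epsilon>^2 + (372519/400000) * \<epsilon>^3 - (351/500) * \<kappa> * \<epsilon> + (91311/100000) * \<kappa> * \<epsilon>^2 - (148689/62500) * \<kappa> * \<epsilon>^3 + (1527/500) * \<kappa>^2 * \<epsilon> - (351/250) * \<kappa>^2 * \<epsilon>^2 + (48313/31250) * \<kappa>^2 * \<epsilon>^3 - (81/25) * \<kappa>^3 * \<epsilon> - (17283/10000) * \<kappa>^3 * \<epsilon>^2 + (41/40) * \<kappa>^4 * \<epsilon> - (441/400) * \<kappa>^4 * \<epsilon>^2 + (6501951/1600000) * \<kappa>^4 * \<epsilon>^3 + (40759/20000) * \<kappa>^5 * \<epsilon>^2 - (63/25) * \<kappa>^5 * \<epsilon>^3 + (21/25) * \<kappa>^6 * \<epsilon>^3 - (81/400) * \<kappa>^7 * \<epsilon>^2 + (8019/12800) * \<kappa>^8 * \<epsilon>^3"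
  let ?B = "- (1/6) - (24/25) * \<epsilon> - (2336/4375) * \<epsilon>^2 - (11/120) * \<kappa> * \<epsilon> + (57/400) * \<kappa> * \<epsilon>^2 + (3501711/14000000) * \<kappa> * \<epsilon>^3 + (40759/300000) * \<kappa>^2 * \<epsilon>^2 - (21/125) * \<kappa>^2 * \<epsilon>^3 + (7/125) * \<kappa>^3 * \<epsilon>^3 - (27/2000) * \<kappa>^4 * \<epsilon>^2 + (2673/64000) * \<kappa>^5 * \<epsilon>^3"
  have e2: "\<epsilon>^2 \<le> 1/5" and e3: "\<epsilon>^3 \<le> 1/10"
    using power_mono[of \<epsilon> "17/40" 2] power_mono[of \<epsilon> "17/40" 3] assms by (simp_all add: power_divide)
  have k0: "0 \<le> \<kappa>" and k1: "\<kappa> \<le> 1" and e0: "0 \<le> \<epsilon>" and e1: "\<epsilon>^1 \<le> 17/40"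
    using kappa_bounds assms by auto
  note m = monomial_bound[OF k0 k1 e0 e1, of 0]
    monomial_bound[OF k0 k1 e0 e2, of 1]
    monomial_bound[OF k0 k1 e0 e1, of 1]
    monomial_bound[OF k0 k1 e0 e2, of 0]
    monomial_bound[OF k0 k1 e0 e2, of 2]
    monomial_bound[OF k0 k1 e0 e3, of 1]
    monomial_bound[OF k0 k1 e0 e3, of 2]
    monomial_bound[OF k0 k1 e0 e2, of 4]
    monomial_bound[OF k0 k1 e0 e3, of 3]
    monomial_bound[OF k0 k1 e0 e3, of 5]
  have B: "?B \<le> 0" using m by ((simp only: power_0 power_one_right mult_1 mult_1_left)?; linarith)
  have "?A + 29/40 * ?B = (- 29/240) + (711/10000 - (18443/24000) * \<kappa> + (1527/500) * \<kappa>^2 - (81/25) * \<kappa>^3 + (41/40) * \<kappa>^4) * \<epsilon> + (278951/700000 + (406569/400000) * \<kappa> - (15665989/12000000) * \<kappa>^2 - (17283/10000) * \<kappa>^3 - (88983/80000) * \<kappa>^4 + (40759/20000) * \<kappa>^5 - (81/400) * \<kappa>^7) * \<epsilon>^2 + (372519/400000 - (1230703821/560000000) * \<kappa> + (178027/125000) * \<kappa>^2 + (203/5000) * \<kappa>^3 + (6501951/1600000) * \<kappa>^4 - (6373683/2560000) * \<kappa>^5 + (21/25) * \<kappa>^6 + (8019/12800) * \<kappa>^8) * \<epsilon>^3"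
    by algebra
  also have "\<dots> < 0"
    by (rule cubic_negative_on_interval[of "17/40"])
       (use assms kappa_bounds bernstein_minus_1[of \<kappa>] bernstein_minus_2[of \<kappa>] bernstein_minus_3[of \<kappa>] in auto)
  finally have "?A + 29/40 * ?B < 0" .
  then have "?A * M 0 + ?B < 0" by (rule combine_unknown[OF M_0_pos M_0_le B])
  also have "?A * M 0 + ?B = ((123/200) * \<epsilon> + 1 * \<epsilon> * (-39/100)^2 + (369/400) * \<epsilon>^2 - (9/10) * \<epsilon>^2 * (-39/100)^2 + (2187/2560) * \<epsilon>^3 + (81/160) * \<epsilon>^3 * (-39/100)^2 + (9/5) * \<kappa> * \<epsilon> * (-39/100) - (3/25) * \<kappa> * \<epsilon>^2 - (81/40) * \<kappa> * \<epsilon>^2 * (-39/100) + (8/5) * \<kappa> * \<epsilon>^2 * (-39/100)^2 - (54/25) * \<kappa> * \<epsilon>^3 - (36/25) * \<kappa> * \<epsilon>^3 * (-39/100)^2 + (243/100) * \<kappa>^2 * \<epsilon> - (8/5) * \<kappa>^2 * \<epsilon> * (-39/100) + (18/5) * \<kappa>^2 * \<epsilon>^2 * (-39/100) + (7/5) * \<kappa>^2 * \<epsilon>^3 + (24/25) * \<kappa>^2 * \<epsilon>^3 * (-39/100)^2 - (81/25) * \<kappa>^3 * \<epsilon> - (891/400) * \<kappa>^3 * \<epsilon>^2 - (32/25) * \<kappa>^3 * \<epsilon>^2 * (-39/100) + (41/40) * \<kappa>^4 * \<epsilon> - (441/400) * \<kappa>^4 * \<epsilon>^2 + (5103/1280)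 * \<kappa>^4 * \<epsilon>^3 + (81/160) * \<kappa>^4 * \<epsilon>^3 * (-39/100)^2 + (47/25) * \<kappa>^5 * \<epsilon>^2 - (81/200) * \<kappa>^5 * \<epsilon>^2 * (-39/100) - (63/25) * \<kappa>^5 * \<epsilon>^3 + (21/25) * \<kappa>^6 * \<epsilon>^3 - (81/400) * \<kappa>^7 * \<epsilon>^2 + (8019/12800) * \<kappa>^8 * \<epsilon>^3) * M 0
     + (- (1/6) - (24/25) * \<epsilon> - (108/175) * \<epsilon>^2 - (16/75) * \<epsilon>^2 * (-39/100) - (11/120) * \<kappa> * \<epsilon> + (57/400) * \<kappa> * \<epsilon>^2 + (21951/89600) * \<kappa> * \<epsilon>^3 + (27/800) * \<kappa> * \<epsilon>^3 * (-39/100)^2 + (47/375) * \<kappa>^2 * \<epsilon>^2 - (27/1000) * \<kappa>^2 * \<epsilon>^2 * (-39/100) - (21/125) * \<kappa>^2 * \<epsilon>^3 + (7/125) * \<kappa>^3 * \<epsilon>^3 - (27/2000) * \<kappa>^4 * \<epsilon>^2 + (2673/64000) * \<kappa>^5 * \<epsilon>^3)"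
    by algebra
  finally show ?thesis .
qed

lemma trial_energy_plus:
  assumes "0 < \<epsilon>" "\<epsilon> \<le> 17/40"
  shows "((123/200) * \<epsilon> + 1 * \<epsilon> * (11/100)^2 + (369/400) * \<epsilon>^2 - (9/10) * \<epsilon>^2 * (11/100)^2 + (2187/2560) * \<epsilon>^3 + (81/160) * \<epsilon>^3 * (11/100)^2 + (9/5) * \<kappa> * \<epsilon> * (11/100) - (3/25) * \<kappa> * \<epsilon>^2 - (81/40) * \<kappa> * \<epsilon>^2 * (11/100) + (8/5) * \<kappa> * \<epsilon>^2 * (11/100)^2 - (54/25) * \<kappa> * \<epsilon>^3 - (36/25) * \<kappa> * \<epsilon>^3 * (11/100)^2 + (243/100) * \<kappa>^2 * \<epsilon> - (8/5) * \<kappa>^2 * \<epsilon> * (11/100) + (18/5) * \<kappa>^2 * \<epsilon>^2 * (11/100) + (7/5) * \<kappa>^2 * \<epsilon>^3 + (24/25) * \<kappa>^2 * \<epsilon>^3 * (11/100)^2 - (81/25) * \<kappa>^3 * \<epsilon> - (891/400) * \<kappa>^3 * \<epsilon>^2 - (32/25) * \<kappa>^3 * \<epsilon>^2 * (11/100) + (41/40) * \<kappa>^4 * \<epsilon> - (441/400) * \<kappa>^4 * \<epsilon>^2 + (5103/1280) * \<kappa>^4 * \<epsilon>^3 + (81/160) * \<kappa>^4 * \<epsilon>^3 * (11/100)^2 + (47/25) * \<kappa>^5 * \<epsilon>^2 - (81/200) * \<kappa>^5 * \<epsilon>^2 * (11/100) - (63/25) * \<kappa>^5 * \<epsilon>^3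 + (21/25) * \<kappa>^6 * \<epsilon>^3 - (81/400) * \<kappa>^7 * \<epsilon>^2 + (8019/12800) * \<kappa>^8 * \<epsilon>^3) * M 0
     + (- (1/6) - (24/25) * \<epsilon> - (108/175) * \<epsilon>^2 - (16/75) * \<epsilon>^2 * (11/100) - (11/120) * \<kappa> * \<epsilon> + (57/400) * \<kappa> * \<epsilon>^2 + (21951/89600) * \<kappa> * \<epsilon>^3 + (27/800) * \<kappa> * \<epsilon>^3 * (11/100)^2 + (47/375) * \<kappa>^2 * \<epsilon>^2 - (27/1000) * \<kappa>^2 * \<epsilon>^2 * (11/100) - (21/125) * \<kappa>^2 * \<epsilon>^3 + (7/125) * \<kappa>^3 * \<epsilon>^3 - (27/2000) * \<kappa>^4 * \<epsilon>^2 + (2673/64000) * \<kappa>^5 * \<epsilon>^3) < 0"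
proof -
  let ?A = "(6271/10000) * \<epsilon> + (91161/100000) * \<epsilon>^2 + (344169/400000) * \<epsilon>^3 + (99/500) * \<kappa> * \<epsilon> - (32339/100000) * \<kappa> * \<epsilon>^2 - (136089/62500) * \<kappa> * \<epsilon>^3 + (1127/500) * \<kappa>^2 * \<epsilon> + (99/250) * \<kappa>^2 * \<epsilon>^2 + (44113/31250) * \<kappa>^2 * \<epsilon>^3 - (81/25) * \<kappa>^3 * \<epsilon> - (23683/10000) * \<kappa>^3 * \<epsilon>^2 + (41/40) * \<kappa>^4 * \<epsilon> - (441/400) * \<kappa>^4 * \<epsilon>^2 + (6388551/1600000) * \<kappa>^4 * \<epsilon>^3 + (36709/20000) * \<kappa>^5 * \<epsilon>^2 - (63/25) * \<kappa>^5 * \<epsilon>^3 + (21/25) * \<kappa>^6 * \<epsilon>^3 - (81/400) * \<kappa>^7 * \<epsilon>^2 + (8019/12800) * \<kappa>^8 * \<epsilon>^3"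
  let ?B = "- (1/6) - (24/25) * \<epsilon> - (8408/13125) * \<epsilon>^2 - (11/120) * \<kappa> * \<epsilon> + (57/400) * \<kappa> * \<epsilon>^2 + (3435561/14000000) * \<kappa> * \<epsilon>^3 + (36709/300000) * \<kappa>^2 * \<epsilon>^2 - (21/125) * \<kappa>^2 * \<epsilon>^3 + (7/125) * \<kappa>^3 * \<epsilon>^3 - (27/2000) * \<kappa>^4 * \<epsilon>^2 + (2673/64000) * \<kappa>^5 * \<epsilon>^3"
  have e2: "\<epsilon>^2 \<le> 1/5" and e3: "\<epsilon>^3 \<le> 1/10"
    using power_mono[of \<epsilon> "17/40" 2] power_mono[of \<epsilon> "17/40" 3] assms by (simp_all add: power_divide)
  have k0: "0 \<le> \<kappa>" and k1: "\<kappa> \<le> 1" and e0: "0 \<le> \<epsilon>" and e1: "\<epsilon>^1 \<le> 17/40"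
    using kappa_bounds assms by auto
  note m = monomial_bound[OF k0 k1 e0 e1, of 0]
    monomial_bound[OF k0 k1 e0 e2, of 1]
    monomial_bound[OF k0 k1 e0 e1, of 1]
    monomial_bound[OF k0 k1 e0 e2, of 0]
    monomial_bound[OF k0 k1 e0 e2, of 2]
    monomial_bound[OF k0 k1 e0 e3, of 1]
    monomial_bound[OF k0 k1 e0 e3, of 2]
    monomial_bound[OF k0 k1 e0 e2, of 4]
    monomial_bound[OF k0 k1 e0 e3, of 3]
    monomial_bound[OF k0 k1 e0 e3, of 5]
  have B: "?B \<le> 0" using m by ((simp only: power_0 power_one_right mult_1 mult_1_left)?; linarith)
  have "?A + 29/40 * ?B = (- 29/240) + (- 689/10000 + (3157/24000) * \<kappa> + (1127/500) * \<kappa>^2 - (81/25) * \<kappa>^3 + (41/40) * \<kappa>^4) * \<epsilon> + (939053/2100000 - (88031/400000) * \<kappa> + (5816561/12000000) * \<kappa>^2 - (23683/10000) * \<kappa>^3 - (88983/80000) * \<kappa>^4 + (36709/20000) * \<kappa>^5 - (81/400) * \<kappa>^7) * \<epsilon>^2 + (344169/400000 - (1119726171/560000000) * \<kappa> + (161227/125000) * \<kappa>^2 + (203/5000) * \<kappa>^3 + (6388551/1600000) * \<kappa>^4 - (6373683/2560000) * \<kappa>^5 + (21/25) * \<kappa>^6 + (8019/12800) * \<kappa>^8) * \<epsilon>^3"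
    by algebra
  also have "\<dots> < 0"
    by (rule cubic_negative_on_interval[of "17/40"])
       (use assms kappa_bounds bernstein_plus_1[of \<kappa>] bernstein_plus_2[of \<kappa>] bernstein_plus_3[of \<kappa>] in auto)
  finally have "?A + 29/40 * ?B < 0" .
  then have "?A * M 0 + ?B < 0" by (rule combine_unknown[OF M_0_pos M_0_le B])
  also have "?A * M 0 + ?B = ((123/200) * \<epsilon> + 1 * \<epsilon> * (11/100)^2 + (369/400) * \<epsilon>^2 - (9/10) * \<epsilon>^2 * (11/100)^2 + (2187/2560) * \<epsilon>^3 + (81/160) * \<epsilon>^3 * (11/100)^2 + (9/5) * \<kappa> * \<epsilon> * (11/100) - (3/25) * \<kappa> * \<epsilon>^2 - (81/40) * \<kappa> * \<epsilon>^2 * (11/100) + (8/5) * \<kappa> * \<epsilon>^2 * (11/100)^2 - (54/25) * \<kappa> * \<epsilon>^3 - (36/25) * \<kappa> * \<epsilon>^3 * (11/100)^2 + (243/100) * \<kappa>^2 * \<epsilon> - (8/5) * \<kappa>^2 * \<epsilon> * (11/100) + (18/5) * \<kappa>^2 * \<epsilon>^2 * (11/100) + (7/5) * \<kappa>^2 * \<epsilon>^3 + (24/25) * \<kappa>^2 * \<epsilon>^3 * (11/100)^2 - (81/25) * \<kappa>^3 * \<epsilon> - (891/400) * \<kappa>^3 * \<epsilon>^2 - (32/25) * \<kappa>^3 * \<epsilon>^2 * (11/100) + (41/40) * \<kappa>^4 * \<epsilon> - (441/400) * \<kappa>^4 * \<epsilon>^2 + (5103/1280) * \<kappa>^4 *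 \<epsilon>^3 + (81/160) * \<kappa>^4 * \<epsilon>^3 * (11/100)^2 + (47/25) * \<kappa>^5 * \<epsilon>^2 - (81/200) * \<kappa>^5 * \<epsilon>^2 * (11/100) - (63/25) * \<kappa>^5 * \<epsilon>^3 + (21/25) * \<kappa>^6 * \<epsilon>^3 - (81/400) * \<kappa>^7 * \<epsilon>^2 + (8019/12800) * \<kappa>^8 * \<epsilon>^3) * M 0
     + (- (1/6) - (24/25) * \<epsilon> - (108/175) * \<epsilon>^2 - (16/75) * \<epsilon>^2 * (11/100) - (11/120) * \<kappa> * \<epsilon> + (57/400) * \<kappa> * \<epsilon>^2 + (21951/89600) * \<kappa> * \<epsilon>^3 + (27/800) * \<kappa> * \<epsilon>^3 * (11/100)^2 + (47/375) * \<kappa>^2 * \<epsilon>^2 - (27/1000) * \<kappa>^2 * \<epsilon>^2 * (11/100) - (21/125) * \<kappa>^2 * \<epsilon>^3 + (7/125) * \<kappa>^3 * \<epsilon>^3 - (27/2000) * \<kappa>^4 * \<epsilon>^2 + (2673/64000) * \<kappa>^5 * \<epsilon>^3)"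
    by algebra
  finally show ?thesis .
qed

text \<open>Beyond the centre of the disk the only negative term of the density changes sign, so the tail may be dropped from the integral.\<close>

lemma energy_density_nonneg:
  assumes "1 \<le> \<epsilon> * t"
  shows "0 \<le> energy_density \<epsilon> s t"
proof -
  have "\<kappa>\<^sup>2 * (1 - \<epsilon>*t) * (trial \<epsilon> t)\<^sup>2 \<le> 0" using assms by (intro mult_nonpos_nonneg mult_nonneg_nonpos) auto
  moreover have "0 \<le> ((1 - \<epsilon>*t) * trial' \<epsilon> t - \<epsilon>/2 * trial \<epsilon> t)\<^sup>2 + (t - s)\<^sup>2 * (trial \<epsilon> t)\<^sup>2"
    by simp
  ultimately show ?thesis unfolding energy_density_def by (meson diff_ge_0_iff_ge order_trans)
qed

text \<open>The offset enters through a square. A convex function that is negative at both ends of an interval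
is negative on all of it, so only the two extreme offsets have to be computed.\<close>

lemma energy_density_convex:
  assumes "0 \<le> \<theta>" "\<theta> \<le> 1"
  shows "energy_density \<epsilon> ((1-\<theta>) * s1 + \<theta> * s2) t \<le> (1-\<theta>) * energy_density \<epsilon> s1 t + \<theta> * energy_density \<epsilon> s2 t"
proof -
  have "(1-\<theta>) * energy_density \<epsilon> s1 t + \<theta> * energy_density \<epsilon> s2 t - energy_density \<epsilon> ((1-\<theta>) * s1 + \<theta> * s2) t
      = \<theta> * (1-\<theta>) * (s1 - s2)\<^sup>2 * (trial \<epsilon> t)\<^sup>2"
    unfolding energy_density_def by algebra
  also have "\<dots> \<ge> 0" using assms by simp
  finally show ?thesis by simp
qed

text \<open>The interval of admissible \<open>s\<close> has length \<open>\<epsilon>/2\<close>, which is the step by which \<open>s\<close> moves when the angular momentum changes by one. It is not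
centred at \<open>\<kappa>\<close>, because the curvature shifts the optimal momentum.\<close>

theorem boundary_layer_trial:
  assumes e: "0 < \<epsilon>" "\<epsilon> \<le> 17/40" and s: "\<kappa> - 39/100 * \<epsilon> \<le> s" "s \<le> \<kappa> + 11/100 * \<epsilon>"
  obtains H h where "\<And>t. t \<ge> 0 \<Longrightarrow> (H has_real_derivative h t) (at t)" "\<And>t. energy_density \<epsilon> s t \<le> h t"
    "H 0 = 0" "H (1/\<epsilon>) < 0"
proof -
  define s1 s2 where "s1 = \<kappa> + (-39/100) * \<epsilon>" and "s2 = \<kappa> + 11/100 * \<epsilon>"
  define \<theta> where "\<theta> = (s - s1) / (s2 - s1)"
  have d: "s2 - s1 = \<epsilon> / 2" unfolding s1_def s2_def by simp
  have th: "0 \<le> \<theta>" "\<theta> \<le> 1" unfolding \<theta>_def d using e s unfolding s1_def by (auto simp: field_simps)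
  have st: "s = (1-\<theta>) * s1 + \<theta> * s2"
  proof -
    have "\<theta> * (s2 - s1) = s - s1" unfolding \<theta>_def using d e by simp
    then show ?thesis by (simp add: algebra_simps)
  qed
  have tail: "0 \<le> energy_density \<epsilon> r t" if "t \<ge> 1/\<epsilon>" for r t
    using that e by (intro energy_density_nonneg) (simp add: field_simps)
  have I: "\<exists>H. (\<forall>t\<ge>0. (H has_real_derivative energy_density \<epsilon> r t) (at t)) \<and> H 0 = 0 \<and> H (1/\<epsilon>) < 0"
    if J: "improper_integral (energy_density \<epsilon> r) (\<epsilon> * J)" "J < 0" for r J
  proof -
    obtain H where H: "\<And>t. t \<ge> 0 \<Longrightarrow> (H has_real_derivative energy_density \<epsilon> r t) (at t)" "H 0 = 0" "(H \<longlongrightarrow> \<epsilon> * J) at_top"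
      using J(1) unfolding improper_integral_def by blast
    have "H (1/\<epsilon>) \<le> \<epsilon> * J" by (rule improper_tail[OF H(1) H(3) tail]) (use e in auto)
    also have "\<dots> < 0" using e J(2) by (intro mult_pos_neg)
    finally show ?thesis using H by blast
  qed
  obtain H1 where H1: "\<And>t. t \<ge> 0 \<Longrightarrow> (H1 has_real_derivative energy_density \<epsilon> s1 t) (at t)" "H1 0 = 0" "H1 (1/\<epsilon>) < 0"
    using I[OF energy_density_integral[of \<epsilon> "-39/100", folded s1_def] trial_energy_minus[OF e]] by blast
  obtain H2 where H2: "\<And>t. t \<ge> 0 \<Longrightarrow> (H2 has_real_derivative energy_density \<epsilon> s2 t) (at t)" "H2 0 = 0" "H2 (1/\<epsilon>) < 0"
    using I[OF energy_density_integral[of \<epsilon> "11/100", folded s2_def] trial_energy_plus[OF e]] by blast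
  show ?thesis
  proof (rule that)
    show "((\<lambda>t. (1-\<theta>) * H1 t + \<theta> * H2 t) has_real_derivative (1-\<theta>) * energy_density \<epsilon> s1 t + \<theta> * energy_density \<epsilon> s2 t) (at t)"
      if "t \<ge> 0" for t by (intro DERIV_add DERIV_cmult H1(1)[OF that] H2(1)[OF that])
    show "energy_density \<epsilon> s t \<le> (1-\<theta>) * energy_density \<epsilon> s1 t + \<theta> * energy_density \<epsilon> s2 t" for t
      unfolding st by (rule energy_density_convex[OF th])
    show "(1-\<theta>) * H1 0 + \<theta> * H2 0 = 0" using H1 H2 by simp
    show "(1-\<theta>) * H1 (1/\<epsilon>) + \<theta> * H2 (1/\<epsilon>) < 0"
    proof (cases "\<theta> = 0")
      case False
      then show ?thesis using th H1(3) H2(3) by (intro add_nonpos_neg mult_nonneg_nonpos mult_pos_neg) auto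
    qed (use H1 in simp)
  qed
qed

end

section \<open>The radial equation on the disk\<close>

text \<open>A continuous function can lose positivity only at a first zero.\<close>

lemma positivity_continuation:
  fixes g :: "real \<Rightarrow> real"
  assumes c: "continuous_on {a..b} g" and a: "g a > 0"
    and step: "\<And>z. a < z \<Longrightarrow> z \<le> b \<Longrightarrow> (\<And>x. a \<le> x \<Longrightarrow> x < z \<Longrightarrow> g x > 0) \<Longrightarrow> g z \<noteq> 0"
    and s: "s \<in> {a..b}"
  shows "g s > 0"
proof (rule ccontr)
  assume neg: "\<not> g s > 0"
  define Z where "Z = {x\<in>{a..s}. g x \<le> 0}"
  have c': "continuous_on {a..s} g" by (rule continuous_on_subset[OF c]) (use s in auto)
  have "Z = {a..s} \<inter> g -` {..0}" unfolding Z_def by auto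
  then have cl: "closed Z" using continuous_closed_preimage[OF c'] by simp
  have ne: "Z \<noteq> {}" using neg s unfolding Z_def by auto
  have bb: "bdd_below Z" unfolding Z_def by (intro bdd_belowI[of _ a]) auto
  define z where "z = Inf Z"
  have zZ: "z \<in> Z" unfolding z_def using closed_contains_Inf[OF ne bb cl] .
  have pos: "g x > 0" if "a \<le> x" "x < z" for x
  proof (rule ccontr)
    assume "\<not> g x > 0"
    then have "x \<in> Z" using that zZ unfolding Z_def by auto
    then have "z \<le> x" unfolding z_def by (rule cInf_lower[OF _ bb])
    then show False using that by simp
  qed
  have az: "a < z" using zZ a unfolding Z_def by (cases "z = a") auto
  have "g z \<noteq> 0" using step[OF az _ pos] zZ s unfolding Z_def by auto
  then have gz: "g z < 0" using zZ unfolding Z_def by auto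
  have "continuous_on {a..z} g" by (rule continuous_on_subset[OF c]) (use zZ s in \<open>auto simp: Z_def\<close>)
  then obtain x where "a \<le> x" "x \<le> z" "g x = 0" using IVT2'[of g z 0 a] gz a az by auto
  then show False using pos[of x] gz by (cases "x = z") auto
qed

text \<open>Taylor coefficients of the solution of the radial equation that is regular at \<open>x = 0\<close>, in the variable \<open>x = \<bar>z\<bar>\<^sup>2\<close> and with the factor \<open>\<bar>z\<bar>\<^sup>m\<close> removed.\<close>

fun rad_coeff :: "nat \<Rightarrow> real \<Rightarrow> real \<Rightarrow> nat \<Rightarrow> real" where
  "rad_coeff m b l 0 = 1"
| "rad_coeff m b l (Suc n) = (b\<^sup>2/4 * (if n = 0 then 0 else rad_coeff m b l (n-1)) - (m * b + l) * rad_coeff m b l n)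
     / (4 * real (n+1) * real (n+1+m))"

lemma rad_tame:
  assumes "\<bar>m * b + l\<bar> \<le> M" "b\<^sup>2/4 \<le> M"
  shows "tame_coeffs M (rad_coeff m b l)"
  unfolding tame_coeffs_def
proof (intro conjI allI impI)
  fix n :: nat assume "n \<ge> 1"
  let ?s = "rad_coeff m b l"
  have M: "M \<ge> 0" using assms by linarith
  obtain k where k: "n = Suc k" using \<open>n \<ge> 1\<close> by (cases n) auto
  define u where "u = (if k = 0 then 0 else ?s (k-1))"
  have "\<bar>b\<^sup>2/4 * u - (m * b + l) * ?s k\<bar> \<le> \<bar>b\<^sup>2/4 * u\<bar> + \<bar>(m * b + l) * ?s k\<bar>" by linarith
  also have "\<dots> \<le> M * \<bar>u\<bar> + M * \<bar>?s k\<bar>" unfolding abs_mult using assms by (intro add_mono mult_right_mono) auto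
  finally have num: "\<bar>b\<^sup>2/4 * u - (m * b + l) * ?s k\<bar> \<le> M * (\<bar>u\<bar> + \<bar>?s k\<bar>)" by (simp only: distrib_left)
  have xs: "\<bar>u\<bar> + \<bar>?s k\<bar> \<le> (\<Sum>i\<in>{n-4..<n}. \<bar>?s i\<bar>)"
  proof (cases "k = 0")
    case True
    then have "{n-4..<n} = {0}" using k by auto
    then show ?thesis using True by (simp add: u_def)
  next
    case False
    have "(\<Sum>i\<in>{k-1,k}. \<bar>?s i\<bar>) \<le> (\<Sum>i\<in>{n-4..<n}. \<bar>?s i\<bar>)" using k by (intro sum_mono2) auto
    then show ?thesis using False by (simp add: u_def)
  qed
  have sn: "?s n = (b\<^sup>2/4 * u - (m * b + l) * ?s k) / (4 * real n * real (n + m))"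
    unfolding k u_def by simp
  have "real n * \<bar>?s n\<bar> = \<bar>b\<^sup>2/4 * u - (m * b + l) * ?s k\<bar> / (4 * real (n + m))"
    unfolding sn abs_divide using \<open>n \<ge> 1\<close> by (simp add: abs_mult divide_simps)
  also have "\<dots> \<le> \<bar>b\<^sup>2/4 * u - (m * b + l) * ?s k\<bar>"
  proof -
    have "1 \<le> 4 * real (n+m)" using \<open>n \<ge> 1\<close> by simp
    then show ?thesis by (intro mult_imp_div_pos_le) (auto intro: mult_left_le simp: mult_le_cancel_left1)
  qed
  also have "\<dots> \<le> M * (\<bar>u\<bar> + \<bar>?s k\<bar>)" by (rule num)
  also have "\<dots> \<le> M * (\<Sum>i\<in>{n-4..<n}. \<bar>?s i\<bar>)" using xs M by (intro mult_left_mono)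
  finally show "real n * \<bar>?s n\<bar> \<le> M * (\<Sum>i\<in>{n-4..<n}. \<bar>?s i\<bar>)" .
qed simp

definition rad :: "nat \<Rightarrow> real \<Rightarrow> real \<Rightarrow> real \<Rightarrow> real" where
  "rad m b l x = (\<Sum>n. rad_coeff m b l n * x^n)"
definition rad' :: "nat \<Rightarrow> real \<Rightarrow> real \<Rightarrow> real \<Rightarrow> real" where
  "rad' m b l x = (\<Sum>n. diffs (rad_coeff m b l) n * x^n)"
definition rad'' :: "nat \<Rightarrow> real \<Rightarrow> real \<Rightarrow> real \<Rightarrow> real" where
  "rad'' m b l x = (\<Sum>n. diffs (diffs (rad_coeff m b l)) n * x^n)"

lemma rad_summable: "summable (\<lambda>n. rad_coeff m b l n * x^n)"
  by (rule tame_summable[OF rad_tame[of m b l "\<bar>m * b + l\<bar> + b\<^sup>2/4"]]) auto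

lemma rad_deriv: "(rad m b l has_real_derivative rad' m b l x) (at x)"
  unfolding rad_def[abs_def] rad'_def by (rule powser_entire_deriv(1)[OF rad_summable])

lemma rad'_deriv: "(rad' m b l has_real_derivative rad'' m b l x) (at x)"
  unfolding rad'_def[abs_def] rad''_def
  by (rule powser_entire_deriv(1)[OF powser_entire_deriv(2)[OF rad_summable]])

lemma rad_0 [simp]: "rad m b l 0 = 1"
  unfolding rad_def using powser_zero[of "rad_coeff m b l"] by simp

lemma rad'_0: "rad' m b l 0 = - (m * b + l) / (4 * (real m + 1))"
  unfolding rad'_def using powser_zero[of "diffs (rad_coeff m b l)"] by (simp add: diffs_def)

lemma rad_equation:
  "4 * x * rad'' m b l x + 4 * (real m + 1) * rad' m b l x = (b\<^sup>2 * x / 4 - m * b - l) * rad m b l x"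
proof -
  let ?c = "rad_coeff m b l"
  have s1: "summable (\<lambda>n. diffs ?c n * t^n)" for t
    using powser_entire_deriv(2)[OF rad_summable] .
  have 0: "(\<lambda>n. ?c n * x^n) sums rad m b l x"
    unfolding rad_def using rad_summable by (rule summable_sums)
  have 1: "(\<lambda>n. diffs ?c n * x^n) sums rad' m b l x"
    unfolding rad'_def using s1 by (rule summable_sums)
  have "(\<lambda>n. diffs (diffs ?c) n * x^n) sums rad'' m b l x"
    unfolding rad''_def using powser_entire_deriv(2)[OF s1] by (rule summable_sums)
  note 2 = sums_shift[OF this]
  have L: "(\<lambda>n. 4 * ((if n = 0 then 0 else diffs (diffs ?c) (n-1)) * x^n) + 4 * (real m + 1) * (diffs ?c n * x^n)) sums
     (4 * (x * rad'' m b l x) + 4 * (real m + 1) * rad' m b l x)"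
    by (intro sums_add sums_mult 1 2)
  have R: "(\<lambda>n. b\<^sup>2/4 * ((if n = 0 then 0 else ?c (n-1)) * x^n) - (m * b + l) * (?c n * x^n)) sums
     (b\<^sup>2/4 * (x * rad m b l x) - (m * b + l) * rad m b l x)"
    by (intro sums_diff sums_mult 0 sums_shift[OF 0])
  have "(\<lambda>n. 4 * ((if n = 0 then 0 else diffs (diffs ?c) (n-1)) * x^n) + 4 * (real m + 1) * (diffs ?c n * x^n))
      = (\<lambda>n. b\<^sup>2/4 * ((if n = 0 then 0 else ?c (n-1)) * x^n) - (m * b + l) * (?c n * x^n))"
  proof
    fix n
    have e: "4 * real (n+1) * real (n+1+m) * ?c (n+1) = b\<^sup>2/4 * (if n = 0 then 0 else ?c (n-1)) - (m * b + l) * ?c n"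
      by (simp del: of_nat_Suc of_nat_add add: field_simps)
    have "4 * (if n = 0 then 0 else diffs (diffs ?c) (n-1)) + 4 * (real m + 1) * diffs ?c n = 4 * real (n+1) * real (n+1+m) * ?c (n+1)"
      by (cases n) (simp_all del: rad_coeff.simps add: diffs_def algebra_simps)
    then have "(4 * (if n = 0 then 0 else diffs (diffs ?c) (n-1)) + 4 * (real m + 1) * diffs ?c n) * x^n
       = (b\<^sup>2/4 * (if n = 0 then 0 else ?c (n-1)) - (m * b + l) * ?c n) * x^n" unfolding e by simp
    then show "4 * ((if n = 0 then 0 else diffs (diffs ?c) (n-1)) * x^n) + 4 * (real m + 1) * (diffs ?c n * x^n)
      = b\<^sup>2/4 * ((if n = 0 then 0 else ?c (n-1)) * x^n) - (m * b + l) * (?c n * x^n)"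
      by (simp only: distrib_right left_diff_distrib mult.assoc)
  qed
  then show ?thesis using sums_unique2[OF L] R by (simp add: algebra_simps)
qed

text \<open>Up to the factor \<open>-\<i> \<zeta> ^ m\<close> with \<open>\<zeta> = x\<^sub>1 - \<i> x\<^sub>2\<close>, the inner product of the position vector with the magnetic gradient of the eigenfunction. The Neumann
condition is that it vanishes at \<open>x = 1\<close>.\<close>

definition flux :: "nat \<Rightarrow> real \<Rightarrow> real \<Rightarrow> real \<Rightarrow> real" where
  "flux m b l x = m * rad m b l x + 2 * x * rad' m b l x"

lemma flux_deriv:
  "(flux m b l has_real_derivative m * rad' m b l x + 2 * rad' m b l x + 2 * x * rad'' m b l x) (at x)"
  unfolding flux_def by (rule derivative_eq_intros rad_deriv rad'_deriv refl | simp)+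

lemma flux_equation:
  "2 * x * (m * rad' m b l x + 2 * rad' m b l x + 2 * x * rad'' m b l x) + m * flux m b l x
     = ((m - b*x/2)\<^sup>2 - l * x) * rad m b l x"
  using rad_equation[of x m b l] unfolding flux_def by algebra

lemma rad_zero_double:
  assumes "0 < x0" "rad m b l x0 = 0" "rad' m b l x0 = 0"
  shows False
proof -
  have "rad m b l a = 0" if a: "0 < a" "a \<le> x0" for a
  proof -
    define M where "M = (b\<^sup>2 * x0/4 + \<bar>m * b + l\<bar> + 4 * (real m + 1)) / (4 * a)"
    have M: "M \<ge> 0" unfolding M_def using a by simp
    show ?thesis
    proof (rule second_order_zero[where a=a and b=x0 and ?t0.0=x0 and t=a and y="rad m b l" and y'="rad' m b l" and y''="rad'' m b l" and M=M])
      fix t assume t: "a < t" "t < x0"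
      have "\<bar>4 * t * rad'' m b l t\<bar> = \<bar>(b\<^sup>2 * t / 4 - m * b - l) * rad m b l t - 4 * (real m + 1) * rad' m b l t\<bar>"
        using rad_equation[of t m b l] by simp
      also have "\<dots> \<le> \<bar>b\<^sup>2 * t / 4 - m * b - l\<bar> * \<bar>rad m b l t\<bar> + 4 * (real m + 1) * \<bar>rad' m b l t\<bar>"
        by (rule order_trans[OF abs_triangle_ineq4]) (simp add: abs_mult)
      also have "\<dots> \<le> (4 * a * M) * \<bar>rad m b l t\<bar> + (4 * a * M) * \<bar>rad' m b l t\<bar>"
      proof (intro add_mono mult_right_mono)
        have aM: "4 * a * M = b\<^sup>2 * x0/4 + \<bar>m * b + l\<bar> + 4 * (real m + 1)" unfolding M_def using a by simp
        have "b\<^sup>2 * t / 4 \<le> b\<^sup>2 * x0 / 4" "0 \<le> b\<^sup>2 * t / 4" using t a by (auto intro!: mult_left_mono divide_right_mono)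
        moreover have "\<bar>b\<^sup>2 * t / 4 - m * b - l\<bar> \<le> \<bar>b\<^sup>2 * t / 4\<bar> + \<bar>m * b + l\<bar>"
          using abs_triangle_ineq4[of "b\<^sup>2 * t / 4" "m * b + l"] by (simp add: diff_diff_add)
        ultimately show "\<bar>b\<^sup>2 * t / 4 - m * b - l\<bar> \<le> 4 * a * M" unfolding aM by simp
        show "4 * (real m + 1) \<le> 4 * a * M" using \<open>b\<^sup>2 * t / 4 \<le> b\<^sup>2 * x0 / 4\<close> \<open>0 \<le> b\<^sup>2 * t / 4\<close> unfolding aM by linarith
      qed auto
      also have "\<dots> = 4 * a * (M * (\<bar>rad m b l t\<bar> + \<bar>rad' m b l t\<bar>))" by (simp add: algebra_simps)
      also have "\<dots> \<le> 4 * t * (M * (\<bar>rad m b l t\<bar> + \<bar>rad' m b l t\<bar>))" using t M by (intro mult_right_mono) auto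
      finally show "\<bar>rad'' m b l t\<bar> \<le> M * (\<bar>rad m b l t\<bar> + \<bar>rad' m b l t\<bar>)"
        using t a by (simp add: abs_mult)
    qed (use a assms M rad_deriv rad'_deriv derivative_imp_continuous_on[OF rad_deriv] derivative_imp_continuous_on[OF rad'_deriv] in auto)
  qed
  then have "\<forall>\<^sub>F a in at_right 0. rad m b l a = 0"
    using eventually_at_right_less[of 0] by (auto simp: eventually_at_right_field intro!: exI[of _ x0] assms)
  moreover have "(rad m b l \<longlongrightarrow> 1) (at_right 0)"
    using DERIV_isCont[OF rad_deriv[of m b l 0]] by (auto simp: isCont_def intro: tendsto_mono[OF at_le])
  ultimately have "((\<lambda>a. 0::real) \<longlongrightarrow> 1) (at_right (0::real))"
    by (rule Lim_transform_eventually[rotated])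
  then have "0 = (1::real)"
    by (rule tendsto_unique[OF trivial_limit_at_right_real tendsto_const])
  then show False by simp
qed

text \<open>The right-hand side of \<open>flux_equation\<close> is positive at \<open>l = -1\<close>, so \<open>rad\<close> and \<open>flux\<close> keep each other positive. This is
the starting point of the shooting in \<open>l\<close>.\<close>

lemma rad_positive_below_spectrum:
  assumes x: "x \<in> {0..1}"
  shows "rad m b (-1) x > 0" "x > 0 \<Longrightarrow> flux m b (-1) x > 0"
proof -
  let ?F = "rad m b (-1)" and ?y = "flux m b (-1)"
  have cF: "continuous_on A ?F" "continuous_on A ?y" for A
    using derivative_imp_continuous_on[OF rad_deriv] derivative_imp_continuous_on[OF flux_deriv] by blast+
  have tF: "(?F \<longlongrightarrow> 1) (at_right 0)" 
    using DERIV_isCont[OF rad_deriv[of m b "-1" 0]] by (auto simp: isCont_def intro: tendsto_mono[OF at_le])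
  have ty: "(?y \<longlongrightarrow> real m) (at_right 0)"
    using DERIV_isCont[OF flux_deriv[of m b "-1" 0]] by (auto simp: isCont_def flux_def intro: tendsto_mono[OF at_le])
  have tF': "(rad' m b (-1) \<longlongrightarrow> rad' m b (-1) 0) (at_right 0)"
    using DERIV_isCont[OF rad'_deriv[of m b "-1" 0]] by (auto simp: isCont_def intro: tendsto_mono[OF at_le])
  have eF: "\<forall>\<^sub>F s in at_right 0. ?F s > 0" using order_tendstoD(1)[OF tF, of 0] by simp
  have ey: "\<forall>\<^sub>F s in at_right 0. ?y s > 0"
  proof (cases "m = 0")
    case True
    have "rad' m b (-1) 0 > 0" using True by (simp add: rad'_0)
    then have "\<forall>\<^sub>F s in at_right 0. rad' m b (-1) s > 0" using order_tendstoD(1)[OF tF', of 0] by simp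
    then show ?thesis using eventually_at_right_less[of 0]
      by eventually_elim (use True in \<open>simp add: flux_def\<close>)
  next
    case False
    then show ?thesis using order_tendstoD(1)[OF ty, of 0] by simp
  qed
  have pos: "?F s > 0 \<and> ?y s > 0" if s: "0 < s" "s \<le> 1" for s
  proof -
    obtain d where d: "0 < d" "d < s" "?F d > 0" "?y d > 0"
    proof -
      have "\<forall>\<^sub>F r in at_right 0. 0 < r \<and> r < s \<and> ?F r > 0 \<and> ?y r > 0"
        using eF ey eventually_at_right_less[of 0] eventually_at_right_real[OF s(1)]
        by eventually_elim auto
      then have "\<exists>r. 0 < r \<and> r < s \<and> ?F r > 0 \<and> ?y r > 0"
        by (rule eventually_happens'[OF trivial_limit_at_right_real])
      then show ?thesis using that by blast
    qed
    define g where "g = (\<lambda>r. min (?F r) (?y r))"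
    have "g s > 0"
    proof (rule positivity_continuation[of d 1 g])
      show "continuous_on {d..1} g" unfolding g_def by (intro continuous_intros cF)
      show "g d > 0" unfolding g_def using d by simp
      show "s \<in> {d..1}" using s d by auto
      fix z assume z: "d < z" "z \<le> 1" and before: "\<And>x. d \<le> x \<Longrightarrow> x < z \<Longrightarrow> g x > 0"
      have "d^m * (?F d)\<^sup>2 \<le> z^m * (?F z)\<^sup>2"
      proof (rule DERIV_nonneg_imp_increasing_open[of d z "\<lambda>x. x^m * (?F x)\<^sup>2"])
        fix x assume x: "d < x" "x < z"
        have "((\<lambda>x. x^m * (?F x)\<^sup>2) has_real_derivative (x^m/x) * (?F x * ?y x)) (at x)"
          by (rule derivative_eq_intros rad_deriv refl)+
             (use x d in \<open>cases m; simp add: flux_def field_simps power2_eq_square\<close>)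
        moreover have "(x^m/x) * (?F x * ?y x) \<ge> 0" using before[of x] x d unfolding g_def by (intro mult_nonneg_nonneg) auto
        ultimately show "\<exists>w. ((\<lambda>x. x^m * (?F x)\<^sup>2) has_real_derivative w) (at x) \<and> 0 \<le> w" by blast
      qed (use z in \<open>auto intro!: continuous_intros cF\<close>)
      moreover have "d^m * (?F d)\<^sup>2 > 0" using d by simp
      ultimately have Fz: "?F z \<noteq> 0" by auto
      have "d^m * (?y d)\<^sup>2 \<le> z^m * (?y z)\<^sup>2"
      proof (rule DERIV_nonneg_imp_increasing_open[of d z "\<lambda>x. x^m * (?y x)\<^sup>2"])
        fix x assume x: "d < x" "x < z"
        define y' where "y' = m * rad' m b (-1) x + 2 * rad' m b (-1) x + 2 * x * rad'' m b (-1) x"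
        have "((\<lambda>x. x^m * (?y x)\<^sup>2) has_real_derivative (x^m/x) * (?y x * (2 * x * y' + m * ?y x))) (at x)"
          unfolding y'_def
          by (rule derivative_eq_intros flux_deriv refl)+
             (use x d in \<open>cases m; simp add: field_simps power2_eq_square\<close>)
        moreover have "2 * x * y' + m * ?y x = ((m - b*x/2)\<^sup>2 + x) * ?F x"
          unfolding y'_def using flux_equation[of x m b "-1"] by simp
        moreover have "(x^m/x) * (?y x * (((m - b*x/2)\<^sup>2 + x) * ?F x)) \<ge> 0"
          using before[of x] x d unfolding g_def by (intro mult_nonneg_nonneg) auto
        ultimately show "\<exists>w. ((\<lambda>x. x^m * (?y x)\<^sup>2) has_real_derivative w) (at x) \<and> 0 \<le> w" by metis
      qed (use z in \<open>auto intro!: continuous_intros cF\<close>)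
      moreover have "d^m * (?y d)\<^sup>2 > 0" using d by simp
      ultimately have "?y z \<noteq> 0" by auto
      then show "g z \<noteq> 0" using Fz unfolding g_def by (auto simp: min_def)
    qed
    then show ?thesis unfolding g_def by simp
  qed
  show "rad m b (-1) x > 0" using pos[of x] x by (cases "x = 0") auto
  show "x > 0 \<Longrightarrow> flux m b (-1) x > 0" using pos[of x] x by auto
qed

lemma regroup_derivative_terms:
  fixes X r x K G P G' q :: real
  assumes "X = r * x"
  shows "2 * (K * r) * G * P + 2 * X * G' * P + 2 * X * G * (2 * q * q')
     = r * (2 * K * G * P + (2 * x * G') * P + 4 * x * G * q * q')"
  unfolding assms by algebra

text \<open>With a positive solution \<open>F\<close> the energy density of any profile \<open>p\<close> equals a square plus the total derivative of \<open>2 x\<^sup>k (flux / F) p\<^sup>2\<close>. As the flux is nonnegative at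
the boundary, the total energy of \<open>p\<close> is nonnegative. The function \<open>S\<close> is an antiderivative of an upper bound for the density,
and \<open>x\<^sup>k\<close> is the weight of the factor \<open>\<bar>z\<bar>\<^sup>k\<close> in the profile.\<close>

lemma trial_inequality:
  fixes p p' S T :: "real \<Rightarrow> real"
  assumes F: "\<And>x. x \<in> {0..1} \<Longrightarrow> rad m b l x > 0" and N: "flux m b l 1 \<ge> 0"
    and k: "k \<ge> 1 \<or> (k = 0 \<and> m = 0)"
    and cp: "continuous_on {0..1} p" and p': "\<And>x. 0 < x \<Longrightarrow> x < 1 \<Longrightarrow> (p has_real_derivative p' x) (at x)"
    and cS: "continuous_on {0..1} S" and S': "\<And>x. 0 < x \<Longrightarrow> x < 1 \<Longrightarrow> (S has_real_derivative T x) (at x)"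
    and T: "\<And>x. 0 < x \<Longrightarrow> x < 1 \<Longrightarrow>
       x^k / x * ((k * p x + 2 * x * p' x)\<^sup>2 + (m - b*x/2)\<^sup>2 * (p x)\<^sup>2 - l * x * (p x)\<^sup>2) \<le> T x"
  shows "S 0 \<le> S 1"
proof -
  let ?F = "rad m b l" and ?y = "flux m b l"
  define G where "G = (\<lambda>x. ?y x / ?F x)"
  \<comment> \<open>The derivative of \<open>Z\<close> is bounded below by the completed square.\<close>
  define Z where "Z = (\<lambda>x. S x - 2 * x^k * G x * (p x)\<^sup>2)"
  have cF: "continuous_on A ?F" "continuous_on A ?y" for A
    using derivative_imp_continuous_on[OF rad_deriv] derivative_imp_continuous_on[OF flux_deriv] by blast+
  have cG: "continuous_on {0..1} G" unfolding G_def by (intro continuous_intros cF) (use F in force)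
  have "Z 0 \<le> Z 1"
  proof (rule DERIV_nonneg_imp_increasing_open[of 0 1 Z])
    show "continuous_on {0..1} Z" unfolding Z_def by (intro continuous_intros cS cG cp)
    fix x :: real assume x: "0 < x" "x < 1"
    have Fx: "?F x > 0" using F x by auto
    define y' where "y' = m * rad' m b l x + 2 * rad' m b l x + 2 * x * rad'' m b l x"
    define G' where "G' = (y' * ?F x - ?y x * rad' m b l x) / (?F x * ?F x)"
    have dG: "(G has_real_derivative G') (at x)"
      unfolding G_def G'_def y'_def
      by (rule derivative_eq_intros rad_deriv flux_deriv refl | use Fx in simp)+
    have ric: "2 * x * G' = (m - b*x/2)\<^sup>2 - l * x - (G x)\<^sup>2"
    proof -
      have "2 * x * y' + m * ?y x = ((m - b*x/2)\<^sup>2 - l * x) * ?F x" unfolding y'_def by (rule flux_equation)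
      moreover have "2 * x * rad' m b l x = ?y x - m * ?F x" unfolding flux_def by simp
      ultimately have "2 * x * (y' * ?F x - ?y x * rad' m b l x) = ((m - b*x/2)\<^sup>2 - l * x) * (?F x * ?F x) - ?y x * ?y x"
        by algebra
      then have "2 * x * G' = (((m - b*x/2)\<^sup>2 - l * x) * (?F x * ?F x) - ?y x * ?y x) / (?F x * ?F x)"
        unfolding G'_def by simp
      also have "\<dots> = (m - b*x/2)\<^sup>2 - l * x - (G x)\<^sup>2"
        unfolding G_def using Fx by (simp add: diff_divide_distrib power2_eq_square)
      finally show ?thesis .
    qed
    have dx: "((\<lambda>x. x^k) has_real_derivative k * (x^k / x)) (at x)"
      by (rule derivative_eq_intros refl)+ (use x in \<open>cases k; simp\<close>)
    have "(Z has_real_derivative T x - (2 * (k * (x^k/x)) * G x * (p x)\<^sup>2 + 2 * x^k * G' * (p x)\<^sup>2 + 2 * x^k * G x * (2 * p x * p' x))) (at x)"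
      unfolding Z_def
      by (rule derivative_eq_intros S' dG p' dx x refl)+ (simp add: algebra_simps)
    moreover have "T x - (2 * (k * (x^k/x)) * G x * (p x)\<^sup>2 + 2 * x^k * G' * (p x)\<^sup>2 + 2 * x^k * G x * (2 * p x * p' x)) \<ge> 0"
    proof -
      have xk: "x^k = x^k/x * x" using x by simp
      have "2 * (k * (x^k/x)) * G x * (p x)\<^sup>2 + 2 * x^k * G' * (p x)\<^sup>2 + 2 * x^k * G x * (2 * p x * p' x)
         = x^k/x * (2 * real k * G x * (p x)\<^sup>2 + (2 * x * G') * (p x)\<^sup>2 + 4 * x * G x * p x * p' x)"
        by (rule regroup_derivative_terms[OF xk])
      also have "\<dots> = x^k / x * ((k * p x + 2 * x * p' x)\<^sup>2 + (m - b*x/2)\<^sup>2 * (p x)\<^sup>2 - l * x * (p x)\<^sup>2)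
           - x^k/x * (k * p x + 2 * x * p' x - G x * p x)\<^sup>2"
        unfolding ric by algebra
      finally have "2 * (k * (x^k/x)) * G x * (p x)\<^sup>2 + 2 * x^k * G' * (p x)\<^sup>2 + 2 * x^k * G x * (2 * p x * p' x)
          \<le> x^k / x * ((k * p x + 2 * x * p' x)\<^sup>2 + (m - b*x/2)\<^sup>2 * (p x)\<^sup>2 - l * x * (p x)\<^sup>2)"
        using x by simp
      then show ?thesis using T[OF x] by linarith
    qed
    ultimately show "\<exists>w. (Z has_real_derivative w) (at x) \<and> 0 \<le> w" by blast
  qed simp
  moreover have "Z 0 = S 0" unfolding Z_def G_def flux_def using k by auto
  moreover have "Z 1 \<le> S 1" unfolding Z_def G_def using N F[of 1] by simp
  ultimately show ?thesis by simp
qed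

lemma rad_coeff_continuous: "continuous_on I (\<lambda>e. rad_coeff m b (e - 1) n)"
proof (induction n rule: less_induct)
  case (less n)
  show ?case
  proof (cases n)
    case (Suc k)
    have [continuous_intros]: "continuous_on I (\<lambda>e. rad_coeff m b (e - 1) k)" 
      "continuous_on I (\<lambda>e. rad_coeff m b (e - 1) (k-1))" using less Suc by auto
    show ?thesis unfolding Suc rad_coeff.simps
      by (cases "k = 0") (auto intro!: continuous_intros simp del: One_nat_def of_nat_Suc of_nat_add)
  qed simp
qed

lemma rad_joint_continuous:
  "continuous_on ({0..L} \<times> {0..1}) (\<lambda>z. rad m b (fst z - 1) (snd z))"
  "continuous_on ({0..L} \<times> {0..1}) (\<lambda>z. flux m b (fst z - 1) (snd z))"
proof -
  let ?M = "\<bar>m * b\<bar> + \<bar>L\<bar> + 1 + b\<^sup>2/4"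
  have t: "tame_coeffs ?M (rad_coeff m b (e - 1))" if "e \<in> {0..L}" for e
  proof (rule rad_tame)
    have "\<bar>m * b + (e - 1)\<bar> \<le> \<bar>m * b\<bar> + \<bar>e - 1\<bar>" by (rule abs_triangle_ineq)
    moreover have "\<bar>e - 1\<bar> \<le> \<bar>L\<bar> + 1" using that by auto
    moreover have "0 \<le> b\<^sup>2/4" by simp
    ultimately show "\<bar>m * b + (e - 1)\<bar> \<le> ?M" by linarith
  qed simp
  have c: "continuous_on {0..L} (\<lambda>e. rad_coeff m b (e - 1) n)" for n by (rule rad_coeff_continuous)
  have "continuous_on ({0..L} \<times> {-1..1}) (\<lambda>z. rad m b (fst z - 1) (snd z))"
    unfolding rad_def by (rule tame_continuous(1)[where c="\<lambda>e. rad_coeff m b (e - 1)", OF _ t c]) auto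
  then show 1: "continuous_on ({0..L} \<times> {0..1}) (\<lambda>z. rad m b (fst z - 1) (snd z))"
    by (rule continuous_on_subset) auto
  have "continuous_on ({0..L} \<times> {-1..1}) (\<lambda>z. rad' m b (fst z - 1) (snd z))"
    unfolding rad'_def by (rule tame_continuous(2)[where c="\<lambda>e. rad_coeff m b (e - 1)", OF _ t c]) auto
  then have 2: "continuous_on ({0..L} \<times> {0..1}) (\<lambda>z. rad' m b (fst z - 1) (snd z))"
    by (rule continuous_on_subset) auto
  show "continuous_on ({0..L} \<times> {0..1}) (\<lambda>z. flux m b (fst z - 1) (snd z))"
    unfolding flux_def by (intro continuous_intros 1 2)
qed

text \<open>Shooting in the spectral parameter from \<open>-1\<close> to \<open>l\<close>: at \<open>-1\<close> solution and boundary flux are positive, and \<open>trial_inequality\<close> excludes this at \<open>l\<close>. In between there is a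
level with a positive solution and zero flux.\<close>

lemma radial_eigenvalue:
  fixes p p' S T :: "real \<Rightarrow> real"
  assumes l: "l > -1"
    and k: "k \<ge> 1 \<or> (k = 0 \<and> m = 0)"
    and cp: "continuous_on {0..1} p" and p': "\<And>x. 0 < x \<Longrightarrow> x < 1 \<Longrightarrow> (p has_real_derivative p' x) (at x)"
    and cS: "continuous_on {0..1} S" and S': "\<And>x. 0 < x \<Longrightarrow> x < 1 \<Longrightarrow> (S has_real_derivative T x) (at x)"
    and T: "\<And>x. 0 < x \<Longrightarrow> x < 1 \<Longrightarrow>
       x^k / x * ((k * p x + 2 * x * p' x)\<^sup>2 + (m - b*x/2)\<^sup>2 * (p x)\<^sup>2 - l * x * (p x)\<^sup>2) \<le> T x"
    and neg: "S 1 < S 0"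
  shows "\<exists>E<l. (\<forall>x\<in>{0..1}. rad m b E x > 0) \<and> flux m b E 1 = 0"
proof -
  define L where "L = l + 1"
  have L: "L > 0" using l unfolding L_def by simp
  define P where "P = (\<lambda>e. (\<exists>x\<in>{0..1}. rad m b (e-1) x < 0) \<or> flux m b (e-1) 1 < 0)"
  define Q where "Q = (\<lambda>e. (\<forall>x\<in>{0..1}. rad m b (e-1) x > 0) \<and> flux m b (e-1) 1 > 0)"
  have strict: "rad m b E x > 0" if nn: "\<And>x. x \<in> {0..1} \<Longrightarrow> rad m b E x \<ge> 0" "flux m b E 1 \<ge> 0" and x: "x \<in> {0..1}" for E x
  proof (rule ccontr)
    assume "\<not> rad m b E x > 0"
    then have z: "rad m b E x = 0" using nn(1)[OF x] by simp
    then have x0: "x > 0" using x by (cases "x = 0") auto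
    have "rad' m b E x = 0"
    proof (cases "x < 1")
      case True
      show ?thesis
        by (rule DERIV_local_min[OF rad_deriv, of "min x (1-x)"]) (use True x0 z nn(1) in \<open>auto simp: abs_if split: if_splits\<close>)
    next
      case False
      then have x1: "x = 1" using x by simp
      have "rad' m b E 1 \<ge> 0" using nn(2) z x1 unfolding flux_def by simp
      moreover have "rad' m b E 1 \<le> 0"
      proof (rule ccontr)
        assume "\<not> rad' m b E 1 \<le> 0"
        then obtain d where "d > 0" "\<And>h. 0 < h \<Longrightarrow> h < d \<Longrightarrow> rad m b E (1 - h) < rad m b E 1"
          using DERIV_pos_inc_left[OF rad_deriv[of m b E 1]] by auto
        moreover define h where "h = min (1/2) (d/2)"
        ultimately have h: "0 < h" "h < d" "h \<le> 1/2" "\<And>h. 0 < h \<Longrightarrow> h < d \<Longrightarrow> rad m b E (1 - h) < rad m b E 1" by auto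
        then have "rad m b E (1 - h) < 0" using z x1 by force
        then show False using nn(1)[of "1 - h"] h by auto
      qed
      ultimately show ?thesis using x1 by simp
    qed
    then show False using rad_zero_double[OF x0 z] by simp
  qed
  obtain e where e: "0 < e" "e < L" "\<not> P e" "\<not> Q e"
  proof (rule connected_interval_gap[of L P Q])
    show "\<not> (P k \<and> Q k)" for k unfolding P_def Q_def by force
    show "P L"
    proof (rule ccontr)
      assume "\<not> P L"
      then have nn: "\<And>x. x \<in> {0..1} \<Longrightarrow> rad m b l x \<ge> 0" "flux m b l 1 \<ge> 0" unfolding P_def L_def by (auto simp: not_less)
      have "S 0 \<le> S 1" by (rule trial_inequality[OF strict[OF nn] nn(2) k cp p' cS S' T])
      then show False using neg by simp
    qed
    show "Q 0" unfolding Q_def using rad_positive_below_spectrum[of _ m b] by simp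
    show "\<exists>d>0. \<forall>k'\<in>{0..L}. dist k' e < d \<longrightarrow> P k'" if kk: "e \<in> {0..L}" "P e" for e
    proof -
      have s: "continuous_on ({0..L} \<times> {x}) (\<lambda>z. - rad m b (fst z - 1) (snd z))"
              "continuous_on ({0..L} \<times> {x}) (\<lambda>z. - flux m b (fst z - 1) (snd z))" if "x \<in> {0..1}" for x
        using that by (auto intro!: continuous_intros continuous_on_subset[OF rad_joint_continuous(1)] continuous_on_subset[OF rad_joint_continuous(2)])
      from kk(2) consider x where "x \<in> {0..1}" "rad m b (e-1) x < 0" | "flux m b (e-1) 1 < 0" unfolding P_def by blast
      then show ?thesis
      proof cases
        case 1
        have "\<exists>d>0. \<forall>k'\<in>{0..L}. dist k' e < d \<longrightarrow> (\<forall>s\<in>{x}. - rad m b (k'-1) s > 0)"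
          using nearby_positive[of "{x}" "{0..L}" "\<lambda>e s. - rad m b (e-1) s" e, OF _ _ s(1)] kk 1 by auto
        then show ?thesis unfolding P_def using 1(1) by fastforce
      next
        case 2
        have "\<exists>d>0. \<forall>k'\<in>{0..L}. dist k' e < d \<longrightarrow> (\<forall>s\<in>{1}. - flux m b (k'-1) s > 0)"
          using nearby_positive[of "{1}" "{0..L}" "\<lambda>e s. - flux m b (e-1) s" e, OF _ _ s(2)] kk 2 by auto
        then show ?thesis unfolding P_def by fastforce
      qed
    qed
    show "\<exists>d>0. \<forall>k'\<in>{0..L}. dist k' e < d \<longrightarrow> Q k'" if kk: "e \<in> {0..L}" "Q e" for e
    proof -
      obtain d1 where d1: "d1 > 0" "\<forall>k'\<in>{0..L}. dist k' e < d1 \<longrightarrow> (\<forall>s\<in>{0..1}. rad m b (k'-1) s > 0)"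
        using nearby_positive[of "{0..1}" "{0..L}" "\<lambda>e s. rad m b (e-1) s" e, OF _ _ rad_joint_continuous(1)] kk
        unfolding Q_def by auto
      have s: "continuous_on ({0..L} \<times> {1}) (\<lambda>z. flux m b (fst z - 1) (snd z))"
        by (auto intro!: continuous_on_subset[OF rad_joint_continuous(2)])
      obtain d2 where d2: "d2 > 0" "\<forall>k'\<in>{0..L}. dist k' e < d2 \<longrightarrow> (\<forall>s\<in>{1}. flux m b (k'-1) s > 0)"
        using nearby_positive[of "{1}" "{0..L}" "\<lambda>e s. flux m b (e-1) s" e, OF _ _ s] kk
        unfolding Q_def by auto
      show ?thesis unfolding Q_def using d1 d2 by (intro exI[of _ "min d1 d2"]) auto
    qed
  qed (use L in auto)
  have nn: "\<And>x. x \<in> {0..1} \<Longrightarrow> rad m b (e-1) x \<ge> 0" "flux m b (e-1) 1 \<ge> 0"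
    using e(3) unfolding P_def by (auto simp: not_less)
  have pos: "\<forall>x\<in>{0..1}. rad m b (e-1) x > 0" using strict[OF nn] by blast
  then have "flux m b (e-1) 1 = 0" using e(4) nn(2) unfolding Q_def by auto
  then show ?thesis using pos e(2) unfolding L_def by (intro exI[of _ "e-1"]) auto
qed

section \<open>Radial trial functions for every field strength\<close>

text \<open>The energy of the cubic profile with coefficients \<open>c\<close> is an explicit quadratic form, obtained by integrating monomials over \<open>[0,1]\<close>.\<close>

lemma polynomial_trial:
  fixes c :: "nat \<Rightarrow> real"
  assumes m: "m \<ge> 1" and l: "l > -1"
    and neg: "(\<Sum>i<4. \<Sum>j<4. c i * c j * (((real m + 2 * real i) * (real m + 2 * real j) + (real m)\<^sup>2) / real (m+i+j)
      - (m * b + l) / real (m+i+j+1) + b\<^sup>2/4 / real (m+i+j+2))) < 0"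
  shows "\<exists>E<l. (\<forall>x\<in>{0..1}. rad m b E x > 0) \<and> flux m b E 1 = 0"
proof -
  define p where "p = (\<lambda>x. \<Sum>i<(4::nat). c i * x^i)"
  define p' where "p' = (\<lambda>x. \<Sum>i<(4::nat). c i * (real i * x^(i-1)))"
  define A where "A = (\<lambda>i j. (real m + 2 * real i) * (real m + 2 * real j) + (real m)\<^sup>2)"
  define S where "S = (\<lambda>x. \<Sum>i<(4::nat). \<Sum>j<(4::nat). c i * c j * (A i j / real (m+i+j) * x^(m+i+j)
     - (m * b + l) / real (m+i+j+1) * x^(m+i+j+1) + b\<^sup>2/4 / real (m+i+j+2) * x^(m+i+j+2)))"
  define T where "T = (\<lambda>x. \<Sum>i<(4::nat). \<Sum>j<(4::nat). c i * c j * (A i j * x^(m+i+j-1)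
     - (m * b + l) * x^(m+i+j) + b\<^sup>2/4 * x^(m+i+j+1)))"
  have pow: "((\<lambda>x. a / real n * x^n) has_real_derivative a * x^(n-1)) (at x)" if "n > 0" for a x n
    using that by (auto intro!: derivative_eq_intros)
  have pow': "((\<lambda>x. a / real (n+1) * x^(n+1)) has_real_derivative a * x^n) (at x)"
    "((\<lambda>x. a / real (n+2) * x^(n+2)) has_real_derivative a * x^(n+1)) (at x)" for a x n
    using pow[of "n+1"] pow[of "n+2"] by simp_all
  have dS: "(S has_real_derivative T x) (at x)" for x
    unfolding S_def T_def using m
    by (intro DERIV_sum DERIV_cmult DERIV_add DERIV_diff pow pow') auto
  have dp: "(p has_real_derivative p' x) (at x)" for x
    unfolding p_def p'_def by (intro DERIV_sum DERIV_cmult) (auto intro!: derivative_eq_intros)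
  show ?thesis
  proof (rule radial_eigenvalue[OF l, of m m p p' S T])
    have "S 0 = 0" unfolding S_def using m by (simp add: power_0_left)
    moreover have "S 1 = (\<Sum>i<4. \<Sum>j<4. c i * c j * (((real m + 2 * real i) * (real m + 2 * real j) + (real m)\<^sup>2) / real (m+i+j)
      - (m * b + l) / real (m+i+j+1) + b\<^sup>2/4 / real (m+i+j+2)))"
      unfolding S_def A_def by simp
    ultimately show "S 1 < S 0" using neg by (simp only:)
    show "x^m / x * ((m * p x + 2 * x * p' x)\<^sup>2 + (m - b*x/2)\<^sup>2 * (p x)\<^sup>2 - l * x * (p x)\<^sup>2) \<le> T x"
      if x: "0 < x" "x < 1" for x
    proof -
      define r where "r = x^m / x"
      define u where "u = (\<lambda>i. (real m + 2 * real i) * (c i * x^i))"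
      define v where "v = (\<lambda>i::nat. c i * x^i)"
      have xi: "x * (real i * x^(i-1)) = real i * x^i" for i by (cases i) auto
      have "m * p x + 2 * x * p' x = (\<Sum>i<4. m * (c i * x^i) + 2 * (c i * (x * (real i * x^(i-1)))))"
        unfolding p_def p'_def sum_distrib_left sum.distrib by (simp add: mult_ac)
      also have "\<dots> = (\<Sum>i<4. u i)" unfolding u_def xi by (intro sum.cong) (auto simp: algebra_simps)
      finally have U: "m * p x + 2 * x * p' x = (\<Sum>i<4. u i)" .
      have V: "p x = (\<Sum>i<4. v i)" unfolding p_def v_def ..
      have x1: "x^(m+i+j-1) = r * (x^i * x^j)" for i j
        unfolding r_def using x m by (cases m) (auto simp: power_add)
      have x2: "x^(m+i+j) = r * x * (x^i * x^j)" "x^(m+i+j+1) = r * x\<^sup>2 * (x^i * x^j)" for i j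
        unfolding r_def using x by (auto simp: power_add power2_eq_square)
      have "r * ((\<Sum>i<4. u i)\<^sup>2 + (m - b*x/2)\<^sup>2 * (\<Sum>i<4. v i)\<^sup>2 - l * x * (\<Sum>i<4. v i)\<^sup>2)
         = r * ((\<Sum>i<4. \<Sum>j<4. u i * u j) + ((m - b*x/2)\<^sup>2 - l * x) * (\<Sum>i<4. \<Sum>j<4. v i * v j))"
        unfolding power2_eq_square[of "sum _ _"] sum_product by (simp add: algebra_simps)
      also have "\<dots> = (\<Sum>i<4. \<Sum>j<4. r * (u i * u j + ((m - b*x/2)\<^sup>2 - l * x) * (v i * v j)))"
        by (simp only: sum_distrib_left sum.distrib distrib_left)
      also have "\<dots> = T x"
        unfolding T_def x1 x2
        by (intro sum.cong refl) (simp add: u_def v_def A_def power2_eq_square field_simps)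
      finally show ?thesis unfolding U unfolding V r_def by simp
    qed
    show "m \<ge> 1 \<or> (m = 0 \<and> m = 0)" using m by simp
    show "continuous_on {0..1} p" "continuous_on {0..1} S"
      using derivative_imp_continuous_on[OF dp] derivative_imp_continuous_on[OF dS] by blast+
  qed (use dp dS in auto)
qed

lemma radial_eigenvalue_0:
  assumes "0 < b" "b \<le> 89/20" "9/16 * b \<le> l"
  shows "\<exists>E<l. (\<forall>x\<in>{0..1}. rad 0 b E x > 0) \<and> flux 0 b E 1 = 0"
proof (rule radial_eigenvalue[of l 0 0 "\<lambda>_. 1" "\<lambda>_. 0" "\<lambda>x. b\<^sup>2/8 * x\<^sup>2 - l * x" "\<lambda>x. b\<^sup>2/4 * x - l"])
  have "b * b < b * (9/2)" using assms by (intro mult_strict_left_mono) auto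
  then have "b * b < 8 * l" using assms by linarith
  then show "b\<^sup>2/8 * 1\<^sup>2 - l * 1 < b\<^sup>2/8 * 0\<^sup>2 - l * 0" using assms by (simp add: power2_eq_square)
qed (use assms in \<open>auto intro!: continuous_intros derivative_eq_intros simp: power2_eq_square field_simps\<close>)

text \<open>The coefficients in this and the following six lemmas are those of simple cubics in \<open>1 - x\<close> that approximate the ground state in the respective range of \<open>b\<close>.
The energy is a convex quadratic polynomial in \<open>b\<close>, negative between the two endpoints.\<close>

lemma radial_eigenvalue_1:
  assumes "89/20 \<le> b" "b \<le> 38/5" "9/16 * b \<le> l"
  shows "\<exists>E<l. (\<forall>x\<in>{0..1}. rad 1 b E x > 0) \<and> flux 1 b E 1 = 0"
proof -
  let ?c = "(!) [5::real, -6, 4, -1]"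
  have "(\<Sum>i<4. \<Sum>j<4. ?c i * ?c j * (((real 1 + 2 * real i) * (real 1 + 2 * real j) + (real 1)\<^sup>2) / real (1+i+j)
      - (real 1 * b + l) / real (1+i+j+1) + b\<^sup>2/4 / real (1+i+j+2)))
    = 92/7 - 2981/840 * b - 2981/840 * l + 89/180 * b\<^sup>2"
    by (simp add: eval_nat_numeral field_simps)
  also have "\<dots> < 0"
  proof -
    have "0 \<le> (b - 89/20) * (38/5 - b)" using assms by simp
    then have "b\<^sup>2 \<le> 241/20 * b - 1691/50" by (simp add: field_simps power2_eq_square)
    then show ?thesis using assms by linarith
  qed
  finally show ?thesis
    by (rule polynomial_trial[rotated 2]) (use assms in auto)
qed

lemma radial_eigenvalue_2:
  assumes "38/5 \<le> b" "b \<le> 103/10" "9/16 * b \<le> l"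
  shows "\<exists>E<l. (\<forall>x\<in>{0..1}. rad 2 b E x > 0) \<and> flux 2 b E 1 = 0"
proof -
  let ?c = "(!) [5::real, -9, 7, -2]"
  have "(\<Sum>i<4. \<Sum>j<4. ?c i * ?c j * (((real 2 + 2 * real i) * (real 2 + 2 * real j) + (real 2)\<^sup>2) / real (2+i+j)
      - (real 2 * b + l) / real (2+i+j+1) + b\<^sup>2/4 / real (2+i+j+2)))
    = 121/15 - 496/315 * b - 248/315 * l + 1193/10080 * b\<^sup>2"
    by (simp add: eval_nat_numeral field_simps)
  also have "\<dots> < 0"
  proof -
    have "0 \<le> (b - 38/5) * (103/10 - b)" using assms by simp
    then have "b\<^sup>2 \<le> 179/10 * b - 1957/25" by (simp add: field_simps power2_eq_square)
    then show ?thesis using assms by linarith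
  qed
  finally show ?thesis
    by (rule polynomial_trial[rotated 2]) (use assms in auto)
qed

lemma radial_eigenvalue_3:
  assumes "103/10 \<le> b" "b \<le> 129/10" "9/16 * b \<le> l"
  shows "\<exists>E<l. (\<forall>x\<in>{0..1}. rad 3 b E x > 0) \<and> flux 3 b E 1 = 0"
proof -
  let ?c = "(!) [10::real, -22, 19, -6]"
  have "(\<Sum>i<4. \<Sum>j<4. ?c i * ?c j * (((real 3 + 2 * real i) * (real 3 + 2 * real j) + (real 3)\<^sup>2) / real (3+i+j)
      - (real 3 * b + l) / real (3+i+j+1) + b\<^sup>2/4 / real (3+i+j+2)))
    = 1706/105 - 689/280 * b - 689/840 * l + 3551/27720 * b\<^sup>2"
    by (simp add: eval_nat_numeral field_simps)
  also have "\<dots> < 0"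
  proof -
    have "0 \<le> (b - 103/10) * (129/10 - b)" using assms by simp
    then have "b\<^sup>2 \<le> 116/5 * b - 13287/100" by (simp add: field_simps power2_eq_square)
    then show ?thesis using assms by linarith
  qed
  finally show ?thesis
    by (rule polynomial_trial[rotated 2]) (use assms in auto)
qed

lemma radial_eigenvalue_4:
  assumes "129/10 \<le> b" "b \<le> 77/5" "9/16 * b \<le> l"
  shows "\<exists>E<l. (\<forall>x\<in>{0..1}. rad 4 b E x > 0) \<and> flux 4 b E 1 = 0"
proof -
  let ?c = "(!) [15::real, -37, 34, -11]"
  have "(\<Sum>i<4. \<Sum>j<4. ?c i * ?c j * (((real 4 + 2 * real i) * (real 4 + 2 * real j) + (real 4)\<^sup>2) / real (4+i+j)
      - (real 4 * b + l) / real (4+i+j+1) + b\<^sup>2/4 / real (4+i+j+2)))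
    = 671/35 - 787/315 * b - 787/1260 * l + 209/2016 * b\<^sup>2"
    by (simp add: eval_nat_numeral field_simps)
  also have "\<dots> < 0"
  proof -
    have "0 \<le> (b - 129/10) * (77/5 - b)" using assms by simp
    then have "b\<^sup>2 \<le> 283/10 * b - 9933/50" by (simp add: field_simps power2_eq_square)
    then show ?thesis using assms by linarith
  qed
  finally show ?thesis
    by (rule polynomial_trial[rotated 2]) (use assms in auto)
qed

lemma radial_eigenvalue_5:
  assumes "77/5 \<le> b" "b \<le> 89/5" "9/16 * b \<le> l"
  shows "\<exists>E<l. (\<forall>x\<in>{0..1}. rad 5 b E x > 0) \<and> flux 5 b E 1 = 0"
proof -
  let ?c = "(!) [25::real, -65, 61, -20]"
  have "(\<Sum>i<4. \<Sum>j<4. ?c i * ?c j * (((real 5 + 2 * real i) * (real 5 + 2 * real j) + (real 5)\<^sup>2) / real (5+i+j)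
      - (real 5 * b + l) / real (5+i+j+1) + b\<^sup>2/4 / real (5+i+j+2)))
    = 20204/693 - 17987/5544 * b - 17987/27720 * l + 1767/16016 * b\<^sup>2"
    by (simp add: eval_nat_numeral field_simps)
  also have "\<dots> < 0"
  proof -
    have "0 \<le> (b - 77/5) * (89/5 - b)" using assms by simp
    then have "b\<^sup>2 \<le> 166/5 * b - 6853/25" by (simp add: field_simps power2_eq_square)
    then show ?thesis using assms by linarith
  qed
  finally show ?thesis
    by (rule polynomial_trial[rotated 2]) (use assms in auto)
qed

lemma radial_eigenvalue_6:
  assumes "89/5 \<le> b" "b \<le> 201/10" "9/16 * b \<le> l"
  shows "\<exists>E<l. (\<forall>x\<in>{0..1}. rad 6 b E x > 0) \<and> flux 6 b E 1 = 0"
proof -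
  let ?c = "(!) [35::real, -96, 93, -31]"
  have "(\<Sum>i<4. \<Sum>j<4. ?c i * ?c j * (((real 6 + 2 * real i) * (real 6 + 2 * real j) + (real 6)\<^sup>2) / real (6+i+j)
      - (real 6 * b + l) / real (6+i+j+1) + b\<^sup>2/4 / real (6+i+j+2)))
    = 1729/55 - 2231/715 * b - 2231/4290 * l + 44117/480480 * b\<^sup>2"
    by (simp add: eval_nat_numeral field_simps)
  also have "\<dots> < 0"
  proof -
    have "0 \<le> (b - 89/5) * (201/10 - b)" using assms by simp
    then have "b\<^sup>2 \<le> 379/10 * b - 17889/50" by (simp add: field_simps power2_eq_square)
    then show ?thesis using assms by linarith
  qed
  finally show ?thesis
    by (rule polynomial_trial[rotated 2]) (use assms in auto)
qed

lemma radial_eigenvalue_7: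
  assumes "201/10 \<le> b" "b \<le> 443/20" "9/16 * b \<le> l"
  shows "\<exists>E<l. (\<forall>x\<in>{0..1}. rad 7 b E x > 0) \<and> flux 7 b E 1 = 0"
proof -
  let ?c = "(!) [49::real, -136, 132, -44]"
  have "(\<Sum>i<4. \<Sum>j<4. ?c i * ?c j * (((real 7 + 2 * real i) * (real 7 + 2 * real j) + (real 7)\<^sup>2) / real (7+i+j)
      - (real 7 * b + l) / real (7+i+j+1) + b\<^sup>2/4 / real (7+i+j+2)))
    = 23678/585 - 16927/4680 * b - 16927/32760 * l + 16867/180180 * b\<^sup>2"
    by (simp add: eval_nat_numeral field_simps)
  also have "\<dots> < 0"
  proof -
    have "0 \<le> (b - 201/10) * (443/20 - b)" using assms by simp
    then have "b\<^sup>2 \<le> 169/4 * b - 89043/200" by (simp add: field_simps power2_eq_square)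
    then show ?thesis using assms by linarith
  qed
  finally show ?thesis
    by (rule polynomial_trial[rotated 2]) (use assms in auto)
qed

context de_Gennes begin

text \<open>Here \<open>\<epsilon> = 2 / sqrt b\<close>, and \<open>m\<close> is the integer for which the centre of the oscillator falls into the interval required by \<open>boundary_layer_trial\<close>.\<close>

lemma radial_eigenvalue_large:
  assumes b: "443/20 \<le> b"
  shows "\<exists>m. \<exists>E<\<kappa>\<^sup>2 * b. (\<forall>x\<in>{0..1}. rad m b E x > 0) \<and> flux m b E 1 = 0"
proof -
  define \<epsilon> where "\<epsilon> = 2 / sqrt b"
  have sq: "sqrt b \<ge> 80/17" using b by (intro real_le_rsqrt) (simp add: power2_eq_square)
  then have sp: "sqrt b > 0" by linarith
  have e: "0 < \<epsilon>" unfolding \<epsilon>_def using sp by simp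
  have e1: "\<epsilon> \<le> 17/40" unfolding \<epsilon>_def using sq sp by (simp only: pos_divide_le_eq)
  have be: "b = 4 / \<epsilon>\<^sup>2" unfolding \<epsilon>_def using b by (simp add: power_divide)
  define y where "y = (1/\<epsilon> - \<kappa> - 11/100 * \<epsilon>) * (2/\<epsilon>)"
  have "1/\<epsilon> \<ge> 40/17" using e e1 by (simp add: field_simps)
  then have "1/\<epsilon> - \<kappa> - 11/100 * \<epsilon> \<ge> 0" using e e1 kappa_less_1 by simp
  then have y0: "y \<ge> 0" unfolding y_def using e by simp
  define m where "m = nat \<lceil>y\<rceil>"
  have m: "y \<le> m" "m < y + 1" unfolding m_def using y0 by linarith+
  define s where "s = 1/\<epsilon> - m * \<epsilon>/2"
  have ye: "y * (\<epsilon>/2) = 1/\<epsilon> - \<kappa> - 11/100 * \<epsilon>" unfolding y_def using e by simp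
  have s: "\<kappa> - 39/100 * \<epsilon> \<le> s" "s \<le> \<kappa> + 11/100 * \<epsilon>"
  proof -
    have "y * (\<epsilon>/2) \<le> m * (\<epsilon>/2)" "m * (\<epsilon>/2) \<le> (y + 1) * (\<epsilon>/2)" using m e by (auto intro!: mult_right_mono)
    then show "\<kappa> - 39/100 * \<epsilon> \<le> s" "s \<le> \<kappa> + 11/100 * \<epsilon>" unfolding s_def using ye by (simp_all add: distrib_right)
  qed
  obtain H h where H: "\<And>t. t \<ge> 0 \<Longrightarrow> (H has_real_derivative h t) (at t)" "\<And>t. energy_density \<epsilon> s t \<le> h t"
    "H 0 = 0" "H (1/\<epsilon>) < 0"
    using boundary_layer_trial[OF e e1 s] by blast
  have lin: "((\<lambda>x. (1 - x)/\<epsilon>) has_real_derivative - 1/\<epsilon>) (at x)" for x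
    using e by (auto intro!: derivative_eq_intros)
  have dH: "((\<lambda>x. - (4/\<epsilon>) * H ((1-x)/\<epsilon>)) has_real_derivative 4/\<epsilon>\<^sup>2 * h ((1-x)/\<epsilon>)) (at x)" if "x \<le> 1" for x
  proof -
    have "(1-x)/\<epsilon> \<ge> 0" using that e by simp
    then have "((\<lambda>x. - (4/\<epsilon>) * H ((1-x)/\<epsilon>)) has_real_derivative - (4/\<epsilon>) * (h ((1-x)/\<epsilon>) * (- 1/\<epsilon>))) (at x)"
      by (intro DERIV_cmult DERIV_chain2[OF H(1) lin])
    then show ?thesis by (simp add: power2_eq_square)
  qed
  have dp: "((\<lambda>x. trial \<epsilon> ((1-x)/\<epsilon>)) has_real_derivative trial' \<epsilon> ((1-x)/\<epsilon>) * (- 1/\<epsilon>)) (at x)" for x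
    by (rule DERIV_chain2[OF trial_deriv lin])
  have "\<exists>E<\<kappa>\<^sup>2 * b. (\<forall>x\<in>{0..1}. rad m b E x > 0) \<and> flux m b E 1 = 0"
  proof (rule radial_eigenvalue[of "\<kappa>\<^sup>2 * b" 1 m "\<lambda>x. trial \<epsilon> ((1-x)/\<epsilon>)" "\<lambda>x. trial' \<epsilon> ((1-x)/\<epsilon>) * (- 1/\<epsilon>)"
        "\<lambda>x. - (4/\<epsilon>) * H ((1-x)/\<epsilon>)" "\<lambda>x. 4/\<epsilon>\<^sup>2 * h ((1-x)/\<epsilon>)"])
    have "\<kappa>\<^sup>2 * b \<ge> 0" using b by simp
    then show "\<kappa>\<^sup>2 * b > -1" by linarith
    show "continuous_on {0..1} (\<lambda>x. trial \<epsilon> ((1-x)/\<epsilon>))" by (rule derivative_imp_continuous_on[OF dp])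
    show "continuous_on {0..1} (\<lambda>x. - (4/\<epsilon>) * H ((1-x)/\<epsilon>))" by (rule derivative_imp_continuous_on[OF dH]) auto
    show "- (4/\<epsilon>) * H ((1-1)/\<epsilon>) < - (4/\<epsilon>) * H ((1-0)/\<epsilon>)" using H(3,4) e by (simp add: field_simps)
    fix x :: real assume x: "0 < x" "x < 1"
    show "((\<lambda>x. trial \<epsilon> ((1-x)/\<epsilon>)) has_real_derivative trial' \<epsilon> ((1-x)/\<epsilon>) * (- 1/\<epsilon>)) (at x)" by (rule dp)
    show "((\<lambda>x. - (4/\<epsilon>) * H ((1-x)/\<epsilon>)) has_real_derivative 4/\<epsilon>\<^sup>2 * h ((1-x)/\<epsilon>)) (at x)" using dH x by simp
    define t where "t = (1-x)/\<epsilon>"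
    define g where "g = trial \<epsilon> t"
    define g' where "g' = trial' \<epsilon> t"
    have xt: "x = 1 - \<epsilon> * t" unfolding t_def using e by simp
    have 1: "real 1 * g + 2 * x * (g' * (- 1/\<epsilon>)) = - (2/\<epsilon>) * (x * g' - \<epsilon>/2 * g)" using e by (simp add: field_simps)
    have 2: "m - b*x/2 = (2/\<epsilon>) * (t - s)" unfolding be s_def xt using e by (simp add: field_simps power2_eq_square)
    have "x^1/x * ((real 1 * g + 2 * x * (g' * (- 1/\<epsilon>)))\<^sup>2 + (m - b*x/2)\<^sup>2 * g\<^sup>2 - \<kappa>\<^sup>2 * b * x * g\<^sup>2)
       = 4/\<epsilon>\<^sup>2 * ((x * g' - \<epsilon>/2 * g)\<^sup>2 + (t - s)\<^sup>2 * g\<^sup>2 - \<kappa>\<^sup>2 * x * g\<^sup>2)"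
    proof -
      define \<delta> where "\<delta> = 2/\<epsilon>"
      have d: "b = \<delta>\<^sup>2" "4/\<epsilon>\<^sup>2 = \<delta>\<^sup>2" unfolding \<delta>_def be by (simp_all add: power_divide)
      have "x^1/x = 1" using x by simp
      then show ?thesis unfolding 1 2 unfolding d \<delta>_def[symmetric] by algebra
    qed
    also have "\<dots> = 4/\<epsilon>\<^sup>2 * energy_density \<epsilon> s t"
      unfolding energy_density_def g_def g'_def xt ..
    also have "\<dots> \<le> 4/\<epsilon>\<^sup>2 * h t" using H(2)[of t] by (intro mult_left_mono) auto
    finally show "x^1/x * ((real 1 * trial \<epsilon> ((1-x)/\<epsilon>) + 2 * x * (trial' \<epsilon> ((1-x)/\<epsilon>) * (- 1/\<epsilon>)))\<^sup>2 + (m - b*x/2)\<^sup>2 * (trial \<epsilon> ((1-x)/\<epsilon>))\<^sup>2 - \<kappa>\<^sup>2 * b * x * (trial \<epsilon> ((1-x)/\<epsilon>))\<^sup>2)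
       \<le> 4/\<epsilon>\<^sup>2 * h ((1-x)/\<epsilon>)" unfolding g_def g'_def t_def .
  qed simp
  then show ?thesis by blast
qed

theorem radial_eigenvalue_below:
  assumes "b > 0"
  shows "\<exists>m. \<exists>E<\<kappa>\<^sup>2 * b. (\<forall>x\<in>{0..1}. rad m b E x > 0) \<and> flux m b E 1 = 0"
proof -
  have "(3/4)\<^sup>2 \<le> \<kappa>\<^sup>2" using kappa_bounds by (intro power_mono) auto
  then have l: "9/16 * b \<le> \<kappa>\<^sup>2 * b" using assms by (intro mult_right_mono) (auto simp: power2_eq_square)
  consider "b \<le> 89/20" | "89/20 \<le> b" "b \<le> 38/5" | "38/5 \<le> b" "b \<le> 103/10" | "103/10 \<le> b" "b \<le> 129/10" | "129/10 \<le> b" "b \<le> 77/5" | "77/5 \<le> b" "b \<le> 89/5" | "89/5 \<le> b" "b \<le> 201/10" | "201/10 \<le> b" "b \<le> 443/20" | "443/20 \<le> b"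
    by linarith
  then show ?thesis
  proof cases
    case 1 then show ?thesis using radial_eigenvalue_0[OF assms _ l] by blast
  next
    case 2 then show ?thesis using radial_eigenvalue_1[OF _ _ l] by blast
  next
    case 3 then show ?thesis using radial_eigenvalue_2[OF _ _ l] by blast
  next
    case 4 then show ?thesis using radial_eigenvalue_3[OF _ _ l] by blast
  next
    case 5 then show ?thesis using radial_eigenvalue_4[OF _ _ l] by blast
  next
    case 6 then show ?thesis using radial_eigenvalue_5[OF _ _ l] by blast
  next
    case 7 then show ?thesis using radial_eigenvalue_6[OF _ _ l] by blast
  next
    case 8 then show ?thesis using radial_eigenvalue_7[OF _ _ l] by blast
  next
    case 9 then show ?thesis by (rule radial_eigenvalue_large)
  qed
qed

end

section \<open>Smooth functions and test functions\<close>

definition smooth :: "('a::euclidean_space \<Rightarrow> complex) \<Rightarrow> bool" where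
  "smooth f \<longleftrightarrow> (\<forall>k. Ck k f)"

abbreviation pd :: "'a::euclidean_space \<Rightarrow> ('a \<Rightarrow> complex) \<Rightarrow> 'a \<Rightarrow> complex" where
  "pd e f x \<equiv> frechet_derivative f (at x) e"

lemma pd_eq: "(f has_derivative D) (at x) \<Longrightarrow> pd e f x = D e"
  using frechet_derivative_at by metis

lemma Ck_SucI:
  assumes "\<And>x. (f has_derivative D x) (at x)" "\<And>e. e \<in> Basis \<Longrightarrow> Ck k (\<lambda>x. D x e)"
  shows "Ck (Suc k) f"
proof -
  have "(\<lambda>x. pd e f x) = (\<lambda>x. D x e)" for e using pd_eq[OF assms(1)] by auto
  then show ?thesis using assms by (auto simp: differentiable_def)
qed

lemma Ck_SucD:
  assumes "Ck (Suc k) f"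
  shows "(f has_derivative frechet_derivative f (at x)) (at x)" "e \<in> Basis \<Longrightarrow> Ck k (\<lambda>x. pd e f x)"
  using assms frechet_derivative_works by auto

lemma Ck_Suc_imp: "Ck (Suc k) f \<Longrightarrow> Ck k f"
proof (induction k arbitrary: f)
  case 0
  then show ?case
    by (auto simp: continuous_at_imp_continuous_on differentiable_imp_continuous_within)
next
  case (Suc k)
  then have "\<forall>e\<in>Basis. Ck k (\<lambda>x. pd e f x)" by simp
  then show ?case using Suc.prems by simp
qed

lemma Ck_imp_continuous: "Ck k f \<Longrightarrow> continuous_on S f"
proof (induction k)
  case 0 then show ?case by (auto intro: continuous_on_subset)
next
  case (Suc k) then show ?case using Ck_Suc_imp by blast
qed

lemma Ck_const: "Ck k (\<lambda>x. c)"
  by (induction k arbitrary: c) (auto intro!: Ck_SucI[where D="\<lambda>_ _. 0"])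

lemma Ck_add: "Ck k f \<Longrightarrow> Ck k g \<Longrightarrow> Ck k (\<lambda>x. f x + g x)"
proof (induction k arbitrary: f g)
  case (Suc k)
  show ?case
    by (rule Ck_SucI[OF has_derivative_add[OF Ck_SucD(1)[OF Suc.prems(1)] Ck_SucD(1)[OF Suc.prems(2)]]])
       (rule Suc.IH[OF Ck_SucD(2)[OF Suc.prems(1)] Ck_SucD(2)[OF Suc.prems(2)]])
qed (auto intro: continuous_intros)

lemma Ck_mult: "Ck k f \<Longrightarrow> Ck k g \<Longrightarrow> Ck k (\<lambda>x. f x * g x)"
proof (induction k arbitrary: f g)
  case (Suc k)
  show ?case
    by (rule Ck_SucI[OF has_derivative_mult[OF Ck_SucD(1)[OF Suc.prems(1)] Ck_SucD(1)[OF Suc.prems(2)]]])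
       (intro Ck_add Suc.IH Ck_SucD(2)[OF Suc.prems(1)] Ck_SucD(2)[OF Suc.prems(2)] Ck_Suc_imp[OF Suc.prems(1)] Ck_Suc_imp[OF Suc.prems(2)])
qed (auto intro: continuous_intros)

lemma Ck_cnj: "Ck k f \<Longrightarrow> Ck k (\<lambda>x. cnj (f x))"
proof (induction k arbitrary: f)
  case (Suc k)
  show ?case
    by (rule Ck_SucI[OF has_derivative_cnj[OF Ck_SucD(1)[OF Suc.prems]]])
       (rule Suc.IH[OF Ck_SucD(2)[OF Suc.prems]])
qed (auto intro: continuous_intros)

lemma smooth_const: "smooth (\<lambda>x. c)"
  and smooth_add: "smooth f \<Longrightarrow> smooth g \<Longrightarrow> smooth (\<lambda>x. f x + g x)"
  and smooth_mult: "smooth f \<Longrightarrow> smooth g \<Longrightarrow> smooth (\<lambda>x. f x * g x)"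
  and smooth_cnj: "smooth f \<Longrightarrow> smooth (\<lambda>x. cnj (f x))"
  unfolding smooth_def using Ck_const Ck_add Ck_mult Ck_cnj by blast+

lemma smooth_power: "smooth f \<Longrightarrow> smooth (\<lambda>x. f x ^ n)"
  by (induction n) (auto intro: smooth_const smooth_mult)

lemma smooth_prod: "(\<And>i. i \<in> I \<Longrightarrow> smooth (f i)) \<Longrightarrow> smooth (\<lambda>x. \<Prod>i\<in>I. f i x)"
  by (induction I rule: infinite_finite_induct) (auto intro: smooth_const smooth_mult)

lemma smooth_linear:
  assumes "bounded_linear l"
  shows "smooth l"
  unfolding smooth_def
proof
  fix k show "Ck k l"
  proof (cases k)
    case 0 then show ?thesis using linear_continuous_on[OF assms] by simp
  next
    case (Suc j)
    then show ?thesis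
      using Ck_SucI[of l "\<lambda>_. l" j, OF bounded_linear_imp_has_derivative[OF assms] Ck_const] by simp
  qed
qed

lemma smooth_of_real_inner: "smooth (\<lambda>x::'a::euclidean_space. complex_of_real (x \<bullet> v))"
  by (rule smooth_linear)
     (rule bounded_linear_compose[OF bounded_linear_of_real bounded_linear_inner_left])

lemma smoothD:
  assumes "smooth f"
  shows "(f has_derivative frechet_derivative f (at x)) (at x)" "continuous_on S f"
    "e \<in> Basis \<Longrightarrow> smooth (\<lambda>x. pd e f x)"
  using assms Ck_SucD Ck_imp_continuous[of 0 f S] unfolding smooth_def by blast+

text \<open>Working with a whole family \<open>H n\<close> closed under differentiation makes the induction on the order of differentiability immediate.\<close>

lemma smooth_compose_real:
  fixes s :: "'a::euclidean_space \<Rightarrow> real"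
  assumes H: "\<And>n t. (H n has_real_derivative H (Suc n) t) (at t)"
    and s: "\<And>x. (s has_derivative s' x) (at x)"
    and s': "\<And>e. e \<in> Basis \<Longrightarrow> smooth (\<lambda>x. complex_of_real (s' x e))"
  shows "smooth (\<lambda>x. complex_of_real (H n (s x)))"
  unfolding smooth_def
proof
  fix k show "Ck k (\<lambda>x. complex_of_real (H n (s x)))"
  proof (induction k arbitrary: n)
    case 0
    have "continuous_on UNIV (H n)" using derivative_imp_continuous_on[OF H] .
    moreover have "continuous_on UNIV s" by (rule has_derivative_continuous_on[of UNIV s s']) (simp add: s)
    ultimately have "continuous_on UNIV (\<lambda>x. H n (s x))" by (rule continuous_on_compose2) auto
    then show ?case by (auto intro: continuous_intros)
  next
    case (Suc k)
    have "((\<lambda>x. H n (s x)) has_derivative (\<lambda>h. H (Suc n) (s x) * s' x h)) (at x)" for x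
      using has_derivative_compose[OF s H[unfolded has_field_derivative_def]] by simp
    then have "((\<lambda>x. complex_of_real (H n (s x))) has_derivative (\<lambda>h. complex_of_real (H (Suc n) (s x) * s' x h))) (at x)" for x
      by (rule has_derivative_of_real)
    then show ?case
      by (rule Ck_SucI) (use Suc s' in \<open>auto simp: smooth_def intro!: Ck_mult\<close>)
  qed
qed

text \<open>A class of functions closed under differentiation that contains the standard bump function \<open>exp (-1/t)\<close>.\<close>

definition flat :: "real poly \<Rightarrow> real \<Rightarrow> real" where
  "flat p t = (if t > 0 then poly p (1/t) * exp (-1/t) else 0)"

lemma flat_deriv: "(flat p has_real_derivative flat ([:0,0,1:] * (p - pderiv p)) t) (at t)"
proof -
  consider "t > 0" | "t < 0" | "t = 0" by linarith
  then show ?thesis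
  proof cases
    case 1
    have "((\<lambda>t. poly p (1/t) * exp (-1/t)) has_real_derivative flat ([:0,0,1:] * (p - pderiv p)) t) (at t)"
      unfolding flat_def using 1
      by (auto intro!: derivative_eq_intros DERIV_chain2[OF poly_DERIV] simp: field_simps power2_eq_square)
    moreover have ev: "\<forall>\<^sub>F s in nhds t. poly p (1/s) * exp (-1/s) = flat p s"
      using eventually_nhds_in_open[of "{0<..}" t] 1 by (auto elim!: eventually_mono simp: flat_def)
    ultimately show ?thesis using DERIV_cong_ev[OF refl ev refl] by blast
  next
    case 2
    have "((\<lambda>t. 0) has_real_derivative 0) (at t)" by simp
    moreover have ev: "\<forall>\<^sub>F s in nhds t. (0::real) = flat p s"
      using eventually_nhds_in_open[of "{..<0}" t] 2 by (auto elim!: eventually_mono simp: flat_def)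
    ultimately have "(flat p has_real_derivative 0) (at t)" using DERIV_cong_ev[OF refl ev refl] by blast
    then show ?thesis using 2 by (simp add: flat_def)
  next
    case 3
    obtain K where K: "K \<ge> 0" "\<And>y. y \<ge> 0 \<Longrightarrow> \<bar>poly ([:0,1:] * p) y\<bar> \<le> K * exp (1/2*y)"
      using poly_exp_bound[of "1/2" "[:0,1:] * p"] by auto
    have "\<bar>(flat p (0 + h) - flat p 0) / h\<bar> \<le> 2 * K * \<bar>h\<bar>" for h
    proof (cases "h > 0")
      case True
      have "\<bar>(flat p (0 + h) - flat p 0) / h\<bar> = \<bar>poly ([:0,1:] * p) (1/h)\<bar> * exp (-1/h)"
        using True by (simp add: flat_def abs_mult)
      also have "\<dots> \<le> (K * exp (1/2*(1/h))) * exp (-1/h)" using K(2)[of "1/h"] True by (intro mult_right_mono) auto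
      also have "\<dots> = K * exp (- (1/(2*h)))" by (simp add: mult.assoc field_simps flip: exp_add)
      also have "\<dots> \<le> K * (2*h)"
      proof (intro mult_left_mono K(1))
        have "1/(2*h) \<le> exp (1/(2*h))" using exp_ge_add_one_self[of "1/(2*h)"] by linarith
        then show "exp (- (1/(2*h))) \<le> 2*h" using True by (simp add: exp_minus field_simps)
      qed
      finally show ?thesis using True by (simp add: mult_ac)
    next
      case False
      then have "(flat p (0 + h) - flat p 0) / h = 0" by (simp add: flat_def)
      then show ?thesis using K(1) by (simp only: abs_zero) (intro mult_nonneg_nonneg; simp)
    qed
    then have "\<forall>\<^sub>F h in at 0. norm ((flat p (0 + h) - flat p 0) / h) \<le> 2 * K * \<bar>h\<bar>"
      by (intro always_eventually allI) (simp only: real_norm_def)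
    moreover have "((\<lambda>h. 2 * K * \<bar>h\<bar>) \<longlongrightarrow> 0) (at 0)" by (auto intro!: tendsto_eq_intros)
    ultimately have "((\<lambda>h. (flat p (0 + h) - flat p 0) / h) \<longlongrightarrow> 0) (at 0)" by (rule Lim_null_comparison)
    then show ?thesis using 3 by (simp add: DERIV_def flat_def)
  qed
qed

definition bump :: "real \<Rightarrow> real" where "bump t = (if t > 0 then exp (-1/t) else 0)"
definition bump' :: "real \<Rightarrow> real" where "bump' t = (if t > 0 then exp (-1/t) / t\<^sup>2 else 0)"

lemma bump_deriv: "(bump has_real_derivative bump' t) (at t)"
proof -
  have "flat 1 = bump" "flat ([:0,0,1:] * (1 - pderiv 1)) t = bump' t"
    by (auto simp: flat_def bump_def bump'_def fun_eq_iff power2_eq_square field_simps)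
  then show ?thesis using flat_deriv[of 1 t] by simp
qed

lemma bump_bounds: "0 \<le> bump t" "bump t \<le> 1"
  unfolding bump_def by auto

lemma smooth_bump:
  fixes s :: "'a::euclidean_space \<Rightarrow> real"
  assumes s: "\<And>x. (s has_derivative s' x) (at x)"
    and s': "\<And>e. e \<in> Basis \<Longrightarrow> smooth (\<lambda>x. complex_of_real (s' x e))"
  shows "smooth (\<lambda>x. complex_of_real (bump (s x)))"
proof -
  define H where "H = (\<lambda>n. flat (((\<lambda>p. [:0,0,1:] * (p - pderiv p)) ^^ n) 1))"
  have "(H n has_real_derivative H (Suc n) t) (at t)" for n t
    unfolding H_def using flat_deriv by simp
  from smooth_compose_real[where H=H and s=s and s'=s' and n=0, OF this s s']
  have "smooth (\<lambda>x. complex_of_real (flat 1 (s x)))" unfolding H_def by simp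
  moreover have "flat 1 = bump" by (auto simp: flat_def bump_def fun_eq_iff)
  ultimately show ?thesis by simp
qed

lemma compact_support_integrable:
  fixes \<psi> :: "'a::euclidean_space \<Rightarrow> complex"
  assumes c: "continuous_on UNIV \<psi>" and K: "compact K" "\<And>x. x \<notin> K \<Longrightarrow> \<psi> x = 0"
  shows "integrable lborel \<psi>"
proof -
  have "integrable lborel (\<lambda>x. indicator K x *\<^sub>R \<psi> x)"
    by (rule borel_integrable_compact[OF K(1) continuous_on_subset[OF c]]) auto
  moreover have "(\<lambda>x. indicator K x *\<^sub>R \<psi> x) = \<psi>" using K(2) by (auto simp: indicator_def)
  ultimately show ?thesis by simp
qed

text \<open>Translation invariance makes the integral of every difference quotient zero; the quotients converge boundedly to the derivative.\<close>

lemma integral_partial_zero: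
  fixes \<psi> :: "'a::euclidean_space \<Rightarrow> complex"
  assumes d: "\<And>x. (\<psi> has_derivative \<psi>' x) (at x)" and c: "continuous_on UNIV (\<lambda>x. \<psi>' x e)"
    and K: "compact K" "\<And>x. x \<notin> K \<Longrightarrow> \<psi> x = 0" "\<And>x. x \<notin> K \<Longrightarrow> \<psi>' x e = 0" and e: "e \<in> Basis"
  shows "(LINT x|lborel. \<psi>' x e) = 0"
proof -
  have c\<psi>: "continuous_on UNIV \<psi>" by (rule has_derivative_continuous_on[of UNIV \<psi> \<psi>']) (simp add: d)
  have [measurable]: "\<psi> \<in> borel_measurable borel" "(\<lambda>x. \<psi>' x e) \<in> borel_measurable borel"
    using c\<psi> c by (auto intro: borel_measurable_continuous_onI)
  have int\<psi>: "integrable lborel \<psi>" by (rule compact_support_integrable[OF c\<psi> K(1,2)])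
  obtain R where R: "\<And>x. x \<in> K \<Longrightarrow> norm x \<le> R" using compact_imp_bounded[OF K(1)] by (auto simp: bounded_iff)
  obtain B where B: "\<And>x. norm (\<psi>' x e) \<le> B"
  proof -
    have "bounded ((\<lambda>x. \<psi>' x e) ` K)" by (intro compact_imp_bounded compact_continuous_image continuous_on_subset[OF c] K) auto
    then obtain B where "\<forall>x\<in>K. norm (\<psi>' x e) \<le> B" by (auto simp: bounded_iff)
    then have "norm (\<psi>' x e) \<le> max B 0" for x using K(3)[of x] by (cases "x \<in> K") (auto simp: le_max_iff_disj)
    then show ?thesis using that by blast
  qed
  have B0: "B \<ge> 0" using B[of 0] norm_ge_zero order_trans by blast
  define t where "t = (\<lambda>n. 1 / real (Suc n))"
  define q where "q = (\<lambda>n x. (\<psi> (t n *\<^sub>R e + x) - \<psi> x) /\<^sub>R t n)"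
  have t: "0 < t n" "t n \<le> 1" for n unfolding t_def by auto
  have ne: "norm e = 1" using e by simp
  have shift: "integrable lborel (\<lambda>x. \<psi> (a + x))" "(LINT x|lborel. \<psi> (a + x)) = (LINT x|lborel. \<psi> x)" for a
  proof -
    have "integrable (distr lborel borel ((+) a)) \<psi>" "(LINT x|distr lborel borel ((+) a). \<psi> x) = (LINT x|lborel. \<psi> x)"
      using int\<psi> by (simp_all add: lborel_distr_plus)
    then show "integrable lborel (\<lambda>x. \<psi> (a + x))" "(LINT x|lborel. \<psi> (a + x)) = (LINT x|lborel. \<psi> x)"
      by (simp_all add: integrable_distr_eq integral_distr)
  qed
  have q0: "(LINT x|lborel. q n x) = 0" for n
    unfolding q_def using shift int\<psi> by simp
  have "(\<lambda>n. LINT x|lborel. q n x) \<longlonglongrightarrow> (LINT x|lborel. \<psi>' x e)"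
  proof (rule integral_dominated_convergence[where w="\<lambda>x. B * indicator (cball 0 (R+1)) x"])
    show "integrable lborel (\<lambda>x::'a. B * indicator (cball 0 (R+1)) x)"
      by (intro integrable_mult_right integrable_real_indicator) (use emeasure_bounded_finite[OF bounded_cball] in auto)
    show "AE x in lborel. (\<lambda>n. q n x) \<longlonglongrightarrow> \<psi>' x e"
    proof (rule AE_I2)
      fix x
      have "((\<lambda>h. norm (\<psi> (x + h) - \<psi> x - \<psi>' x h) / norm h) \<longlongrightarrow> 0) (at 0)"
        using d[of x] unfolding has_derivative_at by blast
      moreover have "filterlim (\<lambda>n. t n *\<^sub>R e) (at 0) sequentially"
      proof -
        have "t \<longlonglongrightarrow> 0" unfolding t_def using LIMSEQ_inverse_real_of_nat by (simp add: inverse_eq_divide)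
        then have "(\<lambda>n. t n *\<^sub>R e) \<longlonglongrightarrow> 0 *\<^sub>R e" by (intro tendsto_intros)
        moreover have "t n *\<^sub>R e \<noteq> 0" for n using t(1)[of n] ne by auto
        ultimately show ?thesis unfolding filterlim_at by simp
      qed
      ultimately have "(\<lambda>n. norm (\<psi> (x + t n *\<^sub>R e) - \<psi> x - \<psi>' x (t n *\<^sub>R e)) / norm (t n *\<^sub>R e)) \<longlonglongrightarrow> 0"
        by (rule filterlim_compose)
      moreover have "norm (\<psi> (x + t n *\<^sub>R e) - \<psi> x - \<psi>' x (t n *\<^sub>R e)) / norm (t n *\<^sub>R e) = norm (q n x - \<psi>' x e)" for n
      proof -
        have "\<psi>' x (t n *\<^sub>R e) = t n *\<^sub>R \<psi>' x e" using linear_scale[OF has_derivative_linear[OF d]] .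
        then have "q n x - \<psi>' x e = (\<psi> (x + t n *\<^sub>R e) - \<psi> x - \<psi>' x (t n *\<^sub>R e)) /\<^sub>R t n"
          unfolding q_def using t(1)[of n] by (simp add: add.commute scaleR_diff_right)
        then show ?thesis using t(1)[of n] ne by (simp add: divide_inverse mult.commute)
      qed
      ultimately have "(\<lambda>n. q n x - \<psi>' x e) \<longlonglongrightarrow> 0" by (simp add: tendsto_norm_zero_iff)
      then show "(\<lambda>n. q n x) \<longlonglongrightarrow> \<psi>' x e" by (rule LIM_zero_cancel)
    qed
    show "AE x in lborel. norm (q n x) \<le> B * indicator (cball 0 (R+1)) x" for n
    proof (rule AE_I2)
      fix x
      show "norm (q n x) \<le> B * indicator (cball 0 (R+1)) x"
      proof (cases "x \<in> cball 0 (R+1)")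
        case True
        have "norm (\<psi> (x + t n *\<^sub>R e) - \<psi> (x + 0 *\<^sub>R e)) \<le> B * norm (t n - 0)"
        proof (rule differentiable_bound[of UNIV "\<lambda>s. \<psi> (x + s *\<^sub>R e)" "\<lambda>s h. h *\<^sub>R \<psi>' (x + s *\<^sub>R e) e"])
          fix s
          have "((\<lambda>s::real. x + s *\<^sub>R e) has_derivative (\<lambda>h. h *\<^sub>R e)) (at s)"
            by (auto intro!: derivative_eq_intros)
          from has_derivative_compose[OF this d]
          show "((\<lambda>s. \<psi> (x + s *\<^sub>R e)) has_derivative (\<lambda>h. h *\<^sub>R \<psi>' (x + s *\<^sub>R e) e)) (at s within UNIV)"
            using linear_scale[OF has_derivative_linear[OF d]] by simp
          show "onorm (\<lambda>h. h *\<^sub>R \<psi>' (x + s *\<^sub>R e) e) \<le> B"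
            using mult_left_mono[OF B abs_ge_zero] by (intro onorm_le) (simp add: mult.commute)
        qed auto
        then show ?thesis unfolding q_def using t[of n] True
          by (simp add: add.commute divide_simps mult.commute)
      next
        case False
        then have "x \<notin> K" using R[of x] by auto
        moreover have "t n *\<^sub>R e + x \<notin> K"
        proof
          assume "t n *\<^sub>R e + x \<in> K"
          then have "norm (t n *\<^sub>R e + x) \<le> R" by (rule R)
          moreover have "norm x \<le> norm (t n *\<^sub>R e + x) + norm (t n *\<^sub>R e)"
            using norm_triangle_ineq4[of "t n *\<^sub>R e + x" "t n *\<^sub>R e"] by simp
          ultimately show False using False t[of n] ne by simp
        qed
        ultimately show ?thesis unfolding q_def using K(2) B0 by simp
      qed
    qed
  qed (auto simp: q_def)
  then show ?thesis unfolding q0 using LIMSEQ_unique tendsto_const by blast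
qed

lemma test_functionD:
  assumes "\<phi> \<in> test_functions \<Omega>"
  obtains K where "compact K" "K \<subseteq> \<Omega>" "smooth \<phi>" "\<And>x. x \<notin> K \<Longrightarrow> \<phi> x = 0" "\<And>x e. x \<notin> K \<Longrightarrow> pd e \<phi> x = 0"
proof -
  let ?K = "closure {x. \<phi> x \<noteq> 0}"
  have z: "\<phi> x = 0" if "x \<notin> ?K" for x using that closure_subset[of "{x. \<phi> x \<noteq> 0}"] by blast
  have "pd e \<phi> x = 0" if "x \<notin> ?K" for x e
  proof -
    have "((\<lambda>x. 0) has_derivative (\<lambda>h. 0)) (at x)" by simp
    then have "(\<phi> has_derivative (\<lambda>h. 0)) (at x)"
      by (rule has_derivative_transform_within_open[of _ _ _ _ "- ?K"]) (rule open_Compl, rule closed_closure, use that in blast, metis z ComplD)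
    then show ?thesis using pd_eq by blast
  qed
  note pz = this
  have "compact ?K" "?K \<subseteq> \<Omega>" "smooth \<phi>" using assms unfolding test_functions_def smooth_def by simp_all
  then show ?thesis using z pz by (rule that)
qed

lemma test_functionI:
  assumes "smooth \<phi>" "compact K" "K \<subseteq> \<Omega>" "\<And>x. x \<notin> K \<Longrightarrow> \<phi> x = 0"
  shows "\<phi> \<in> test_functions \<Omega>"
proof -
  have "{x. \<phi> x \<noteq> 0} \<subseteq> K" using assms(4) by blast
  then have s: "closure {x. \<phi> x \<noteq> 0} \<subseteq> K" using assms(2) by (simp add: closure_minimal compact_imp_closed)
  have "compact (K \<inter> closure {x. \<phi> x \<noteq> 0})" using assms(2) by (rule compact_Int_closed) simp
  then have "compact (closure {x. \<phi> x \<noteq> 0})" using s by (simp only: inf_absorb2)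
  moreover have "closure {x. \<phi> x \<noteq> 0} \<subseteq> \<Omega>" using s assms(3) by (rule order_trans)
  ultimately show ?thesis using assms(1) unfolding test_functions_def smooth_def by simp
qed

lemma integral_lebesgue_on_supported:
  fixes h :: "'a::euclidean_space \<Rightarrow> complex"
  assumes S: "S \<in> sets lebesgue" and c: "h \<in> borel_measurable borel" and z: "\<And>x. x \<notin> S \<Longrightarrow> h x = 0"
  shows "(LINT x|lebesgue_on S. h x) = (LINT x|lborel. h x)"
proof -
  have "(LINT x|lebesgue_on S. h x) = (LINT x|lebesgue. indicator S x *\<^sub>R h x)"
    using S by (simp add: integral_restrict_space)
  also have "(\<lambda>x. indicator S x *\<^sub>R h x) = h" using z by (auto simp: indicator_def)
  also have "(LINT x|lebesgue. h x) = (LINT x|lborel. h x)" using c by (simp add: integral_completion)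
  finally show ?thesis .
qed

lemma smooth_integration_by_parts:
  assumes O: "open \<Omega>" and u: "smooth u" and \<phi>: "\<phi> \<in> test_functions \<Omega>" and e: "e \<in> Basis"
  shows "(LINT x|lebesgue_on \<Omega>. u x * pd e \<phi> x) = - (LINT x|lebesgue_on \<Omega>. pd e u x * \<phi> x)"
proof -
  obtain K where K: "compact K" "K \<subseteq> \<Omega>" "smooth \<phi>" "\<And>x. x \<notin> K \<Longrightarrow> \<phi> x = 0" "\<And>x e. x \<notin> K \<Longrightarrow> pd e \<phi> x = 0"
    by (rule test_functionD[OF \<phi>]) (rule that)
  have c: "continuous_on UNIV (\<lambda>x. u x * pd e \<phi> x)" "continuous_on UNIV (\<lambda>x. pd e u x * \<phi> x)"
    using smoothD[OF u] smoothD[OF K(3)] smoothD(2)[OF smoothD(3)[OF u e]] smoothD(2)[OF smoothD(3)[OF K(3) e]] by (auto intro!: continuous_intros)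
  have i: "integrable lborel (\<lambda>x. u x * pd e \<phi> x)" "integrable lborel (\<lambda>x. pd e u x * \<phi> x)"
    by (rule compact_support_integrable[OF c(1) K(1)], simp add: K(5), rule compact_support_integrable[OF c(2) K(1)], simp add: K(4))
  have "(LINT x|lborel. u x * pd e \<phi> x + pd e u x * \<phi> x) = 0"
    by (rule integral_partial_zero[OF has_derivative_mult[OF smoothD(1)[OF u] smoothD(1)[OF K(3)]], of e K])
       (use K e continuous_on_add[OF c] in auto)
  then have "(LINT x|lborel. u x * pd e \<phi> x) = - (LINT x|lborel. pd e u x * \<phi> x)"
    using i by (simp add: eq_neg_iff_add_eq_0)
  moreover have "(LINT x|lebesgue_on \<Omega>. u x * pd e \<phi> x) = (LINT x|lborel. u x * pd e \<phi> x)"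
    "(LINT x|lebesgue_on \<Omega>. pd e u x * \<phi> x) = (LINT x|lborel. pd e u x * \<phi> x)"
  proof -
    have S: "\<Omega> \<in> sets lebesgue" using borel_open[OF O] by (simp add: sets_completionI_sets)
    have z: "x \<notin> K" if "x \<notin> \<Omega>" for x using K(2) that by auto
    show "(LINT x|lebesgue_on \<Omega>. u x * pd e \<phi> x) = (LINT x|lborel. u x * pd e \<phi> x)"
      by (rule integral_lebesgue_on_supported[OF S borel_measurable_continuous_onI[OF c(1)]]) (simp add: K(5)[OF z])
    show "(LINT x|lebesgue_on \<Omega>. pd e u x * \<phi> x) = (LINT x|lborel. pd e u x * \<phi> x)"
      by (rule integral_lebesgue_on_supported[OF S borel_measurable_continuous_onI[OF c(2)]]) (simp add: K(4)[OF z])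
  qed
  ultimately show ?thesis by simp
qed

section \<open>Uniqueness of weak derivatives\<close>

text \<open>The positive and negative parts of \<open>f\<close> are densities of two measures that agree on the boxes, an intersection-stable generator.\<close>

lemma AE_zero_if_box_integrals_zero:
  fixes f :: "'a::euclidean_space \<Rightarrow> real"
  assumes f: "integrable lborel f" and z: "\<And>a b. (LINT x|lborel. indicator (box a b) x * f x) = 0"
  shows "AE x in lborel. f x = 0"
proof -
  have [measurable]: "f \<in> borel_measurable borel" using borel_measurable_integrable[OF f] by simp
  define p where "p = (\<lambda>x. ennreal (f x))"
  define n where "n = (\<lambda>x. ennreal (- f x))"
  have [measurable]: "p \<in> borel_measurable lborel" "n \<in> borel_measurable lborel" unfolding p_def n_def by auto
  have fin: "integral\<^sup>N lborel p \<noteq> \<infinity>" 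
    using f unfolding p_def real_integrable_def by simp
  have eq: "emeasure (density lborel p) (box a b) = emeasure (density lborel n) (box a b)" for a b
  proof -
    have i: "integrable lborel (\<lambda>x. indicator (box a b) x * f x)"
      by (rule Bochner_Integration.integrable_bound[OF f]) (auto simp: indicator_def)
    have P: "emeasure (density lborel p) (box a b) = (\<integral>\<^sup>+x. ennreal (indicator (box a b) x * f x) \<partial>lborel)"
      by (subst emeasure_density) (auto simp: p_def indicator_def intro!: nn_integral_cong)
    have N: "emeasure (density lborel n) (box a b) = (\<integral>\<^sup>+x. ennreal (- (indicator (box a b) x * f x)) \<partial>lborel)"
      by (subst emeasure_density) (auto simp: n_def indicator_def intro!: nn_integral_cong)
    have fi: "(\<integral>\<^sup>+x. ennreal (indicator (box a b) x * f x) \<partial>lborel) \<noteq> \<infinity>" "(\<integral>\<^sup>+x. ennreal (- (indicator (box a b) x * f x)) \<partial>lborel) \<noteq> \<infinity>"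
      using i unfolding real_integrable_def by auto
    have "enn2real (\<integral>\<^sup>+x. ennreal (indicator (box a b) x * f x) \<partial>lborel) = enn2real (\<integral>\<^sup>+x. ennreal (- (indicator (box a b) x * f x)) \<partial>lborel)"
      using real_lebesgue_integral_def[OF i] z[of a b] by simp
    then have "ennreal (enn2real (\<integral>\<^sup>+x. ennreal (indicator (box a b) x * f x) \<partial>lborel)) = ennreal (enn2real (\<integral>\<^sup>+x. ennreal (- (indicator (box a b) x * f x)) \<partial>lborel))"
      by (rule arg_cong)
    then have "(\<integral>\<^sup>+x. ennreal (indicator (box a b) x * f x) \<partial>lborel) = (\<integral>\<^sup>+x. ennreal (- (indicator (box a b) x * f x)) \<partial>lborel)"
      unfolding ennreal_enn2real[OF fi(1)[unfolded infinity_ennreal_def less_top]] ennreal_enn2real[OF fi(2)[unfolded infinity_ennreal_def less_top]] .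
    then show ?thesis unfolding P N .
  qed
  have "density lborel p = density lborel n"
  proof (rule measure_eqI_generator_eq[where E="range (\<lambda>(a,b). box a b)" and \<Omega>=UNIV and A="\<lambda>i. box (- (real i *\<^sub>R One)) (real i *\<^sub>R One)"])
    show "Int_stable (range (\<lambda>(a::'a, b). box a b))"
      by (auto simp: Int_stable_def box_Int_box)
    show "sets (density lborel p) = sigma_sets UNIV (range (\<lambda>(a, b). box a b))"
      "sets (density lborel n) = sigma_sets UNIV (range (\<lambda>(a, b). box a b))"
      unfolding sets_density sets_lborel by (subst borel_eq_box, simp)+
    show "(\<Union>i. box (- (real i *\<^sub>R One)) (real i *\<^sub>R One)) = (UNIV :: 'a set)" by (rule UN_box_eq_UNIV)
    show "emeasure (density lborel p) (box (- (real i *\<^sub>R One)) (real i *\<^sub>R One)) \<noteq> \<infinity>" for i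
    proof -
      have "emeasure (density lborel p) (box (- (real i *\<^sub>R One)) (real i *\<^sub>R One)) \<le> integral\<^sup>N lborel p"
        by (subst emeasure_density) (auto intro!: nn_integral_mono simp: indicator_def)
      then show ?thesis using fin by (auto simp: top_unique)
    qed
    show "emeasure (density lborel p) X = emeasure (density lborel n) X" if X: "X \<in> range (\<lambda>(a::'a, b). box a b)" for X
    proof -
      obtain a b where "X = box a b" using X by auto
      then show ?thesis using eq by simp
    qed
  qed auto
  then have "AE x in lborel. p x = n x"
    using finite_density_unique[of p lborel n] fin by auto
  then show ?thesis
  proof eventually_elim
    case (elim x)
    then show ?case unfolding p_def n_def by (cases "f x \<ge> 0") (auto simp: ennreal_neg)
  qed
qed

lemma smooth_measurable:
  assumes "smooth \<phi>"
  shows "\<phi> \<in> borel_measurable borel" "\<phi> \<in> borel_measurable lebesgue" "\<phi> \<in> borel_measurable (lebesgue_on S)"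
proof -
  show b: "\<phi> \<in> borel_measurable borel" using smoothD(2)[OF assms] by (rule borel_measurable_continuous_onI)
  then have "\<phi> \<in> borel_measurable lborel" by simp
  then show l: "\<phi> \<in> borel_measurable lebesgue" by (rule measurable_completion)
  then show "\<phi> \<in> borel_measurable (lebesgue_on S)" by (rule measurable_restrict_space1)
qed

definition box_cutoff :: "'a::euclidean_space \<Rightarrow> 'a \<Rightarrow> real \<Rightarrow> 'a \<Rightarrow> complex" where
  "box_cutoff a b n x =
     (\<Prod>e\<in>Basis. complex_of_real (bump (n * (x \<bullet> e - a \<bullet> e))) * complex_of_real (bump (n * (b \<bullet> e - x \<bullet> e))))"

lemma box_cutoff_zero: "box_cutoff a b n x = 0" if x: "x \<notin> box a b" and n: "n > 0"
proof -
  obtain e where e: "e \<in> Basis" "x \<bullet> e \<le> a \<bullet> e \<or> b \<bullet> e \<le> x \<bullet> e" using x unfolding mem_box by (meson not_less)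
  then have "n * (x \<bullet> e - a \<bullet> e) \<le> 0 \<or> n * (b \<bullet> e - x \<bullet> e) \<le> 0" using n by (auto simp: mult_le_0_iff)
  then show ?thesis unfolding box_cutoff_def by (intro prod_zero bexI[OF _ e(1)]) (auto simp: bump_def)
qed

lemma box_cutoff_le_1: "cmod (box_cutoff a b n x) \<le> 1"
  unfolding box_cutoff_def prod_norm[symmetric]
  by (intro prod_le_1) (auto simp: norm_mult abs_of_nonneg bump_bounds intro!: mult_le_one)

lemma smooth_box_cutoff: "smooth (box_cutoff a b n)"
  unfolding box_cutoff_def
proof (intro smooth_prod smooth_mult smooth_bump)
  fix e x :: 'a
  show "((\<lambda>x. n * (x \<bullet> e - a \<bullet> e)) has_derivative (\<lambda>h. n * (h \<bullet> e))) (at x)"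
    by (auto intro!: derivative_eq_intros)
  show "((\<lambda>x. n * (b \<bullet> e - x \<bullet> e)) has_derivative (\<lambda>h. n * (- (h \<bullet> e)))) (at x)"
    by (auto intro!: derivative_eq_intros)
qed (auto intro: smooth_const)

lemma box_cutoff_test:
  assumes "cbox a b \<subseteq> \<Omega>" "n > 0"
  shows "box_cutoff a b n \<in> test_functions \<Omega>"
  by (rule test_functionI[OF smooth_box_cutoff compact_cbox assms(1)])
     (use box_cutoff_zero[OF _ assms(2)] box_subset_cbox in blast)

lemma box_cutoff_limit: "(\<lambda>n. box_cutoff a b (real (Suc n)) x) \<longlonglongrightarrow> indicator (box a b) x"
proof (cases "x \<in> box a b")
  case True
  have l: "(\<lambda>n. complex_of_real (bump (real (Suc n) * t))) \<longlonglongrightarrow> of_real 1" if "t > 0" for t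
  proof (intro tendsto_of_real)
    have "(\<lambda>n. exp (- ((1/t) * (1 / real (Suc n))))) \<longlonglongrightarrow> exp (- ((1/t) * 0))"
      by (intro tendsto_intros) (use LIMSEQ_inverse_real_of_nat in \<open>simp add: inverse_eq_divide\<close>)
    moreover have "bump (real (Suc n) * t) = exp (- ((1/t) * (1 / real (Suc n))))" for n
      using that by (simp add: bump_def field_simps del: of_nat_Suc)
    ultimately show "(\<lambda>n. bump (real (Suc n) * t)) \<longlonglongrightarrow> 1" by simp
  qed
  have "(\<lambda>n. box_cutoff a b (real (Suc n)) x) \<longlonglongrightarrow> (\<Prod>e\<in>(Basis::'a set). of_real 1 * of_real 1)"
    unfolding box_cutoff_def by (intro tendsto_prod tendsto_mult l) (use True in \<open>auto simp: mem_box\<close>)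
  then show ?thesis using True by simp
next
  case False
  then show ?thesis using box_cutoff_zero[OF False] by (simp del: of_nat_Suc)
qed

text \<open>Smooth cutoffs converge to the indicator function of a box, so the integrals over all boxes in \<open>\<Omega>\<close> vanish, and countably many boxes cover \<open>\<Omega>\<close>.\<close>

lemma AE_zero_if_orthogonal_to_test_functions:
  fixes d :: "'a::euclidean_space \<Rightarrow> complex"
  assumes O: "open \<Omega>" and d: "integrable (lebesgue_on \<Omega>) d"
    and z: "\<And>\<phi>. \<phi> \<in> test_functions \<Omega> \<Longrightarrow> (LINT x|lebesgue_on \<Omega>. d x * \<phi> x) = 0"
  shows "AE x in lebesgue_on \<Omega>. d x = 0"
proof -
  have S: "\<Omega> \<in> sets lebesgue" using borel_open[OF O] by (simp add: sets_completionI_sets)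
  define f where "f = (\<lambda>x. indicator \<Omega> x *\<^sub>R d x)"
  have f: "integrable lebesgue f" using d S unfolding f_def by (simp add: integrable_restrict_space)
  have fm[measurable]: "f \<in> borel_measurable lebesgue" using f by simp
  have bm[measurable]: "box a b \<in> sets lebesgue" for a b :: 'a by simp
  have box0: "(LINT x|lebesgue. indicator (box a b) x *\<^sub>R f x) = 0" if "cbox a b \<subseteq> \<Omega>" for a b
  proof -
    let ?c = "\<lambda>n. box_cutoff a b (real (Suc n))"
    have cm[measurable]: "?c n \<in> borel_measurable lebesgue" for n
      by (rule smooth_measurable[OF smooth_box_cutoff])
    have "(\<lambda>n. LINT x|lebesgue. f x * ?c n x) \<longlonglongrightarrow> (LINT x|lebesgue. indicator (box a b) x *\<^sub>R f x)"
    proof (rule integral_dominated_convergence[where w="\<lambda>x. cmod (f x)"])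
      show "AE x in lebesgue. (\<lambda>n. f x * ?c n x) \<longlonglongrightarrow> indicator (box a b) x *\<^sub>R f x"
      proof (rule AE_I2)
        fix x
        have "(\<lambda>n. f x * ?c n x) \<longlonglongrightarrow> f x * indicator (box a b) x" by (intro tendsto_intros box_cutoff_limit)
        then show "(\<lambda>n. f x * ?c n x) \<longlonglongrightarrow> indicator (box a b) x *\<^sub>R f x" by (auto simp: indicator_def)
      qed
      show "AE x in lebesgue. norm (f x * ?c n x) \<le> cmod (f x)" for n
        using mult_left_mono[OF box_cutoff_le_1 norm_ge_zero] by (intro AE_I2) (simp add: norm_mult del: of_nat_Suc)
    qed (use f in \<open>simp_all del: of_nat_Suc\<close>)
    moreover have "(LINT x|lebesgue. f x * ?c n x) = 0" for n
    proof -
      have "(LINT x|lebesgue. f x * ?c n x) = (LINT x|lebesgue_on \<Omega>. d x * ?c n x)"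
        using S by (simp add: integral_restrict_space f_def mult.assoc scaleR_conv_of_real)
      also have "\<dots> = 0" by (rule z[OF box_cutoff_test[OF that]]) simp
      finally show ?thesis .
    qed
    ultimately show ?thesis using LIMSEQ_unique[OF _ tendsto_const] by (simp del: of_nat_Suc)
  qed
  have real_part: "AE x in lebesgue. x \<in> box a b \<longrightarrow> g x = 0"
    if ab: "cbox a b \<subseteq> \<Omega>" and g: "integrable lebesgue g" and gz: "\<And>a b. cbox a b \<subseteq> \<Omega> \<Longrightarrow> (LINT x|lebesgue. indicator (box a b) x * g x) = 0"
    for a b and g :: "'a \<Rightarrow> real"
  proof -
    define h where "h = (\<lambda>x. indicator (box a b) x * g x)"
    have [measurable]: "g \<in> borel_measurable lebesgue" using g by simp
    have hm[measurable]: "h \<in> borel_measurable lebesgue" unfolding h_def by measurable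
    have h: "integrable lebesgue h"
      by (rule Bochner_Integration.integrable_bound[OF g]) (auto simp: h_def indicator_def)
    obtain h' where h'[measurable]: "h' \<in> borel_measurable lborel" and ae: "AE x in lborel. h x = h' x"
      using completion_ex_borel_measurable_real[OF hm] by blast
    have ae': "AE x in lebesgue. h x = h' x" using ae by (rule AE_completion)
    have h'2: "h' \<in> borel_measurable lebesgue" using h' by (rule measurable_completion)
    have "integrable lebesgue h'" using h integrable_cong_AE[OF hm h'2 ae'] by simp
    then have ih': "integrable lborel h'" using integrable_completion[OF h'] by simp
    have "AE x in lborel. h' x = 0"
    proof (rule AE_zero_if_box_integrals_zero[OF ih'])
      fix c d :: 'a
      have [measurable]: "(\<lambda>x. indicator (box c d) x * h' x) \<in> borel_measurable lborel" by measurable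
      have "(LINT x|lborel. indicator (box c d) x * h' x) = (LINT x|lebesgue. indicator (box c d) x * h' x)"
        by (simp add: integral_completion)
      also have "\<dots> = (LINT x|lebesgue. indicator (box c d) x * h x)"
        using h'2 by (intro integral_cong_AE) (use ae' in \<open>auto elim!: eventually_mono\<close>)
      also have "\<dots> = (LINT x|lebesgue. indicator (box c d \<inter> box a b) x * g x)"
        unfolding h_def by (simp add: indicator_inter_arith mult.assoc)
      also have "\<dots> = 0"
      proof -
        obtain p q where pq: "box c d \<inter> box a b = box p q" unfolding box_Int_box by blast
        show ?thesis
        proof (cases "box p q = {}")
          case False
          then have "cbox p q = closure (box p q)" by (simp add: closure_box)
          also have "\<dots> \<subseteq> cbox a b" using pq box_subset_cbox[of a b] by (intro closure_minimal) auto
          finally show ?thesis unfolding pq using ab by (intro gz) blast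
        qed (simp add: pq)
      qed
      finally show "(LINT x|lborel. indicator (box c d) x * h' x) = 0" .
    qed
    then have "AE x in lebesgue. h' x = 0" by (rule AE_completion)
    with ae' show ?thesis
    proof eventually_elim
      case (elim x)
      then show ?case unfolding h_def by (auto simp: indicator_def split: if_splits)
    qed
  qed
  have part: "AE x in lebesgue. x \<in> cbox a b \<longrightarrow> f x = 0" if ab: "cbox a b \<subseteq> \<Omega>" for a b
  proof -
    have I: "integrable lebesgue (\<lambda>x. indicator (box a b) x *\<^sub>R f x)" for a b
      by (rule Bochner_Integration.integrable_bound[OF f]) (auto simp: indicator_def)
    have "(LINT x|lebesgue. indicator (box a b) x * Re (f x)) = 0" "(LINT x|lebesgue. indicator (box a b) x * Im (f x)) = 0"
      if "cbox a b \<subseteq> \<Omega>" for a b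
      using arg_cong[OF box0[OF that], of Re] arg_cong[OF box0[OF that], of Im] I[of a b]
      by (simp_all flip: integral_Re integral_Im)
    from real_part[OF ab _ this(1)] real_part[OF ab _ this(2)] f
    have "AE x in lebesgue. x \<in> box a b \<longrightarrow> Re (f x) = 0" "AE x in lebesgue. x \<in> box a b \<longrightarrow> Im (f x) = 0"
      by simp_all
    moreover have "AE x in lebesgue. x \<notin> cbox a b - box a b"
      by (rule AE_not_in) (use negligible_frontier_interval negligible_iff_null_sets in blast)
    ultimately show ?thesis by eventually_elim (auto simp: complex_eq_iff)
  qed
  obtain \<D> where D: "countable \<D>" "\<D> \<subseteq> Pow \<Omega>" "\<And>X. X \<in> \<D> \<Longrightarrow> \<exists>a b. X = cbox a b" "\<Union>\<D> = \<Omega>"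
    using open_countable_Union_open_cbox[OF O] by metis
  have "AE x in lebesgue. \<forall>X\<in>\<D>. x \<in> X \<longrightarrow> f x = 0"
  proof (subst AE_ball_countable[OF D(1)], intro ballI)
    fix X assume "X \<in> \<D>"
    moreover obtain a b where "X = cbox a b" using D(3)[OF \<open>X \<in> \<D>\<close>] by blast
    ultimately show "AE x in lebesgue. x \<in> X \<longrightarrow> f x = 0" using part[of a b] D(2) by auto
  qed
  then have "AE x in lebesgue. x \<in> \<Omega> \<longrightarrow> d x = 0"
  proof eventually_elim
    case (elim x)
    show ?case
    proof
      assume x: "x \<in> \<Omega>"
      then obtain X where "X \<in> \<D>" "x \<in> X" using D(4) by blast
      then have "f x = 0" using elim by blast
      then show "d x = 0" using x by (simp add: f_def)
    qed
  qed
  then show ?thesis using S by (simp add: AE_restrict_space_iff)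
qed

lemma test_function_bounded:
  assumes "\<phi> \<in> test_functions \<Omega>"
  obtains B where "\<And>x. cmod (\<phi> x) \<le> B" "B \<ge> 0"
proof -
  obtain K where K: "compact K" "K \<subseteq> \<Omega>" "smooth \<phi>" "\<And>x. x \<notin> K \<Longrightarrow> \<phi> x = 0" "\<And>x e. x \<notin> K \<Longrightarrow> pd e \<phi> x = 0"
    by (rule test_functionD[OF assms]) (rule that)
  have "bounded (\<phi> ` K)"
    by (intro compact_imp_bounded compact_continuous_image continuous_on_subset[OF smoothD(2)[OF K(3)]] K(1)) auto
  then obtain B where B: "\<And>x. x \<in> K \<Longrightarrow> cmod (\<phi> x) \<le> B" by (auto simp: bounded_iff)
  have "cmod (\<phi> x) \<le> max B 0" for x using B[of x] K(4)[of x] by (cases "x \<in> K") (auto simp: le_max_iff_disj)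
  then show ?thesis using that[of "max B 0"] by simp
qed

lemma test_function_pd:
  assumes "\<phi> \<in> test_functions \<Omega>" "e \<in> Basis"
  shows "pd e \<phi> \<in> test_functions \<Omega>"
proof -
  obtain K where K: "compact K" "K \<subseteq> \<Omega>" "smooth \<phi>" "\<And>x. x \<notin> K \<Longrightarrow> \<phi> x = 0" "\<And>x e. x \<notin> K \<Longrightarrow> pd e \<phi> x = 0"
    by (rule test_functionD[OF assms(1)]) (rule that)
  show ?thesis by (rule test_functionI[OF smoothD(3)[OF K(3) assms(2)] K(1,2)]) (simp add: K(5))
qed

lemma integrable_mult_test_function:
  assumes O: "open \<Omega>" and d: "integrable (lebesgue_on \<Omega>) d" and \<phi>: "\<phi> \<in> test_functions \<Omega>"
  shows "integrable (lebesgue_on \<Omega>) (\<lambda>x. d x * \<phi> x)"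
proof -
  obtain B where B: "\<And>x. cmod (\<phi> x) \<le> B" "B \<ge> 0" by (rule test_function_bounded[OF \<phi>]) (rule that)
  have "smooth \<phi>" by (rule test_functionD[OF \<phi>])
  then have [measurable]: "\<phi> \<in> borel_measurable (lebesgue_on \<Omega>)"
    by (rule smooth_measurable)
  have [measurable]: "d \<in> borel_measurable (lebesgue_on \<Omega>)" using d by simp
  show ?thesis
  proof (rule Bochner_Integration.integrable_bound[of _ "\<lambda>x. B * cmod (d x)"])
    show "AE x in lebesgue_on \<Omega>. norm (d x * \<phi> x) \<le> norm (B * cmod (d x))"
      using mult_right_mono[OF B(1) norm_ge_zero, of _ "d _"] B(2) by (auto simp: norm_mult mult.commute)
  qed (use d in auto)
qed

lemma weak_partial_unique:
  assumes O: "open \<Omega>" and g: "integrable (lebesgue_on \<Omega>) g" "is_weak_partial \<Omega> e u g"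
    and h: "integrable (lebesgue_on \<Omega>) h" "is_weak_partial \<Omega> e u h"
  shows "AE x in lebesgue_on \<Omega>. g x = h x"
proof -
  have "AE x in lebesgue_on \<Omega>. g x - h x = 0"
  proof (rule AE_zero_if_orthogonal_to_test_functions[OF O])
    show "integrable (lebesgue_on \<Omega>) (\<lambda>x. g x - h x)" using g h by simp
    fix \<phi> assume \<phi>: "\<phi> \<in> test_functions \<Omega>"
    have "(LINT x|lebesgue_on \<Omega>. g x * \<phi> x) = (LINT x|lebesgue_on \<Omega>. h x * \<phi> x)"
      using g(2) h(2) \<phi> unfolding is_weak_partial_def by (metis neg_equal_iff_equal)
    then show "(LINT x|lebesgue_on \<Omega>. (g x - h x) * \<phi> x) = 0"
      using integrable_mult_test_function[OF O g(1) \<phi>] integrable_mult_test_function[OF O h(1) \<phi>]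
      by (simp add: left_diff_distrib)
  qed
  then show ?thesis by simp
qed

section \<open>Riesz representation and completeness of L2\<close>

lemma quadratic_nonneg_discriminant:
  fixes p q r :: real
  assumes "\<And>t. p * t\<^sup>2 + 2 * q * t + r \<ge> 0" "p \<ge> 0"
  shows "q\<^sup>2 \<le> p * r"
proof (cases "p = 0")
  case True
  have "q = 0"
  proof (rule ccontr)
    assume "q \<noteq> 0"
    then show False using assms(1)[of "- (r + 1) / (2 * q)"] True by (simp add: field_simps)
  qed
  then show ?thesis using True by simp
next
  case False
  then have p: "p > 0" using assms(2) by simp
  have "p * (p * (- q/p)\<^sup>2 + 2 * q * (- q/p) + r) \<ge> 0" using assms(1)[of "- q/p"] p by simp
  moreover have "p * (p * (- q/p)\<^sup>2 + 2 * q * (- q/p) + r) = p * r - q\<^sup>2"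
    using p by (simp add: field_simps power2_eq_square)
  ultimately show ?thesis by simp
qed

text \<open>The form domain consists of functions modulo null sets and is not a type, so completeness is stated for a set with an explicit
operation \<open>comb t u v\<close>, which stands for \<open>u + t v\<close>, and a semidefinite form \<open>B\<close>.\<close>

locale semi_inner_complete =
  fixes V :: "'v set" and comb :: "real \<Rightarrow> 'v \<Rightarrow> 'v \<Rightarrow> 'v" and B :: "'v \<Rightarrow> 'v \<Rightarrow> real"
  assumes nonempty: "V \<noteq> {}"
    and comb: "\<And>t u v. u \<in> V \<Longrightarrow> v \<in> V \<Longrightarrow> comb t u v \<in> V"
    and B_comb: "\<And>t u v w. u \<in> V \<Longrightarrow> v \<in> V \<Longrightarrow> w \<in> V \<Longrightarrow> B (comb t u v) w = B u w + t * B v w"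
    and B_sym: "\<And>u v. u \<in> V \<Longrightarrow> v \<in> V \<Longrightarrow> B u v = B v u"
    and B_nonneg: "\<And>u. u \<in> V \<Longrightarrow> B u u \<ge> 0"
    and complete: "\<And>s. (\<And>n. s n \<in> V) \<Longrightarrow>
      (\<And>e. e > 0 \<Longrightarrow> \<exists>N::nat. \<forall>m\<ge>N. \<forall>n\<ge>N. B (comb (-1) (s m) (s n)) (comb (-1) (s m) (s n)) < e) \<Longrightarrow>
      \<exists>u\<in>V. (\<lambda>n. B (comb (-1) (s n) u) (comb (-1) (s n) u)) \<longlonglongrightarrow> 0"
begin

lemma B_comb_right:
  assumes "u \<in> V" "v \<in> V" "w \<in> V" shows "B w (comb t u v) = B w u + t * B w v"
  using B_comb[OF assms, of t] B_sym[OF comb[OF assms(1,2), of t] assms(3)] B_sym[OF assms(1,3)] B_sym[OF assms(2,3)] by simp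

lemma B_comb_self:
  assumes "u \<in> V" "v \<in> V"
  shows "B (comb t u v) (comb t u v) = B v v * t\<^sup>2 + 2 * B u v * t + B u u"
  using B_comb[OF assms comb[OF assms], of t t] B_comb_right[OF assms assms(1), of t] B_comb_right[OF assms assms(2), of t]
    B_sym[OF assms] by (simp add: algebra_simps power2_eq_square)

lemma Cauchy_Schwarz: assumes "u \<in> V" "v \<in> V" shows "(B u v)\<^sup>2 \<le> B u u * B v v"
proof -
  have "(B u v)\<^sup>2 \<le> B v v * B u u"
    by (rule quadratic_nonneg_discriminant)
       (use B_comb_self[OF assms] B_nonneg[OF comb[OF assms]] B_nonneg[OF assms(2)] in simp_all)
  then show ?thesis by (simp add: mult.commute)
qed

text \<open>A minimizing sequence of \<open>J u = B u u - 2 l u\<close> is Cauchy by the parallelogram law. Instead of the minimality of its limit, the proof uses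
the variation of \<open>J\<close> at almost minimizers, which gives \<open>(B u v - l v)\<^sup>2 \<le> \<delta> B v v\<close> with \<open>\<delta>\<close> tending to \<open>0\<close>.\<close>

theorem riesz_representation:
  assumes l_comb: "\<And>t u v. u \<in> V \<Longrightarrow> v \<in> V \<Longrightarrow> l (comb t u v) = l u + t * l v"
    and l_bound: "\<And>u. u \<in> V \<Longrightarrow> (l u)\<^sup>2 \<le> C * B u u" and C: "C \<ge> 0"
  shows "\<exists>u\<in>V. \<forall>v\<in>V. B u v = l v"
proof -
  define J where "J = (\<lambda>u. B u u - 2 * l u)"
  have lower: "- C \<le> J u" if "u \<in> V" for u
  proof -
    have "(2 * l u)\<^sup>2 \<le> (B u u + C)\<^sup>2"
    proof -
      have "(2 * l u)\<^sup>2 \<le> 4 * (C * B u u)" using l_bound[OF that] by (simp add: power_mult_distrib)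
      also have "\<dots> \<le> (B u u + C)\<^sup>2" using zero_le_power2[of "B u u - C"] by (simp add: power2_eq_square algebra_simps)
      finally show ?thesis .
    qed
    then have "\<bar>2 * l u\<bar> \<le> \<bar>B u u + C\<bar>" by (simp add: abs_le_square_iff)
    then show ?thesis unfolding J_def using B_nonneg[OF that] C by linarith
  qed
  define I where "I = Inf (J ` V)"
  have bdd: "bdd_below (J ` V)" using lower by (intro bdd_belowI2)
  have I_le: "I \<le> J u" if "u \<in> V" for u unfolding I_def using bdd that by (intro cInf_lower) auto
  have "\<exists>u\<in>V. J u < I + 1 / real (Suc n)" for n
  proof -
    have "Inf (J ` V) < I + 1 / real (Suc n)" unfolding I_def by simp
    then show ?thesis using cInf_lessD[of "J ` V"] nonempty by blast
  qed
  then obtain s where s: "\<And>n. s n \<in> V" "\<And>n. J (s n) < I + 1 / real (Suc n)" by metis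
  have J_comb: "J (comb t u v) = B v v * t\<^sup>2 + 2 * (B u v - l v) * t + J u" if "u \<in> V" "v \<in> V" for t u v
    unfolding J_def B_comb_self[OF that] l_comb[OF that] by (simp add: algebra_simps)
  have parallelogram: "B (comb (-1) u v) (comb (-1) u v) \<le> 2 * (J u - I) + 2 * (J v - I)" if uv: "u \<in> V" "v \<in> V" for u v
  proof -
    define w where "w = comb (-1) v u"
    have w: "w \<in> V" unfolding w_def using comb uv by simp
    have "I \<le> J (comb (1/2) u w)" using I_le comb uv w by simp
    also have "\<dots> = B w w / 4 + (B u w - l w) + J u" unfolding J_comb[OF uv(1) w] by (simp add: power2_eq_square)
    finally have 1: "I \<le> B w w / 4 + (B u w - l w) + J u" .
    have 2: "B w w = B u u - 2 * B v u + B v v" unfolding w_def B_comb_self[OF uv(2,1)] by simp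
    have 3: "B u w = B u v - B u u" unfolding w_def using B_comb_right[OF uv(2,1,1)] by simp
    have 4: "l w = l v - l u" unfolding w_def using l_comb[OF uv(2,1)] by simp
    have 5: "B (comb (-1) u v) (comb (-1) u v) = B v v - 2 * B u v + B u u" unfolding B_comb_self[OF uv] by simp
    show ?thesis using 1 unfolding 2 3 4 5 J_def B_sym[OF uv(2,1)] by (simp add: field_simps)
  qed
  obtain u where u: "u \<in> V" "(\<lambda>n. B (comb (-1) (s n) u) (comb (-1) (s n) u)) \<longlonglongrightarrow> 0"
  proof -
    have "\<exists>N. \<forall>m\<ge>N. \<forall>n\<ge>N. B (comb (-1) (s m) (s n)) (comb (-1) (s m) (s n)) < e" if e: "e > 0" for e
    proof -
      obtain N where N: "1 / real (Suc N) < e/4" using reals_Archimedean[of "e/4"] e by (auto simp: inverse_eq_divide)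
      have "B (comb (-1) (s m) (s n)) (comb (-1) (s m) (s n)) < e" if mn: "m \<ge> N" "n \<ge> N" for m n
      proof -
        have "1 / real (Suc m) \<le> 1 / real (Suc N)" "1 / real (Suc n) \<le> 1 / real (Suc N)"
          using mn by (simp_all add: frac_le)
        then have "J (s m) < I + 1 / real (Suc N)" "J (s n) < I + 1 / real (Suc N)"
          using s(2) by (meson add_left_mono less_le_trans)+
        then have "J (s m) < I + e/4" "J (s n) < I + e/4"
          using N by (meson add_strict_left_mono less_trans)+
        then have "2 * (J (s m) - I) + 2 * (J (s n) - I) < e" by (simp add: field_simps)
        with parallelogram[OF s(1) s(1)] show ?thesis by (rule le_less_trans)
      qed
      then show ?thesis by blast
    qed
    then show ?thesis using complete[of s] s(1) that by blast
  qed
  have "B u v = l v" if v: "v \<in> V" for v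
  proof -
    have q: "(B (s n) v - l v)\<^sup>2 \<le> B v v * (1 / real (Suc n))" for n
    proof (rule quadratic_nonneg_discriminant)
      fix t
      have "I \<le> J (comb t (s n) v)" using I_le comb s(1) v by simp
      then show "B v v * t\<^sup>2 + 2 * (B (s n) v - l v) * t + 1 / real (Suc n) \<ge> 0"
        unfolding J_comb[OF s(1) v] using s(2)[of n] by linarith
    qed (rule B_nonneg[OF v])
    have h: "(\<lambda>n. 1 / real (Suc n)) \<longlonglongrightarrow> 0" using LIMSEQ_inverse_real_of_nat by (simp add: inverse_eq_divide)
    have "(\<lambda>n. (B (s n) v - l v)\<^sup>2) \<longlonglongrightarrow> 0"
      by (rule tendsto_sandwich[OF _ _ tendsto_const tendsto_mult_right_zero[OF h, of "B v v"]]) (use q in auto)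
    moreover have "(\<lambda>n. (B (s n) v - B u v)\<^sup>2) \<longlonglongrightarrow> 0"
    proof (rule tendsto_sandwich[OF _ _ tendsto_const tendsto_mult_left_zero[OF u(2), of "B v v"]])
      have "B (s n) v - B u v = B (comb (-1) (s n) u) v" for n using B_comb[OF s(1) u(1) v, of "-1"] by simp
      then show "\<forall>\<^sub>F n in sequentially. (B (s n) v - B u v)\<^sup>2 \<le> B (comb (-1) (s n) u) (comb (-1) (s n) u) * B v v"
        using Cauchy_Schwarz[OF comb[OF s(1) u(1)] v] by simp
    qed auto
    ultimately have "(\<lambda>n. B (s n) v - l v) \<longlonglongrightarrow> 0" "(\<lambda>n. B (s n) v - B u v) \<longlonglongrightarrow> 0" by simp_all
    then have "(\<lambda>n. (B (s n) v - l v) - (B (s n) v - B u v)) \<longlonglongrightarrow> 0 - 0" by (rule tendsto_diff)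
    then have "(\<lambda>n::nat. B u v - l v) \<longlonglongrightarrow> 0" by simp
    then show ?thesis by (simp add: LIMSEQ_const_iff)
  qed
  then show ?thesis using u(1) by blast
qed

end

lemma L2_D:
  assumes "u \<in> L2 \<Omega>"
  shows "u \<in> borel_measurable (lebesgue_on \<Omega>)" "integrable (lebesgue_on \<Omega>) (\<lambda>x. (cmod (u x))\<^sup>2)"
  using assms unfolding L2_def by auto

lemma L2_I_bound:
  assumes "u \<in> borel_measurable (lebesgue_on \<Omega>)" "integrable (lebesgue_on \<Omega>) f"
    and "AE x in lebesgue_on \<Omega>. (cmod (u x))\<^sup>2 \<le> f x"
  shows "u \<in> L2 \<Omega>"
proof -
  have "integrable (lebesgue_on \<Omega>) (\<lambda>x. (cmod (u x))\<^sup>2)"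
    by (rule Bochner_Integration.integrable_bound[OF assms(2)]) (use assms in \<open>auto elim!: eventually_mono\<close>)
  then show ?thesis using assms(1) unfolding L2_def by simp
qed

lemma L2_lincomb:
  assumes u: "u \<in> L2 \<Omega>" and v: "v \<in> L2 \<Omega>"
  shows "(\<lambda>x. u x + c * v x) \<in> L2 \<Omega>"
proof (rule L2_I_bound[where f="\<lambda>x. 2 * (cmod (u x))\<^sup>2 + 2 * (cmod c)\<^sup>2 * (cmod (v x))\<^sup>2"])
  show "AE x in lebesgue_on \<Omega>. (cmod (u x + c * v x))\<^sup>2 \<le> 2 * (cmod (u x))\<^sup>2 + 2 * (cmod c)\<^sup>2 * (cmod (v x))\<^sup>2"
  proof (rule AE_I2)
    fix x
    have "(cmod (u x + c * v x))\<^sup>2 \<le> (cmod (u x) + cmod (c * v x))\<^sup>2" by (intro power_mono norm_triangle_ineq) simp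
    also have "\<dots> \<le> 2 * (cmod (u x))\<^sup>2 + 2 * (cmod (c * v x))\<^sup>2"
      using zero_le_power2[of "cmod (u x) - cmod (c * v x)"] by (simp add: power2_eq_square algebra_simps)
    finally show "(cmod (u x + c * v x))\<^sup>2 \<le> 2 * (cmod (u x))\<^sup>2 + 2 * (cmod c)\<^sup>2 * (cmod (v x))\<^sup>2"
      by (simp add: norm_mult power_mult_distrib)
  qed
qed (use L2_D[OF u] L2_D[OF v] in auto)

lemma L2_zero: "(\<lambda>x. 0) \<in> L2 \<Omega>" unfolding L2_def by simp

lemma L2_mult_bounded:
  assumes u: "u \<in> L2 \<Omega>" and f: "f \<in> borel_measurable (lebesgue_on \<Omega>)" "\<And>x. x \<in> \<Omega> \<Longrightarrow> cmod (f x) \<le> K"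
  shows "(\<lambda>x. f x * u x) \<in> L2 \<Omega>"
proof (rule L2_I_bound[where f="\<lambda>x. K\<^sup>2 * (cmod (u x))\<^sup>2"])
  show "AE x in lebesgue_on \<Omega>. (cmod (f x * u x))\<^sup>2 \<le> K\<^sup>2 * (cmod (u x))\<^sup>2"
    by (intro AE_I2) (auto simp: norm_mult power_mult_distrib space_restrict_space intro!: mult_right_mono power_mono f(2))
qed (use L2_D[OF u] f in auto)

lemma L2_mult_integrable:
  assumes u: "u \<in> L2 \<Omega>" and v: "v \<in> L2 \<Omega>"
  shows "integrable (lebesgue_on \<Omega>) (\<lambda>x. u x * v x)" "integrable (lebesgue_on \<Omega>) (\<lambda>x. u x * cnj (v x))"
proof -
  have I: "integrable (lebesgue_on \<Omega>) (\<lambda>x. (cmod (u x))\<^sup>2 + (cmod (v x))\<^sup>2)" using L2_D[OF u] L2_D[OF v] by simp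
  have b: "cmod (u x) * cmod (v x) \<le> (cmod (u x))\<^sup>2 + (cmod (v x))\<^sup>2" for x
    using zero_le_power2[of "cmod (u x) - cmod (v x)"] zero_le_power2[of "cmod (u x)"] zero_le_power2[of "cmod (v x)"]
      unfolding power2_diff by linarith
  have [measurable]: "u \<in> borel_measurable (lebesgue_on \<Omega>)" "v \<in> borel_measurable (lebesgue_on \<Omega>)" using L2_D[OF u] L2_D[OF v] by auto
  have [measurable]: "(\<lambda>x. cnj (v x)) \<in> borel_measurable (lebesgue_on \<Omega>)"
    by (rule borel_measurable_continuous_on[OF continuous_on_cnj[OF continuous_on_id]]) measurable
  show "integrable (lebesgue_on \<Omega>) (\<lambda>x. u x * v x)"
    by (rule Bochner_Integration.integrable_bound[OF I]) (measurable, use b in \<open>auto simp: norm_mult intro!: AE_I2 order_trans[OF b]\<close>)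
  show "integrable (lebesgue_on \<Omega>) (\<lambda>x. u x * cnj (v x))"
    by (rule Bochner_Integration.integrable_bound[OF I]) (measurable, use b in \<open>auto simp: norm_mult intro!: AE_I2 order_trans[OF b]\<close>)
qed

definition l2_real :: "'a::euclidean_space set \<Rightarrow> ('a \<Rightarrow> complex) \<Rightarrow> ('a \<Rightarrow> complex) \<Rightarrow> real" where
  "l2_real \<Omega> u v = Re (l2_inner \<Omega> u v)"

lemma l2_real_self: "u \<in> L2 \<Omega> \<Longrightarrow> l2_real \<Omega> u u = (LINT x|lebesgue_on \<Omega>. (cmod (u x))\<^sup>2)"
  unfolding l2_real_def l2_inner_def complex_norm_square[symmetric] by (simp only: integral_complex_of_real Re_complex_of_real)

lemma l2_norm_square: "u \<in> L2 \<Omega> \<Longrightarrow> (l2_norm \<Omega> u)\<^sup>2 = l2_real \<Omega> u u"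
  unfolding l2_norm_def by (simp add: l2_real_self)

lemma l2_inner_lincomb_left:
  assumes "u \<in> L2 \<Omega>" "v \<in> L2 \<Omega>" "w \<in> L2 \<Omega>"
  shows "l2_inner \<Omega> (\<lambda>x. u x + c * v x) w = l2_inner \<Omega> u w + c * l2_inner \<Omega> v w"
  unfolding l2_inner_def using L2_mult_integrable(2)[OF assms(1,3)] L2_mult_integrable(2)[OF assms(2,3)]
  by (simp add: distrib_right mult.assoc)

lemma l2_inner_commute: "l2_inner \<Omega> u v = cnj (l2_inner \<Omega> v u)"
proof -
  have "cnj (l2_inner \<Omega> v u) = (LINT x|lebesgue_on \<Omega>. cnj (v x * cnj (u x)))"
    unfolding l2_inner_def by (rule Bochner_Integration.integral_cnj[symmetric])
  then show ?thesis unfolding l2_inner_def by (simp add: mult.commute)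
qed

lemma l2_real_commute: "l2_real \<Omega> u v = l2_real \<Omega> v u"
  unfolding l2_real_def by (subst l2_inner_commute) simp

lemma l2_real_lincomb_left:
  assumes "u \<in> L2 \<Omega>" "v \<in> L2 \<Omega>" "w \<in> L2 \<Omega>"
  shows "l2_real \<Omega> (\<lambda>x. u x + complex_of_real t * v x) w = l2_real \<Omega> u w + t * l2_real \<Omega> v w"
  unfolding l2_real_def l2_inner_lincomb_left[OF assms] by simp

lemma l2_real_nonneg: "u \<in> L2 \<Omega> \<Longrightarrow> l2_real \<Omega> u u \<ge> 0"
  by (simp add: l2_real_self)

lemma l2_real_zero_iff:
  assumes "u \<in> L2 \<Omega>"
  shows "l2_real \<Omega> u u = 0 \<longleftrightarrow> (AE x in lebesgue_on \<Omega>. u x = 0)"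
  unfolding l2_real_self[OF assms] using integral_nonneg_eq_0_iff_AE[OF L2_D(2)[OF assms]] by simp

lemma l2_real_Cauchy_Schwarz:
  assumes u: "u \<in> L2 \<Omega>" and v: "v \<in> L2 \<Omega>"
  shows "(l2_real \<Omega> u v)\<^sup>2 \<le> l2_real \<Omega> u u * l2_real \<Omega> v v"
proof -
  have "(l2_real \<Omega> u v)\<^sup>2 \<le> l2_real \<Omega> v v * l2_real \<Omega> u u"
  proof (rule quadratic_nonneg_discriminant)
    fix t
    let ?w = "\<lambda>x. u x + complex_of_real t * v x"
    have w: "?w \<in> L2 \<Omega>" by (rule L2_lincomb[OF u v])
    have "0 \<le> l2_real \<Omega> ?w ?w" by (rule l2_real_nonneg[OF w])
    also have "\<dots> = l2_real \<Omega> u ?w + t * l2_real \<Omega> v ?w" by (rule l2_real_lincomb_left[OF u v w])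
    also have "l2_real \<Omega> u ?w = l2_real \<Omega> u u + t * l2_real \<Omega> v u" by (subst l2_real_commute, rule l2_real_lincomb_left[OF u v u])
    also have "l2_real \<Omega> v ?w = l2_real \<Omega> u v + t * l2_real \<Omega> v v" by (subst l2_real_commute, rule l2_real_lincomb_left[OF u v v])
    finally show "0 \<le> l2_real \<Omega> v v * t\<^sup>2 + 2 * l2_real \<Omega> u v * t + l2_real \<Omega> u u"
      by (simp add: l2_real_commute[of \<Omega> v u] power2_eq_square algebra_simps)
  qed (rule l2_real_nonneg[OF v])
  then show ?thesis by (simp add: mult.commute)
qed

text \<open>Along a subsequence with \<open>\<parallel>s\<^sub>k\<^sub>+\<^sub>1 - s\<^sub>k\<parallel>\<^sup>2 \<le> 4\<^sup>-\<^sup>k\<close> the weighted sum of the squared increments is integrable with weights \<open>2\<^sup>k\<close>, so almost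
everywhere the increments decay geometrically. This argument needs no finiteness of the measure. Convergence in L2 then
follows from Fatou's lemma.\<close>

lemma L2_complete:
  fixes s :: "nat \<Rightarrow> 'a::euclidean_space \<Rightarrow> complex"
  assumes s: "\<And>n. s n \<in> L2 \<Omega>"
    and cau: "\<And>e. e > 0 \<Longrightarrow> \<exists>N. \<forall>m\<ge>N. \<forall>n\<ge>N. (LINT x|lebesgue_on \<Omega>. (cmod (s m x - s n x))\<^sup>2) < e"
  shows "\<exists>u\<in>L2 \<Omega>. (\<lambda>n. LINT x|lebesgue_on \<Omega>. (cmod (s n x - u x))\<^sup>2) \<longlonglongrightarrow> 0"
proof -
  let ?M = "lebesgue_on \<Omega>"
  have sm[measurable]: "s n \<in> borel_measurable ?M" for n using L2_D[OF s] by simp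
  have int: "integrable ?M (\<lambda>x. (cmod (s m x - s n x))\<^sup>2)" for m n
    using L2_D(2)[OF L2_lincomb[OF s s, of m "-1" n]] by simp
  have "\<exists>N. \<forall>m\<ge>N. \<forall>n\<ge>N. (LINT x|?M. (cmod (s m x - s n x))\<^sup>2) < (1/4)^k" for k
    by (rule cau) simp
  then obtain N where N: "\<And>k m n. m \<ge> N k \<Longrightarrow> n \<ge> N k \<Longrightarrow> (LINT x|?M. (cmod (s m x - s n x))\<^sup>2) < (1/4)^k"
    by metis
  \<comment> \<open>Summation makes the chosen indices monotone and unbounded.\<close>
  define r where "r = (\<lambda>k. \<Sum>i\<le>k. N i + i)"
  have rN: "r k \<ge> N k" "r (Suc k) \<ge> N k" "r k \<ge> k" for k
  proof -
    have "N k + k \<le> r k" unfolding r_def by (rule member_le_sum) auto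
    moreover have "r k \<le> r (Suc k)" unfolding r_def by simp
    ultimately show "r k \<ge> N k" "r (Suc k) \<ge> N k" "r k \<ge> k" by linarith+
  qed
  define d where "d = (\<lambda>k x. (cmod (s (r (Suc k)) x - s (r k) x))\<^sup>2)"
  have dm[measurable]: "d k \<in> borel_measurable ?M" for k unfolding d_def by measurable
  have d0: "d k x \<ge> 0" for k x unfolding d_def by simp
  have dint: "(\<integral>\<^sup>+x. ennreal (d k x) \<partial>?M) \<le> ennreal ((1/4)^k)" for k
  proof -
    have "(\<integral>\<^sup>+x. ennreal (d k x) \<partial>?M) = ennreal (LINT x|?M. d k x)"
      unfolding d_def by (intro nn_integral_eq_integral int) auto
    also have "\<dots> \<le> ennreal ((1/4)^k)" unfolding d_def using N[OF rN(2) rN(1), of k] by (intro ennreal_leI) simp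
    finally show ?thesis .
  qed
  have "(\<integral>\<^sup>+x. (\<Sum>k. ennreal (2^k * d k x)) \<partial>?M) = (\<Sum>k. \<integral>\<^sup>+x. ennreal (2^k * d k x) \<partial>?M)"
    by (rule nn_integral_suminf) measurable
  also have "\<dots> \<le> (\<Sum>k. ennreal ((1/2)^k))"
  proof (intro suminf_le)
    fix k
    have "(\<integral>\<^sup>+x. ennreal (2^k * d k x) \<partial>?M) = ennreal (2^k) * (\<integral>\<^sup>+x. ennreal (d k x) \<partial>?M)"
      using d0 by (subst nn_integral_cmult[symmetric]) (auto simp: ennreal_mult)
    also have "\<dots> \<le> ennreal (2^k) * ennreal ((1/4)^k)" by (intro mult_left_mono dint) simp
    also have "\<dots> = ennreal ((1/2)^k)" by (simp add: ennreal_mult[symmetric] power_mult_distrib[symmetric])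
    finally show "(\<integral>\<^sup>+x. ennreal (2^k * d k x) \<partial>?M) \<le> ennreal ((1/2)^k)" .
  qed auto
  also have "\<dots> < \<infinity>"
    by (subst suminf_ennreal_eq[OF _ geometric_sums]) auto
  finally have fin: "(\<integral>\<^sup>+x. (\<Sum>k. ennreal (2^k * d k x)) \<partial>?M) \<noteq> \<infinity>" by simp
  have "AE x in ?M. (\<Sum>k. ennreal (2^k * d k x)) \<noteq> \<infinity>"
    by (rule nn_integral_PInf_AE[OF _ fin]) measurable
  then have conv: "AE x in ?M. convergent (\<lambda>k. s (r k) x)"
  proof eventually_elim
    case (elim x)
    have "summable (\<lambda>k. 2^k * d k x)" using elim d0 by (intro summable_suminf_not_top) auto
    then have "(\<lambda>k. 2^k * d k x) \<longlonglongrightarrow> 0" by (rule summable_LIMSEQ_zero)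
    then have "Bseq (\<lambda>k. 2^k * d k x)" by (intro convergent_imp_Bseq convergentI)
    then obtain K where K: "K > 0" "\<And>k. norm (2^k * d k x) \<le> K" by (auto simp: Bseq_def)
    have b1: "cmod (s (r (Suc k)) x - s (r k) x) \<le> sqrt K * (1 / sqrt 2)^k" for k
    proof -
      have "d k x \<le> K / 2^k" using K(2)[of k] d0[of k x] by (simp add: field_simps)
      then have "sqrt (d k x) \<le> sqrt (K / 2^k)" by simp
      also have "\<dots> = sqrt K * (1 / sqrt 2)^k" by (simp add: real_sqrt_divide real_sqrt_power power_one_over)
      finally show ?thesis by (simp add: d_def)
    qed
    have b2: "summable (\<lambda>k. sqrt K * (1 / sqrt 2)^k)"
      by (intro summable_mult summable_geometric) simp
    have "summable (\<lambda>k. s (r (Suc k)) x - s (r k) x)"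
      by (rule summable_comparison_test'[OF b2, of 0]) (use b1 in simp)
    then have "convergent (\<lambda>n. \<Sum>k<n. s (r (Suc k)) x - s (r k) x)" by (simp add: summable_iff_convergent)
    then have "convergent (\<lambda>n. s (r n) x - s (r 0) x)" using sum_lessThan_telescope[of "\<lambda>k. s (r k) x"] by simp
    then have "convergent (\<lambda>n. (s (r n) x - s (r 0) x) + s (r 0) x)" by (intro convergent_add convergent_const)
    then show ?case by simp
  qed
  define u where "u = (\<lambda>x. lim (\<lambda>k. s (r k) x))"
  have um[measurable]: "u \<in> borel_measurable ?M" unfolding u_def by measurable
  have lim: "AE x in ?M. (\<lambda>k. s (r k) x) \<longlonglongrightarrow> u x"
    using conv unfolding u_def by eventually_elim (simp add: convergent_LIMSEQ_iff)
  have fatou: "(\<integral>\<^sup>+x. ennreal ((cmod (s n x - u x))\<^sup>2) \<partial>?M) \<le> ennreal e"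
    if e: "e > 0" and n: "\<And>m. m \<ge> n0 \<Longrightarrow> (LINT x|?M. (cmod (s n x - s m x))\<^sup>2) < e" for e n n0
  proof -
    have "(\<integral>\<^sup>+x. ennreal ((cmod (s n x - u x))\<^sup>2) \<partial>?M) = (\<integral>\<^sup>+x. liminf (\<lambda>k. ennreal ((cmod (s n x - s (r k) x))\<^sup>2)) \<partial>?M)"
    proof (rule nn_integral_cong_AE)
      show "AE x in ?M. ennreal ((cmod (s n x - u x))\<^sup>2) = liminf (\<lambda>k. ennreal ((cmod (s n x - s (r k) x))\<^sup>2))"
        using lim
      proof eventually_elim
        case (elim x)
        have "(\<lambda>k. ennreal ((cmod (s n x - s (r k) x))\<^sup>2)) \<longlonglongrightarrow> ennreal ((cmod (s n x - u x))\<^sup>2)"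
          by (intro tendsto_ennrealI tendsto_intros elim)
        then show ?case by (rule lim_imp_Liminf[OF trivial_limit_sequentially, symmetric])
      qed
    qed
    also have "\<dots> \<le> liminf (\<lambda>k. \<integral>\<^sup>+x. ennreal ((cmod (s n x - s (r k) x))\<^sup>2) \<partial>?M)"
      by (rule nn_integral_liminf) measurable
    also have "\<dots> \<le> liminf (\<lambda>k. ennreal e)"
    proof (intro Liminf_mono)
      have "(\<integral>\<^sup>+x. ennreal ((cmod (s n x - s (r k) x))\<^sup>2) \<partial>?M) \<le> ennreal e" if "k \<ge> n0" for k
      proof -
        have "r k \<ge> n0" using that rN(3)[of k] by simp
        then show ?thesis using nn_integral_eq_integral[OF int] n by (simp add: ennreal_leI less_imp_le)
      qed
      then show "\<forall>\<^sub>F k in sequentially. (\<integral>\<^sup>+x. ennreal ((cmod (s n x - s (r k) x))\<^sup>2) \<partial>?M) \<le> ennreal e"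
        by (auto simp: eventually_sequentially)
    qed
    finally show ?thesis by (simp add: Liminf_const)
  qed
  have fatou2: "integrable ?M (\<lambda>x. (cmod (s n x - u x))\<^sup>2)" "(LINT x|?M. (cmod (s n x - u x))\<^sup>2) \<le> e"
    if e: "e > 0" and n: "\<And>m. m \<ge> n0 \<Longrightarrow> (LINT x|?M. (cmod (s n x - s m x))\<^sup>2) < e" for e n n0
  proof -
    have F: "(\<integral>\<^sup>+x. ennreal ((cmod (s n x - u x))\<^sup>2) \<partial>?M) \<le> ennreal e" by (rule fatou[OF e n])
    then have "(\<integral>\<^sup>+x. ennreal ((cmod (s n x - u x))\<^sup>2) \<partial>?M) < \<infinity>" using ennreal_less_top le_less_trans by (simp add: le_less_trans)
    then show i: "integrable ?M (\<lambda>x. (cmod (s n x - u x))\<^sup>2)" by (intro integrableI_nonneg) auto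
    have "ennreal (LINT x|?M. (cmod (s n x - u x))\<^sup>2) \<le> ennreal e"
      using F nn_integral_eq_integral[OF i] by simp
    then show "(LINT x|?M. (cmod (s n x - u x))\<^sup>2) \<le> e" using e by simp
  qed
  obtain N1 where N1: "\<And>m n. m \<ge> N1 \<Longrightarrow> n \<ge> N1 \<Longrightarrow> (LINT x|?M. (cmod (s m x - s n x))\<^sup>2) < 1"
    using cau[of 1] by auto
  have "(\<lambda>x. s N1 x - u x) \<in> L2 \<Omega>" using fatou2(1)[of 1 N1 N1] N1 unfolding L2_def by simp
  from L2_lincomb[OF s this, of N1 "-1"] have "u \<in> L2 \<Omega>" by simp
  moreover have "(\<lambda>n. LINT x|?M. (cmod (s n x - u x))\<^sup>2) \<longlonglongrightarrow> 0"
  proof (rule LIMSEQ_I)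
    fix e :: real assume e: "e > 0"
    then obtain N2 where N2: "\<And>m n. m \<ge> N2 \<Longrightarrow> n \<ge> N2 \<Longrightarrow> (LINT x|?M. (cmod (s m x - s n x))\<^sup>2) < e/2"
      using cau[of "e/2"] by auto
    have "norm ((LINT x|?M. (cmod (s n x - u x))\<^sup>2) - 0) < e" if "n \<ge> N2" for n
    proof -
      have "(LINT x|?M. (cmod (s n x - u x))\<^sup>2) \<le> e/2" using fatou2(2)[of "e/2" N2 n] N2 that e by simp
      then show ?thesis using e by simp
    qed
    then show "\<exists>no. \<forall>n\<ge>no. norm ((LINT x|?M. (cmod (s n x - u x))\<^sup>2) - 0) < e" by blast
  qed
  ultimately show ?thesis by blast
qed

section \<open>The spectrum is bounded below\<close>

lemma lebesgue_on_integrable_one: "\<Omega> \<in> lmeasurable \<Longrightarrow> integrable (lebesgue_on \<Omega>) (\<lambda>x. 1::real)"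
  by (auto simp: integrable_restrict_space fmeasurable_def intro!: integrable_real_indicator)

lemma bounded_in_L2:
  assumes "\<Omega> \<in> lmeasurable" "f \<in> borel_measurable (lebesgue_on \<Omega>)" "\<And>x. x \<in> \<Omega> \<Longrightarrow> cmod (f x) \<le> K"
  shows "f \<in> L2 \<Omega>"
proof -
  have "(\<lambda>x. 1) \<in> L2 \<Omega>" unfolding L2_def using lebesgue_on_integrable_one[OF assms(1)] by simp
  from L2_mult_bounded[OF this assms(2,3)] show ?thesis by simp
qed

lemma L2_integrable:
  assumes "\<Omega> \<in> lmeasurable" "u \<in> L2 \<Omega>"
  shows "integrable (lebesgue_on \<Omega>) u"
proof -
  have "(\<lambda>x. 1) \<in> L2 \<Omega>" by (rule bounded_in_L2[OF assms(1), of _ 1]) auto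
  from L2_mult_integrable(1)[OF assms(2) this] show ?thesis by simp
qed

lemma test_function_L2:
  assumes "\<Omega> \<in> lmeasurable" "\<phi> \<in> test_functions \<Omega>"
  shows "\<phi> \<in> L2 \<Omega>"
proof -
  obtain B where B: "\<And>x. cmod (\<phi> x) \<le> B" "B \<ge> 0" by (rule test_function_bounded[OF assms(2)]) (rule that)
  have "smooth \<phi>" by (rule test_functionD[OF assms(2)])
  then show ?thesis using B(1) by (intro bounded_in_L2[OF assms(1)] smooth_measurable)
qed

lemma disk_lmeasurable: "disk \<in> lmeasurable" by simp

lemma smooth_L2_disk:
  assumes "smooth f"
  shows "f \<in> L2 disk"
proof -
  have "bounded (f ` cball 0 1)"
    by (intro compact_imp_bounded compact_continuous_image smoothD(2)[OF assms]) auto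
  then obtain B where "\<forall>x\<in>cball 0 1. cmod (f x) \<le> B" by (auto simp: bounded_iff)
  then show ?thesis using assms by (intro bounded_in_L2[OF disk_lmeasurable, of _ B] smooth_measurable) auto
qed

lemma weak_partial_lincomb:
  assumes O: "open \<Omega>" "\<Omega> \<in> lmeasurable" and L: "u \<in> L2 \<Omega>" "v \<in> L2 \<Omega>" "g \<in> L2 \<Omega>" "h \<in> L2 \<Omega>"
    and w: "is_weak_partial \<Omega> e u g" "is_weak_partial \<Omega> e v h" and e: "e \<in> Basis"
  shows "is_weak_partial \<Omega> e (\<lambda>x. u x + c * v x) (\<lambda>x. g x + c * h x)"
  unfolding is_weak_partial_def
proof
  fix \<phi> assume \<phi>: "\<phi> \<in> test_functions \<Omega>"
  have i: "integrable (lebesgue_on \<Omega>) (\<lambda>x. f x * \<phi> x)" "integrable (lebesgue_on \<Omega>) (\<lambda>x. f x * pd e \<phi> x)" if "f \<in> L2 \<Omega>" for f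
    using integrable_mult_test_function[OF O(1) L2_integrable[OF O(2) that]] \<phi> test_function_pd[OF \<phi> e] by auto
  have "(LINT x|lebesgue_on \<Omega>. (u x + c * v x) * pd e \<phi> x) = (LINT x|lebesgue_on \<Omega>. u x * pd e \<phi> x) + c * (LINT x|lebesgue_on \<Omega>. v x * pd e \<phi> x)"
    using i(2)[OF L(1)] i(2)[OF L(2)] by (simp add: distrib_right mult.assoc)
  also have "\<dots> = - ((LINT x|lebesgue_on \<Omega>. g x * \<phi> x) + c * (LINT x|lebesgue_on \<Omega>. h x * \<phi> x))"
    using w \<phi> unfolding is_weak_partial_def by simp
  also have "(LINT x|lebesgue_on \<Omega>. g x * \<phi> x) + c * (LINT x|lebesgue_on \<Omega>. h x * \<phi> x) = (LINT x|lebesgue_on \<Omega>. (g x + c * h x) * \<phi> x)"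
    using i(1)[OF L(3)] i(1)[OF L(4)] by (simp add: distrib_right mult.assoc)
  finally show "(LINT x|lebesgue_on \<Omega>. (u x + c * v x) * pd e \<phi> x) = - (LINT x|lebesgue_on \<Omega>. (g x + c * h x) * \<phi> x)" .
qed

lemma L2_limit_integral:
  assumes s: "\<And>n. s n \<in> L2 \<Omega>" and u: "u \<in> L2 \<Omega>" and \<phi>: "\<phi> \<in> L2 \<Omega>"
    and lim: "(\<lambda>n. LINT x|lebesgue_on \<Omega>. (cmod (s n x - u x))\<^sup>2) \<longlonglongrightarrow> 0"
  shows "(\<lambda>n. LINT x|lebesgue_on \<Omega>. s n x * \<phi> x) \<longlonglongrightarrow> (LINT x|lebesgue_on \<Omega>. u x * \<phi> x)"
proof -
  have d: "(\<lambda>x. s n x - u x) \<in> L2 \<Omega>" for n using L2_lincomb[OF s u, of n "-1"] by simp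
  have R: "(\<lambda>n. Re (LINT x|lebesgue_on \<Omega>. (s n x - u x) * \<psi> x)) \<longlonglongrightarrow> 0" if \<psi>: "\<psi> \<in> L2 \<Omega>" for \<psi>
  proof -
    have c: "(\<lambda>x. cnj (\<psi> x)) \<in> L2 \<Omega>"
    proof -
      have "(\<lambda>x. cnj (\<psi> x)) \<in> borel_measurable (lebesgue_on \<Omega>)"
        by (rule borel_measurable_continuous_on[OF continuous_on_cnj[OF continuous_on_id] L2_D(1)[OF \<psi>]])
      then show ?thesis using L2_D(2)[OF \<psi>] unfolding L2_def by simp
    qed
    have "(\<lambda>n. (l2_real \<Omega> (\<lambda>x. s n x - u x) (\<lambda>x. cnj (\<psi> x)))\<^sup>2) \<longlonglongrightarrow> 0"
    proof (rule tendsto_sandwich[OF _ _ tendsto_const tendsto_mult_left_zero[OF lim, of "l2_real \<Omega> (\<lambda>x. cnj (\<psi> x)) (\<lambda>x. cnj (\<psi> x))"]])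
      show "\<forall>\<^sub>F n in sequentially. (l2_real \<Omega> (\<lambda>x. s n x - u x) (\<lambda>x. cnj (\<psi> x)))\<^sup>2
        \<le> (LINT x|lebesgue_on \<Omega>. (cmod (s n x - u x))\<^sup>2) * l2_real \<Omega> (\<lambda>x. cnj (\<psi> x)) (\<lambda>x. cnj (\<psi> x))"
        using l2_real_Cauchy_Schwarz[OF d c] by (simp add: l2_real_self[OF d])
    qed auto
    then show ?thesis unfolding l2_real_def l2_inner_def by simp
  qed
  have "(\<lambda>x. 0 + (- \<i>) * \<phi> x) \<in> L2 \<Omega>" by (rule L2_lincomb[OF L2_zero \<phi>])
  from R[OF this] have "(\<lambda>n. Re (LINT x|lebesgue_on \<Omega>. (- \<i>) * ((s n x - u x) * \<phi> x))) \<longlonglongrightarrow> 0"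
    by (simp add: mult.left_commute)
  then have I: "(\<lambda>n. Im (LINT x|lebesgue_on \<Omega>. (s n x - u x) * \<phi> x)) \<longlonglongrightarrow> 0" by simp
  have "(\<lambda>n. LINT x|lebesgue_on \<Omega>. (s n x - u x) * \<phi> x) \<longlonglongrightarrow> 0"
    using tendsto_Complex[OF R[OF \<phi>] I] by (simp add: zero_complex.code)
  moreover have "(LINT x|lebesgue_on \<Omega>. (s n x - u x) * \<phi> x) = (LINT x|lebesgue_on \<Omega>. s n x * \<phi> x) - (LINT x|lebesgue_on \<Omega>. u x * \<phi> x)" for n
    using L2_mult_integrable(1)[OF s \<phi>, of n] L2_mult_integrable(1)[OF u \<phi>] by (simp add: left_diff_distrib)
  ultimately show ?thesis by (simp add: LIM_zero_iff)
qed

definition magA :: "real \<Rightarrow> real^2 \<Rightarrow> real^2 \<Rightarrow> complex" where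
  "magA b e x = complex_of_real (b * (vecpot x \<bullet> e))"

lemma vecpot_inner: "vecpot x \<bullet> y = x \<bullet> (- vecpot y)"
  by (simp add: vecpot_def inner_vec_def sum_2)

lemma smooth_magA: "smooth (magA b e)"
proof -
  have "magA b e = (\<lambda>x. complex_of_real b * complex_of_real (x \<bullet> (- vecpot e)))"
    unfolding magA_def[abs_def] vecpot_inner by simp
  then show ?thesis by (simp only: smooth_mult[OF smooth_const smooth_of_real_inner])
qed

lemma magA_mult_L2: "u \<in> L2 disk \<Longrightarrow> (\<lambda>x. magA b e x * u x) \<in> L2 disk"
proof (rule L2_mult_bounded[where K="\<bar>b\<bar> * norm (vecpot e)"])
  show "magA b e \<in> borel_measurable (lebesgue_on disk)" by (rule smooth_measurable[OF smooth_magA])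
  show "cmod (magA b e x) \<le> \<bar>b\<bar> * norm (vecpot e)" if "x \<in> disk" for x
  proof -
    have "\<bar>x \<bullet> (- vecpot e)\<bar> \<le> norm x * norm (- vecpot e)" by (rule Cauchy_Schwarz_ineq2)
    also have "\<dots> \<le> 1 * norm (vecpot e)" using that by (intro mult_mono) auto
    finally have "\<bar>b\<bar> * \<bar>x \<bullet> (- vecpot e)\<bar> \<le> \<bar>b\<bar> * norm (vecpot e)" by (intro mult_left_mono) auto
    then show ?thesis unfolding magA_def vecpot_inner by (simp only: norm_of_real abs_mult)
  qed
qed

text \<open>The graph of the magnetic gradient. Treating the gradient as an independent component avoids the choice made in \<open>weak_partial\<close>
until the very end, and makes linearity and completeness componentwise statements.\<close>

definition mag_pairs :: "real \<Rightarrow> ((real^2 \<Rightarrow> complex) \<times> (real^2 \<Rightarrow> real^2 \<Rightarrow> complex)) set" where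
  "mag_pairs b = {(u, X). u \<in> L2 disk \<and>
     (\<forall>e\<in>Basis. X e \<in> L2 disk \<and> is_weak_partial disk e u (\<lambda>x. \<i> * (X e x - magA b e x * u x)))}"

lemma mag_pairsD:
  assumes "(u, X) \<in> mag_pairs b"
  shows "u \<in> L2 disk" "e \<in> Basis \<Longrightarrow> X e \<in> L2 disk"
    "e \<in> Basis \<Longrightarrow> is_weak_partial disk e u (\<lambda>x. \<i> * (X e x - magA b e x * u x))"
    "e \<in> Basis \<Longrightarrow> (\<lambda>x. \<i> * (X e x - magA b e x * u x)) \<in> L2 disk"
proof -
  show u: "u \<in> L2 disk" and X: "e \<in> Basis \<Longrightarrow> X e \<in> L2 disk"
    and "e \<in> Basis \<Longrightarrow> is_weak_partial disk e u (\<lambda>x. \<i> * (X e x - magA b e x * u x))"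
    using assms unfolding mag_pairs_def by auto
  assume "e \<in> Basis"
  have "(\<lambda>x. X e x + (-1) * (magA b e x * u x)) \<in> L2 disk" by (rule L2_lincomb[OF X[OF \<open>e \<in> Basis\<close>] magA_mult_L2[OF u]])
  from L2_lincomb[OF L2_zero this, of \<i>] show "(\<lambda>x. \<i> * (X e x - magA b e x * u x)) \<in> L2 disk" by simp
qed

lemma H1_mag_pair:
  assumes "u \<in> H1 disk"
  shows "(u, \<lambda>e. mag_grad b e u) \<in> mag_pairs b"
proof -
  have u: "u \<in> L2 disk" using assms unfolding H1_def by simp
  have "mag_grad b e u \<in> L2 disk \<and> is_weak_partial disk e u (\<lambda>x. \<i> * (mag_grad b e u x - magA b e x * u x))" if e: "e \<in> Basis" for e
  proof -
    have "\<exists>g. g \<in> L2 disk \<and> is_weak_partial disk e u g" using assms e unfolding H1_def by auto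
    from someI_ex[OF this] have w: "weak_partial disk e u \<in> L2 disk" "is_weak_partial disk e u (weak_partial disk e u)"
      unfolding weak_partial_def by auto
    have m: "mag_grad b e u = (\<lambda>x. magA b e x * u x + (- \<i>) * weak_partial disk e u x)"
      unfolding mag_grad_def[abs_def] magA_def by (simp add: add.commute)
    have "mag_grad b e u \<in> L2 disk" unfolding m by (rule L2_lincomb[OF magA_mult_L2[OF u] w(1)])
    moreover have "(\<lambda>x. \<i> * (mag_grad b e u x - magA b e x * u x)) = weak_partial disk e u" unfolding m by (auto simp: fun_eq_iff)
    ultimately show ?thesis using w(2) by simp
  qed
  then show ?thesis using u unfolding mag_pairs_def by auto
qed

text \<open>Here uniqueness of weak derivatives identifies the second component with the magnetic gradient built from the chosen weak derivative.\<close>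

lemma mag_pair_H1:
  assumes p: "(u, X) \<in> mag_pairs b"
  shows "u \<in> H1 disk" "e \<in> Basis \<Longrightarrow> AE x in lebesgue_on disk. X e x = mag_grad b e u x"
proof -
  show h: "u \<in> H1 disk" unfolding H1_def using mag_pairsD[OF p] by blast
  assume e: "e \<in> Basis"
  note q = H1_mag_pair[OF h, of b]
  have "AE x in lebesgue_on disk. \<i> * (X e x - magA b e x * u x) = \<i> * (mag_grad b e u x - magA b e x * u x)"
    by (rule weak_partial_unique[OF open_ball _ mag_pairsD(3)[OF p e] _ mag_pairsD(3)[OF q e]])
       (intro L2_integrable[OF disk_lmeasurable] mag_pairsD(4)[OF p e] mag_pairsD(4)[OF q e])+
  then show "AE x in lebesgue_on disk. X e x = mag_grad b e u x" by eventually_elim simp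
qed

definition pair_add :: "complex \<Rightarrow> ((real^2 \<Rightarrow> complex) \<times> (real^2 \<Rightarrow> real^2 \<Rightarrow> complex)) \<Rightarrow> _ \<Rightarrow> _" where
  "pair_add c p q = ((\<lambda>x. fst p x + c * fst q x), (\<lambda>e x. snd p e x + c * snd q e x))"

lemma mag_pairs_add:
  assumes p: "p \<in> mag_pairs b" and q: "q \<in> mag_pairs b"
  shows "pair_add c p q \<in> mag_pairs b"
proof -
  obtain u X v Y where pq: "p = (u, X)" "q = (v, Y)" by (cases p, cases q) auto
  note P = mag_pairsD[OF p[unfolded pq]] and Q = mag_pairsD[OF q[unfolded pq]]
  have "is_weak_partial disk e (\<lambda>x. u x + c * v x) (\<lambda>x. \<i> * ((X e x + c * Y e x) - magA b e x * (u x + c * v x)))" if e: "e \<in> Basis" for e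
  proof -
    have "(\<lambda>x. \<i> * ((X e x + c * Y e x) - magA b e x * (u x + c * v x)))
        = (\<lambda>x. \<i> * (X e x - magA b e x * u x) + c * (\<i> * (Y e x - magA b e x * v x)))"
      by (simp add: fun_eq_iff algebra_simps)
    then show ?thesis
      using weak_partial_lincomb[OF open_ball disk_lmeasurable P(1) Q(1) P(4)[OF e] Q(4)[OF e] P(3)[OF e] Q(3)[OF e] e, of c] by simp
  qed
  then show ?thesis using L2_lincomb[OF P(1) Q(1)] L2_lincomb[OF P(2) Q(2)] unfolding mag_pairs_def pair_add_def pq by auto
qed

definition pair_form :: "real \<Rightarrow> ((real^2 \<Rightarrow> complex) \<times> (real^2 \<Rightarrow> real^2 \<Rightarrow> complex)) \<Rightarrow> _ \<Rightarrow> real" where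
  "pair_form c p q = c * l2_real disk (fst p) (fst q) + (\<Sum>e\<in>Basis. l2_real disk (snd p e) (snd q e))"

lemma zero_mag_pair: "((\<lambda>x. 0), (\<lambda>e x. 0)) \<in> mag_pairs b"
  unfolding mag_pairs_def is_weak_partial_def by (auto intro: L2_zero)

lemma mag_pairs_complete:
  assumes c: "c > 0" and s: "\<And>n. s n \<in> mag_pairs b"
    and cau: "\<And>e. e > 0 \<Longrightarrow> \<exists>N::nat. \<forall>m\<ge>N. \<forall>n\<ge>N. pair_form c (pair_add (-1) (s m) (s n)) (pair_add (-1) (s m) (s n)) < e"
  shows "\<exists>p\<in>mag_pairs b. (\<lambda>n. pair_form c (pair_add (-1) (s n) p) (pair_add (-1) (s n) p)) \<longlonglongrightarrow> 0"
proof -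
  have L: "fst p \<in> L2 disk" "e \<in> Basis \<Longrightarrow> snd p e \<in> L2 disk" if "p \<in> mag_pairs b" for p e
    using mag_pairsD[of "fst p" "snd p" b] that by auto
  have form: "pair_form c (pair_add (-1) p q) (pair_add (-1) p q)
     = c * (LINT x|lebesgue_on disk. (cmod (fst p x - fst q x))\<^sup>2) + (\<Sum>e\<in>Basis. LINT x|lebesgue_on disk. (cmod (snd p e x - snd q e x))\<^sup>2)"
    if pq: "p \<in> mag_pairs b" "q \<in> mag_pairs b" for p q
    unfolding pair_form_def using L[OF mag_pairs_add[OF pq, of "-1"]] by (simp add: l2_real_self) (simp add: pair_add_def)
  have cu: "\<exists>N. \<forall>m\<ge>N. \<forall>n\<ge>N. (LINT x|lebesgue_on disk. (cmod (fst (s m) x - fst (s n) x))\<^sup>2) < r" if r: "r > 0" for r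
  proof -
    obtain N where N: "\<And>m n. m \<ge> N \<Longrightarrow> n \<ge> N \<Longrightarrow> pair_form c (pair_add (-1) (s m) (s n)) (pair_add (-1) (s m) (s n)) < c * r"
      using cau[of "c * r"] c r by auto
    have "(LINT x|lebesgue_on disk. (cmod (fst (s m) x - fst (s n) x))\<^sup>2) < r" if "m \<ge> N" "n \<ge> N" for m n
    proof -
      have "0 \<le> (\<Sum>e\<in>Basis. LINT x|lebesgue_on disk. (cmod (snd (s m) e x - snd (s n) e x))\<^sup>2)" by (intro sum_nonneg) simp
      then have "c * (LINT x|lebesgue_on disk. (cmod (fst (s m) x - fst (s n) x))\<^sup>2) < c * r"
        using N[OF that] unfolding form[OF s s] by linarith
      then show ?thesis using c by simp
    qed
    then show ?thesis by blast
  qed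
  have cX: "\<exists>N. \<forall>m\<ge>N. \<forall>n\<ge>N. (LINT x|lebesgue_on disk. (cmod (snd (s m) e x - snd (s n) e x))\<^sup>2) < r" if r: "r > 0" and e: "e \<in> Basis" for r e
  proof -
    obtain N where N: "\<And>m n. m \<ge> N \<Longrightarrow> n \<ge> N \<Longrightarrow> pair_form c (pair_add (-1) (s m) (s n)) (pair_add (-1) (s m) (s n)) < r"
      using cau[OF r] by auto
    have "(LINT x|lebesgue_on disk. (cmod (snd (s m) e x - snd (s n) e x))\<^sup>2) < r" if "m \<ge> N" "n \<ge> N" for m n
    proof -
      have "(LINT x|lebesgue_on disk. (cmod (snd (s m) e x - snd (s n) e x))\<^sup>2)
          \<le> (\<Sum>e\<in>Basis. LINT x|lebesgue_on disk. (cmod (snd (s m) e x - snd (s n) e x))\<^sup>2)"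
        by (rule member_le_sum[OF e]) auto
      moreover have "0 \<le> c * (LINT x|lebesgue_on disk. (cmod (fst (s m) x - fst (s n) x))\<^sup>2)" using c by simp
      ultimately show ?thesis using N[OF that] unfolding form[OF s s] by linarith
    qed
    then show ?thesis by blast
  qed
  obtain u where u: "u \<in> L2 disk" "(\<lambda>n. LINT x|lebesgue_on disk. (cmod (fst (s n) x - u x))\<^sup>2) \<longlonglongrightarrow> 0"
    using L2_complete[of "\<lambda>n. fst (s n)", OF L(1)[OF s] cu] by blast
  have "\<forall>e\<in>Basis. \<exists>Y. Y \<in> L2 disk \<and> (\<lambda>n. LINT x|lebesgue_on disk. (cmod (snd (s n) e x - Y x))\<^sup>2) \<longlonglongrightarrow> 0"
  proof
    fix e :: "real^2" assume e: "e \<in> Basis"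
    show "\<exists>Y. Y \<in> L2 disk \<and> (\<lambda>n. LINT x|lebesgue_on disk. (cmod (snd (s n) e x - Y x))\<^sup>2) \<longlonglongrightarrow> 0"
      using L2_complete[of "\<lambda>n. snd (s n) e", OF L(2)[OF s e] cX[OF _ e]] by (simp only: Bex_def)
  qed
  from bchoice[OF this] obtain X where X0:
    "\<forall>e\<in>Basis. X e \<in> L2 disk \<and> (\<lambda>n. LINT x|lebesgue_on disk. (cmod (snd (s n) e x - X e x))\<^sup>2) \<longlonglongrightarrow> 0"
    by (rule exE)
  have X: "X e \<in> L2 disk" "(\<lambda>n. LINT x|lebesgue_on disk. (cmod (snd (s n) e x - X e x))\<^sup>2) \<longlonglongrightarrow> 0"
    if "e \<in> Basis" for e using X0 that by simp_all
  have "is_weak_partial disk e u (\<lambda>x. \<i> * (X e x - magA b e x * u x))" if e: "e \<in> Basis" for e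
    unfolding is_weak_partial_def
  proof
    fix \<phi> assume \<phi>: "\<phi> \<in> test_functions (disk)"
    note \<phi>2 = test_function_L2[OF disk_lmeasurable \<phi>] and d\<phi>2 = test_function_L2[OF disk_lmeasurable test_function_pd[OF \<phi> e]]
    have i\<phi>: "(\<lambda>x. \<i> * \<phi> x) \<in> L2 disk" using L2_lincomb[OF L2_zero \<phi>2, of \<i>] by simp
    have a\<phi>: "(\<lambda>x. \<i> * (magA b e x * \<phi> x)) \<in> L2 disk" using L2_lincomb[OF L2_zero magA_mult_L2[OF \<phi>2], of \<i>] by simp
    have split: "(LINT x|lebesgue_on disk. \<i> * (Y x - magA b e x * w x) * \<phi> x)
       = (LINT x|lebesgue_on disk. Y x * (\<i> * \<phi> x)) - (LINT x|lebesgue_on disk. w x * (\<i> * (magA b e x * \<phi> x)))"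
      if "Y \<in> L2 disk" "w \<in> L2 disk" for Y w
    proof -
      have "(\<lambda>x. \<i> * (Y x - magA b e x * w x) * \<phi> x) = (\<lambda>x. Y x * (\<i> * \<phi> x) - w x * (\<i> * (magA b e x * \<phi> x)))"
        by (simp add: fun_eq_iff algebra_simps)
      then show ?thesis using Bochner_Integration.integral_diff[OF L2_mult_integrable(1)[OF that(1) i\<phi>] L2_mult_integrable(1)[OF that(2) a\<phi>]] by simp
    qed
    have "(\<lambda>n. LINT x|lebesgue_on disk. fst (s n) x * pd e \<phi> x) \<longlonglongrightarrow> (LINT x|lebesgue_on disk. u x * pd e \<phi> x)"
      by (rule L2_limit_integral[OF L(1)[OF s] u(1) d\<phi>2 u(2)])
    moreover have "(LINT x|lebesgue_on disk. fst (s n) x * pd e \<phi> x) = - (LINT x|lebesgue_on disk. \<i> * (snd (s n) e x - magA b e x * fst (s n) x) * \<phi> x)" for n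
      using mag_pairsD(3)[of "fst (s n)" "snd (s n)" b e] s e \<phi> unfolding is_weak_partial_def by simp
    moreover have "(\<lambda>n. - (LINT x|lebesgue_on disk. \<i> * (snd (s n) e x - magA b e x * fst (s n) x) * \<phi> x))
       \<longlonglongrightarrow> - (LINT x|lebesgue_on disk. \<i> * (X e x - magA b e x * u x) * \<phi> x)"
      unfolding split[OF L(2)[OF s e] L(1)[OF s]] split[OF X(1)[OF e] u(1)]
      by (intro tendsto_minus tendsto_diff L2_limit_integral[OF L(2)[OF s e] X(1)[OF e] i\<phi> X(2)[OF e]]
           L2_limit_integral[OF L(1)[OF s] u(1) a\<phi> u(2)])
    ultimately show "(LINT x|lebesgue_on disk. u x * pd e \<phi> x) = - (LINT x|lebesgue_on disk. \<i> * (X e x - magA b e x * u x) * \<phi> x)"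
      by (simp add: LIMSEQ_unique)
  qed
  then have p: "(u, X) \<in> mag_pairs b" using u(1) X(1) unfolding mag_pairs_def by auto
  have "(\<lambda>n. c * (LINT x|lebesgue_on disk. (cmod (fst (s n) x - u x))\<^sup>2) + (\<Sum>e\<in>Basis. LINT x|lebesgue_on disk. (cmod (snd (s n) e x - X e x))\<^sup>2))
     \<longlonglongrightarrow> c * 0 + (\<Sum>e\<in>(Basis::(real^2) set). 0)"
    by (intro tendsto_add tendsto_mult tendsto_const u(2) tendsto_sum X(2))
  then show ?thesis using p form[OF s p] by (intro bexI[OF _ p]) simp
qed

lemma mag_pairs_semi_inner:
  assumes c: "c > 0"
  shows "semi_inner_complete (mag_pairs b) (\<lambda>t. pair_add (complex_of_real t)) (pair_form c)"
proof
  have L: "fst p \<in> L2 disk" "e \<in> Basis \<Longrightarrow> snd p e \<in> L2 disk" if "p \<in> mag_pairs b" for p e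
    using mag_pairsD[of "fst p" "snd p" b] that by auto
  show "mag_pairs b \<noteq> {}" using zero_mag_pair by blast
  show "pair_add (complex_of_real t) u v \<in> mag_pairs b" if "u \<in> mag_pairs b" "v \<in> mag_pairs b" for t u v
    by (rule mag_pairs_add[OF that])
  show "pair_form c (pair_add (complex_of_real t) u v) w = pair_form c u w + t * pair_form c v w"
    if "u \<in> mag_pairs b" "v \<in> mag_pairs b" "w \<in> mag_pairs b" for t u v w
    unfolding pair_form_def pair_add_def
    using l2_real_lincomb_left[OF L(1)[OF that(1)] L(1)[OF that(2)] L(1)[OF that(3)]]
      l2_real_lincomb_left[OF L(2)[OF that(1)] L(2)[OF that(2)] L(2)[OF that(3)]]
    by (simp add: sum.distrib sum_distrib_left algebra_simps)
  show "pair_form c u v = pair_form c v u" for u v unfolding pair_form_def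
    by (intro arg_cong2[where f="(+)"] arg_cong2[where f="(*)"] sum.cong refl l2_real_commute)
  show "pair_form c u u \<ge> 0" if "u \<in> mag_pairs b" for u
    unfolding pair_form_def using c by (intro add_nonneg_nonneg mult_nonneg_nonneg sum_nonneg l2_real_nonneg L[OF that]) auto
  show "\<exists>u\<in>mag_pairs b. (\<lambda>n. pair_form c (pair_add (complex_of_real (-1)) (s n) u) (pair_add (complex_of_real (-1)) (s n) u)) \<longlonglongrightarrow> 0"
    if "\<And>n. s n \<in> mag_pairs b"
      "\<And>e. e > 0 \<Longrightarrow> \<exists>N::nat. \<forall>m\<ge>N. \<forall>n\<ge>N. pair_form c (pair_add (complex_of_real (-1)) (s m) (s n)) (pair_add (complex_of_real (-1)) (s m) (s n)) < e" for s
    using mag_pairs_complete[OF c that(1)] that(2) by simp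
qed

lemma mag_form_pairs:
  assumes p: "(u, X) \<in> mag_pairs b" and v: "(v, Y) \<in> mag_pairs b"
  shows "mag_form b u v = (\<Sum>e\<in>Basis. l2_inner disk (X e) (Y e))"
proof -
  note P = H1_mag_pair[OF mag_pair_H1(1)[OF p], of b] and Q = H1_mag_pair[OF mag_pair_H1(1)[OF v], of b]
  have "mag_form b u v = (\<Sum>e\<in>Basis. l2_inner disk (mag_grad b e u) (mag_grad b e v))"
    unfolding mag_form_def l2_inner_def
    by (rule Bochner_Integration.integral_sum) (rule L2_mult_integrable(2)[OF mag_pairsD(2)[OF P] mag_pairsD(2)[OF Q]])
  also have "\<dots> = (\<Sum>e\<in>Basis. l2_inner disk (X e) (Y e))"
  proof (rule sum.cong[OF refl])
    fix e :: "real^2" assume e: "e \<in> Basis"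
    have m: "(\<lambda>x. f x * cnj (g x)) \<in> borel_measurable (lebesgue_on disk)" if "f \<in> L2 disk" "g \<in> L2 disk" for f g
      by (rule borel_measurable_integrable[OF L2_mult_integrable(2)[OF that]])
    show "l2_inner disk (mag_grad b e u) (mag_grad b e v) = l2_inner disk (X e) (Y e)"
      unfolding l2_inner_def
    proof (rule integral_cong_AE[OF m[OF mag_pairsD(2)[OF P e] mag_pairsD(2)[OF Q e]] m[OF mag_pairsD(2)[OF p e] mag_pairsD(2)[OF v e]]])
      show "AE x in lebesgue_on disk. mag_grad b e u x * cnj (mag_grad b e v x) = X e x * cnj (Y e x)"
        using mag_pair_H1(2)[OF p e] mag_pair_H1(2)[OF v e] by eventually_elim simp
    qed
  qed
  finally show ?thesis .
qed

text \<open>The Riesz theorem for \<open>-E <u, v> + q\<^sub>b(u, v)\<close> solves the weak equation in real parts; replacing \<open>v\<close> by \<open>\<i> v\<close> gives the imaginary parts. The bound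
on the inverse follows by testing the equation with its solution.\<close>

theorem negative_in_resolvent_set:
  assumes E: "E < 0"
  shows "complex_of_real E \<in> resolvent_set disk (mag_laplacian b)"
proof -
  define c where "c = - E"
  have c: "c > 0" using E c_def by simp
  interpret semi_inner_complete "mag_pairs b" "\<lambda>t. pair_add (complex_of_real t)" "pair_form c"
    by (rule mag_pairs_semi_inner[OF c])
  have "\<exists>u f. mag_laplacian b u f \<and> (AE x in lebesgue_on disk. f x - complex_of_real E * u x = g x)" if g: "g \<in> L2 disk" for g
  proof -
    have "\<exists>u\<in>mag_pairs b. \<forall>v\<in>mag_pairs b. pair_form c u v = l2_real disk (fst v) g"
    proof (rule riesz_representation[where C="l2_real disk g g / c"])
      have L: "fst p \<in> L2 disk" if "p \<in> mag_pairs b" for p using mag_pairsD[of "fst p" "snd p" b] that by auto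
      show "l2_real disk (fst (pair_add (complex_of_real t) u v)) g = l2_real disk (fst u) g + t * l2_real disk (fst v) g"
        if "u \<in> mag_pairs b" "v \<in> mag_pairs b" for t u v
        unfolding pair_add_def using l2_real_lincomb_left[OF L[OF that(1)] L[OF that(2)] g] by simp
      show "(l2_real disk (fst u) g)\<^sup>2 \<le> l2_real disk g g / c * pair_form c u u" if "u \<in> mag_pairs b" for u
      proof -
        have X: "snd u e \<in> L2 disk" if "e \<in> Basis" for e using mag_pairsD(2)[of "fst u" "snd u" b] \<open>u \<in> mag_pairs b\<close> that by simp
        have "(l2_real disk (fst u) g)\<^sup>2 \<le> l2_real disk (fst u) (fst u) * l2_real disk g g"
          by (rule l2_real_Cauchy_Schwarz[OF L[OF that] g])
        also have "\<dots> = l2_real disk g g / c * (c * l2_real disk (fst u) (fst u))" using c by simp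
        also have "\<dots> \<le> l2_real disk g g / c * pair_form c u u"
          unfolding pair_form_def using c l2_real_nonneg[OF g] X
          by (intro mult_left_mono) (auto intro!: sum_nonneg l2_real_nonneg)
        finally show ?thesis .
      qed
      show "l2_real disk g g / c \<ge> 0" using c l2_real_nonneg[OF g] by simp
    qed
    then obtain u X where p: "(u, X) \<in> mag_pairs b" and
      eq: "\<And>v Y. (v, Y) \<in> mag_pairs b \<Longrightarrow> c * l2_real disk u v + (\<Sum>e\<in>Basis. l2_real disk (X e) (Y e)) = l2_real disk v g"
      unfolding pair_form_def by fastforce
    note u = mag_pairsD(1)[OF p] and X = mag_pairsD(2)[OF p]
    define f where "f = (\<lambda>x. g x + complex_of_real E * u x)"
    have f: "f \<in> L2 disk" unfolding f_def by (rule L2_lincomb[OF g u])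
    have "mag_form b u v = l2_inner disk f v" if v: "v \<in> H1 disk" for v
    proof -
      note q = H1_mag_pair[OF v, of b]
      define Y where "Y = (\<lambda>e. mag_grad b e v)"
      have q: "(v, Y) \<in> mag_pairs b" unfolding Y_def by (rule q)
      note v2 = mag_pairsD(1)[OF q] and Y2 = mag_pairsD(2)[OF q]
      define D where "D = (\<lambda>v Y. of_real c * l2_inner disk u v + (\<Sum>e\<in>Basis. l2_inner disk (X e) (Y e)) - l2_inner disk g v)"
      have re: "Re (D v Y) = 0" if "(v, Y) \<in> mag_pairs b" for v Y
        using eq[OF that] unfolding D_def l2_real_commute[of disk v g] by (simp add: l2_real_def)
      have "pair_add \<i> ((\<lambda>x. 0), (\<lambda>e x. 0)) (v, Y) \<in> mag_pairs b" by (rule mag_pairs_add[OF zero_mag_pair q])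
      then have "Re (D (\<lambda>x. \<i> * v x) (\<lambda>e x. \<i> * Y e x)) = 0" using re unfolding pair_add_def by simp
      moreover have "l2_inner disk w (\<lambda>x. \<i> * y x) = - \<i> * l2_inner disk w y" for w y
      proof -
        have "(\<lambda>x. w x * cnj (\<i> * y x)) = (\<lambda>x. - \<i> * (w x * cnj (y x)))" by (simp add: fun_eq_iff)
        then show ?thesis unfolding l2_inner_def by (simp only: integral_mult_right_zero)
      qed
      then have "D (\<lambda>x. \<i> * v x) (\<lambda>e x. \<i> * Y e x) = - \<i> * D v Y"
        unfolding D_def by (simp add: sum_distrib_left sum_negf algebra_simps)
      ultimately have "Im (D v Y) = 0" by simp
      then have "D v Y = 0" using re[OF q] by (simp add: complex_eq_iff)
      then have "(\<Sum>e\<in>Basis. l2_inner disk (X e) (Y e)) = l2_inner disk g v + of_real E * l2_inner disk u v"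
        unfolding D_def c_def by (simp add: algebra_simps)
      then show ?thesis unfolding mag_form_pairs[OF p q] f_def l2_inner_lincomb_left[OF g u v2] .
    qed
    then have "mag_laplacian b u f" unfolding mag_laplacian_def form_operator_def using mag_pair_H1(1)[OF p] f by blast
    moreover have "AE x in lebesgue_on disk. f x - complex_of_real E * u x = g x" unfolding f_def by simp
    ultimately show ?thesis by blast
  qed
  moreover have "l2_norm disk u \<le> 1/c * l2_norm disk (\<lambda>x. f x - complex_of_real E * u x)" if T: "mag_laplacian b u f" for u f
  proof -
    have uh: "u \<in> H1 disk" and f: "f \<in> L2 disk" and fe: "mag_form b u u = l2_inner disk f u"
      using T unfolding mag_laplacian_def form_operator_def by auto
    have u: "u \<in> L2 disk" using uh unfolding H1_def by simp
    define w where "w = (\<lambda>x. f x - complex_of_real E * u x)"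
    have w: "w \<in> L2 disk" unfolding w_def using L2_lincomb[OF f u, of "- complex_of_real E"] by simp
    have "0 \<le> mag_qform b u" unfolding mag_qform_def by (intro Bochner_Integration.integral_nonneg sum_nonneg) simp
    moreover have "mag_qform b u = l2_real disk f u" using fe unfolding mag_form_diag l2_real_def by (metis Re_complex_of_real)
    moreover have "l2_real disk w u = l2_real disk f u + c * l2_real disk u u"
      unfolding w_def c_def using l2_real_lincomb_left[OF f u u, of "- E"] by simp
    ultimately have 1: "c * l2_real disk u u \<le> l2_real disk w u" by linarith
    have U: "l2_real disk u u \<ge> 0" "l2_real disk w w \<ge> 0" using l2_real_nonneg u w by auto
    have "(c * l2_real disk u u)\<^sup>2 \<le> (l2_real disk w u)\<^sup>2" using 1 U c by (intro power_mono) auto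
    also have "\<dots> \<le> l2_real disk w w * l2_real disk u u" by (rule l2_real_Cauchy_Schwarz[OF w u])
    finally have 2: "c\<^sup>2 * l2_real disk u u * l2_real disk u u \<le> l2_real disk w w * l2_real disk u u"
      by (simp add: power2_eq_square algebra_simps)
    have "c\<^sup>2 * l2_real disk u u \<le> l2_real disk w w"
      using 2 U by (cases "l2_real disk u u = 0") auto
    then have "(c * l2_norm disk u)\<^sup>2 \<le> (l2_norm disk w)\<^sup>2"
      unfolding power_mult_distrib l2_norm_square[OF u] l2_norm_square[OF w] .
    then have "c * l2_norm disk u \<le> l2_norm disk w" by (rule power2_le_imp_le) (simp add: l2_norm_def)
    then show ?thesis unfolding w_def using c by (simp add: field_simps)
  qed
  ultimately show ?thesis unfolding resolvent_set_def by blast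
qed

text \<open>An eigenfunction violates the resolvent estimate at \<open>E\<close>, and the infimum is taken over a set bounded below by \<open>0\<close>.\<close>

theorem mag_lambda_le_eigenvalue:
  assumes T: "mag_laplacian b u (\<lambda>x. complex_of_real E * u x)" and u: "\<not> (AE x in lebesgue_on disk. u x = 0)"
  shows "mag_lambda b \<le> E"
proof -
  have u2: "u \<in> L2 disk" using T unfolding mag_laplacian_def form_operator_def H1_def by simp
  have "complex_of_real E \<notin> resolvent_set disk (mag_laplacian b)"
  proof
    assume "complex_of_real E \<in> resolvent_set disk (mag_laplacian b)"
    then obtain C where "l2_norm disk u \<le> C * l2_norm disk (\<lambda>x. complex_of_real E * u x - complex_of_real E * u x)"
      using T unfolding resolvent_set_def by blast
    then have "l2_norm disk u \<le> 0" by (simp add: l2_norm_def)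
    moreover have "l2_norm disk u \<ge> 0" by (simp add: l2_norm_def)
    ultimately have "l2_norm disk u = 0" by simp
    then have "l2_real disk u u = 0" using l2_norm_square[OF u2] by simp
    then show False using u l2_real_zero_iff[OF u2] by simp
  qed
  moreover have "bdd_below {E. complex_of_real E \<in> spectrum disk (mag_laplacian b)}"
  proof (rule bdd_belowI[of _ 0])
    fix r assume "r \<in> {E. complex_of_real E \<in> spectrum disk (mag_laplacian b)}"
    then have "complex_of_real r \<notin> resolvent_set disk (mag_laplacian b)" by (simp add: spectrum_def)
    then show "0 \<le> r" using negative_in_resolvent_set[of r b] by (meson not_le)
  qed
  ultimately show ?thesis unfolding mag_lambda_def by (intro cInf_lower) (simp_all add: spectrum_def)
qed

section \<open>Radial functions as eigenfunctions\<close>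

text \<open>This cutoff vanishes for \<open>\<bar>x\<bar>\<^sup>2 \<ge> 1 - 1/n\<close>; its gradient is radial, which is what pairs with the boundary condition.\<close>

definition disk_cutoff :: "real \<Rightarrow> real^2 \<Rightarrow> complex" where
  "disk_cutoff n x = complex_of_real (bump (n * (1 - x \<bullet> x) - 1))"

lemma disk_cutoff_has_derivative:
  "((\<lambda>x. n * (1 - x \<bullet> x) - 1) has_derivative (\<lambda>h. - (2 * n) * (x \<bullet> h))) (at x)" for x :: "real^2"
  by (auto intro!: derivative_eq_intros simp: inner_commute algebra_simps)

lemma smooth_disk_cutoff: "smooth (disk_cutoff n)"
  unfolding disk_cutoff_def
proof (rule smooth_bump[OF disk_cutoff_has_derivative])
  fix e :: "real^2"
  have "(\<lambda>x. complex_of_real (- (2 * n) * (x \<bullet> e))) = (\<lambda>x. complex_of_real (- (2 * n)) * complex_of_real (x \<bullet> e))" by simp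
  then show "smooth (\<lambda>x. complex_of_real (- (2 * n) * (x \<bullet> e)))"
    by (simp only: smooth_mult[OF smooth_const smooth_of_real_inner])
qed

lemma disk_cutoff_pd: "pd e (disk_cutoff n) x = complex_of_real (bump' (n * (1 - x \<bullet> x) - 1) * (- (2 * n) * (x \<bullet> e)))"
proof -
  have "((\<lambda>x. bump (n * (1 - x \<bullet> x) - 1)) has_derivative (\<lambda>h. bump' (n * (1 - x \<bullet> x) - 1) * (- (2 * n) * (x \<bullet> h)))) (at x)"
    using has_derivative_compose[OF disk_cutoff_has_derivative bump_deriv[unfolded has_field_derivative_def]] by simp
  from pd_eq[OF has_derivative_of_real[OF this]] show ?thesis unfolding disk_cutoff_def by simp
qed

lemma disk_cutoff_test:
  assumes n: "n > 0"
  shows "disk_cutoff n \<in> test_functions disk"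
proof (rule test_functionI[OF smooth_disk_cutoff])
  let ?K = "cball 0 1 \<inter> {x::real^2. x \<bullet> x \<le> 1 - 1/n}"
  have "closed {x::real^2. x \<bullet> x \<le> 1 - 1/n}" by (intro closed_Collect_le continuous_intros)
  then show "compact ?K" by (intro compact_Int_closed) auto
  show "?K \<subseteq> disk"
  proof
    fix x assume "x \<in> ?K"
    then have "x \<bullet> x \<le> 1 - 1/n" by simp
    moreover have "1/n > 0" using n by simp
    ultimately have "(norm x)\<^sup>2 < 1" unfolding power2_norm_eq_inner by linarith
    then have "norm x < 1" using power2_less_imp_less[of "norm x" 1] by simp
    then show "x \<in> disk" by simp
  qed
  show "disk_cutoff n x = 0" if x: "x \<notin> ?K" for x
  proof -
    have "n * (1 - x \<bullet> x) - 1 \<le> 0"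
    proof (rule ccontr)
      assume "\<not> ?thesis"
      then have a: "x \<bullet> x < 1 - 1/n" using n by (simp add: field_simps)
      moreover have "1/n > 0" using n by simp
      ultimately have "(norm x)\<^sup>2 < 1" unfolding power2_norm_eq_inner by linarith
      then have "norm x < 1" using power2_less_imp_less[of "norm x" 1] by simp
      then show False using a x by simp
    qed
    then show ?thesis unfolding disk_cutoff_def bump_def by simp
  qed
qed

lemma disk_cutoff_le_1: "cmod (disk_cutoff n x) \<le> 1"
  unfolding disk_cutoff_def using bump_bounds by simp

lemma disk_square_less: "x \<in> disk \<Longrightarrow> x \<bullet> x < 1" for x :: "real^2"
  using power_strict_mono[of "norm x" 1 2] by (simp add: power2_norm_eq_inner)

lemma disk_cutoff_limit:
  assumes "x \<in> disk"
  shows "(\<lambda>n. disk_cutoff (real (Suc n)) x) \<longlonglongrightarrow> 1"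
proof -
  define d where "d = 1 - x \<bullet> x"
  have d: "d > 0" unfolding d_def using disk_square_less[OF assms] by simp
  have "(\<lambda>n. exp (-1 / (real (Suc n) * d - 1))) \<longlonglongrightarrow> 1" using d by real_asymp
  moreover have "\<forall>\<^sub>F n in sequentially. real (Suc n) * d - 1 > 0" using d by real_asymp
  then have "\<forall>\<^sub>F n in sequentially. exp (-1 / (real (Suc n) * d - 1)) = bump (real (Suc n) * d - 1)"
    by eventually_elim (simp add: bump_def)
  ultimately have "(\<lambda>n. bump (real (Suc n) * d - 1)) \<longlonglongrightarrow> 1" by (rule Lim_transform_eventually)
  from tendsto_of_real[OF this, where 'a=complex] show ?thesis unfolding disk_cutoff_def d_def by simp
qed

text \<open>The product of the distance to the boundary with the gradient of the cutoff is bounded uniformly and tends to zero pointwise.\<close>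

lemma bump'_bounds:
  shows "0 \<le> (t + 1) * bump' t" "(t + 1) * bump' t \<le> 2" "t > 0 \<Longrightarrow> (t + 1) * bump' t \<le> 1/t + 1/t\<^sup>2"
proof -
  show "0 \<le> (t + 1) * bump' t" unfolding bump'_def by simp
  have eq: "(t + 1) * bump' t = (1/t + 1/t\<^sup>2) * exp (- (1/t))" if "t > 0"
    unfolding bump'_def using that by (simp add: field_simps power2_eq_square)
  show "(t + 1) * bump' t \<le> 2"
  proof (cases "t > 0")
    case True
    define y where "y = 1/t"
    have y: "y > 0" using True y_def by simp
    have "1 + y + y\<^sup>2/2 \<le> exp y" using exp_lower_Taylor_quadratic[of y] y by simp
    then have "y + y\<^sup>2 \<le> 2 * exp y" using y by linarith
    then have "(y + y\<^sup>2) * exp (- y) \<le> 2 * exp y * exp (- y)" by (intro mult_right_mono) auto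
    also have "\<dots> = 2" by (simp add: exp_minus)
    finally show ?thesis unfolding eq[OF True] y_def by (simp add: power_one_over)
  qed (simp add: bump'_def)
  assume t: "t > 0"
  have "exp (- (1/t)) \<le> 1" using t by simp
  then have "(1/t + 1/t\<^sup>2) * exp (- (1/t)) \<le> (1/t + 1/t\<^sup>2) * 1" using t by (intro mult_left_mono) auto
  then show "(t + 1) * bump' t \<le> 1/t + 1/t\<^sup>2" unfolding eq[OF t] by simp
qed

lemma integral_disk_cutoff_limit:
  assumes f: "integrable (lebesgue_on disk) f"
  shows "(\<lambda>n. LINT x|lebesgue_on disk. f x * disk_cutoff (real (Suc n)) x) \<longlonglongrightarrow> (LINT x|lebesgue_on disk. f x)"
proof (rule integral_dominated_convergence[where w="\<lambda>x. cmod (f x)"])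
  have [measurable]: "f \<in> borel_measurable (lebesgue_on disk)" using f by simp
  have [measurable]: "disk_cutoff n \<in> borel_measurable (lebesgue_on disk)" for n by (rule smooth_measurable[OF smooth_disk_cutoff])
  show "(\<lambda>x. f x * disk_cutoff (real (Suc n)) x) \<in> borel_measurable (lebesgue_on disk)" for n by measurable
  show "AE x in lebesgue_on disk. (\<lambda>n. f x * disk_cutoff (real (Suc n)) x) \<longlonglongrightarrow> f x"
  proof (rule AE_I2)
    fix x :: "real^2" assume "x \<in> space (lebesgue_on disk)"
    then have "(\<lambda>n. f x * disk_cutoff (real (Suc n)) x) \<longlonglongrightarrow> f x * 1"
      by (intro tendsto_mult tendsto_const disk_cutoff_limit) simp
    then show "(\<lambda>n. f x * disk_cutoff (real (Suc n)) x) \<longlonglongrightarrow> f x" by simp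
  qed
  show "AE x in lebesgue_on disk. norm (f x * disk_cutoff (real (Suc n)) x) \<le> cmod (f x)" for n
    using mult_left_mono[OF disk_cutoff_le_1 norm_ge_zero] by (intro AE_I2) (simp add: norm_mult del: of_nat_Suc)
qed (use f in simp_all)

text \<open>Test functions have compact support in the disk, so Green's formula up to the boundary is obtained by testing with
\<open>disk_cutoff n * cnj (X e)\<close>. The error term contains the radial component of \<open>X\<close>, which by hypothesis is at most a multiple of the distance to the
boundary and thereby compensates the growing gradient of the cutoff; dominated convergence removes it.\<close>

theorem smooth_eigenfunction:
  fixes u :: "real^2 \<Rightarrow> complex" and X :: "real^2 \<Rightarrow> real^2 \<Rightarrow> complex"
  assumes u: "smooth u" and X: "\<And>e. e \<in> Basis \<Longrightarrow> smooth (X e)"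
    and Xu: "\<And>e x. e \<in> Basis \<Longrightarrow> X e x = - \<i> * pd e u x + magA b e x * u x"
    and pde: "\<And>x. (\<Sum>e\<in>Basis. - \<i> * pd e (X e) x + magA b e x * X e x) = complex_of_real E * u x"
    and bc: "\<And>x. x \<in> disk \<Longrightarrow> cmod (\<Sum>e\<in>Basis. complex_of_real (x \<bullet> e) * X e x) \<le> C * (1 - x \<bullet> x)" and C: "C \<ge> 0"
  shows "mag_laplacian b u (\<lambda>x. complex_of_real E * u x)"
proof -
  have u2: "u \<in> L2 disk" by (rule smooth_L2_disk[OF u])
  have Eu2: "(\<lambda>x. complex_of_real E * u x) \<in> L2 disk" using L2_lincomb[OF L2_zero u2, of "complex_of_real E"] by simp
  have p: "(u, X) \<in> mag_pairs b"
  proof -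
    have "is_weak_partial disk e u (\<lambda>x. \<i> * (X e x - magA b e x * u x))" if e: "e \<in> Basis" for e
    proof -
      have eq: "(\<lambda>x. \<i> * (X e x - magA b e x * u x)) = pd e u" using Xu[OF e] by (simp add: fun_eq_iff)
      show ?thesis unfolding eq is_weak_partial_def
        by (intro ballI) (rule smooth_integration_by_parts[OF open_ball u _ e])
    qed
    then show ?thesis unfolding mag_pairs_def using u2 smooth_L2_disk[OF X] by simp
  qed
  have "mag_form b u v = l2_inner disk (\<lambda>x. complex_of_real E * u x) v" if v: "v \<in> H1 disk" for v
  proof -
    define Y where "Y = (\<lambda>e. mag_grad b e v)"
    have q: "(v, Y) \<in> mag_pairs b" unfolding Y_def by (rule H1_mag_pair[OF v])
    note v2 = mag_pairsD(1)[OF q] and Y2 = mag_pairsD(2)[OF q]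
    have vi: "integrable (lebesgue_on disk) v" by (rule L2_integrable[OF disk_lmeasurable v2])
    let ?c = "\<lambda>n. disk_cutoff (real (Suc n))"
    define G where "G = (\<lambda>n x. v x * cnj (\<Sum>e\<in>Basis. pd e (?c n) x * X e x))"
    have parts: "(\<Sum>e\<in>Basis. LINT x|lebesgue_on disk. Y e x * cnj (X e x) * ?c n x)
      = (LINT x|lebesgue_on disk. v x * cnj (complex_of_real E * u x) * ?c n x) + \<i> * (LINT x|lebesgue_on disk. G n x)"
      and Gi: "integrable (lebesgue_on disk) (G n)" for n
    proof -
      define \<phi> where "\<phi> = (\<lambda>e x. ?c n x * cnj (X e x))"
      have ct: "?c n \<in> test_functions disk" by (rule disk_cutoff_test) simp
      have \<phi>: "\<phi> e \<in> test_functions disk" if e: "e \<in> Basis" for e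
      proof -
        obtain K where K: "compact K" "K \<subseteq> disk" "smooth (?c n)" "\<And>x. x \<notin> K \<Longrightarrow> ?c n x = 0" "\<And>x e. x \<notin> K \<Longrightarrow> pd e (?c n) x = 0"
          by (rule test_functionD[OF ct]) (rule that)
        show ?thesis unfolding \<phi>_def
          by (rule test_functionI[OF smooth_mult[OF K(3) smooth_cnj[OF X[OF e]]] K(1,2)]) (simp add: K(4) del: of_nat_Suc)
      qed
      have pd\<phi>: "pd e (\<phi> e) x = ?c n x * cnj (pd e (X e) x) + pd e (?c n) x * cnj (X e x)" if e: "e \<in> Basis" for e x
        unfolding \<phi>_def
        by (rule pd_eq[OF has_derivative_mult[OF smoothD(1)[OF smooth_disk_cutoff] has_derivative_cnj[OF smoothD(1)[OF X[OF e]]]]])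
      have ia: "integrable (lebesgue_on disk) (\<lambda>x. magA b e x * v x * \<phi> e x)" if e: "e \<in> Basis" for e
        by (rule integrable_mult_test_function[OF open_ball L2_integrable[OF disk_lmeasurable magA_mult_L2[OF v2]] \<phi>[OF e]])
      have id: "integrable (lebesgue_on disk) (\<lambda>x. v x * pd e (\<phi> e) x)" if e: "e \<in> Basis" for e
        by (rule integrable_mult_test_function[OF open_ball vi test_function_pd[OF \<phi>[OF e] e]])
      have iY: "integrable (lebesgue_on disk) (\<lambda>x. Y e x * \<phi> e x)" if e: "e \<in> Basis" for e
        by (rule integrable_mult_test_function[OF open_ball L2_integrable[OF disk_lmeasurable Y2[OF e]] \<phi>[OF e]])
      have one: "(LINT x|lebesgue_on disk. Y e x * \<phi> e x) = (LINT x|lebesgue_on disk. magA b e x * v x * \<phi> e x + \<i> * (v x * pd e (\<phi> e) x))"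
        if e: "e \<in> Basis" for e
      proof -
        have "(LINT x|lebesgue_on disk. v x * pd e (\<phi> e) x) = - (LINT x|lebesgue_on disk. \<i> * (Y e x - magA b e x * v x) * \<phi> e x)"
          using mag_pairsD(3)[OF q e] \<phi>[OF e] unfolding is_weak_partial_def by blast
        also have "(LINT x|lebesgue_on disk. \<i> * (Y e x - magA b e x * v x) * \<phi> e x)
            = (LINT x|lebesgue_on disk. \<i> * (Y e x * \<phi> e x - magA b e x * v x * \<phi> e x))"
          by (rule arg_cong[where f="integral\<^sup>L _"]) (simp add: fun_eq_iff algebra_simps)
        also have "\<dots> = \<i> * ((LINT x|lebesgue_on disk. Y e x * \<phi> e x) - (LINT x|lebesgue_on disk. magA b e x * v x * \<phi> e x))"
          using iY[OF e] ia[OF e] by simp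
        finally have A: "(LINT x|lebesgue_on disk. v x * pd e (\<phi> e) x)
            = - (\<i> * ((LINT x|lebesgue_on disk. Y e x * \<phi> e x) - (LINT x|lebesgue_on disk. magA b e x * v x * \<phi> e x)))" .
        have "(LINT x|lebesgue_on disk. magA b e x * v x * \<phi> e x + \<i> * (v x * pd e (\<phi> e) x))
           = (LINT x|lebesgue_on disk. magA b e x * v x * \<phi> e x) + \<i> * (LINT x|lebesgue_on disk. v x * pd e (\<phi> e) x)"
          using ia[OF e] id[OF e] by simp
        then show ?thesis unfolding A by (simp add: algebra_simps)
      qed
      have Fi: "integrable (lebesgue_on disk) (\<lambda>x. v x * cnj (complex_of_real E * u x) * ?c n x)"
        by (rule integrable_mult_test_function[OF open_ball L2_mult_integrable(2)[OF v2 Eu2] ct])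
      have pw: "(\<Sum>e\<in>Basis. magA b e x * v x * \<phi> e x + \<i> * (v x * pd e (\<phi> e) x))
          = v x * cnj (complex_of_real E * u x) * ?c n x + \<i> * G n x" for x
      proof -
        have re: "cnj (magA b e x) = magA b e x" "cnj (pd e (?c n) x) = pd e (?c n) x" for e
          unfolding magA_def disk_cutoff_pd by simp_all
        have s: "cnj (complex_of_real E * u x) = (\<Sum>e\<in>Basis. \<i> * cnj (pd e (X e) x) + magA b e x * cnj (X e x))"
          unfolding pde[symmetric] by (simp add: re add.commute)
        have "v x * cnj (complex_of_real E * u x) * ?c n x + \<i> * G n x
          = (\<Sum>e\<in>Basis. v x * (\<i> * cnj (pd e (X e) x) + magA b e x * cnj (X e x)) * ?c n x + \<i> * (v x * (pd e (?c n) x * cnj (X e x))))"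
          unfolding s G_def by (simp only: cnj_sum complex_cnj_mult re sum_distrib_left sum_distrib_right sum.distrib[symmetric])
        also have "\<dots> = (\<Sum>e\<in>Basis. magA b e x * v x * \<phi> e x + \<i> * (v x * pd e (\<phi> e) x))"
        proof (rule sum.cong[OF refl])
          fix e :: "real^2" assume e: "e \<in> Basis"
          show "v x * (\<i> * cnj (pd e (X e) x) + magA b e x * cnj (X e x)) * ?c n x + \<i> * (v x * (pd e (?c n) x * cnj (X e x)))
             = magA b e x * v x * \<phi> e x + \<i> * (v x * pd e (\<phi> e) x)"
            unfolding pd\<phi>[OF e] unfolding \<phi>_def by (simp only: algebra_simps)
        qed
        finally show ?thesis ..
      qed
      show G: "integrable (lebesgue_on disk) (G n)"
      proof -
        have "integrable (lebesgue_on disk) (\<lambda>x. \<Sum>e\<in>Basis. magA b e x * v x * \<phi> e x + \<i> * (v x * pd e (\<phi> e) x))"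
          using ia id by (intro Bochner_Integration.integrable_sum Bochner_Integration.integrable_add integrable_mult_right) auto
        then have "integrable (lebesgue_on disk) (\<lambda>x. v x * cnj (complex_of_real E * u x) * ?c n x + \<i> * G n x)"
          unfolding pw .
        from Bochner_Integration.integrable_diff[OF this Fi] have "integrable (lebesgue_on disk) (\<lambda>x. \<i> * G n x)" by simp
        from integrable_mult_right[OF this, of "- \<i>"] show ?thesis by (simp flip: mult.assoc)
      qed
      have "(\<Sum>e\<in>Basis. LINT x|lebesgue_on disk. Y e x * cnj (X e x) * ?c n x)
         = (\<Sum>e\<in>Basis. LINT x|lebesgue_on disk. Y e x * \<phi> e x)" unfolding \<phi>_def by (simp only: mult_ac)
      also have "\<dots> = (\<Sum>e\<in>Basis. LINT x|lebesgue_on disk. magA b e x * v x * \<phi> e x + \<i> * (v x * pd e (\<phi> e) x))"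
        by (rule sum.cong[OF refl]) (rule one)
      also have "\<dots> = (LINT x|lebesgue_on disk. (\<Sum>e\<in>Basis. magA b e x * v x * \<phi> e x + \<i> * (v x * pd e (\<phi> e) x)))"
        using ia id by (intro Bochner_Integration.integral_sum[symmetric] Bochner_Integration.integrable_add integrable_mult_right) auto
      also have "\<dots> = (LINT x|lebesgue_on disk. v x * cnj (complex_of_real E * u x) * ?c n x + \<i> * G n x)" unfolding pw ..
      also have "\<dots> = (LINT x|lebesgue_on disk. v x * cnj (complex_of_real E * u x) * ?c n x) + \<i> * (LINT x|lebesgue_on disk. G n x)"
        using Fi G by (subst Bochner_Integration.integral_add) (auto intro!: integrable_mult_right)
      finally show "(\<Sum>e\<in>Basis. LINT x|lebesgue_on disk. Y e x * cnj (X e x) * ?c n x)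
        = (LINT x|lebesgue_on disk. v x * cnj (complex_of_real E * u x) * ?c n x) + \<i> * (LINT x|lebesgue_on disk. G n x)" .
    qed
    have Gb: "cmod (G n x) \<le> cmod (v x) * (2 * C * ((real (Suc n) * (1 - x \<bullet> x) - 1 + 1) * bump' (real (Suc n) * (1 - x \<bullet> x) - 1)))"
      if x: "x \<in> disk" for n x
    proof -
      define t where "t = real (Suc n) * (1 - x \<bullet> x) - 1"
      have b0: "bump' t \<ge> 0" unfolding bump'_def by simp
      have "(\<Sum>e\<in>Basis. pd e (?c n) x * X e x) = complex_of_real (bump' t * (- (2 * real (Suc n)))) * (\<Sum>e\<in>Basis. complex_of_real (x \<bullet> e) * X e x)"
        unfolding disk_cutoff_pd t_def[symmetric] sum_distrib_left by (simp only: of_real_mult mult_ac)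
      then have "cmod (\<Sum>e\<in>Basis. pd e (?c n) x * X e x) = bump' t * (2 * real (Suc n)) * cmod (\<Sum>e\<in>Basis. complex_of_real (x \<bullet> e) * X e x)"
        using b0 by (simp only: norm_mult norm_of_real abs_mult abs_minus_cancel abs_of_nonneg)
      also have "\<dots> \<le> bump' t * (2 * real (Suc n)) * (C * (1 - x \<bullet> x))" using b0 by (intro mult_left_mono bc[OF x]) auto
      also have "\<dots> = 2 * C * ((t + 1) * bump' t)" unfolding t_def by (simp add: mult_ac del: of_nat_Suc)
      finally have "cmod (v x) * cmod (\<Sum>e\<in>Basis. pd e (?c n) x * X e x) \<le> cmod (v x) * (2 * C * ((t + 1) * bump' t))" by (rule mult_left_mono) simp
      then show ?thesis unfolding G_def t_def[symmetric] norm_mult complex_mod_cnj .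
    qed
    have "(\<lambda>n. LINT x|lebesgue_on disk. G n x) \<longlonglongrightarrow> (LINT x|lebesgue_on disk. 0)"
    proof (rule integral_dominated_convergence[where w="\<lambda>x. 4 * C * cmod (v x)"])
      show "integrable (lebesgue_on disk) (\<lambda>x. 4 * C * cmod (v x))" using vi by simp
      show "G n \<in> borel_measurable (lebesgue_on disk)" for n using Gi by simp
      show "AE x in lebesgue_on disk. norm (G n x) \<le> 4 * C * cmod (v x)" for n
      proof (rule AE_I2)
        fix x :: "real^2" assume "x \<in> space (lebesgue_on disk)"
        then have x: "x \<in> disk" by simp
        define t where "t = real (Suc n) * (1 - x \<bullet> x) - 1"
        have "cmod (G n x) \<le> cmod (v x) * (2 * C * ((t + 1) * bump' t))" using Gb[OF x] unfolding t_def .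
        also have "\<dots> \<le> cmod (v x) * (2 * C * 2)" using C by (intro mult_left_mono bump'_bounds) auto
        finally show "norm (G n x) \<le> 4 * C * cmod (v x)" by (simp add: mult_ac)
      qed
      show "AE x in lebesgue_on disk. (\<lambda>n. G n x) \<longlonglongrightarrow> 0"
      proof (rule AE_I2)
        fix x :: "real^2" assume "x \<in> space (lebesgue_on disk)"
        then have x: "x \<in> disk" by simp
        define d where "d = 1 - x \<bullet> x"
        have d: "d > 0" unfolding d_def using disk_square_less[OF x] by simp
        have lim: "(\<lambda>n. 1 / (real (Suc n) * d - 1) + 1 / (real (Suc n) * d - 1)\<^sup>2) \<longlonglongrightarrow> 0" using d by real_asymp
        have ev: "\<forall>\<^sub>F n in sequentially. real (Suc n) * d - 1 > 0" using d by real_asymp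
        show "(\<lambda>n. G n x) \<longlonglongrightarrow> 0"
        proof (rule Lim_null_comparison[OF _ tendsto_mult_right_zero[OF lim, of "cmod (v x) * (2 * C)"]])
          show "\<forall>\<^sub>F n in sequentially. norm (G n x) \<le> cmod (v x) * (2 * C) * (1 / (real (Suc n) * d - 1) + 1 / (real (Suc n) * d - 1)\<^sup>2)"
            using ev
          proof eventually_elim
            case (elim n)
            have "cmod (G n x) \<le> cmod (v x) * (2 * C) * ((real (Suc n) * d - 1 + 1) * bump' (real (Suc n) * d - 1))"
              using Gb[OF x, of n] unfolding d_def[symmetric] by (simp only: mult.assoc)
            also have "\<dots> \<le> cmod (v x) * (2 * C) * (1 / (real (Suc n) * d - 1) + 1 / (real (Suc n) * d - 1)\<^sup>2)"
              using C by (intro mult_left_mono bump'_bounds(3)[OF elim]) auto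
            finally show ?case .
          qed
        qed
      qed
    qed simp
    then have limG: "(\<lambda>n. LINT x|lebesgue_on disk. G n x) \<longlonglongrightarrow> 0" by simp
    have "(\<lambda>n. \<Sum>e\<in>Basis. LINT x|lebesgue_on disk. Y e x * cnj (X e x) * ?c n x) \<longlonglongrightarrow> (\<Sum>e\<in>Basis. LINT x|lebesgue_on disk. Y e x * cnj (X e x))"
      by (intro tendsto_sum integral_disk_cutoff_limit L2_mult_integrable(2)[OF Y2 smooth_L2_disk[OF X]])
    moreover have "(\<lambda>n. (LINT x|lebesgue_on disk. v x * cnj (complex_of_real E * u x) * ?c n x) + \<i> * (LINT x|lebesgue_on disk. G n x))
       \<longlonglongrightarrow> (LINT x|lebesgue_on disk. v x * cnj (complex_of_real E * u x)) + \<i> * 0"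
      by (intro tendsto_add tendsto_mult tendsto_const limG integral_disk_cutoff_limit L2_mult_integrable(2)[OF v2 Eu2])
    ultimately have "(\<Sum>e\<in>Basis. LINT x|lebesgue_on disk. Y e x * cnj (X e x)) = (LINT x|lebesgue_on disk. v x * cnj (complex_of_real E * u x)) + \<i> * 0"
      unfolding parts by (rule LIMSEQ_unique)
    then have "(\<Sum>e\<in>Basis. l2_inner disk (Y e) (X e)) = l2_inner disk v (\<lambda>x. complex_of_real E * u x)"
      unfolding l2_inner_def by simp
    from arg_cong[OF this, of cnj] have "(\<Sum>e\<in>Basis. l2_inner disk (X e) (Y e)) = l2_inner disk (\<lambda>x. complex_of_real E * u x) v"
      by (simp only: cnj_sum l2_inner_commute[symmetric])
    then show ?thesis unfolding mag_form_pairs[OF p q] .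
  qed
  then show ?thesis unfolding mag_laplacian_def form_operator_def using mag_pair_H1(1)[OF p] Eu2 by blast
qed

lemma pd_add: "smooth f \<Longrightarrow> smooth g \<Longrightarrow> pd e (\<lambda>x. f x + g x) x = pd e f x + pd e g x"
  and pd_mult: "smooth f \<Longrightarrow> smooth g \<Longrightarrow> pd e (\<lambda>x. f x * g x) x = f x * pd e g x + pd e f x * g x"
  using pd_eq[OF has_derivative_add[OF smoothD(1) smoothD(1)]] pd_eq[OF has_derivative_mult[OF smoothD(1) smoothD(1)]] by blast+

lemma pd_const: "pd e (\<lambda>x. c) x = 0"
  by (rule pd_eq) simp

lemma Basis_real2: "(Basis :: (real^2) set) = {axis 1 1, axis 2 1}"
  by (auto simp: Basis_vec_def) (metis exhaust_2)

lemma sum_Basis_real2: "(\<Sum>e\<in>(Basis :: (real^2) set). f e) = f (axis 1 1) + f (axis 2 1)"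
  unfolding Basis_real2 by (simp add: axis_eq_axis)

text \<open>With \<open>z = x\<^sub>1 - \<i> x\<^sub>2\<close> the power \<open>z ^ m\<close> is antiholomorphic, so the second derivatives of it cancel in the
Laplacian and only \<open>z Q = m P\<close> is needed to reduce the eigenvalue equation to the radial one. The family \<open>H\<close> consists of the successive derivatives of the
profile and provides smoothness.\<close>

theorem mag_lambda_le_radial:
  fixes H :: "nat \<Rightarrow> real \<Rightarrow> real"
  assumes H: "\<And>n t. (H n has_real_derivative H (Suc n) t) (at t)"
    and ode: "\<And>t. 4 * t * H 2 t + 4 * (real m + 1) * H 1 t = (b\<^sup>2 * t / 4 - m * b - E) * H 0 t"
    and bc: "real m * H 0 1 + 2 * H 1 1 = 0" and pos: "\<And>t. t \<in> {0..1} \<Longrightarrow> H 0 t > 0"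
  shows "mag_lambda b \<le> E"
proof -
  define z where "z = (\<lambda>x::real^2. complex_of_real (x $ 1) - \<i> * complex_of_real (x $ 2))"
  define P where "P = (\<lambda>x. z x ^ m)"
  define Q where "Q = (\<lambda>x. of_nat m * z x ^ (m - 1))"
  define S where "S = (\<lambda>x. of_nat m * of_nat (m - 1) * z x ^ (m - 1 - 1))"
  define h where "h = (\<lambda>n (x::real^2). complex_of_real (H n (x \<bullet> x)))"
  define c where "c = (\<lambda>i (x::real^2). complex_of_real (x $ i))"
  have dc: "(c i has_derivative c i) (at x)" for i x
    unfolding c_def by (intro has_derivative_of_real bounded_linear.has_derivative[OF bounded_linear_vec_nth] has_derivative_ident)
  have sc: "smooth (c i)" for i
  proof -
    have "c i = (\<lambda>x. complex_of_real (x \<bullet> axis i 1))" unfolding c_def by (simp add: inner_axis fun_eq_iff)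
    then show ?thesis using smooth_of_real_inner by simp
  qed
  have zc: "z = (\<lambda>x. c 1 x + (- \<i>) * c 2 x)" unfolding z_def c_def by simp
  have sz: "smooth z" unfolding zc by (intro smooth_add smooth_mult smooth_const sc)
  have dz: "(z has_derivative z) (at x)" for x
    unfolding zc by (intro has_derivative_add dc bounded_linear.has_derivative[OF bounded_linear_mult_right])
  have sP: "smooth P" and sQ: "smooth Q" unfolding P_def Q_def by (intro smooth_power smooth_mult smooth_const sz)+
  have sh: "smooth (h n)" for n
    unfolding h_def
  proof (rule smooth_compose_real[where H=H, OF H])
    fix x :: "real^2"
    show "((\<lambda>x. x \<bullet> x) has_derivative (\<lambda>y. 2 * (x \<bullet> y))) (at x)" by (auto intro!: derivative_eq_intros simp: inner_commute)
    have "(\<lambda>x::real^2. complex_of_real (2 * (x \<bullet> e))) = (\<lambda>x. 2 * complex_of_real (x \<bullet> e))" for e by simp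
    then show "smooth (\<lambda>x::real^2. complex_of_real (2 * (x \<bullet> e)))" for e
      by (simp only: smooth_mult[OF smooth_const smooth_of_real_inner])
  qed
  have pP: "pd e P x = Q x * z e" for e x
    unfolding P_def Q_def by (subst pd_eq[OF has_derivative_power[OF dz]]) (simp add: mult_ac)
  have pQ: "pd e Q x = S x * z e" for e x
  proof -
    have "((\<lambda>x. of_nat m * z x ^ (m - 1)) has_derivative (\<lambda>y. of_nat m * (of_nat (m - 1) * z y * z x ^ (m - 1 - 1)))) (at x)"
      by (rule bounded_linear.has_derivative[OF bounded_linear_mult_right has_derivative_power[OF dz]])
    from pd_eq[OF this] show ?thesis unfolding Q_def S_def by (simp add: mult_ac)
  qed
  have ph: "pd e (h n) x = h (Suc n) x * complex_of_real (2 * (x \<bullet> e))" for e n x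
  proof -
    have "((\<lambda>x. x \<bullet> x) has_derivative (\<lambda>y. 2 * (x \<bullet> y))) (at x)" by (auto intro!: derivative_eq_intros simp: inner_commute)
    from has_derivative_compose[OF this H[unfolded has_field_derivative_def]]
    have "((\<lambda>x. H n (x \<bullet> x)) has_derivative (\<lambda>y. H (Suc n) (x \<bullet> x) * (2 * (x \<bullet> y)))) (at x)" by simp
    from pd_eq[OF has_derivative_of_real[OF this]] show ?thesis unfolding h_def by simp
  qed
  have pc: "pd e (c i) x = c i e" for e i x by (rule pd_eq[OF dc])
  let ?e1 = "axis 1 1 :: real^2" and ?e2 = "axis 2 1 :: real^2"
  have e12: "z ?e1 = 1" "z ?e2 = - \<i>" "c 1 ?e1 = 1" "c 2 ?e1 = 0" "c 1 ?e2 = 0" "c 2 ?e2 = 1"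
    unfolding z_def c_def by (simp_all add: axis_def)
  have inn: "complex_of_real (x \<bullet> ?e1) = c 1 x" "complex_of_real (x \<bullet> ?e2) = c 2 x" for x
    unfolding c_def by (simp_all add: inner_axis)
  have ph': "pd ?e1 (h n) x = 2 * c 1 x * h (Suc n) x" "pd ?e2 (h n) x = 2 * c 2 x * h (Suc n) x" for n x
    unfolding ph of_real_mult inn by simp_all
  define \<beta> where "\<beta> = complex_of_real (b/2)"
  have A: "magA b ?e1 x = - \<beta> * c 2 x" "magA b ?e2 x = \<beta> * c 1 x" for x
    unfolding magA_def \<beta>_def c_def vecpot_def by (simp_all add: inner_axis)
  define u where "u = (\<lambda>x. P x * h 0 x)"
  define X1 where "X1 = (\<lambda>x. - \<i> * (2 * (c 1 x * (P x * h 1 x)) + Q x * h 0 x) + (- \<beta>) * (c 2 x * (P x * h 0 x)))"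
  define X2 where "X2 = (\<lambda>x. - \<i> * (2 * (c 2 x * (P x * h 1 x)) + (- \<i>) * (Q x * h 0 x)) + \<beta> * (c 1 x * (P x * h 0 x)))"
  define X where "X = (\<lambda>e. if e = ?e1 then X1 else X2)"
  have ne: "?e2 \<noteq> ?e1" by (simp add: axis_eq_axis)
  have X12: "X ?e1 = X1" "X ?e2 = X2" unfolding X_def using ne by simp_all
  note sm = smooth_add smooth_mult smooth_const sP sQ sh sc
  have su: "smooth u" unfolding u_def by (intro sm)
  have sX: "smooth X1" "smooth X2" unfolding X1_def X2_def by (intro sm)+
  have pu: "pd ?e1 u x = 2 * c 1 x * P x * h 1 x + Q x * h 0 x" "pd ?e2 u x = 2 * c 2 x * P x * h 1 x - \<i> * Q x * h 0 x" for x
    unfolding u_def by (simp_all add: pd_mult sm pP ph' e12)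
  have pX1: "pd ?e1 X1 x = - \<i> * (2 * (P x * h 1 x + c 1 x * (Q x * h 1 x + P x * (2 * c 1 x * h 2 x))) + S x * h 0 x + Q x * (2 * c 1 x * h 1 x))
      - \<beta> * (c 2 x * (Q x * h 0 x + P x * (2 * c 1 x * h 1 x)))" for x
    unfolding X1_def by (simp only: pd_mult pd_add pd_const sm pP pQ ph' pc e12) (simp add: numeral_2_eq_2 algebra_simps)
  have pX2: "pd ?e2 X2 x = - \<i> * (2 * (P x * h 1 x + c 2 x * (- \<i> * Q x * h 1 x + P x * (2 * c 2 x * h 2 x))) - \<i> * (- \<i> * S x * h 0 x + Q x * (2 * c 2 x * h 1 x)))
      + \<beta> * (c 1 x * (- \<i> * Q x * h 0 x + P x * (2 * c 2 x * h 1 x)))" for x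
    unfolding X2_def by (simp only: pd_mult pd_add pd_const sm pP pQ ph' pc e12) (simp add: numeral_2_eq_2 algebra_simps)
  have zQ: "(c 1 x - \<i> * c 2 x) * Q x = of_nat m * P x" for x
    unfolding Q_def P_def c_def z_def by (cases m) (simp_all add: mult_ac)
  have s2: "complex_of_real (x \<bullet> x) = c 1 x * c 1 x + c 2 x * c 2 x" for x
    unfolding c_def by (simp add: inner_vec_def sum_2)
  have odec: "4 * (c 1 x * c 1 x + c 2 x * c 2 x) * h 2 x + 4 * (of_nat m + 1) * h 1 x
      = (\<beta> * \<beta> * (c 1 x * c 1 x + c 2 x * c 2 x) - 2 * of_nat m * \<beta> - complex_of_real E) * h 0 x" for x
  proof -
    have "complex_of_real (4 * (x \<bullet> x) * H 2 (x \<bullet> x) + 4 * (real m + 1) * H 1 (x \<bullet> x))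
        = complex_of_real (((b/2) * (b/2) * (x \<bullet> x) - 2 * real m * (b/2) - E) * H 0 (x \<bullet> x))"
      unfolding ode[of "x \<bullet> x"] by (simp add: power2_eq_square)
    then show ?thesis unfolding h_def \<beta>_def by (simp only: s2[symmetric] of_real_add of_real_mult of_real_diff of_real_numeral of_real_of_nat_eq of_real_1)
  qed
  have ii: "\<i> * \<i> = -1" by simp
  have T: "mag_laplacian b u (\<lambda>x. complex_of_real E * u x)"
  proof -
    define F where "F = (\<lambda>t. real m * H 0 t + 2 * t * H 1 t)"
    define F' where "F' = (\<lambda>t. real m * H 1 t + (2 * H 1 t + 2 * t * H 2 t))"
    have dF: "(F has_real_derivative F' t) (at t)" for t
    proof -
      have "((\<lambda>t. 2 * t) has_real_derivative 2) (at t)" by (auto intro!: derivative_eq_intros)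
      from DERIV_add[OF DERIV_cmult[OF H[of 0]] DERIV_mult[OF this H[of 1]]] show ?thesis
        unfolding F_def F'_def by (simp add: numeral_2_eq_2 mult_ac)
    qed
    have "continuous_on {0..1} F'" unfolding F'_def
      by (intro continuous_intros DERIV_continuous_on[OF has_field_derivative_at_within[OF H]])
    then have "bounded (F' ` {0..1})" by (intro compact_imp_bounded compact_continuous_image) auto
    then obtain K where "\<forall>y\<in>F' ` {0..1}. norm y \<le> K" unfolding bounded_iff by blast
    then have K: "norm (F' t) \<le> K" if "t \<in> {0..1}" for t using that by blast
    have K0: "K \<ge> 0" using order_trans[OF norm_ge_zero K[of 0]] by simp
    have Fb: "\<bar>F t\<bar> \<le> K * (1 - t)" if t: "t \<in> {0..1}" for t
    proof -
      have "norm (F t - F 1) \<le> K * norm (t - 1)"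
        by (rule field_differentiable_bound[of "{0..1}", OF _ has_field_derivative_at_within[OF dF] K]) (use t in auto)
      moreover have "F 1 = 0" unfolding F_def using bc by simp
      ultimately show ?thesis using t by simp
    qed
    show ?thesis
    proof (rule smooth_eigenfunction[OF su, where X=X and C=K])
      show "smooth (X e)" for e unfolding X_def using sX by simp
      show "X e x = - \<i> * pd e u x + magA b e x * u x" if e: "e \<in> Basis" for e x
      proof -
        have "X1 x = - \<i> * pd ?e1 u x + magA b ?e1 x * u x" "X2 x = - \<i> * pd ?e2 u x + magA b ?e2 x * u x"
          unfolding X1_def X2_def pu A unfolding u_def by (simp_all add: algebra_simps)
        then show ?thesis using e X12 unfolding Basis_real2 by auto
      qed
      show "(\<Sum>e\<in>Basis. - \<i> * pd e (X e) x + magA b e x * X e x) = complex_of_real E * u x" for x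
        unfolding sum_Basis_real2 X12 pX1 pX2 A unfolding X1_def X2_def u_def
        using zQ[of x] odec[of x] ii by algebra
      show "cmod (\<Sum>e\<in>Basis. complex_of_real (x \<bullet> e) * X e x) \<le> K * (1 - x \<bullet> x)" if x: "x \<in> disk" for x
      proof -
        have t: "x \<bullet> x \<in> {0..1}" using disk_square_less[OF x] by simp
        have "(\<Sum>e\<in>Basis. complex_of_real (x \<bullet> e) * X e x) = - \<i> * P x * (of_nat m * h 0 x + 2 * (c 1 x * c 1 x + c 2 x * c 2 x) * h 1 x)"
          unfolding sum_Basis_real2 X12 inn unfolding X1_def X2_def using zQ[of x] ii by algebra
        also have "of_nat m * h 0 x + 2 * (c 1 x * c 1 x + c 2 x * c 2 x) * h 1 x = complex_of_real (F (x \<bullet> x))"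
          unfolding F_def h_def s2[symmetric] by simp
        finally have "cmod (\<Sum>e\<in>Basis. complex_of_real (x \<bullet> e) * X e x) = cmod (P x) * \<bar>F (x \<bullet> x)\<bar>" by (simp add: norm_mult)
        also have "\<dots> \<le> 1 * (K * (1 - x \<bullet> x))"
        proof (intro mult_mono Fb t)
          have "(cmod (z x))\<^sup>2 = x \<bullet> x" unfolding z_def cmod_power2 by (simp add: inner_vec_def sum_2 power2_eq_square)
          then have "cmod (z x) \<le> 1" using t power2_le_imp_le[of "cmod (z x)" 1] by simp
          then show "cmod (P x) \<le> 1" unfolding P_def by (simp add: norm_power power_le_one)
        qed auto
        finally show ?thesis by simp
      qed
    qed (rule K0)
  qed
  have "\<not> (AE x in lebesgue_on disk. u x = 0)"
  proof
    assume "AE x in lebesgue_on disk. u x = 0"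
    then have "AE x in lebesgue. x \<in> disk \<longrightarrow> u x = 0" by (simp add: AE_restrict_space_iff)
    then obtain N where N: "N \<in> null_sets lebesgue" "{x. \<not> (x \<in> disk \<longrightarrow> u x = 0)} \<subseteq> N" unfolding eventually_ae_filter by auto
    have "u x \<noteq> 0" if x: "x \<in> disk" "x \<noteq> 0" for x
    proof -
      have "(cmod (z x))\<^sup>2 = x \<bullet> x" unfolding z_def cmod_power2 by (simp add: inner_vec_def sum_2 power2_eq_square)
      then have "z x \<noteq> 0" using x by auto
      moreover have "H 0 (x \<bullet> x) > 0" using disk_square_less[OF x(1)] by (intro pos) simp
      ultimately show ?thesis unfolding u_def P_def h_def by simp
    qed
    then have "disk - {0} \<subseteq> N" using N(2) by auto
    then have "negligible (disk - {0})" using N(1) negligible_subset negligible_iff_null_sets by blast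
    moreover have "open (disk - {0})" by (intro open_Diff) auto
    moreover
    define y where "y = (1/2) *\<^sub>R (axis 1 1 :: real^2)"
    have "norm y = 1/2" unfolding y_def by (simp add: norm_axis_1)
    then have "y \<in> disk - {0}" by auto
    ultimately show False using open_not_negligible by blast
  qed
  then show ?thesis by (rule mag_lambda_le_eigenvalue[OF T])
qed

section \<open>The lowest eigenvalue lies below the de Gennes bound\<close>

text \<open>Iterating the termwise derivative of the entire series.\<close>

lemma rad_derivative_family:
  obtains H where "\<And>n t. (H n has_real_derivative H (Suc n) t) (at t)"
    "H 0 = rad m b l" "H 1 = rad' m b l" "H 2 = rad'' m b l"
proof -
  define c where "c = (\<lambda>n. (diffs ^^ n) (rad_coeff m b l))"
  have c: "c (Suc n) = diffs (c n)" for n unfolding c_def by simp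
  have s: "summable (\<lambda>k. c n k * t^k)" for n t
  proof (induction n arbitrary: t)
    case 0
    then show ?case unfolding c_def using rad_summable by simp
  next
    case (Suc n)
    then show ?case unfolding c by (intro powser_entire_deriv(2))
  qed
  define H where "H = (\<lambda>n t. \<Sum>k. c n k * t^k)"
  have d: "(H n has_real_derivative H (Suc n) t) (at t)" for n t
    unfolding H_def c by (rule powser_entire_deriv(1)[OF s])
  have "H 0 = rad m b l" "H 1 = rad' m b l" "H 2 = rad'' m b l"
    unfolding H_def c_def rad_def[abs_def] rad'_def[abs_def] rad''_def[abs_def] by (simp_all add: numeral_2_eq_2)
  with d show ?thesis by (rule that)
qed

theorem theorem1p4:
  fixes b :: real
  assumes "b > 0"
  shows "mag_lambda b < Theta0 * b"
proof -
  obtain \<kappa> C :: real and f f' :: "real \<Rightarrow> real" where F: "\<kappa> > 0" "\<And>t. (f has_real_derivative f' t) (at t)"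
    "\<And>t. (f' has_real_derivative (t\<^sup>2 - 2*\<kappa>*t) * f t) (at t)" "f 0 = 1" "f' 0 = 0"
    "\<And>t. f t > 0" "\<And>t. f' t \<le> 0"
    "\<And>t. t \<ge> 0 \<Longrightarrow> \<bar>f t\<bar> \<le> C * exp (-2*t)" "\<And>t. t \<ge> 0 \<Longrightarrow> \<bar>f' t\<bar> \<le> C * exp (-2*t)"
    by (rule de_Gennes_function) (rule that)
  have dG: "de_Gennes \<kappa> f f' C" by (rule de_Gennes.intro) (fact F)+
  have le: "\<kappa>\<^sup>2 \<le> Theta0" by (rule Theta0_ge[OF F(1,2,3,6,7,9)])
  obtain m E where E: "E < \<kappa>\<^sup>2 * b" "\<forall>x\<in>{0..1}. rad m b E x > 0" "flux m b E 1 = 0"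
    using de_Gennes.radial_eigenvalue_below[OF dG assms] by blast
  obtain H where H: "\<And>n t. (H n has_real_derivative H (Suc n) t) (at t)"
    "H 0 = rad m b E" "H 1 = rad' m b E" "H 2 = rad'' m b E"
    by (rule rad_derivative_family) (rule that)
  have "mag_lambda b \<le> E"
  proof (rule mag_lambda_le_radial[where H=H and m=m])
    show "(H n has_real_derivative H (Suc n) t) (at t)" for n t by (rule H(1))
    show "4 * t * H 2 t + 4 * (real m + 1) * H 1 t = (b\<^sup>2 * t / 4 - m * b - E) * H 0 t" for t
      unfolding H(2-4) by (rule rad_equation)
    show "real m * H 0 1 + 2 * H 1 1 = 0" using E(3) unfolding H(2-4) flux_def by simp
    show "H 0 t > 0" if "t \<in> {0..1}" for t using E(2) that unfolding H(2) by blast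
  qed
  also have "E < \<kappa>\<^sup>2 * b" by (rule E(1))
  also have "\<dots> \<le> Theta0 * b" using le assms by (intro mult_right_mono) auto
  finally show ?thesis .
qed

end
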